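(* Let $r\in(1,\infty)$, $p,q\in(0,\infty]$ and $\beta\in\mathbb R$, and assume that $$\gamma:=1-n\,[\min\{p,q,1\},1]>0,$$ equivalently $p,q>\frac n{n+1}$. Let $k(t,x;s,y)$ be a kernel satisfying $$|k(t,x;s,y)|\lesssim\frac1{(|t-s|+|x-y|)^{1+n}},\qquad (t,x),(s,y)\in\mathbb R^{1+n}_+,\ (t,x)\neq(s,y).$$ (1) If $Sf(t,x)=\mathrm{p.v.}\int_{\mathbb R^{1+n}_+}k(t,x;s,y)f(s,y)\,ds\,dy$ is bounded $S:L^r(\mathbb R^{1+n}_+)\to L^r(\mathbb R^{1+n}_+)$, then $S:T^{p,q,r}_\beta\to T^{p,q,r}_\beta$ is bounded if $q^{-1}-\gamma<\beta<q^{-1}$. (2) If the causal truncation $S^+$, with kernel $k^+(t,x;s,y)=k(t,x;s,y)1_{t>s}$, is bounded $S^+:L^r(\mathbb R^{1+n}_+)\to L^r(\mathbb R^{1+n}_+)$, then $S^+:T^{p,q,r}_\beta\to T^{p,q,r}_\beta$ is bounded if $q^{-1}-\gamma<\beta$. (3) If the anti-causal truncation $S^-$, with kernel $k^-(t,x;s,y)=k(t,x;s,y)1_{t<s}$, is bounded $S^-:L^r(\mathbb R^{1+n}_+)\to L^r(\mathbb R^{1+n}_+)$, then $S^-:T^{p,q,r}_\beta\to T^{p,q,r}_\beta$ is bounded if $\beta<q^{-1}$.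
   Context: Notation. $n\ge1$; $\mathbb R^{1+n}_+=(0,\infty)\times\mathbb R^n$ with points $(t,x)$. In algebraic expressions $[p,q]:=\frac1p-\frac1q$ for $p,q\in(0,\infty]$ ($1/\infty=0$). $L^\infty_c(\mathbb R^{1+n}_+)$: bounded measurable functions with compact support in $\mathbb R^{1+n}_+$. The operators $S^\pm$ are given by the corresponding principal value integrals with kernels $k^\pm$. Tent spaces (homogeneity $m=1$). $W_rf(t,x)=\Big(⨍_{t/2}^t⨍_{B(x,t)}|f(s,y)|^rdy\,ds\Big)^{1/r}$ (⨍ is the mean value integral). For $p<\infty$, $\|f\|_{T^{p,q,r}_\beta}=\Big(\int_{\mathbb R^n}\Big(\int_0^\infty|t^{-\beta}W_rf(t,x)|^qdt\Big)^{p/q}dx\Big)^{1/p}$ (ess sup in $t$ if $q=\infty$). For $p=\infty$, $q<\infty$, $\|f\|_{T^{\infty,q,r}_\beta}=\sup_{(\tau,y)\in\mathbb R^{1+n}_+}\Big(\int_0^\tau⨍_{B(y,\tau)}|t^{-\beta}W_rf(t,x)|^qdx\,dt\Big)^{1/q}$. For $p=q=\infty$, $\|f\|_{T^{\infty,\infty,r}_\beta}=\|t^{-\beta}W_rf\|_{L^\infty(\mathbb R^{1+n}_+)}$. Meaning of boundedness on tent spaces: $T\in\{S,S^+,S^-\}$, restricted to $L^\infty_c(\mathbb R^{1+n}_+)$, has a bounded extension $\widetilde T$ on $T^{p,q,r}_\beta$ such that for all $f\in T^{p,q,r}_\beta$, all compact $\boldsymbol K\subseteq\mathbb R^{1+n}_+$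 and all sequences of compact sets $\boldsymbol K_j\subseteq\operatorname{Int}\boldsymbol K_{j+1}$ exhausting $\mathbb R^{1+n}_+$, $1_{\boldsymbol K}\widetilde Tf=\lim_{j}1_{\boldsymbol K}T(f1_{\boldsymbol K_j})$ in the norm of $T^{p,q,r}_\beta$ ($T$ being defined on compactly supported elements of $T^{p,q,r}_\beta$ by continuity from $L^\infty_c$). *)

theory Defs
  imports "HOL-Analysis.Analysis" "HOL-Probability.Essential_Supremum"
begin

text \<open>
  Elements of the function spaces below are represented by total functions on
  \<^typ>\<open>real \<times> (real ^ 'n)\<close>; only their values on the half-space matter, and functions that
  agree almost everywhere on the half-space represent the same element.  All norms take values in
  \<^typ>\<open>ennreal\<close>, and a space consists of the measurable functions of finite norm.
\<close>

definition half_space :: "(real \<times> (real ^ 'n)) set" where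
  "half_space = {0<..} \<times> UNIV"

abbreviation half_leb :: "(real \<times> (real ^ 'n)) measure" where
  "half_leb \<equiv> lebesgue_on half_space"

text \<open>Powers of extended non-negative numbers; used for positive exponents only.\<close>

definition epowr :: "ennreal \<Rightarrow> real \<Rightarrow> ennreal" where
  "epowr u a = (if u = \<infinity> then \<infinity> else ennreal (enn2real u powr a))"

definition mean_value :: "'a::euclidean_space set \<Rightarrow> ('a \<Rightarrow> ennreal) \<Rightarrow> ennreal" where
  "mean_value A g = (\<integral>\<^sup>+x\<in>A. g x \<partial>lebesgue) / emeasure lebesgue A"

text \<open>
  Exponents in $(0,\infty]$ are elements of \<^typ>\<open>ennreal\<close>.  For a positive exponent the value
  of \<open>rcp\<close> is its reciprocal, with \<open>rcp \<infinity> = 0\<close>.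
\<close>

definition rcp :: "ennreal \<Rightarrow> real" where
  "rcp p = enn2real (inverse p)"

definition exponent_gap :: "ennreal \<Rightarrow> ennreal \<Rightarrow> real" where
  "exponent_gap p q = rcp p - rcp q"

definition whitney_avg ::
  "real \<Rightarrow> (real \<times> (real ^ 'n) \<Rightarrow> complex) \<Rightarrow> real \<Rightarrow> real ^ 'n \<Rightarrow> ennreal" where
  "whitney_avg r f t x =
     epowr (mean_value {t/2..t} (\<lambda>s. mean_value (ball x t) (\<lambda>y. ennreal (norm (f (s, y)) powr r))))
           (1 / r)"

definition weighted_avg ::
  "real \<Rightarrow> real \<Rightarrow> (real \<times> (real ^ 'n) \<Rightarrow> complex) \<Rightarrow> real \<Rightarrow> real ^ 'n \<Rightarrow> ennreal" where
  "weighted_avg r \<beta> f t x = ennreal (t powr (-\<beta>)) * whitney_avg r f t x"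

definition tent_norm ::
  "ennreal \<Rightarrow> ennreal \<Rightarrow> real \<Rightarrow> real \<Rightarrow> (real \<times> (real ^ 'n) \<Rightarrow> complex) \<Rightarrow> ennreal" where
  "tent_norm p q r \<beta> f =
     (if p < \<infinity> then
        if q < \<infinity> then
          epowr (\<integral>\<^sup>+x. epowr (\<integral>\<^sup>+t\<in>{0<..}. epowr (weighted_avg r \<beta> f t x) (enn2real q) \<partial>lebesgue)
                             (enn2real p / enn2real q) \<partial>lebesgue)
                (1 / enn2real p)
        else
          epowr (\<integral>\<^sup>+x. epowr (esssup (lebesgue_on {0<..}) (\<lambda>t. weighted_avg r \<beta> f t x))
                             (enn2real p) \<partial>lebesgue)
                (1 / enn2real p)
      else
        if q < \<infinity> then
          (SUP (\<tau>, y)\<in>half_space.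
             epowr (\<integral>\<^sup>+t\<in>{0<..<\<tau>}.
                       mean_value (ball y \<tau>) (\<lambda>x. epowr (weighted_avg r \<beta> f t x) (enn2real q))
                     \<partial>lebesgue)
                   (1 / enn2real q))
        else esssup half_leb (\<lambda>(t, x). weighted_avg r \<beta> f t x))"

definition Lr_norm :: "real \<Rightarrow> (real \<times> (real ^ 'n) \<Rightarrow> complex) \<Rightarrow> ennreal" where
  "Lr_norm r f = epowr (\<integral>\<^sup>+z. ennreal (norm (f z) powr r) \<partial>half_leb) (1 / r)"

definition space_of ::
  "((real \<times> (real ^ 'n) \<Rightarrow> complex) \<Rightarrow> ennreal) \<Rightarrow> (real \<times> (real ^ 'n) \<Rightarrow> complex) set" where
  "space_of N = {f \<in> borel_measurable half_leb. N f < \<infinity>}"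

definition Linf_c :: "(real \<times> (real ^ 'n) \<Rightarrow> complex) set" where
  "Linf_c = {f \<in> borel_measurable half_leb.
     (\<exists>M. \<forall>z\<in>half_space. norm (f z) \<le> M) \<and>
     (\<exists>K. compact K \<and> K \<subseteq> half_space \<and> (\<forall>z\<in>half_space - K. f z = 0))}"

text \<open>
  Bounded linear operators on a (quasi-)normed space of functions.  Linearity is required almost
  everywhere; together with boundedness this makes the operator well defined on classes of
  functions modulo equality almost everywhere.
\<close>

definition bounded_operator ::
  "((real \<times> (real ^ 'n) \<Rightarrow> complex) \<Rightarrow> ennreal) \<Rightarrow>
   ((real \<times> (real ^ 'n) \<Rightarrow> complex) \<Rightarrow> (real \<times> (real ^ 'n) \<Rightarrow> complex)) \<Rightarrow> bool" where
  "bounded_operator N A \<longleftrightarrow>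
     (\<forall>f\<in>space_of N. A f \<in> space_of N) \<and>
     (\<forall>f\<in>space_of N. \<forall>g\<in>space_of N. AE z in half_leb. A (\<lambda>w. f w + g w) z = A f z + A g z) \<and>
     (\<forall>c. \<forall>f\<in>space_of N. AE z in half_leb. A (\<lambda>w. c * f w) z = c * A f z) \<and>
     (\<exists>C::real. \<forall>f\<in>space_of N. N (A f) \<le> ennreal C * N f)"

subsection \<open>Principal value operators\<close>

text \<open>Joint Lebesgue measurability on the half-space is implicit in the notion of a kernel.  Values on
  the diagonal are irrelevant.\<close>

definition size_kernel ::
  "(real \<times> (real ^ 'n) \<Rightarrow> real \<times> (real ^ 'n) \<Rightarrow> complex) \<Rightarrow> bool" where
  "size_kernel k \<longleftrightarrow>
     (\<lambda>(z, w). k z w) \<in> borel_measurable (lebesgue_on (half_space \<times> half_space)) \<and>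
     (\<exists>C. \<forall>t>0. \<forall>s>0. \<forall>x y. (t, x) \<noteq> (s, y) \<longrightarrow>
        norm (k (t, x) (s, y)) \<le> C / (\<bar>t - s\<bar> + norm (x - y)) ^ (1 + CARD('n)))"

definition causal ::
  "(real \<times> (real ^ 'n) \<Rightarrow> real \<times> (real ^ 'n) \<Rightarrow> complex) \<Rightarrow>
   real \<times> (real ^ 'n) \<Rightarrow> real \<times> (real ^ 'n) \<Rightarrow> complex" where
  "causal k z w = (if fst z > fst w then k z w else 0)"

definition anticausal ::
  "(real \<times> (real ^ 'n) \<Rightarrow> real \<times> (real ^ 'n) \<Rightarrow> complex) \<Rightarrow>
   real \<times> (real ^ 'n) \<Rightarrow> real \<times> (real ^ 'n) \<Rightarrow> complex" where
  "anticausal k z w = (if fst z < fst w then k z w else 0)"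

text \<open>Principal values are limits of integrals with Euclidean balls around \<open>z\<close> removed.\<close>

definition truncated_integral ::
  "(real \<times> (real ^ 'n) \<Rightarrow> real \<times> (real ^ 'n) \<Rightarrow> complex) \<Rightarrow>
   (real \<times> (real ^ 'n) \<Rightarrow> complex) \<Rightarrow> real \<times> (real ^ 'n) \<Rightarrow> real \<Rightarrow> complex" where
  "truncated_integral k f z \<epsilon> = (LINT w:{w\<in>half_space. dist z w > \<epsilon>}|lebesgue. k z w * f w)"

definition pv_exists ::
  "(real \<times> (real ^ 'n) \<Rightarrow> real \<times> (real ^ 'n) \<Rightarrow> complex) \<Rightarrow>
   (real \<times> (real ^ 'n) \<Rightarrow> complex) \<Rightarrow> real \<times> (real ^ 'n) \<Rightarrow> bool" where
  "pv_exists k f z \<longleftrightarrow> (\<exists>l. (truncated_integral k f z \<longlongrightarrow> l) (at_right 0))"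

definition pv_operator ::
  "(real \<times> (real ^ 'n) \<Rightarrow> real \<times> (real ^ 'n) \<Rightarrow> complex) \<Rightarrow>
   (real \<times> (real ^ 'n) \<Rightarrow> complex) \<Rightarrow> real \<times> (real ^ 'n) \<Rightarrow> complex" where
  "pv_operator k f z = Lim (at_right 0) (truncated_integral k f z)"

text \<open>
  As usual for singular integrals, the principal value is taken pointwise almost everywhere for
  functions in \<open>Linf_c\<close>, which is dense in $L^r$, and the operator on $L^r$ is the bounded
  extension.  This is a weaker requirement than existence of the principal value for all of $L^r$.
\<close>

definition bounded_on_Lr ::
  "real \<Rightarrow> (real \<times> (real ^ 'n) \<Rightarrow> real \<times> (real ^ 'n) \<Rightarrow> complex) \<Rightarrow> bool" where
  "bounded_on_Lr r k \<longleftrightarrow>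
     (\<exists>A. bounded_operator (Lr_norm r) A \<and>
          (\<forall>f\<in>Linf_c. AE z in half_leb. pv_exists k f z \<and> A f z = pv_operator k f z))"

text \<open>\<open>value_by_continuity N T f g\<close>: the continuous extension of \<open>T\<close> from \<open>Linf_c\<close>
  with respect to \<open>N\<close> is defined at \<open>f\<close> and has the value \<open>g\<close> there.\<close>

definition value_by_continuity ::
  "((real \<times> (real ^ 'n) \<Rightarrow> complex) \<Rightarrow> ennreal) \<Rightarrow>
   ((real \<times> (real ^ 'n) \<Rightarrow> complex) \<Rightarrow> (real \<times> (real ^ 'n) \<Rightarrow> complex)) \<Rightarrow>
   (real \<times> (real ^ 'n) \<Rightarrow> complex) \<Rightarrow> (real \<times> (real ^ 'n) \<Rightarrow> complex) \<Rightarrow> bool" where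
  "value_by_continuity N T f g \<longleftrightarrow>
     g \<in> space_of N \<and>
     (\<exists>\<phi>::nat \<Rightarrow> _. (\<forall>i. \<phi> i \<in> Linf_c) \<and> (\<lambda>i. N (\<lambda>z. \<phi> i z - f z)) \<longlonglongrightarrow> 0) \<and>
     (\<forall>\<phi>::nat \<Rightarrow> _. (\<forall>i. \<phi> i \<in> Linf_c) \<and> (\<lambda>i. N (\<lambda>z. \<phi> i z - f z)) \<longlonglongrightarrow> 0 \<longrightarrow>
        (\<lambda>i. N (\<lambda>z. T (\<phi> i) z - g z)) \<longlonglongrightarrow> 0)"

definition restrict_to ::
  "(real \<times> (real ^ 'n)) set \<Rightarrow> (real \<times> (real ^ 'n) \<Rightarrow> complex) \<Rightarrow> real \<times> (real ^ 'n) \<Rightarrow> complex" where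
  "restrict_to K f z = indicator K z * f z"

definition compact_exhaustion :: "(nat \<Rightarrow> (real \<times> (real ^ 'n)) set) \<Rightarrow> bool" where
  "compact_exhaustion Ks \<longleftrightarrow>
     (\<forall>j. compact (Ks j) \<and> Ks j \<subseteq> interior (Ks (Suc j))) \<and> (\<Union>j. Ks j) = half_space"

text \<open>In the limit condition, \<open>g j\<close> is the value (unique up to equality almost everywhere) at
  \<open>f 1\<^bsub>Ks j\<^esub>\<close> of the principal value operator extended by continuity.\<close>

definition bounded_on_tent ::
  "ennreal \<Rightarrow> ennreal \<Rightarrow> real \<Rightarrow> real \<Rightarrow>
   (real \<times> (real ^ 'n) \<Rightarrow> real \<times> (real ^ 'n) \<Rightarrow> complex) \<Rightarrow> bool" where
  "bounded_on_tent p q r \<beta> k \<longleftrightarrow>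
     (\<exists>A. bounded_operator (tent_norm p q r \<beta>) A \<and>
          (\<forall>f\<in>Linf_c. AE z in half_leb. pv_exists k f z \<and> A f z = pv_operator k f z) \<and>
          (\<forall>f\<in>space_of (tent_norm p q r \<beta>). \<forall>K Ks.
             compact K \<and> K \<subseteq> half_space \<and> compact_exhaustion Ks \<longrightarrow>
             (\<exists>g. (\<forall>j. value_by_continuity (tent_norm p q r \<beta>) (pv_operator k)
                          (restrict_to (Ks j) f) (g j)) \<and>
                  (\<lambda>j. tent_norm p q r \<beta> (\<lambda>z. restrict_to K (g j) z - restrict_to K (A f) z))
                    \<longlonglongrightarrow> 0)))"

end

theory Submission
  imports Defs "HOL-Probability.Probability_Measure" "HOL-Analysis.Ball_Volume"
begin

text \<open>The tent norm is comparable to a norm of the sequence of Whitney averages at the scales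
  \<open>3 powr (k / 2)\<close>.  The kernel is split into a part near the diagonal, handled by the boundedness
  on $L^r$, and a far part.  By the size condition the latter is dominated pointwise by a sum of
  averages over triadic cubes, geometrically weighted in the difference \<open>m\<close> of the scales of the
  two time variables and in the size of the cubes.  Such averaging operators act on the discrete
  spaces with at most linear growth of the norm if $p, q \ge 1$ (a version of Stein's inequality for
  averages that are adapted up to a delay), and otherwise with a loss of a power of the number of
  subcubes, which is the source of $\gamma$.  Multiplication by $t^{-\beta}$ contributes a further
  exponential in \<open>m\<close>; the sum over \<open>m\<close> converges upwards if $\beta < q^{-1}$ and downwards if
  $\beta > q^{-1} - \gamma$, and causality removes one of the two conditions.

  If $p$ or $q$ is infinite, $L^\infty_c$ is not dense.  But the domination shows that the far part
  converges absolutely and locally uniformly, so the extension can be defined as a pointwise limit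
  along an exhaustion.\<close>

section \<open>Powers of extended non-negative numbers\<close>

text \<open>The constants 3 and sqrt 3 reconcile two demands. Tripling preserves shifts by one half
  modulo 1, as doubling does not, so the 2^n grids shifted by half a side in some coordinates are
  all nested, and together they catch any two nearby points. On the other hand a Whitney window
  [t/2, t] contains a whole time slice only if consecutive scales have a ratio below 2; hence sqrt
  3, and two levels per side length. Exponents below 1 leave neither duality nor a triangle
  inequality. Raising to the power \<mu> = min(p, q) makes one exponent equal to 1, and infinite
  sums are controlled through geometric weights instead. A source m levels below the target
  oscillates on cubes smaller by the factor 3^(|m|/2). For \<mu> < 1 counting these subcubes costs
  3^(|m| n (1/\<mu> - 1)/2) = 3^(|m| (1 - \<gamma>)/2), while the size of the kernel gains
  3^(-|m|/2). The remaining decay 3^(-|m| \<gamma>/2) is the width \<gamma> of the range of \<beta>.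
  The delay of adaptedness is also of order |m|, but its linear cost is absorbed by any
  exponential.\<close>

lemma epowr_ennreal [simp]: "0 \<le> x \<Longrightarrow> epowr (ennreal x) a = ennreal (x powr a)"
  by (simp add: epowr_def)

lemma epowr_top [simp]: "epowr top a = top"
  by (simp add: epowr_def)

lemma epowr_0 [simp]: "epowr 0 a = 0"
  by (simp add: epowr_def)

lemma epowr_1 [simp]: "epowr u 1 = u"
  by (cases u) (auto simp: epowr_def)

lemma epowr_one [simp]: "epowr 1 a = 1"
  by (simp add: epowr_def)

lemma epowr_mono: "u \<le> v \<Longrightarrow> 0 \<le> a \<Longrightarrow> epowr u a \<le> epowr v a"
  by (cases u; cases v) (auto intro!: powr_mono2 simp: top_unique)

lemma epowr_mult: "0 < a \<Longrightarrow> epowr (u * v) a = epowr u a * epowr v a"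
proof (cases u; cases v)
  fix x y assume "u = ennreal x" "0 \<le> x" "v = ennreal y" "0 \<le> y"
  then show ?thesis by (simp flip: ennreal_mult add: powr_mult)
next
  fix x assume "u = ennreal x" "0 \<le> x" "v = top" "0 < a"
  then show ?thesis by (cases "x = 0") (auto simp: ennreal_mult_top)
next
  fix y assume "v = ennreal y" "0 \<le> y" "u = top" "0 < a"
  then show ?thesis by (cases "y = 0") (auto simp: ennreal_top_mult)
qed auto

lemma epowr_epowr [simp]: "epowr (epowr u a) b = epowr u (a * b)"
  by (cases u) (auto simp: powr_powr)

lemma epowr_add: "0 < a \<Longrightarrow> 0 < b \<Longrightarrow> epowr u (a + b) = epowr u a * epowr u b"
  by (cases u) (auto simp: powr_add ennreal_mult)

lemma epowr_eq_top_iff [simp]: "epowr u a = top \<longleftrightarrow> u = top"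
  by (cases u) auto

lemma epowr_less_top_iff [simp]: "epowr u a < top \<longleftrightarrow> u < top"
  by (simp add: less_top[symmetric])

text \<open>For a > 0 the power is an order isomorphism of [0, top] with inverse exponent 1/a. In
  this form roots move across inequalities, and suprema through powers, without any appeal to
  continuity.\<close>

lemma epowr_le_swap: "0 < a \<Longrightarrow> epowr u a \<le> v \<longleftrightarrow> u \<le> epowr v (1 / a)"
  using epowr_mono[of "epowr u a" v "1 / a"] epowr_mono[of u "epowr v (1 / a)" a] by auto

lemma le_epowr_swap: "0 < a \<Longrightarrow> u \<le> epowr v a \<longleftrightarrow> epowr u (1 / a) \<le> v"
  using epowr_mono[of u "epowr v a" "1 / a"] epowr_mono[of "epowr u (1 / a)" v a] by auto

lemma epowr_SUP:
  assumes "0 < a"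
  shows "epowr (SUP i\<in>I. f i) a = (SUP i\<in>I. epowr (f i) a)"
proof (rule antisym)
  show "epowr (SUP i\<in>I. f i) a \<le> (SUP i\<in>I. epowr (f i) a)"
  proof (subst epowr_le_swap[OF assms], rule SUP_least)
    fix i assume "i \<in> I"
    then show "f i \<le> epowr (SUP i\<in>I. epowr (f i) a) (1 / a)"
      by (subst epowr_le_swap[OF assms, symmetric]) (rule SUP_upper)
  qed
  show "(SUP i\<in>I. epowr (f i) a) \<le> epowr (SUP i\<in>I. f i) a"
    using assms by (auto intro!: SUP_least epowr_mono SUP_upper)
qed

lemma borel_measurable_epowr [measurable]: "(\<lambda>u. epowr u a) \<in> borel_measurable borel"
  unfolding epowr_def by measurable

lemma measurable_epowr_fun [measurable (raw)]:
  "f \<in> borel_measurable M \<Longrightarrow> (\<lambda>x. epowr (f x) a) \<in> borel_measurable M"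
  using measurable_compose borel_measurable_epowr by blast

lemma epowr_real_bound:
  "0 \<le> c \<Longrightarrow> 0 < a \<Longrightarrow> epowr (ennreal c * u) a = ennreal (c powr a) * epowr u a"
  by (simp add: epowr_mult)

text \<open>Comparison with twice the larger summand treats exponents below and above 1 at
  once.\<close>

lemma epowr_max_sum: "0 < a \<Longrightarrow> epowr (u + v) a \<le> ennreal (2 powr a) * (epowr u a + epowr v a)"
proof -
  assume a: "0 < a"
  have "u + v \<le> ennreal 2 * max u v"
    by (metis add_mono ennreal_numeral max.cobounded1 max.cobounded2 mult_2)
  then have "epowr (u + v) a \<le> ennreal (2 powr a) * epowr (max u v) a"
    using a by (metis epowr_mono epowr_real_bound less_imp_le zero_le_numeral)
  also have "\<dots> \<le> ennreal (2 powr a) * (epowr u a + epowr v a)"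
    by (intro mult_left_mono) (auto simp: max_def)
  finally show ?thesis .
qed

section \<open>Countable sums as integrals for counting measure\<close>

abbreviation csum :: "('i \<Rightarrow> ennreal) \<Rightarrow> ennreal" where
  "csum f \<equiv> (\<integral>\<^sup>+i. f i \<partial>count_space UNIV)"

lemma csum_ge: "f i \<le> csum f"
  by (rule nn_integral_ge_point) simp

lemma csum_cmult: "csum (\<lambda>i. c * f i) = c * csum f"
  by (rule nn_integral_cmult) simp

text \<open>This is where writing sums as integrals pays off: interchanging sum and integral is
  Tonelli's theorem, and no summability is ever discussed.\<close>

lemma csum_swap:
  fixes f :: "'i::countable \<Rightarrow> 'a \<Rightarrow> ennreal"
  assumes "\<And>i. f i \<in> borel_measurable M"
  shows "(\<integral>\<^sup>+x. csum (\<lambda>i. f i x) \<partial>M) = csum (\<lambda>i. \<integral>\<^sup>+x. f i x \<partial>M)"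
  by (rule nn_integral_count_space_nn_integral) (use assms in auto)

lemma csum_swap2:
  fixes f :: "'i::countable \<Rightarrow> 'j \<Rightarrow> ennreal"
  shows "csum (\<lambda>x. csum (\<lambda>i. f i x)) = csum (\<lambda>i. csum (f i))"
  by (rule csum_swap) auto

lemma measurable_csum [measurable (raw)]:
  fixes f :: "'i::countable \<Rightarrow> 'a \<Rightarrow> ennreal"
  assumes "\<And>i. f i \<in> borel_measurable M"
  shows "(\<lambda>x. csum (\<lambda>i. f i x)) \<in> borel_measurable M"
proof (rule sigma_finite_measure.borel_measurable_nn_integral)
  show "sigma_finite_measure (count_space (UNIV::'i set))"
    by (rule sigma_finite_measure_count_space)
  show "(\<lambda>(x, i). f i x) \<in> borel_measurable (M \<Otimes>\<^sub>M count_space UNIV)"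
    unfolding case_prod_beta
    by (rule measurable_compose_countable'[where I=UNIV and g=snd and f="\<lambda>i z. f i (fst z)"]) (use assms in auto)
qed

text \<open>Splitting off the square root of the weights makes a supremum out of the sum; this works
  for every exponent and replaces all (quasi-)triangle inequalities.\<close>

lemma epowr_csum_weighted:
  fixes e :: "'i \<Rightarrow> real"
  assumes "0 < \<kappa>" "\<And>i. 0 \<le> e i"
  shows "epowr (csum (\<lambda>i. ennreal (e i) * a i)) \<kappa>
    \<le> epowr (csum (\<lambda>i. ennreal (sqrt (e i)))) \<kappa> * csum (\<lambda>i. ennreal (e i powr (\<kappa> / 2)) * epowr (a i) \<kappa>)"
proof -
  define S where "S = csum (\<lambda>i. ennreal (e i powr (\<kappa> / 2)) * epowr (a i) \<kappa>)"
  have pw: "sqrt (e i) powr \<kappa> = e i powr (\<kappa> / 2)" for i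
    using assms by (simp add: powr_half_sqrt[symmetric] powr_powr)
  have "ennreal (sqrt (e i)) * a i \<le> epowr S (1 / \<kappa>)" for i
  proof -
    have "epowr (ennreal (sqrt (e i)) * a i) \<kappa> = ennreal (e i powr (\<kappa> / 2)) * epowr (a i) \<kappa>"
      using assms by (simp add: epowr_real_bound pw)
    also have "\<dots> \<le> S"
      unfolding S_def by (rule csum_ge[where f="\<lambda>i. ennreal (e i powr (\<kappa> / 2)) * epowr (a i) \<kappa>"])
    finally show ?thesis using assms by (simp add: epowr_le_swap)
  qed
  then have "ennreal (e i) * a i \<le> epowr S (1 / \<kappa>) * ennreal (sqrt (e i))" for i
  proof -
    have "ennreal (e i) * a i = ennreal (sqrt (e i)) * (ennreal (sqrt (e i)) * a i)"
      using assms(2)[of i] by (simp add: mult.assoc[symmetric] flip: ennreal_mult)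
    also have "\<dots> \<le> ennreal (sqrt (e i)) * epowr S (1 / \<kappa>)"
      by (intro mult_left_mono \<open>\<And>i. ennreal (sqrt (e i)) * a i \<le> epowr S (1 / \<kappa>)\<close>) simp
    finally show ?thesis by (simp add: mult.commute)
  qed
  then have "csum (\<lambda>i. ennreal (e i) * a i) \<le> csum (\<lambda>i. epowr S (1 / \<kappa>) * ennreal (sqrt (e i)))"
    by (intro nn_integral_mono) simp
  also have "\<dots> = csum (\<lambda>i. ennreal (sqrt (e i))) * epowr S (1 / \<kappa>)"
    by (subst csum_cmult) (rule mult.commute)
  finally have "epowr (csum (\<lambda>i. ennreal (e i) * a i)) \<kappa> \<le> epowr \<dots> \<kappa>"
    using assms by (intro epowr_mono) auto
  then show ?thesis using assms by (simp add: epowr_mult S_def)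
qed

text \<open>Symmetric windows reduce two-sided sequences to finite sums, where an induction over
  scales can start at the coarsest one.\<close>

lemma csum_int_SUP:
  fixes f :: "int \<Rightarrow> ennreal"
  shows "csum f = (SUP N. \<Sum>k\<in>{- int N..int N}. f k)"
proof -
  have un: "(\<Union>N. {- int N..int N}) = UNIV"
  proof (intro set_eqI iffI UNIV_I)
    fix x show "x \<in> (\<Union>N. {- int N..int N})" by (rule UN_I[of "nat \<bar>x\<bar>"]) auto
  qed
  have "(SUP N. \<integral>\<^sup>+k. f k * indicator {- int N..int N} k \<partial>count_space UNIV)
      = (\<integral>\<^sup>+k. (SUP N. f k * indicator {- int N..int N} k) \<partial>count_space UNIV)"
    by (rule nn_integral_monotone_convergence_SUP[symmetric])
       (auto simp: incseq_def le_fun_def indicator_def)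
  also have "(\<lambda>k. (SUP N. f k * indicator {- int N..int N} k)) = f"
  proof (intro ext antisym SUP_least)
    fix k show "f k \<le> (SUP N. f k * indicator {- int N..int N} k)"
      by (rule SUP_upper2[of "nat \<bar>k\<bar>"]) (auto simp: indicator_def abs_if)
  qed (auto simp: indicator_def)
  also have "(\<lambda>N. \<integral>\<^sup>+k. f k * indicator {- int N..int N} k \<partial>count_space UNIV) = (\<lambda>N. \<Sum>k\<in>{- int N..int N}. f k)"
    by (auto simp: nn_integral_count_space_indicator[symmetric] nn_integral_count_space_finite)
  finally show ?thesis by simp
qed

lemma csum_int_shift: "csum (\<lambda>k::int. f (k + m)) = csum f"
  by (rule nn_integral_bij_count_space[of "\<lambda>k. k + m"])
     (auto intro!: bij_betwI[where g="\<lambda>k. k - m"])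


section \<open>Convexity\<close>

text \<open>The tangent of y powr P at z, y^P \<ge> z^P + P z^(P-1) (y - z), cleared of
  subtractions; Young's inequality for y and z^(P-1) yields it. It is the source of Jensen's
  inequality, of the increment bound for powers and of the supporting functionals of the
  \<open>l^Q\<close> norm.\<close>

lemma tangent_powr_real:
  fixes y z P :: real
  assumes "1 \<le> P" "0 \<le> y" "0 \<le> z"
  shows "P * z powr (P - 1) * y \<le> y powr P + (P - 1) * z powr P"
proof (cases "P = 1 \<or> z = 0 \<or> y = 0")
  case True
  then show ?thesis using assms by auto
next
  case False
  define Q where "Q = P / (P - 1)"
  have P: "1 < P" "1 < Q" "1 / P + 1 / Q = 1" "(P - 1) * Q = P" "P / Q = P - 1"
    using assms False by (auto simp: Q_def field_simps)
  have "y * z powr (P - 1) \<le> y powr P / P + (z powr (P - 1)) powr Q / Q"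
    using P assms by (intro Youngs_inequality) auto
  also have "(z powr (P - 1)) powr Q = z powr P"
    using P by (simp add: powr_powr)
  finally have "P * (y * z powr (P - 1)) \<le> P * (y powr P / P + z powr P / Q)"
    using P by (intro mult_left_mono) auto
  also have "\<dots> = y powr P + P / Q * z powr P"
    using P(1) by (simp add: distrib_left)
  finally show ?thesis unfolding P(5) by (simp add: mult_ac)
qed

lemma tangent_powr:
  assumes "1 \<le> P" "0 \<le> z"
  shows "ennreal (P * z powr (P - 1)) * y \<le> epowr y P + ennreal ((P - 1) * z powr P)"
proof (cases y)
  case (real r)
  then show ?thesis using assms tangent_powr_real[of P r z]
    by (simp flip: ennreal_mult ennreal_plus)
qed auto

text \<open>Integrate the tangent at the mean value. With tangents in subtraction-free form both
  sides may be infinite.\<close>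

lemma (in prob_space) jensen_epowr:
  assumes [measurable]: "g \<in> borel_measurable M" and P: "1 \<le> P"
  shows "epowr (\<integral>\<^sup>+x. g x \<partial>M) P \<le> (\<integral>\<^sup>+x. epowr (g x) P \<partial>M)"
proof -
  define A where "A = (\<integral>\<^sup>+x. g x \<partial>M)"
  define R where "R = (\<integral>\<^sup>+x. epowr (g x) P \<partial>M)"
  have tangent: "ennreal (P * z powr (P - 1)) * A \<le> R + ennreal ((P - 1) * z powr P)" if "0 \<le> z" for z
  proof -
    have "(\<integral>\<^sup>+x. ennreal (P * z powr (P - 1)) * g x \<partial>M)
        \<le> (\<integral>\<^sup>+x. epowr (g x) P + ennreal ((P - 1) * z powr P) \<partial>M)"
      using P that by (intro nn_integral_mono tangent_powr) auto
    also have "\<dots> = R + ennreal ((P - 1) * z powr P)"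
      using P by (subst nn_integral_add) (auto simp: R_def emeasure_space_1)
    finally show ?thesis by (simp add: nn_integral_cmult A_def)
  qed
  have "epowr A P \<le> R"
  proof (cases A)
    case top
    \<comment> \<open>If the mean is infinite, any tangent of positive slope forces the right-hand
      side to be infinite; the one at 1 is taken.\<close>
    then show ?thesis using tangent[of 1] P by (auto simp: ennreal_mult_top top_unique)
  next
    case (real a)
    have "ennreal (P * a powr P) = ennreal (P * a powr (P - 1)) * A"
      using real P by (cases "a = 0") (auto simp flip: ennreal_mult simp: powr_diff)
    also have "\<dots> \<le> R + ennreal ((P - 1) * a powr P)"
      using real by (intro tangent) auto
    finally have "ennreal (P * a powr P) \<le> R + ennreal ((P - 1) * a powr P)" .
    then have "a powr P \<le> r" if "R = ennreal r" "0 \<le> r" for r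
    proof -
      have "ennreal (P * a powr P) \<le> ennreal (r + (P - 1) * a powr P)"
        using \<open>ennreal (P * a powr P) \<le> _\<close> that P by (subst ennreal_plus) auto
      then have "P * a powr P \<le> r + (P - 1) * a powr P"
        using that P by (subst (asm) ennreal_le_iff) auto
      then show ?thesis by (simp add: algebra_simps)
    qed
    then show ?thesis using real by (cases R) auto
  qed
  then show ?thesis by (simp add: A_def R_def)
qed

section \<open>Shifted triadic grids\<close>

text \<open>The side length is constant on pairs of consecutive levels, because a level will be matched
  with a time interval of ratio \<open>sqrt 3\<close>.\<close>

definition side :: "int \<Rightarrow> real" where
  "side k = 3 powr real_of_int (k div 2)"

text \<open>The set \<open>a\<close> selects the coordinates in which the grid is shifted by half a
  side. The 2^n choices play the part of the adjacent dyadic systems obtained from one-third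
  shifts.\<close>

definition offset :: "'n set \<Rightarrow> 'n \<Rightarrow> real" where
  "offset a c = (if c \<in> a then 1 / 2 else 0)"

text \<open>A cube is named by any of its points and not by an index. Lying in a common cube is then
  visibly an equivalence relation, and the cubes of one level form a partition by
  construction.\<close>

definition cube :: "'n::finite set \<Rightarrow> int \<Rightarrow> real ^ 'n \<Rightarrow> (real ^ 'n) set" where
  "cube a k x = {y. \<forall>c. \<lfloor>y $ c / side k - offset a c\<rfloor> = \<lfloor>x $ c / side k - offset a c\<rfloor>}"

definition avg :: "'n::finite set \<Rightarrow> int \<Rightarrow> (real ^ 'n \<Rightarrow> ennreal) \<Rightarrow> real ^ 'n \<Rightarrow> ennreal" where
  "avg a k w x = (\<integral>\<^sup>+y. w y * indicator (cube a k x) y \<partial>lborel) / ennreal (side k ^ CARD('n))"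

text \<open>In martingale terms \<open>avg a k\<close> is the conditional expectation given the
  partition at level k, and \<open>level a k w\<close> expresses that w is adapted to this
  partition. Larger k means a coarser partition.\<close>

definition level :: "'n::finite set \<Rightarrow> int \<Rightarrow> (real ^ 'n \<Rightarrow> ennreal) \<Rightarrow> bool" where
  "level a k w \<longleftrightarrow> (\<forall>x y. y \<in> cube a k x \<longrightarrow> w y = w x)"

lemma side_pos [simp]: "0 < side k"
  by (simp add: side_def)

lemma side_neq_0 [simp]: "side k \<noteq> 0" and abs_side [simp]: "\<bar>side k\<bar> = side k"
  using side_pos[of k] by (simp_all del: side_pos)

lemma side_power_neq_0 [simp]: "ennreal (side k ^ n) \<noteq> 0"
proof -
  have "0 < side k ^ n" by simp
  then show ?thesis by (metis ennreal_eq_0_iff not_le)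
qed

lemma vec_nth_borel_measurable [measurable]: "(\<lambda>x::real ^ 'n. x $ c) \<in> borel_measurable borel"
  by (intro borel_measurable_continuous_onI continuous_intros)

lemma cube_self [simp]: "x \<in> cube a k x"
  by (simp add: cube_def)

lemma cube_eq: "y \<in> cube a k x \<Longrightarrow> cube a k y = cube a k x"
  by (simp add: cube_def)

lemma cube_sym: "y \<in> cube a k x \<longleftrightarrow> x \<in> cube a k y"
  by (auto simp: cube_def)

lemma cube_Suc: "cube a k x \<subseteq> cube a (k + 1) x"
proof (cases "(k + 1) div 2 = k div 2")
  case True
  then show ?thesis by (simp add: cube_def side_def)
next
  case False
  then have "(k + 1) div 2 = k div 2 + 1" by presburger
  then have s: "side (k + 1) = 3 * side k" by (simp add: side_def powr_add)
  \<comment> \<open>In a shifted coordinate y / (3 s) - 1/2 = (v - 1) / 3 with v = y / s - 1/2.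
    Hence the coarse index is a function of the fine one.\<close>
  have fl: "\<lfloor>y $ c / side (k + 1) - offset a c\<rfloor>
      = (\<lfloor>y $ c / side k - offset a c\<rfloor> - (if c \<in> a then 1 else 0)) div 3" for y :: "real ^ 'a" and c
  proof -
    define v where "v = y $ c / side k - offset a c"
    have "y $ c / side (k + 1) - offset a c = (v - real_of_int (if c \<in> a then 1 else 0)) / real_of_int 3"
      unfolding v_def s using side_pos[of k] by (auto simp: offset_def field_simps)
    then show ?thesis
      unfolding v_def[symmetric] by (simp only: floor_divide_real_eq_div floor_diff_of_int)
  qed
  show ?thesis unfolding cube_def fl by auto
qed

lemma cube_mono: "k \<le> j \<Longrightarrow> cube a k x \<subseteq> cube a j x"
proof (induction j rule: int_ge_induct)
  case (step i)
  then show ?case using cube_Suc[of a i x] by blast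
qed simp

lemma cube_dist:
  assumes "y \<in> cube a k x"
  shows "\<bar>y $ c - x $ c\<bar> < side k"
proof -
  have "\<lfloor>y $ c / side k - offset a c\<rfloor> = \<lfloor>x $ c / side k - offset a c\<rfloor>"
    using assms by (simp add: cube_def)
  then have "\<bar>y $ c / side k - x $ c / side k\<bar> < 1" by linarith
  then show ?thesis using side_pos[of k] by (simp add: abs_less_iff field_simps)
qed

lemma cube_norm:
  fixes x :: "real ^ 'n"
  assumes "y \<in> cube a k x"
  shows "norm (y - x) < CARD('n) * side k"
proof -
  have "norm (y - x) \<le> (\<Sum>c\<in>UNIV. \<bar>(y - x) $ c\<bar>)" by (rule norm_le_l1_cart)
  also have "\<dots> < (\<Sum>c\<in>(UNIV::'n set). side k)"
    using cube_dist[OF assms] by (intro sum_strict_mono) auto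
  finally show ?thesis by simp
qed

text \<open>If a grid line separates two coordinates closer than half a side, then no line of the
  grid shifted by half a side separates them. So the shift can be chosen coordinate by coordinate,
  depending on the two points.\<close>

lemma in_some_cube:
  fixes x y :: "real ^ 'n"
  assumes "norm (x - y) < side k / 2"
  shows "\<exists>a. y \<in> cube a k x"
proof -
  have d: "\<bar>x $ c / side k - y $ c / side k\<bar> < 1 / 2" for c
  proof -
    have "\<bar>x $ c - y $ c\<bar> < side k / 2"
      using assms component_le_norm_cart[of "x - y" c] by simp
    then have "\<bar>x $ c - y $ c\<bar> / side k < 1 / 2" using side_pos[of k] by (simp add: field_simps)
    then show ?thesis using side_pos[of k] by (simp add: abs_divide abs_of_pos diff_divide_distrib[symmetric])
  qed
  define a where "a = {c. \<lfloor>y $ c / side k\<rfloor> \<noteq> \<lfloor>x $ c / side k\<rfloor>}"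
  have "\<lfloor>y $ c / side k - offset a c\<rfloor> = \<lfloor>x $ c / side k - offset a c\<rfloor>" for c
  proof (cases "c \<in> a")
    case True
    then have ne: "\<lfloor>y $ c / side k\<rfloor> \<noteq> \<lfloor>x $ c / side k\<rfloor>" by (simp add: a_def)
    have aux: "\<lfloor>u - 1 / 2\<rfloor> = \<lfloor>v - 1 / 2\<rfloor>" if "\<bar>u - v\<bar> < 1 / 2" "\<lfloor>u\<rfloor> \<noteq> \<lfloor>v\<rfloor>" for u v :: real
    proof -
      have "\<lfloor>u - 1 / 2\<rfloor> = \<lfloor>u\<rfloor> \<and> \<lfloor>v - 1 / 2\<rfloor> = \<lfloor>u\<rfloor>" if "\<lfloor>u\<rfloor> < \<lfloor>v\<rfloor>" "\<bar>u - v\<bar> < 1 / 2" for u v :: real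
        using that by (auto intro!: floor_unique; linarith)
      from this[of u v] this[of v u] show ?thesis using that by (cases "\<lfloor>u\<rfloor> < \<lfloor>v\<rfloor>") (auto simp: abs_minus_commute)
    qed
    show ?thesis using True aux[OF _ ne] d[of c] by (simp add: offset_def abs_minus_commute)
  qed (auto simp: a_def offset_def)
  then show ?thesis unfolding cube_def by blast
qed

lemma cube_measurable2 [measurable]:
  "{z. snd z \<in> cube a k (fst z)} \<in> sets (borel \<Otimes>\<^sub>M borel)"
proof -
  have "Measurable.pred (borel \<Otimes>\<^sub>M borel) (\<lambda>z::(real^'a) \<times> (real^'a).
      \<forall>c. \<lfloor>snd z $ c / side k - offset a c\<rfloor> = \<lfloor>fst z $ c / side k - offset a c\<rfloor>)"
    by measurable
  then show ?thesis by (simp add: cube_def pred_def space_pair_measure)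
qed

lemma cube_borel [measurable]: "cube a k x \<in> sets borel"
proof -
  have "Measurable.pred borel (\<lambda>y::(real^'a).
      \<forall>c. \<lfloor>y $ c / side k - offset a c\<rfloor> = \<lfloor>x $ c / side k - offset a c\<rfloor>)"
    by measurable
  then show ?thesis by (simp add: cube_def pred_def)
qed

lemma indicator_cube_measurable [measurable]:
  "(\<lambda>z. indicator (cube a k (fst z)) (snd z) :: ennreal) \<in> borel_measurable (borel \<Otimes>\<^sub>M borel)"
proof -
  have "(\<lambda>z. indicator (cube a k (fst z)) (snd z) :: ennreal) = indicator {z. snd z \<in> cube a k (fst z)}"
    by (auto simp: indicator_def)
  then show ?thesis by simp
qed

text \<open>The cube is half-open and squeezed between the open and the closed box with the same
  corners.\<close>

lemma emeasure_cube:
  fixes x :: "real ^ 'n"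
  shows "emeasure lborel (cube a k x) = ennreal (side k ^ CARD('n))"
proof -
  define l :: "real ^ 'n" where "l = (\<chi> c. side k * (real_of_int \<lfloor>x $ c / side k - offset a c\<rfloor> + offset a c))"
  define u :: "real ^ 'n" where "u = (\<chi> c. l $ c + side k)"
  have mem: "y \<in> cube a k x \<longleftrightarrow> (\<forall>c. l $ c \<le> y $ c \<and> y $ c < u $ c)" for y
  proof -
    have "\<lfloor>y $ c / side k - offset a c\<rfloor> = \<lfloor>x $ c / side k - offset a c\<rfloor> \<longleftrightarrow> l $ c \<le> y $ c \<and> y $ c < u $ c" for c
      using side_pos[of k] by (auto simp: floor_eq_iff l_def u_def field_simps)
    then show ?thesis by (simp add: cube_def)
  qed
  have sub: "box l u \<subseteq> cube a k x" "cube a k x \<subseteq> cbox l u"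
    using mem by (auto simp: subset_eq mem_box_cart intro: less_imp_le)
  have "(\<Prod>b\<in>Basis. (u - l) \<bullet> b) = (\<Prod>b\<in>(Basis :: (real ^ 'n) set). side k)"
    by (rule prod.cong) (auto simp: Basis_vec_def u_def inner_axis)
  then have prod: "(\<Prod>b\<in>Basis. (u - l) \<bullet> b) = side k ^ CARD('n)" by simp
  have le: "\<And>b. b \<in> Basis \<Longrightarrow> l \<bullet> b \<le> u \<bullet> b"
    by (auto simp: Basis_vec_def u_def inner_axis intro: less_imp_le)
  have "emeasure lborel (box l u) = ennreal (side k ^ CARD('n))"
    "emeasure lborel (cbox l u) = ennreal (side k ^ CARD('n))"
    using le prod by (auto simp: emeasure_lborel_box emeasure_lborel_cbox)
  moreover have "emeasure lborel (box l u) \<le> emeasure lborel (cube a k x)"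
    "emeasure lborel (cube a k x) \<le> emeasure lborel (cbox l u)"
    using sub by (auto intro!: emeasure_mono)
  ultimately show ?thesis by (simp add: antisym)
qed

section \<open>Averages over cubes as conditional expectations\<close>

lemma avg_uniform: "w \<in> borel_measurable borel \<Longrightarrow> avg a k w x = (\<integral>\<^sup>+y. w y \<partial>uniform_measure lborel (cube a k x))"
  by (simp add: avg_def nn_integral_uniform_measure emeasure_cube)

lemma prob_cube: "prob_space (uniform_measure lborel (cube a k x))"
  by (rule prob_space_uniform_measure) (auto simp: emeasure_cube)

lemma avg_mono: "(\<And>y. v y \<le> w y) \<Longrightarrow> avg a k v x \<le> avg a k w x"
  unfolding avg_def by (intro divide_right_mono_ennreal nn_integral_mono mult_right_mono) auto

lemma avg_measurable [measurable]:
  assumes [measurable]: "w \<in> borel_measurable borel"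
  shows "avg a k w \<in> borel_measurable borel"
proof -
  have "(\<lambda>x. \<integral>\<^sup>+y. w (snd (x, y)) * indicator (cube a k (fst (x, y))) (snd (x, y)) \<partial>lborel) \<in> borel_measurable borel"
    by (rule lborel.borel_measurable_nn_integral) (simp add: split_beta)
  then show ?thesis by (simp add: avg_def[abs_def])
qed

lemma level_avg: "level a k (avg a k w)"
  by (auto simp: level_def avg_def dest: cube_eq)

lemma levelD: "level a k w \<Longrightarrow> y \<in> cube a k x \<Longrightarrow> w y = w x"
  by (auto simp: level_def)

lemma level_mono: "level a j w \<Longrightarrow> k \<le> j \<Longrightarrow> level a k w"
  using cube_mono[of k j a] by (auto simp: level_def)

lemma level_cube: "level a k (indicator (cube a k x))"
  by (auto simp: level_def indicator_def cube_def)

lemma level_comp: "level a k w \<Longrightarrow> level a k (\<lambda>x. f (w x))"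
  unfolding level_def by metis

text \<open>Tonelli together with the symmetry of lying in a common cube.\<close>

lemma avg_adjoint:
  fixes w g :: "real ^ 'n \<Rightarrow> ennreal"
  assumes [measurable]: "w \<in> borel_measurable borel" "g \<in> borel_measurable borel"
  shows "(\<integral>\<^sup>+x. avg a k w x * g x \<partial>lborel) = (\<integral>\<^sup>+x. w x * avg a k g x \<partial>lborel)"
proof -
  define v where "v = ennreal (side k ^ CARD('n))"
  have "(\<integral>\<^sup>+x. avg a k w x * g x \<partial>lborel)
      = (\<integral>\<^sup>+x. (\<integral>\<^sup>+y. w y * indicator (cube a k x) y * (g x / v) \<partial>lborel) \<partial>lborel)"
    by (subst nn_integral_multc) (auto simp: avg_def v_def divide_ennreal_def mult_ac)
  also have "\<dots> = (\<integral>\<^sup>+y. (\<integral>\<^sup>+x. w y * indicator (cube a k x) y * (g x / v) \<partial>lborel) \<partial>lborel)"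
  proof (rule lborel_pair.Fubini'[symmetric])
    have "(\<lambda>z. w (snd z) * indicator (cube a k (fst z)) (snd z) * (g (fst z) / v)) \<in> borel_measurable (lborel \<Otimes>\<^sub>M lborel)"
      by measurable
    then show "(\<lambda>(x, y). w y * indicator (cube a k x) y * (g x / v)) \<in> borel_measurable (lborel \<Otimes>\<^sub>M lborel)"
      by (simp add: case_prod_beta')
  qed
  also have "\<dots> = (\<integral>\<^sup>+y. (\<integral>\<^sup>+x. g x * indicator (cube a k y) x * (w y / v) \<partial>lborel) \<partial>lborel)"
    by (intro nn_integral_cong) (auto simp: indicator_def divide_ennreal_def mult_ac cube_sym[of _ a k] split: if_splits)
  also have "\<dots> = (\<integral>\<^sup>+x. w x * avg a k g x \<partial>lborel)"
    by (subst nn_integral_multc) (auto simp: avg_def v_def divide_ennreal_def mult_ac)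
  finally show ?thesis .
qed

lemma avg_level_eq:
  assumes "level a k g"
  shows "avg a k g x = g x"
proof -
  have "avg a k g x = (\<integral>\<^sup>+y. g x * indicator (cube a k x) y \<partial>lborel) / ennreal (side k ^ CARD('a))"
    unfolding avg_def using levelD[OF assms]
    by (intro arg_cong2[where f="(/)"] nn_integral_cong) (auto simp: indicator_def)
  also have "\<dots> = g x"
    by (simp add: nn_integral_cmult emeasure_cube ennreal_mult_divide_eq)
  finally show ?thesis .
qed

lemma avg_const: "avg a k (\<lambda>y. c) x = c"
  by (rule avg_level_eq) (simp add: level_def)

lemma nn_integral_avg_level:
  assumes "w \<in> borel_measurable borel" "g \<in> borel_measurable borel" "level a k g"
  shows "(\<integral>\<^sup>+x. avg a k w x * g x \<partial>lborel) = (\<integral>\<^sup>+x. w x * g x \<partial>lborel)"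
  by (simp add: avg_adjoint assms avg_level_eq)

lemma nn_integral_avg:
  assumes "w \<in> borel_measurable borel"
  shows "(\<integral>\<^sup>+x. avg a k w x \<partial>lborel) = (\<integral>\<^sup>+x. w x \<partial>lborel)"
  using nn_integral_avg_level[OF assms, of "\<lambda>x. 1" a k] by (simp add: level_def)

lemma avg_tower:
  assumes "w \<in> borel_measurable borel" "k \<le> j"
  shows "avg a j (avg a k w) x = avg a j w x"
  unfolding avg_def[of a j]
  by (subst nn_integral_avg_level) (auto simp: assms intro: level_mono[OF level_cube])

text \<open>The integral over the large cube dominates the one over the small cube around y, where w
  is constant. The factor is the number of small cubes in a large one; its powers are what reduces
  \<gamma> below 1.\<close>

lemma level_le_avg:
  fixes x :: "real ^ 'n"
  assumes "level a j w" "j \<le> k" "y \<in> cube a k x"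
  shows "w y \<le> ennreal ((side k / side j) ^ CARD('n)) * avg a k w x"
proof -
  have sub: "cube a j y \<subseteq> cube a k x"
    using cube_mono[OF assms(2)] cube_eq[OF assms(3)] by blast
  have "w y = (\<integral>\<^sup>+z. w z * indicator (cube a j y) z \<partial>lborel) / ennreal (side j ^ CARD('n))"
    using avg_level_eq[OF assms(1), of y] by (simp add: avg_def)
  also have "\<dots> \<le> (\<integral>\<^sup>+z. w z * indicator (cube a k x) z \<partial>lborel) / ennreal (side j ^ CARD('n))"
    using sub by (intro divide_right_mono_ennreal nn_integral_mono) (auto simp: indicator_def)
  also have "\<dots> = ennreal ((side k / side j) ^ CARD('n)) * avg a k w x"
  proof -
    define A where "A = (\<integral>\<^sup>+z. w z * indicator (cube a k x) z \<partial>lborel)"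
    have "ennreal ((side k / side j) ^ CARD('n)) / ennreal (side k ^ CARD('n)) = 1 / ennreal (side j ^ CARD('n))"
      by (subst divide_ennreal) (auto simp: power_divide divide_ennreal less_imp_le simp flip: ennreal_1)
    then show ?thesis
      unfolding avg_def A_def[symmetric] divide_ennreal_def by (simp add: mult_ac)
  qed
  finally show ?thesis .
qed

text \<open>For exponents below one, averages of functions of level \<open>j\<close> are controlled at the price of
  a power of the number of subcubes.\<close>

lemma avg_le_power_mean:
  fixes w :: "real ^ 'n \<Rightarrow> ennreal"
  assumes [measurable]: "w \<in> borel_measurable borel" and "level a j w" "j \<le> k" "0 < \<mu>"
  shows "avg a k w x \<le> ennreal (((side k / side j) ^ CARD('n)) powr max (1 / \<mu> - 1) 0)
      * epowr (avg a k (\<lambda>y. epowr (w y) \<mu>) x) (1 / \<mu>)"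
proof (cases "1 \<le> \<mu>")
  case True
  have "epowr (avg a k w x) \<mu> \<le> avg a k (\<lambda>y. epowr (w y) \<mu>) x"
    using True prob_space.jensen_epowr[OF prob_cube, of w a k x \<mu>] by (simp add: avg_uniform)
  moreover have "max (1 / \<mu> - 1) 0 = 0" using True by simp
  moreover have "side k / side j \<noteq> 0" using side_pos[of k] side_pos[of j] by simp
  ultimately show ?thesis using assms(4) by (simp add: epowr_le_swap)
next
  case False
  define N where "N = (side k / side j) ^ CARD('n)"
  define T where "T = avg a k (\<lambda>y. epowr (w y) \<mu>) x"
  have N: "0 < N" using side_pos[of k] side_pos[of j] by (simp add: N_def)
  define \<theta> where "\<theta> = 1 / \<mu> - 1"
  have \<theta>: "0 < \<theta>" "\<mu> + \<mu> * \<theta> = 1" "1 + \<theta> = 1 / \<mu>" using False assms(4) by (auto simp: \<theta>_def field_simps)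
  \<comment> \<open>Split w = w^\<mu> w^(1 - \<mu>), where 1 - \<mu> = \<mu> \<theta>, and apply the
    pointwise bound to the second factor only.\<close>
  have "w y \<le> epowr (w y) \<mu> * (ennreal (N powr \<theta>) * epowr T \<theta>)" if y: "y \<in> cube a k x" for y
  proof -
    have "epowr (w y) \<mu> \<le> ennreal N * T"
      unfolding N_def T_def by (rule level_le_avg) (use assms y in \<open>auto intro: level_comp\<close>)
    then have "epowr (epowr (w y) \<mu>) \<theta> \<le> epowr (ennreal N * T) \<theta>"
      using \<theta> by (intro epowr_mono) auto
    also have "\<dots> = ennreal (N powr \<theta>) * epowr T \<theta>"
      using \<theta> N by (simp add: epowr_mult)
    finally have "epowr (w y) (\<mu> * \<theta>) \<le> ennreal (N powr \<theta>) * epowr T \<theta>" by simp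
    then have "epowr (w y) \<mu> * epowr (w y) (\<mu> * \<theta>) \<le> epowr (w y) \<mu> * (ennreal (N powr \<theta>) * epowr T \<theta>)"
      by (intro mult_left_mono) auto
    moreover have "epowr (w y) \<mu> * epowr (w y) (\<mu> * \<theta>) = w y"
      using \<theta> assms(4) by (subst epowr_add[symmetric]) auto
    ultimately show ?thesis by simp
  qed
  then have "(\<integral>\<^sup>+y. w y * indicator (cube a k x) y \<partial>lborel)
     \<le> (\<integral>\<^sup>+y. (epowr (w y) \<mu> * indicator (cube a k x) y) * (ennreal (N powr \<theta>) * epowr T \<theta>) \<partial>lborel)"
    by (intro nn_integral_mono) (auto simp: indicator_def)
  also have "\<dots> = (\<integral>\<^sup>+y. epowr (w y) \<mu> * indicator (cube a k x) y \<partial>lborel) * (ennreal (N powr \<theta>) * epowr T \<theta>)"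
    by (rule nn_integral_multc) simp
  finally have "avg a k w x \<le> T * (ennreal (N powr \<theta>) * epowr T \<theta>)"
    unfolding avg_def T_def
    by (metis (no_types, lifting) divide_right_mono_ennreal ennreal_times_divide mult.commute)
  also have "\<dots> = ennreal (N powr \<theta>) * (epowr T 1 * epowr T \<theta>)" by (simp add: mult_ac)
  also have "\<dots> = ennreal (N powr \<theta>) * epowr T (1 / \<mu>)"
    using \<theta> by (subst epowr_add[symmetric]) auto
  finally show ?thesis using \<theta> by (simp add: N_def T_def \<theta>_def)
qed


section \<open>Averages of sequences at varying scales\<close>

text \<open>The tangent at the right end point V + v bounds the increment of the power. The right
  end point matters, since in the application V + v is constant on the cubes over which v was
  averaged.\<close>

lemma powr_Suc_le:
  assumes "1 \<le> P"
  shows "epowr (V + v) P \<le> epowr V P + ennreal P * (v * epowr (V + v) (P - 1))"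
proof (cases "P = 1 \<or> V + v = top")
  case True
  then show ?thesis
  proof
    assume P: "P = 1"
    \<comment> \<open>For P = 1 the exponent P - 1 is 0, and \<open>epowr 0 0\<close> is 0 rather
      than 1; the case \<open>V + v = 0\<close> is therefore treated apart.\<close>
    show ?thesis
    proof (cases "V + v = 0")
      case False
      then have "1 \<le> epowr (V + v) 0" by (cases "V + v") auto
      then have "v * 1 \<le> v * epowr (V + v) 0" by (rule mult_left_mono) simp
      then show ?thesis using P by (simp add: add_left_mono)
    qed (use P in auto)
  next
    assume "V + v = top"
    then show ?thesis using assms by (auto simp: ennreal_mult_top ennreal_top_mult)
  qed
next
  case False
  then obtain a b where ab: "V = ennreal a" "v = ennreal b" "0 \<le> a" "0 \<le> b"
    by (cases V; cases v) auto
  have "P * (a + b) powr (P - 1) * a \<le> a powr P + (P - 1) * (a + b) powr P"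
    using assms ab by (intro tangent_powr_real) auto
  moreover have "(a + b) powr P = (a + b) powr (P - 1) * (a + b)"
    using ab assms by (cases "a + b = 0") (auto simp: powr_diff)
  ultimately have "(a + b) powr P \<le> a powr P + P * (b * (a + b) powr (P - 1))"
    by (simp add: algebra_simps)
  then show ?thesis using ab assms
    by (simp flip: ennreal_plus ennreal_mult)
qed

text \<open>The constant grows with N. Only its finiteness for each N is drawn upon, to justify an
  absorption argument.\<close>

lemma epowr_sum_le:
  assumes "0 < P"
  shows "epowr (\<Sum>n<N. f n) P \<le> ennreal (2 powr (P * real N)) * (\<Sum>n<N. epowr (f n) P)"
proof (induction N)
  case (Suc N)
  have "epowr (\<Sum>n<Suc N. f n) P \<le> ennreal (2 powr P) * (epowr (\<Sum>n<N. f n) P + epowr (f N) P)"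
    using epowr_max_sum[OF assms] by simp
  also have "\<dots> \<le> ennreal (2 powr P) * (ennreal (2 powr (P * real N)) * (\<Sum>n<N. epowr (f n) P)
      + ennreal (2 powr (P * real N)) * epowr (f N) P)"
  proof (intro mult_left_mono add_mono Suc)
    have "1 \<le> ennreal (2 powr (P * real N))" using assms by (simp add: ge_one_powr_ge_zero)
    then show "epowr (f N) P \<le> ennreal (2 powr (P * real N)) * epowr (f N) P"
      using mult_right_mono[of 1 "ennreal (2 powr (P * real N))" "epowr (f N) P"] by simp
  qed auto
  also have "\<dots> = ennreal (2 powr (P * real (Suc N))) * (\<Sum>n<Suc N. epowr (f n) P)"
  proof -
    have "ennreal (2 powr (P * real (Suc N))) = ennreal (2 powr P) * ennreal (2 powr (P * real N))"
    proof -
      have "P * real (Suc N) = P + P * real N" by (simp add: algebra_simps)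
      then show ?thesis by (simp add: powr_add ennreal_mult)
    qed
    then show ?thesis unfolding sum.lessThan_Suc distrib_left by (simp only: mult.assoc)
  qed
  finally show ?case .
qed simp

text \<open>The partial sums \<open>V n\<close> of averages, coarse scales first, are themselves of the level of the
  next average, so that the average may be moved onto the function by self-adjointness.\<close>

lemma sum_avg_powr_le:
  fixes w :: "nat \<Rightarrow> real ^ 'n \<Rightarrow> ennreal" and L :: "nat \<Rightarrow> int"
  assumes [measurable]: "\<And>n. w n \<in> borel_measurable borel" and "antimono L" and P: "1 \<le> P"
  shows "(\<integral>\<^sup>+x. epowr (\<Sum>n<N. avg a (L n) (w n) x) P \<partial>lborel)
    \<le> ennreal (2 * (P * (2 * P) powr (P - 1))) * (\<integral>\<^sup>+x. epowr (\<Sum>n<N. w n x) P \<partial>lborel)"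
proof -
  define v where "v n = avg a (L n) (w n)" for n
  define V where "V n x = (\<Sum>i<n. v i x)" for n x
  define U where "U x = (\<Sum>n<N. w n x)" for x
  define C where "C = P * (2 * P) powr (P - 1)"
  have [measurable]: "v n \<in> borel_measurable borel" for n unfolding v_def by measurable
  have [measurable]: "V n \<in> borel_measurable borel" for n unfolding V_def[abs_def] by measurable
  have [measurable]: "U \<in> borel_measurable borel" unfolding U_def[abs_def] by measurable
  define IV where "IV = (\<integral>\<^sup>+x. epowr (V N x) P \<partial>lborel)"
  define IU where "IU = (\<integral>\<^sup>+x. epowr (U x) P \<partial>lborel)"
  \<comment> \<open>Scales get finer with n, so all earlier averages are constant on the cubes of
    level \<open>L n\<close>, and so is the new one.\<close>
  have lev: "level a (L n) (V (Suc n))" for n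
    unfolding level_def V_def
  proof (intro allI impI sum.cong refl)
    fix x y i assume "y \<in> cube a (L n) x" "i \<in> {..<Suc n}"
    then show "v i y = v i x"
      using level_mono[OF level_avg, of "L n" "L i" a "w i"] \<open>antimono L\<close>
      by (auto simp: v_def antimono_def intro!: levelD)
  qed
  have step: "(\<integral>\<^sup>+x. epowr (V n x) P \<partial>lborel)
      \<le> ennreal P * (\<Sum>i<n. \<integral>\<^sup>+x. w i x * epowr (V (Suc i) x) (P - 1) \<partial>lborel)" for n
  proof (induction n)
    case (Suc n)
    have "(\<integral>\<^sup>+x. epowr (V (Suc n) x) P \<partial>lborel)
      \<le> (\<integral>\<^sup>+x. epowr (V n x) P + ennreal P * (v n x * epowr (V (Suc n) x) (P - 1)) \<partial>lborel)"
      using powr_Suc_le[OF P] by (intro nn_integral_mono) (simp add: V_def)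
    also have "\<dots> = (\<integral>\<^sup>+x. epowr (V n x) P \<partial>lborel) + ennreal P * (\<integral>\<^sup>+x. v n x * epowr (V (Suc n) x) (P - 1) \<partial>lborel)"
      by (simp add: nn_integral_add nn_integral_cmult)
    also have "(\<integral>\<^sup>+x. v n x * epowr (V (Suc n) x) (P - 1) \<partial>lborel) = (\<integral>\<^sup>+x. w n x * epowr (V (Suc n) x) (P - 1) \<partial>lborel)"
      unfolding v_def by (rule nn_integral_avg_level) (auto intro: level_comp lev)
    also have "(\<integral>\<^sup>+x. epowr (V n x) P \<partial>lborel) + ennreal P * (\<integral>\<^sup>+x. w n x * epowr (V (Suc n) x) (P - 1) \<partial>lborel)
      \<le> ennreal P * (\<Sum>i<Suc n. \<integral>\<^sup>+x. w i x * epowr (V (Suc i) x) (P - 1) \<partial>lborel)"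
      using add_right_mono[OF Suc] by (simp add: distrib_left)
    finally show ?case .
  qed (simp add: V_def)
  have mult_le: "epowr t 1 * epowr t (P - 1) \<le> epowr t P" for t
  proof (cases "P = 1")
    case True
    then show ?thesis by (cases t) auto
  next
    case False
    then show ?thesis using P epowr_add[of 1 "P - 1" t] by simp
  qed
  \<comment> \<open>Either V \<le> 2 P U, and the product is at most C U^P, or P U \<le> V / 2, and
    it is at most V^P / 2, which can be absorbed. This dichotomy is the origin of C.\<close>
  have young: "ennreal P * (U x * epowr (V N x) (P - 1)) \<le> ennreal (1 / 2) * epowr (V N x) P + ennreal C * epowr (U x) P" for x
  proof (cases "V N x \<le> ennreal (2 * P) * U x")
    case True
    then have "epowr (V N x) (P - 1) \<le> ennreal ((2 * P) powr (P - 1)) * epowr (U x) (P - 1)"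
    proof (cases "P = 1")
      case True
      then show ?thesis using \<open>V N x \<le> _\<close>
        by (cases "V N x"; cases "U x") (auto simp: ennreal_mult_eq_top_iff top_unique)
    next
      case False
      then show ?thesis using epowr_mono[OF \<open>V N x \<le> _\<close>, of "P - 1"] P by (simp add: epowr_mult)
    qed
    then have "ennreal P * (U x * epowr (V N x) (P - 1)) \<le> ennreal P * (U x * (ennreal ((2 * P) powr (P - 1)) * epowr (U x) (P - 1)))"
      by (intro mult_left_mono) auto
    also have "\<dots> = ennreal C * (epowr (U x) 1 * epowr (U x) (P - 1))"
      using P by (simp add: C_def ennreal_mult mult_ac)
    also have "epowr (U x) 1 * epowr (U x) (P - 1) \<le> epowr (U x) P"
      by (rule mult_le)
    finally show ?thesis by (meson add_increasing le_zero_eq linear mult_left_mono order_trans zero_le)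
  next
    case False
    then have le: "ennreal P * U x \<le> ennreal (1 / 2) * V N x"
    proof -
      have "ennreal P * U x = ennreal (1 / 2) * (ennreal (2 * P) * U x)"
      proof -
        have "ennreal P = ennreal (1 / 2) * ennreal (2 * P)" using P by (subst ennreal_mult[symmetric]) auto
        then show ?thesis by (simp only: mult.assoc)
      qed
      also have "\<dots> \<le> ennreal (1 / 2) * V N x" using False by (intro mult_left_mono) auto
      finally show ?thesis .
    qed
    have "ennreal P * (U x * epowr (V N x) (P - 1)) = (ennreal P * U x) * epowr (V N x) (P - 1)" by (simp add: mult_ac)
    also have "\<dots> \<le> (ennreal (1 / 2) * V N x) * epowr (V N x) (P - 1)" by (intro mult_right_mono le) auto
    also have "\<dots> = ennreal (1 / 2) * (epowr (V N x) 1 * epowr (V N x) (P - 1))" by (simp add: mult_ac)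
    also have "epowr (V N x) 1 * epowr (V N x) (P - 1) \<le> epowr (V N x) P"
      by (rule mult_le)
    finally show ?thesis by (meson add_increasing2 le_zero_eq linear mult_left_mono order_trans zero_le)
  qed
  have "IV \<le> ennreal P * (\<Sum>i<N. \<integral>\<^sup>+x. w i x * epowr (V N x) (P - 1) \<partial>lborel)"
    unfolding IV_def using P
    by (intro order_trans[OF step] mult_left_mono sum_mono nn_integral_mono epowr_mono)
       (auto simp: V_def simp del: sum.lessThan_Suc intro!: sum_mono2)
  also have "\<dots> = (\<integral>\<^sup>+x. ennreal P * (U x * epowr (V N x) (P - 1)) \<partial>lborel)"
    by (simp add: U_def sum_distrib_right nn_integral_sum nn_integral_cmult)
  also have "\<dots> \<le> (\<integral>\<^sup>+x. ennreal (1 / 2) * epowr (V N x) P + ennreal C * epowr (U x) P \<partial>lborel)"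
    by (intro nn_integral_mono young)
  also have "\<dots> = ennreal (1 / 2) * IV + ennreal C * IU"
    by (simp add: nn_integral_add nn_integral_cmult IV_def IU_def)
  finally have main: "IV \<le> ennreal (1 / 2) * IV + ennreal C * IU" .
  have C: "0 < C" using P by (simp add: C_def)
  have "IV \<le> ennreal (2 * C) * IU"
  proof (cases "IU = top")
    case True
    then show ?thesis using C by (simp add: ennreal_mult_top)
  next
    \<comment> \<open>Absorbing half of \<open>IV\<close> into the left-hand side requires
      \<open>IV\<close> to be finite. For fixed N this follows from Jensen's inequality for the
      single averages and the crude bound \<open>epowr_sum_le\<close>.\<close>
    case False
    have "(\<integral>\<^sup>+x. epowr (v n x) P \<partial>lborel) < top" if "n < N" for n
    proof -
      have "(\<integral>\<^sup>+x. epowr (v n x) P \<partial>lborel) \<le> (\<integral>\<^sup>+x. avg a (L n) (\<lambda>x. epowr (w n x) P) x \<partial>lborel)"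
        using P prob_space.jensen_epowr[OF prob_cube, of "w n" a "L n" _ P]
        by (intro nn_integral_mono) (simp add: v_def avg_uniform)
      also have "\<dots> = (\<integral>\<^sup>+x. epowr (w n x) P \<partial>lborel)" by (rule nn_integral_avg) measurable
      also have "\<dots> \<le> IU"
        unfolding IU_def U_def using P that
        by (intro nn_integral_mono epowr_mono) (auto intro: member_le_sum)
      finally show ?thesis using False by (simp add: less_top order_le_less_trans)
    qed
    then have "(\<integral>\<^sup>+x. ennreal (2 powr (P * real N)) * (\<Sum>n<N. epowr (v n x) P) \<partial>lborel) < top"
      by (simp add: nn_integral_cmult nn_integral_sum ennreal_mult_less_top ennreal_sum_less_top)
    moreover have "IV \<le> (\<integral>\<^sup>+x. ennreal (2 powr (P * real N)) * (\<Sum>n<N. epowr (v n x) P) \<partial>lborel)"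
      unfolding IV_def V_def using P by (intro nn_integral_mono epowr_sum_le) auto
    ultimately have "IV < top" by (rule order_le_less_trans[rotated])
    then obtain i u where iu: "IV = ennreal i" "IU = ennreal u" "0 \<le> i" "0 \<le> u"
      using False by (cases IV; cases IU) auto
    have "ennreal (1 / 2) * ennreal i + ennreal C * ennreal u = ennreal (1 / 2 * i + C * u)"
      using iu C by (simp only: ennreal_plus[symmetric] ennreal_mult[symmetric] mult_nonneg_nonneg
        zero_le_divide_1_iff zero_le_numeral less_imp_le)
    then have "i \<le> 1 / 2 * i + C * u"
      using main iu C by (simp only: ennreal_le_iff mult_nonneg_nonneg add_nonneg_nonneg
        zero_le_divide_1_iff zero_le_numeral less_imp_le)
    then show ?thesis unfolding iu using iu C by (simp flip: ennreal_mult)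
  qed
  then show ?thesis by (simp add: IV_def IU_def V_def U_def v_def C_def)
qed

text \<open>A binary operation that is a supremum of positive linear functionals with slope at most one
  in the first argument; the examples are the \<open>l\<^sup>Q\<close> norms on the plane.\<close>

locale gauge =
  fixes h :: "ennreal \<Rightarrow> ennreal \<Rightarrow> ennreal"
  assumes h_mono: "a \<le> a' \<Longrightarrow> u \<le> u' \<Longrightarrow> h a u \<le> h a' u'"
    and h_le1: "a \<le> h a u" and h_le2: "u \<le> h a u" and h_0: "h 0 0 = 0"
    and h_measurable2: "(\<lambda>z. h (fst z) (snd z)) \<in> borel_measurable (borel \<Otimes>\<^sub>M borel)"
    and h_support: "0 \<le> r \<Longrightarrow> 0 \<le> t \<Longrightarrow> \<exists>c d. 0 \<le> c \<and> c \<le> 1 \<and> 0 \<le> d \<and>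
        h (ennreal r) (ennreal t) = ennreal (c * r + d * t) \<and>
        (\<forall>r' t'. 0 \<le> r' \<longrightarrow> 0 \<le> t' \<longrightarrow> ennreal (c * r' + d * t') \<le> h (ennreal r') (ennreal t'))"
begin

lemma h_measurable:
  assumes "f \<in> borel_measurable M" "g \<in> borel_measurable M"
  shows "(\<lambda>x. h (f x) (g x)) \<in> borel_measurable M"
  using measurable_compose[OF measurable_Pair[OF assms] h_measurable2] by simp


text \<open>The supporting functional at (a, u) has slope at most 1 in the first variable, so h
  drops by at most a - b when a is lowered to b. Sums in place of differences keep the inequality
  meaningful at top.\<close>

lemma h_diff: "b \<le> a \<Longrightarrow> h a u + b \<le> a + h b u"
proof (cases "a = top \<or> u = top")
  case True
  then show ?thesis using h_le2[of u b] by (auto simp: top_unique)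
next
  case False
  assume ba: "b \<le> a"
  from False obtain ra ru where r: "a = ennreal ra" "u = ennreal ru" "0 \<le> ra" "0 \<le> ru"
    by (cases a; cases u) auto
  from ba r obtain rb where b: "b = ennreal rb" "0 \<le> rb" by (cases b) (auto simp: top_unique)
  have "rb \<le> ra" using ba r b by simp
  obtain c d where cd: "0 \<le> c" "c \<le> 1" "0 \<le> d" "h (ennreal ra) (ennreal ru) = ennreal (c * ra + d * ru)"
    "ennreal (c * rb + d * ru) \<le> h (ennreal rb) (ennreal ru)"
    using h_support[of ra ru] r b by blast
  have "(1 - c) * rb \<le> (1 - c) * ra" using \<open>rb \<le> ra\<close> cd by (intro mult_left_mono) auto
  then have "c * ra + d * ru + rb \<le> ra + (c * rb + d * ru)" by (simp add: algebra_simps)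
  then have "h a u + b \<le> ennreal (ra + (c * rb + d * ru))"
    using cd r b by (simp flip: ennreal_plus)
  also have "\<dots> = ennreal ra + ennreal (c * rb + d * ru)" using r b cd by simp
  also have "\<dots> \<le> a + h b u" using cd r b by (intro add_mono) auto
  finally show ?thesis .
qed

text \<open>Average the supporting functional taken at z and the mean of w. The first argument stays
  fixed here; it will be a function that is constant on the cube.\<close>

lemma h_jensen:
  fixes w :: "real ^ 'n \<Rightarrow> ennreal"
  assumes [measurable]: "w \<in> borel_measurable borel"
  shows "h z (avg a k w x) \<le> avg a k (\<lambda>y. h z (w y)) x"
proof -
  have [measurable]: "(\<lambda>y. h z (w y)) \<in> borel_measurable borel" by (intro h_measurable) auto
  consider "z = top" | "avg a k w x = top" | r u where "z = ennreal r" "avg a k w x = ennreal u" "0 \<le> r" "0 \<le> u"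
    by (cases z; cases "avg a k w x") auto
  then show ?thesis
  proof cases
    case 1
    then have "h z (w y) = top" for y using h_le1[of z "w y"] by (simp add: top_unique)
    then show ?thesis by (simp add: avg_const)
  next
    case 2
    have "avg a k w x \<le> avg a k (\<lambda>y. h z (w y)) x" by (intro avg_mono h_le2)
    then show ?thesis using 2 by (simp add: top_unique)
  next
    case 3
    obtain c d where cd: "0 \<le> c" "0 \<le> d" "h z (avg a k w x) = ennreal (c * r + d * u)"
      "\<And>u'. 0 \<le> u' \<Longrightarrow> ennreal (c * r + d * u') \<le> h (ennreal r) (ennreal u')"
      using h_support[of r u] 3 by metis
    interpret prob_space "uniform_measure lborel (cube a k x)" by (rule prob_cube)
    have "ennreal c * z + ennreal d * w y \<le> h z (w y)" for y
    proof (cases "w y")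
      case (real t)
      then show ?thesis using cd 3 by (simp flip: ennreal_mult ennreal_plus)
    next
      case top
      then show ?thesis using h_le2[of top z] by (simp add: top_unique)
    qed
    then have "avg a k (\<lambda>y. ennreal c * z + ennreal d * w y) x \<le> avg a k (\<lambda>y. h z (w y)) x"
      by (rule avg_mono)
    also have "avg a k (\<lambda>y. ennreal c * z + ennreal d * w y) x = ennreal c * z + ennreal d * avg a k w x"
      using emeasure_space_1 by (simp add: avg_uniform nn_integral_add nn_integral_cmult)
    also have "\<dots> = h z (avg a k w x)"
      using cd 3 by (simp flip: ennreal_mult ennreal_plus)
    finally show ?thesis .
  qed
qed

text \<open>For the two gauges in use this is the \<open>l^Q\<close> norm, respectively the maximum,
  of the first n entries.\<close>

primrec fold_h :: "(nat \<Rightarrow> ennreal) \<Rightarrow> nat \<Rightarrow> ennreal" where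
  "fold_h u 0 = 0"
| "fold_h u (Suc n) = h (fold_h u n) (u n)"

lemma fold_h_mono: "m \<le> n \<Longrightarrow> fold_h u m \<le> fold_h u n"
  using lift_Suc_mono_le[of "fold_h u" m n] h_le1 by simp

text \<open>Averages of an adapted sequence, where adaptedness holds up to a delay of \<open>D\<close> steps.
  The auxiliary process \<open>Z\<close> never drops below the delayed process \<open>U\<close>, so that by
  concavity its increments are controlled by those of \<open>U\<close>.\<close>

lemma nn_integral_fold_avg_le:
  fixes w :: "nat \<Rightarrow> real ^ 'n \<Rightarrow> ennreal" and L l :: "nat \<Rightarrow> int"
  assumes w [measurable]: "\<And>n. w n \<in> borel_measurable borel"
    and lev: "\<And>n. level a (l n) (w n)"
    and "antimono L" and delay: "\<And>m n. m + D < n \<Longrightarrow> L n \<le> l m"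
  shows "(\<integral>\<^sup>+x. fold_h (\<lambda>n. avg a (L n) (w n) x) N \<partial>lborel)
    \<le> of_nat (D + 2) * (\<integral>\<^sup>+x. fold_h (\<lambda>n. w n x) N \<partial>lborel)"
proof -
  define v where "v n = avg a (L n) (w n)" for n
  define U where "U n x = fold_h (\<lambda>i. w i x) n" for n x
  define V where "V n x = fold_h (\<lambda>i. v i x) n" for n x
  define Z where "Z = rec_nat (\<lambda>x. 0) (\<lambda>n z x. h (max (z x) (U (n - D) x)) (v n x))"
  define A where "A n x = max (Z n x) (U (n - D) x)" for n x
  have Z0: "Z 0 = (\<lambda>x. 0)" and ZS: "Z (Suc n) = (\<lambda>x. h (A n x) (v n x))" for n
    by (simp_all add: Z_def A_def)
  have U0: "U 0 x = 0" and US: "U (Suc n) x = h (U n x) (w n x)" for n x by (simp_all add: U_def)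
  have U_mono: "m \<le> n \<Longrightarrow> U m x \<le> U n x" for m n x unfolding U_def by (rule fold_h_mono)
  have [measurable]: "v n \<in> borel_measurable borel" for n unfolding v_def by measurable
  have [measurable]: "U n \<in> borel_measurable borel" for n
    by (induction n) (auto simp: U_def[abs_def] intro!: h_measurable)
  have ZA: "Z n \<in> borel_measurable borel \<and> A n \<in> borel_measurable borel" for n
  proof (induction n)
    case 0
    then show ?case by (simp add: Z0 A_def[abs_def])
  next
    case (Suc n)
    then have [measurable]: "Z (Suc n) \<in> borel_measurable borel" by (auto simp: ZS intro!: h_measurable)
    then show ?case by (simp add: A_def[abs_def])
  qed
  then have [measurable]: "Z n \<in> borel_measurable borel" "A n \<in> borel_measurable borel" for n by auto
  have levU: "level a (L n) (U m)" if "m \<le> n - D" for m n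
    using that
  proof (induction m)
    case 0
    then show ?case by (simp add: level_def U0)
  next
    case (Suc m)
    then have "level a (L n) (w m)" using delay[of m n] lev level_mono by force
    moreover have "level a (L n) (U m)" using Suc by simp
    ultimately show ?case unfolding level_def US by metis
  qed
  have levZ: "level a (L n) (Z m)" if "m \<le> n" for m n
    using that
  proof (induction m)
    case 0
    then show ?case by (simp add: level_def Z0)
  next
    case (Suc m)
    have "level a (L n) (v m)"
      unfolding v_def using \<open>antimono L\<close> Suc.prems by (auto intro!: level_mono[OF level_avg] simp: antimono_def)
    moreover have "level a (L n) (Z m)" "level a (L n) (U (m - D))"
      using Suc by (auto intro!: levU diff_le_mono)
    ultimately show ?case unfolding level_def ZS A_def by metis
  qed
  have levA: "level a (L n) (A n)" for n
    using levZ[of n n] levU[of "n - D" n] unfolding level_def A_def by simp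
  define I where "I n = (\<integral>\<^sup>+x. U n x \<partial>lborel)" for n
  define J where "J n = (\<integral>\<^sup>+x. A n x \<partial>lborel)" for n
  have I_mono: "m \<le> n \<Longrightarrow> I m \<le> I n" for m n unfolding I_def by (intro nn_integral_mono U_mono)
  have I0: "I 0 = 0" by (simp add: I_def U0)
  \<comment> \<open>Of the two copies of \<open>I (n - D)\<close> one stems from the maximum in A
    and one from \<open>h_diff\<close> with b = \<open>U (n - D)\<close>. Rearranged, J grows by at
    most (I (n+1) - I (n-D)) + (I (n+1-D) - I (n-D)). For n < D the truncated difference n - D
    refers to \<open>U 0\<close>, which vanishes.\<close>
  have step: "J (Suc n) + (I (n - D) + I (n - D)) \<le> J n + (I (Suc n) + I (Suc n - D))" for n
  proof -
    have "A (Suc n) x + U (n - D) x \<le> Z (Suc n) x + U (Suc n - D) x" for x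
    proof -
      have "U (n - D) x \<le> Z (Suc n) x"
        unfolding ZS A_def by (rule order_trans[OF _ h_le1]) simp
      moreover have "U (n - D) x \<le> U (Suc n - D) x" by (intro U_mono) simp
      ultimately show ?thesis
        by (simp add: A_def max_def add.commute add_mono)
    qed
    then have "(\<integral>\<^sup>+x. A (Suc n) x + U (n - D) x \<partial>lborel) \<le> (\<integral>\<^sup>+x. Z (Suc n) x + U (Suc n - D) x \<partial>lborel)"
      by (intro nn_integral_mono)
    then have 1: "J (Suc n) + I (n - D) \<le> (\<integral>\<^sup>+x. Z (Suc n) x \<partial>lborel) + I (Suc n - D)"
      by (simp add: nn_integral_add J_def I_def)
    have [measurable]: "(\<lambda>x. h (A n x) (w n x)) \<in> borel_measurable borel" by (intro h_measurable) auto
    have "(\<integral>\<^sup>+x. Z (Suc n) x \<partial>lborel) \<le> (\<integral>\<^sup>+x. avg a (L n) (\<lambda>y. h (A n y) (w n y)) x \<partial>lborel)"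
    proof (intro nn_integral_mono)
      fix x
      have "Z (Suc n) x \<le> avg a (L n) (\<lambda>y. h (A n x) (w n y)) x"
        unfolding ZS v_def by (rule h_jensen) simp
      \<comment> \<open>\<open>A n\<close> is constant on the cube of x, so its frozen value may be
        replaced by the function.\<close>
      also have "\<dots> = avg a (L n) (\<lambda>y. h (A n y) (w n y)) x"
        unfolding avg_def using levelD[OF levA]
        by (intro arg_cong2[where f="(/)"] nn_integral_cong refl) (auto simp: indicator_def)
      finally show "Z (Suc n) x \<le> avg a (L n) (\<lambda>y. h (A n y) (w n y)) x" .
    qed
    also have "\<dots> = (\<integral>\<^sup>+x. h (A n x) (w n x) \<partial>lborel)" by (rule nn_integral_avg) simp
    finally have 2: "(\<integral>\<^sup>+x. Z (Suc n) x \<partial>lborel) \<le> (\<integral>\<^sup>+x. h (A n x) (w n x) \<partial>lborel)" .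
    have "h (A n x) (w n x) + U (n - D) x \<le> A n x + U (Suc n) x" for x
    proof -
      have "h (A n x) (w n x) + U (n - D) x \<le> A n x + h (U (n - D) x) (w n x)"
        by (rule h_diff) (simp add: A_def)
      also have "\<dots> \<le> A n x + U (Suc n) x"
        unfolding US by (intro add_left_mono h_mono U_mono) auto
      finally show ?thesis .
    qed
    then have "(\<integral>\<^sup>+x. h (A n x) (w n x) + U (n - D) x \<partial>lborel) \<le> (\<integral>\<^sup>+x. A n x + U (Suc n) x \<partial>lborel)"
      by (intro nn_integral_mono)
    then have 3: "(\<integral>\<^sup>+x. h (A n x) (w n x) \<partial>lborel) + I (n - D) \<le> J n + I (Suc n)"
      by (simp add: nn_integral_add J_def I_def)
    have "J (Suc n) + (I (n - D) + I (n - D)) \<le> (\<integral>\<^sup>+x. Z (Suc n) x \<partial>lborel) + I (Suc n - D) + I (n - D)"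
      using 1 by (simp add: add.assoc[symmetric] add_right_mono)
    also have "\<dots> = (\<integral>\<^sup>+x. Z (Suc n) x \<partial>lborel) + I (n - D) + I (Suc n - D)" by (simp add: ac_simps)
    also have "\<dots> \<le> (J n + I (Suc n)) + I (Suc n - D)"
      using order_trans[OF add_right_mono[OF 2] 3] by (rule add_right_mono)
    finally show ?thesis by (simp add: add.assoc)
  qed
  have "J N \<le> of_nat (D + 2) * I N"
  proof (cases "I N = top")
    case True
    then show ?thesis by (simp add: ennreal_mult_top)
  next
    case False
    then have fin: "I n < top" if "n \<le> N" for n
      using I_mono[OF that] by (simp add: less_top order_le_less_trans)
    define i where "i n = enn2real (I n)" for n
    have Ii: "I n = ennreal (i n)" if "n \<le> N" for n using fin[OF that] by (simp add: i_def less_top)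
    have i_nonneg: "0 \<le> i n" for n by (simp add: i_def)
    \<comment> \<open>Both brackets of the increment telescope: the first leaves the last D + 1
      values of i, the second leaves one more. This gives the D + 2 copies of
      \<open>I N\<close>.\<close>
    have bound: "J n \<le> ennreal ((\<Sum>j\<le>D. i (n - j)) + i (n - D))" if "n \<le> N" for n
      using that
    proof (induction n)
      case 0
      then show ?case by (simp add: J_def A_def Z0 U0)
    next
      case (Suc n)
      define s where "s = (\<Sum>j\<le>D. i (n - j))"
      have s: "0 \<le> s" unfolding s_def by (intro sum_nonneg i_nonneg)
      have Jn: "J n \<le> ennreal (s + i (n - D))" using Suc by (simp add: s_def)
      have "J (Suc n) + (I (n - D) + I (n - D)) \<le> J n + (I (Suc n) + I (Suc n - D))" by (rule step)
      also have "\<dots> \<le> ennreal (s + i (n - D)) + (I (Suc n) + I (Suc n - D))"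
        by (intro add_right_mono Jn)
      also have "\<dots> = ennreal (s + i (n - D) + (i (Suc n) + i (Suc n - D)))"
        using Suc.prems s i_nonneg Ii[of "Suc n"] Ii[of "Suc n - D"] by simp
      finally have le: "J (Suc n) + ennreal (i (n - D) + i (n - D)) \<le> ennreal (s + i (n - D) + (i (Suc n) + i (Suc n - D)))"
        using Suc.prems i_nonneg Ii[of "n - D"] by (simp del: mult_2 add: ennreal_plus[symmetric] del: ennreal_plus)
      then obtain j where j: "J (Suc n) = ennreal j" "0 \<le> j" by (cases "J (Suc n)") (auto simp: top_unique)
      have "j \<le> s + i (Suc n) + i (Suc n - D) - i (n - D)"
        using le s i_nonneg unfolding j by (simp flip: ennreal_plus add: j)
      also have "\<dots> = (\<Sum>j\<le>D. i (Suc n - j)) + i (Suc n - D)"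
      proof -
        have "(\<Sum>j\<le>D. i (Suc n - j)) + i (n - D) = (\<Sum>j\<le>Suc D. i (Suc n - j))" by simp
        also have "\<dots> = i (Suc n) + s" by (subst sum.atMost_Suc_shift) (simp add: s_def)
        finally show ?thesis by simp
      qed
      finally show ?case using j by simp
    qed
    have "(\<Sum>j\<le>D. i (N - j)) + i (N - D) \<le> (\<Sum>j\<le>D. i N) + i N"
    proof (intro add_mono sum_mono)
      have "i n \<le> i N" if "n \<le> N" for n
        using I_mono[OF that] Ii[OF that] Ii[of N] i_nonneg by simp
      then show "i (N - j) \<le> i N" "i (N - D) \<le> i N" for j by auto
    qed
    also have "\<dots> = real (D + 2) * i N" by (simp add: algebra_simps)
    finally have "J N \<le> ennreal (real (D + 2) * i N)"
      using bound[of N] by (meson ennreal_leI le_refl order_trans)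
    also have "\<dots> = of_nat (D + 2) * I N"
      using Ii[of N] i_nonneg by (subst ennreal_mult) (auto simp: ennreal_of_nat_eq_real_of_nat)
    finally show ?thesis .
  qed
  moreover have "V n x \<le> Z n x" for n x
  proof (induction n)
    case (Suc n)
    then show ?case by (auto simp: V_def ZS A_def intro!: h_mono max.coboundedI1)
  qed (simp add: V_def)
  then have "(\<integral>\<^sup>+x. V N x \<partial>lborel) \<le> J N"
    unfolding J_def A_def by (intro nn_integral_mono max.coboundedI1)
  ultimately show ?thesis by (simp add: V_def I_def U_def v_def)
qed

end


section \<open>The two gauges: \<open>l^Q\<close> norms and the maximum\<close>

definition hpow :: "real \<Rightarrow> ennreal \<Rightarrow> ennreal \<Rightarrow> ennreal" where
  "hpow Q a u = epowr (epowr a Q + epowr u Q) (1 / Q)"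

text \<open>(c, d) is the gradient of the \<open>l^Q\<close> norm at (r, t), which is homogeneous of
  degree 0. After scaling both points to the unit sphere the claim is the sum of two tangent
  inequalities, one for each coordinate.\<close>

lemma hpow_support:
  fixes r t Q :: real
  assumes Q: "1 \<le> Q" and "0 \<le> r" "0 \<le> t"
  defines "H \<equiv> \<lambda>x y :: real. (x powr Q + y powr Q) powr (1 / Q)"
  shows "\<exists>c d. 0 \<le> c \<and> c \<le> 1 \<and> 0 \<le> d \<and> H r t = c * r + d * t \<and>
    (\<forall>r' t'. 0 \<le> r' \<longrightarrow> 0 \<le> t' \<longrightarrow> c * r' + d * t' \<le> H r' t')"
proof (cases "Q = 1 \<or> H r t = 0")
  case True
  then show ?thesis
  proof
    assume "Q = 1"
    then show ?thesis using assms by (intro exI[of _ 1]) auto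
  next
    assume "H r t = 0"
    then have "r = 0" "t = 0"
      using assms by (auto simp: H_def add_nonneg_eq_0_iff)
    then show ?thesis using Q by (intro exI[of _ 0]) (auto simp: H_def)
  qed
next
  case False
  define h where "h = H r t"
  have h: "0 < h" using False by (auto simp: h_def H_def)
  have hQ: "h powr Q = r powr Q + t powr Q"
    using Q by (simp add: h_def H_def powr_powr)
  define c where "c = (r / h) powr (Q - 1)"
  define d where "d = (t / h) powr (Q - 1)"
  have "r powr Q \<le> h powr Q" by (simp add: hQ)
  then have "r \<le> h" using assms h powr_less_mono2[of Q h r] by (meson less_le_trans linorder_not_le zero_less_one less_imp_le)
  then have c: "0 \<le> c" "c \<le> 1" using assms h False by (auto simp: c_def intro!: powr_le1)
  have cr: "c * r = h * (r / h) powr Q" "d * t = h * (t / h) powr Q"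
    using h assms by (auto simp: c_def d_def powr_diff)
  have one: "(r / h) powr Q + (t / h) powr Q = 1"
    using h assms by (simp add: powr_divide add_divide_distrib[symmetric] hQ[symmetric])
  have "c * r + d * t = h" unfolding cr distrib_left[symmetric] one by simp
  moreover have "c * r' + d * t' \<le> H r' t'" if "0 \<le> r'" "0 \<le> t'" for r' t'
  proof (cases "H r' t' = 0")
    case True
    then have "r' = 0" "t' = 0"
      using that by (auto simp: H_def add_nonneg_eq_0_iff)
    then show ?thesis by (simp add: H_def)
  next
    case False
    define g where "g = H r' t'"
    have g: "0 < g" using False by (auto simp: g_def H_def)
    have gQ: "g powr Q = r' powr Q + t' powr Q" using Q by (simp add: g_def H_def powr_powr)
    have one': "(r' / g) powr Q + (t' / g) powr Q = 1"
      using g that by (simp add: powr_divide add_divide_distrib[symmetric] gQ[symmetric])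
    have "Q * (c * (r' / g) + d * (t' / g))
        \<le> ((r' / g) powr Q + (Q - 1) * (r / h) powr Q) + ((t' / g) powr Q + (Q - 1) * (t / h) powr Q)"
      using tangent_powr_real[OF Q, of "r' / g" "r / h"] tangent_powr_real[OF Q, of "t' / g" "t / h"] that g h assms
      by (simp add: c_def d_def distrib_left mult.assoc)
    also have "\<dots> = ((r' / g) powr Q + (t' / g) powr Q) + (Q - 1) * ((r / h) powr Q + (t / h) powr Q)"
      by (simp add: algebra_simps)
    also have "\<dots> = Q" by (simp add: one one')
    finally have "c * (r' / g) + d * (t' / g) \<le> 1" using Q by simp
    then show ?thesis using g unfolding g_def[symmetric] by (simp add: field_simps)
  qed
  ultimately show ?thesis using c unfolding h_def by (intro exI[of _ c] exI[of _ d]) (auto simp: d_def)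
qed

lemma gauge_hpow:
  assumes Q: "1 \<le> Q"
  shows "gauge (hpow Q)"
proof
  have pos: "0 < Q" using Q by simp
  fix a a' u u' :: ennreal and r t :: real
  show "a \<le> a' \<Longrightarrow> u \<le> u' \<Longrightarrow> hpow Q a u \<le> hpow Q a' u'"
    unfolding hpow_def using Q by (intro epowr_mono add_mono) auto
  show "a \<le> hpow Q a u" "u \<le> hpow Q a u"
    unfolding hpow_def using pos by (simp_all add: epowr_le_swap[symmetric])
  show "hpow Q 0 0 = 0" by (simp add: hpow_def)
  show "(\<lambda>z. hpow Q (fst z) (snd z)) \<in> borel_measurable (borel \<Otimes>\<^sub>M borel)"
    unfolding hpow_def by measurable
  assume rt: "0 \<le> r" "0 \<le> t"
  have eq: "hpow Q (ennreal x) (ennreal y) = ennreal ((x powr Q + y powr Q) powr (1 / Q))" if "0 \<le> x" "0 \<le> y" for x y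
    using that by (simp add: hpow_def flip: ennreal_plus)
  obtain c d where cd: "0 \<le> c" "c \<le> 1" "0 \<le> d" "(r powr Q + t powr Q) powr (1 / Q) = c * r + d * t"
     "\<And>r' t'. 0 \<le> r' \<Longrightarrow> 0 \<le> t' \<Longrightarrow> c * r' + d * t' \<le> (r' powr Q + t' powr Q) powr (1 / Q)"
    using hpow_support[OF Q rt] by auto
  have "hpow Q (ennreal r) (ennreal t) = ennreal (c * r + d * t)"
    using eq[OF rt] cd(4) by simp
  moreover have "ennreal (c * r' + d * t') \<le> hpow Q (ennreal r') (ennreal t')" if "0 \<le> r'" "0 \<le> t'" for r' t'
    unfolding eq[OF that] by (rule ennreal_leI) (rule cd(5)[OF that])
  ultimately show "\<exists>c d. 0 \<le> c \<and> c \<le> 1 \<and> 0 \<le> d \<and>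
      hpow Q (ennreal r) (ennreal t) = ennreal (c * r + d * t) \<and>
      (\<forall>r' t'. 0 \<le> r' \<longrightarrow> 0 \<le> t' \<longrightarrow> ennreal (c * r' + d * t') \<le> hpow Q (ennreal r') (ennreal t'))"
    using cd by blast
qed

lemma gauge_max: "gauge (max :: ennreal \<Rightarrow> ennreal \<Rightarrow> ennreal)"
proof
  fix r t :: real
  assume "0 \<le> r" "0 \<le> t"
  then show "\<exists>c d. 0 \<le> c \<and> c \<le> 1 \<and> 0 \<le> d \<and> max (ennreal r) (ennreal t) = ennreal (c * r + d * t) \<and>
      (\<forall>r' t'. 0 \<le> r' \<longrightarrow> 0 \<le> t' \<longrightarrow> ennreal (c * r' + d * t') \<le> max (ennreal r') (ennreal t'))"
    by (cases "t \<le> r"; intro exI[of _ "if t \<le> r then 1 else 0"] exI[of _ "if t \<le> r then 0 else 1"])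
       (auto simp: max_def ennreal_leI)
qed (auto simp: max.coboundedI1 max.coboundedI2)

interpretation max: gauge max by (rule gauge_max)

lemma fold_hpow:
  assumes "1 \<le> Q"
  shows "gauge.fold_h (hpow Q) u n = epowr (\<Sum>i<n. epowr (u i) Q) (1 / Q)"
proof -
  interpret gauge "hpow Q" by (rule gauge_hpow[OF assms])
  show ?thesis
  proof (induction n)
    case 0
    show ?case by (simp only: fold_h.simps lessThan_0 sum.empty epowr_0)
  next
    case (Suc n)
    have "fold_h u (Suc n) = hpow Q (fold_h u n) (u n)" by (rule fold_h.simps)
    also have "\<dots> = epowr (\<Sum>i<Suc n. epowr (u i) Q) (1 / Q)"
      unfolding Suc hpow_def using assms by simp
    finally show ?case .
  qed
qed

lemma fold_max: "max.fold_h u n = (SUP i\<in>{..<n}. u i)"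
  by (induction n) (auto simp: lessThan_Suc sup_max bot_ennreal max.commute)

section \<open>From finite windows of scales, listed from coarse to fine, to all scales\<close>

lemma sum_int_window: "(\<Sum>k\<in>{- int N..int N}. f k) = (\<Sum>n<2 * N + 1. f (int N - int n))"
  by (rule sum.reindex_bij_witness[of _ "\<lambda>n. int N - int n" "\<lambda>k. nat (int N - k)"]) auto

lemma SUP_int_window: "(SUP k. f k :: ennreal) = (SUP N. SUP n\<in>{..<2 * N + 1}. f (int N - int n))"
proof (intro antisym SUP_least)
  fix k :: int
  show "f k \<le> (SUP N. SUP n\<in>{..<2 * N + 1}. f (int N - int n))"
    by (rule SUP_upper2[of "nat \<bar>k\<bar>"], simp, rule SUP_upper2[of "nat (\<bar>k\<bar> - k)"]) auto
qed (rule SUP_upper2, auto)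

text \<open>Serves the case q \<le> p after taking q-th powers, with P = p / q. The averaging level
  is at least the evaluation level k and at least the level k + m of the function; j accounts for
  the distance between source and target.\<close>

lemma nn_integral_powr_csum_avg_le:
  fixes w :: "int \<Rightarrow> real ^ 'n \<Rightarrow> ennreal"
  assumes [measurable]: "\<And>k. w k \<in> borel_measurable borel" and P: "1 \<le> P"
  shows "(\<integral>\<^sup>+x. epowr (csum (\<lambda>k. avg a (max k (k + m) + j) (w (k + m)) x)) P \<partial>lborel)
    \<le> ennreal (2 * (P * (2 * P) powr (P - 1))) * (\<integral>\<^sup>+x. epowr (csum (\<lambda>k. w k x)) P \<partial>lborel)"
proof -
  have inc: "incseq (\<lambda>N. epowr (\<Sum>k\<in>{- int N..int N}. f k) P)" for f
    using P by (intro monoI epowr_mono sum_mono2) auto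
  have "(\<integral>\<^sup>+x. epowr (csum (\<lambda>k. avg a (max k (k + m) + j) (w (k + m)) x)) P \<partial>lborel)
    = (SUP N. \<integral>\<^sup>+x. epowr (\<Sum>k\<in>{- int N..int N}. avg a (max k (k + m) + j) (w (k + m)) x) P \<partial>lborel)"
    using P inc by (simp add: csum_int_SUP epowr_SUP)
      (rule nn_integral_monotone_convergence_SUP, auto simp: incseq_def le_fun_def)
  also have "\<dots> \<le> ennreal (2 * (P * (2 * P) powr (P - 1))) * (\<integral>\<^sup>+x. epowr (csum (\<lambda>k. w (k + m) x)) P \<partial>lborel)"
  proof (rule SUP_least)
    fix N
    have "(\<integral>\<^sup>+x. epowr (\<Sum>k\<in>{- int N..int N}. avg a (max k (k + m) + j) (w (k + m)) x) P \<partial>lborel)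
      \<le> ennreal (2 * (P * (2 * P) powr (P - 1))) * (\<integral>\<^sup>+x. epowr (\<Sum>k\<in>{- int N..int N}. w (k + m) x) P \<partial>lborel)"
      unfolding sum_int_window using P
      by (intro sum_avg_powr_le[where L="\<lambda>n. max (int N - int n) (int N - int n + m) + j"])
         (auto simp: antimono_def)
    also have "\<dots> \<le> ennreal (2 * (P * (2 * P) powr (P - 1))) * (\<integral>\<^sup>+x. epowr (csum (\<lambda>k. w (k + m) x)) P \<partial>lborel)"
      using P by (intro mult_left_mono nn_integral_mono epowr_mono) (auto simp: csum_int_SUP intro: SUP_upper)
    finally show "(\<integral>\<^sup>+x. epowr (\<Sum>k\<in>{- int N..int N}. avg a (max k (k + m) + j) (w (k + m)) x) P \<partial>lborel)
      \<le> ennreal (2 * (P * (2 * P) powr (P - 1))) * (\<integral>\<^sup>+x. epowr (csum (\<lambda>k. w (k + m) x)) P \<partial>lborel)" .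
  qed
  also have "(\<lambda>x. csum (\<lambda>k. w (k + m) x)) = (\<lambda>x. csum (\<lambda>k. w k x))"
    by (rule ext) (rule csum_int_shift)
  finally show ?thesis .
qed

text \<open>The n-th average has level N - n + max 0 m + j, the i-th function has level N - i + m.
  Adaptedness is thus delayed by j + max 0 (-m) steps, and |m| + j is an upper bound for both signs
  of m.\<close>

lemma (in gauge) nn_integral_window_avg_le:
  fixes w :: "int \<Rightarrow> real ^ 'n \<Rightarrow> ennreal"
  assumes "\<And>k. w k \<in> borel_measurable borel" "\<And>k. level a k (w k)" and "0 \<le> j"
  shows "(\<integral>\<^sup>+x. fold_h (\<lambda>n. avg a (max (int N - int n) (int N - int n + m) + j) (w (int N - int n + m)) x) M \<partial>lborel)
    \<le> of_nat (nat \<bar>m\<bar> + nat j + 2) * (\<integral>\<^sup>+x. fold_h (\<lambda>n. w (int N - int n + m) x) M \<partial>lborel)"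
  by (rule nn_integral_fold_avg_le[where l="\<lambda>n. int N - int n + m"]) (use assms in \<open>auto simp: antimono_def\<close>)

text \<open>Serves the case p < q < top after taking p-th powers, with Q = q / p. The outer exponent
  is then 1, and the constant depends linearly on the delay, in contrast to the bound for q \<le>
  p.\<close>

lemma nn_integral_lQ_avg_le:
  fixes w :: "int \<Rightarrow> real ^ 'n \<Rightarrow> ennreal"
  assumes [measurable]: "\<And>k. w k \<in> borel_measurable borel" and lev: "\<And>k. level a k (w k)" and Q: "1 \<le> Q" and j: "0 \<le> j"
  shows "(\<integral>\<^sup>+x. epowr (csum (\<lambda>k. epowr (avg a (max k (k + m) + j) (w (k + m)) x) Q)) (1 / Q) \<partial>lborel)
    \<le> of_nat (nat \<bar>m\<bar> + nat j + 2) * (\<integral>\<^sup>+x. epowr (csum (\<lambda>k. epowr (w k x) Q)) (1 / Q) \<partial>lborel)"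
proof -
  interpret gauge "hpow Q" by (rule gauge_hpow[OF Q])
  have inc: "incseq (\<lambda>N. epowr (\<Sum>k\<in>{- int N..int N}. f k) (1 / Q))" for f
    using Q by (intro monoI epowr_mono sum_mono2) auto
  have "(\<integral>\<^sup>+x. epowr (csum (\<lambda>k. epowr (avg a (max k (k + m) + j) (w (k + m)) x) Q)) (1 / Q) \<partial>lborel)
    = (SUP N. \<integral>\<^sup>+x. epowr (\<Sum>k\<in>{- int N..int N}. epowr (avg a (max k (k + m) + j) (w (k + m)) x) Q) (1 / Q) \<partial>lborel)"
    using Q inc by (simp add: csum_int_SUP epowr_SUP)
      (rule nn_integral_monotone_convergence_SUP, auto simp: incseq_def le_fun_def)
  also have "\<dots> \<le> of_nat (nat \<bar>m\<bar> + nat j + 2) * (\<integral>\<^sup>+x. epowr (csum (\<lambda>k. epowr (w (k + m) x) Q)) (1 / Q) \<partial>lborel)"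
  proof (rule SUP_least)
    fix N
    have "(\<integral>\<^sup>+x. epowr (\<Sum>k\<in>{- int N..int N}. epowr (avg a (max k (k + m) + j) (w (k + m)) x) Q) (1 / Q) \<partial>lborel)
      \<le> of_nat (nat \<bar>m\<bar> + nat j + 2) * (\<integral>\<^sup>+x. epowr (\<Sum>k\<in>{- int N..int N}. epowr (w (k + m) x) Q) (1 / Q) \<partial>lborel)"
      using nn_integral_window_avg_le[of w a j N m "2 * N + 1"] lev j
      unfolding fold_hpow[OF Q] sum_int_window by simp
    also have "\<dots> \<le> of_nat (nat \<bar>m\<bar> + nat j + 2) * (\<integral>\<^sup>+x. epowr (csum (\<lambda>k. epowr (w (k + m) x) Q)) (1 / Q) \<partial>lborel)"
      using Q by (intro mult_left_mono nn_integral_mono epowr_mono) (auto simp: csum_int_SUP intro: SUP_upper)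
    finally show "(\<integral>\<^sup>+x. epowr (\<Sum>k\<in>{- int N..int N}. epowr (avg a (max k (k + m) + j) (w (k + m)) x) Q) (1 / Q) \<partial>lborel)
      \<le> of_nat (nat \<bar>m\<bar> + nat j + 2) * (\<integral>\<^sup>+x. epowr (csum (\<lambda>k. epowr (w (k + m) x) Q)) (1 / Q) \<partial>lborel)" .
  qed
  also have "(\<lambda>x. csum (\<lambda>k. epowr (w (k + m) x) Q)) = (\<lambda>x. csum (\<lambda>k. epowr (w k x) Q))"
    by (rule ext) (rule csum_int_shift[where f="\<lambda>k. epowr (w k _) Q"])
  finally show ?thesis .
qed

lemma nn_integral_SUP_avg_le:
  fixes w :: "int \<Rightarrow> real ^ 'n \<Rightarrow> ennreal"
  assumes [measurable]: "\<And>k. w k \<in> borel_measurable borel" and lev: "\<And>k. level a k (w k)" and j: "0 \<le> j"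
  shows "(\<integral>\<^sup>+x. (SUP k. avg a (max k (k + m) + j) (w (k + m)) x) \<partial>lborel)
    \<le> of_nat (nat \<bar>m\<bar> + nat j + 2) * (\<integral>\<^sup>+x. (SUP k. w k x) \<partial>lborel)"
proof -
  have inc: "incseq (\<lambda>N. SUP n\<in>{..<2 * N + 1}. f (int N - int n) :: ennreal)" for f
  proof (intro monoI SUP_least)
    fix N M n :: nat assume "N \<le> M" "n \<in> {..<2 * N + 1}"
    then show "f (int N - int n) \<le> (SUP n\<in>{..<2 * M + 1}. f (int M - int n))"
      by (intro SUP_upper2[of "n + (M - N)"]) auto
  qed
  have "(\<integral>\<^sup>+x. (SUP k. avg a (max k (k + m) + j) (w (k + m)) x) \<partial>lborel)
    = (SUP N. \<integral>\<^sup>+x. (SUP n\<in>{..<2 * N + 1}. avg a (max (int N - int n) (int N - int n + m) + j) (w (int N - int n + m)) x) \<partial>lborel)"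
    unfolding SUP_int_window[where f="\<lambda>k. avg a (max k (k + m) + j) (w (k + m)) _"]
    using inc[of "\<lambda>k. avg a (max k (k + m) + j) (w (k + m)) x" for x]
    by (intro nn_integral_monotone_convergence_SUP) (auto simp: incseq_def le_fun_def)
  also have "\<dots> \<le> of_nat (nat \<bar>m\<bar> + nat j + 2) * (\<integral>\<^sup>+x. (SUP k. w k x) \<partial>lborel)"
  proof (rule SUP_least)
    fix N
    have "(\<integral>\<^sup>+x. (SUP n\<in>{..<2 * N + 1}. avg a (max (int N - int n) (int N - int n + m) + j) (w (int N - int n + m)) x) \<partial>lborel)
      \<le> of_nat (nat \<bar>m\<bar> + nat j + 2) * (\<integral>\<^sup>+x. (SUP n\<in>{..<2 * N + 1}. w (int N - int n + m) x) \<partial>lborel)"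
      using max.nn_integral_window_avg_le[of w a j N m "2 * N + 1"] lev j
      unfolding fold_max by simp
    also have "\<dots> \<le> of_nat (nat \<bar>m\<bar> + nat j + 2) * (\<integral>\<^sup>+x. (SUP k. w k x) \<partial>lborel)"
      by (intro mult_left_mono nn_integral_mono SUP_mono) auto
    finally show "(\<integral>\<^sup>+x. (SUP n\<in>{..<2 * N + 1}. avg a (max (int N - int n) (int N - int n + m) + j) (w (int N - int n + m)) x) \<partial>lborel)
      \<le> of_nat (nat \<bar>m\<bar> + nat j + 2) * (\<integral>\<^sup>+x. (SUP k. w k x) \<partial>lborel)" .
  qed
  finally show ?thesis .
qed


section \<open>Discrete tent norms\<close>

lemma csum_multc: "csum (\<lambda>i. f i * c) = csum f * c"
  by (rule nn_integral_multc) simp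

text \<open>Time scales of ratio sqrt 3. With d the dimension, the factor 3^d \<ge> d makes the
  diameter of a cube of level k smaller than \<open>tau d k\<close>.\<close>

definition tau :: "nat \<Rightarrow> int \<Rightarrow> real" where
  "tau d k = 3 powr (real_of_int k / 2 + real d)"

text \<open>The tent norm with the integral in t replaced by a sum over scales. Measure and weight
  are carried by X, which in applications contains the factor tau^(1/q - \<beta>). For p = top a
  Carleson box of size \<open>tau\<close> at j sees the scales k \<le> j, and balls are normalised
  by a power of the radius.\<close>

definition dtn :: "ennreal \<Rightarrow> ennreal \<Rightarrow> (int \<Rightarrow> real ^ 'n \<Rightarrow> ennreal) \<Rightarrow> ennreal" where
  "dtn p q X =
     (if p < \<infinity> then
        if q < \<infinity> then
          epowr (\<integral>\<^sup>+x. epowr (csum (\<lambda>k. epowr (X k x) (enn2real q))) (enn2real p / enn2real q) \<partial>lborel)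
            (1 / enn2real p)
        else epowr (\<integral>\<^sup>+x. epowr (SUP k. X k x) (enn2real p) \<partial>lborel) (1 / enn2real p)
      else
        if q < \<infinity> then
          (SUP (j, y). epowr ((\<integral>\<^sup>+x. csum (\<lambda>k. if k \<le> j then epowr (X k x) (enn2real q) else 0)
                * indicator (ball y (tau CARD('n) j)) x \<partial>lborel) / ennreal (tau CARD('n) j ^ CARD('n)))
            (1 / enn2real q))
        else (SUP k. SUP x. X k x))"

lemma tau_pos [simp]: "0 < tau d k" and tau_neq_0 [simp]: "tau d k \<noteq> 0"
  by (simp_all add: tau_def)

lemma tau_add: "tau d (k + m) = 3 powr (real_of_int m / 2) * tau d k"
  by (simp add: tau_def powr_add add_divide_distrib)

lemma tau_mono: "k \<le> j \<Longrightarrow> tau d k \<le> tau d j"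
  by (simp add: tau_def)

lemma tau_strict_mono: "k < j \<Longrightarrow> tau d k < tau d j"
  by (simp add: tau_def)

lemma le_power_3: "real d \<le> 3 ^ d"
proof -
  have "d < 3 ^ d" by (induction d) auto
  then have "real d < real (3 ^ d)" by (simp only: of_nat_less_iff)
  then show ?thesis by simp
qed

lemma side_tau: "side k * 3 ^ d \<le> tau d k" and tau_side: "tau d k \<le> 3 ^ (d + 1) * side k"
proof -
  have "real_of_int (k div 2) \<le> real_of_int k / 2" "real_of_int k / 2 \<le> real_of_int (k div 2) + 1"
    by linarith+
  moreover have "(3::real) ^ d = 3 powr real d" "(3::real) ^ (d + 1) = 3 powr (real d + 1)"
    by (simp_all add: powr_add powr_realpow)
  ultimately show "side k * 3 ^ d \<le> tau d k" "tau d k \<le> 3 ^ (d + 1) * side k"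
    by (simp_all only: side_def tau_def powr_add[symmetric]) auto
qed

lemma cube_norm_tau:
  fixes x :: "real ^ 'n"
  assumes "y \<in> cube a k x"
  shows "norm (y - x) < tau CARD('n) k"
proof -
  have "norm (y - x) < CARD('n) * side k" by (rule cube_norm[OF assms])
  also have "\<dots> \<le> 3 ^ CARD('n) * side k" by (intro mult_right_mono le_power_3) (simp add: less_imp_le)
  also have "\<dots> \<le> tau CARD('n) k" using side_tau[of k "CARD('n)"] by (simp add: mult.commute)
  finally show ?thesis .
qed

lemma dtn_fin_fin:
  assumes "0 < P" "0 < Q"
  shows "dtn (ennreal P) (ennreal Q) X = epowr (\<integral>\<^sup>+x. epowr (csum (\<lambda>k. epowr (X k x) Q)) (P / Q) \<partial>lborel) (1 / P)"
  using assms by (simp add: dtn_def)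

lemma dtn_fin_inf:
  assumes "0 < P"
  shows "dtn (ennreal P) top X = epowr (\<integral>\<^sup>+x. epowr (SUP k. X k x) P \<partial>lborel) (1 / P)"
  using assms by (simp add: dtn_def)

definition carl :: "real \<Rightarrow> (int \<Rightarrow> real ^ 'n \<Rightarrow> ennreal) \<Rightarrow> int \<Rightarrow> real ^ 'n \<Rightarrow> ennreal" where
  "carl Q X j y = (\<integral>\<^sup>+x. csum (\<lambda>k. if k \<le> j then epowr (X k x) Q else 0)
                * indicator (ball y (tau CARD('n) j)) x \<partial>lborel) / ennreal (tau CARD('n) j ^ CARD('n))"

lemma dtn_inf_fin:
  assumes "0 < Q"
  shows "dtn top (ennreal Q) X = (SUP (j, y). epowr (carl Q X j y) (1 / Q))"
  using assms by (simp add: dtn_def carl_def cong: if_cong)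

lemma dtn_inf_inf: "dtn top top X = (SUP k. SUP x. X k x)"
  by (simp add: dtn_def)

lemma exponent_cases:
  assumes "0 < p"
  obtains "p = top" | P where "p = ennreal P" "0 < P"
  using assms by (cases p) auto

lemma carl_le_dtn:
  assumes "0 < Q"
  shows "carl Q X j y \<le> epowr (dtn top (ennreal Q) X) Q"
proof -
  have "epowr (carl Q X j y) (1 / Q) \<le> dtn top (ennreal Q) X"
    unfolding dtn_inf_fin[OF assms] by (rule SUP_upper2[of "(j, y)"]) auto
  then show ?thesis using assms epowr_le_swap[of "1 / Q" "carl Q X j y"] by simp
qed

lemma dtn_inf_fin_le:
  assumes "0 < Q" "\<And>j y. carl Q X j y \<le> epowr D Q"
  shows "dtn top (ennreal Q) X \<le> D"
  unfolding dtn_inf_fin[OF assms(1)]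
  using assms by (auto intro!: SUP_least simp: epowr_le_swap)

lemma dtn_mono:
  assumes "0 < p" "0 < q" "\<And>k x. X k x \<le> Y k x"
  shows "dtn p q X \<le> dtn p q Y"
  using assms(1)
proof (cases rule: exponent_cases)
  case p: 1
  from assms(2) show ?thesis
  proof (cases rule: exponent_cases)
    case 1
    then show ?thesis using p assms(3) by (auto simp: dtn_inf_inf intro!: SUP_mono)
  next
    case (2 Q)
    have "carl Q X j y \<le> carl Q Y j y" for j y
      unfolding carl_def using assms(3) 2
      by (intro divide_right_mono_ennreal nn_integral_mono mult_right_mono) (auto intro!: epowr_mono)
    then show ?thesis using 2 p unfolding p 2 dtn_inf_fin[OF 2(2)]
      by (intro SUP_mono) (force intro!: epowr_mono)
  qed
next
  case p: (2 P)
  from assms(2) show ?thesis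
  proof (cases rule: exponent_cases)
    case 1
    show ?thesis unfolding p 1 dtn_fin_inf[OF p(2)] using p assms(3)
      by (intro epowr_mono nn_integral_mono SUP_mono) auto
  next
    case (2 Q)
    show ?thesis unfolding p 2 dtn_fin_fin[OF p(2) 2(2)] using p 2 assms(3)
      by (intro epowr_mono nn_integral_mono) auto
  qed
qed

lemma dtn_cmult:
  fixes X :: "int \<Rightarrow> real ^ 'n \<Rightarrow> ennreal"
  assumes "0 < p" "0 < q" "\<And>k. X k \<in> borel_measurable borel"
  shows "dtn p q (\<lambda>k x. c * X k x) = c * dtn p q X"
  using assms(1)
proof (cases rule: exponent_cases)
  case p: 1
  from assms(2) show ?thesis
  proof (cases rule: exponent_cases)
    case 1
    then show ?thesis using p by (simp add: dtn_inf_inf SUP_mult_left_ennreal)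
  next
    case (2 Q)
    note [measurable] = assms(3)
    have "carl Q (\<lambda>k x. c * X k x) j y = epowr c Q * carl Q X j y" for j y
    proof -
      have "csum (\<lambda>k. if k \<le> j then epowr (c * X k x) Q else 0) = epowr c Q * csum (\<lambda>k. if k \<le> j then epowr (X k x) Q else 0)" for x
        by (subst csum_cmult[symmetric]) (auto intro!: nn_integral_cong simp: epowr_mult 2)
      then show ?thesis
      proof -
        define G where "G x = csum (\<lambda>k. if k \<le> j then epowr (X k x) Q else 0) * indicator (ball y (tau CARD('n) j)) x" for x
        have [measurable]: "ball y (tau CARD('n) j) \<in> sets borel" by simp
        have [measurable]: "G \<in> borel_measurable borel" unfolding G_def[abs_def] by measurable
        have "(\<integral>\<^sup>+x. epowr c Q * G x \<partial>lborel) = epowr c Q * (\<integral>\<^sup>+x. G x \<partial>lborel)"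
          by (rule nn_integral_cmult) simp
        then show ?thesis
          using \<open>\<And>x. csum (\<lambda>k. if k \<le> j then epowr (c * X k x) Q else 0) = _\<close>
          unfolding carl_def G_def ennreal_times_divide by (simp only: mult.assoc)
      qed
    qed
    then show ?thesis unfolding p 2 dtn_inf_fin[OF 2(2)]
      using 2 by (simp add: epowr_mult SUP_mult_left_ennreal split_beta)
  qed
next
  case p: (2 P)
  note [measurable] = assms(3)
  from assms(2) show ?thesis
  proof (cases rule: exponent_cases)
    case 1
    show ?thesis unfolding p 1 dtn_fin_inf[OF p(2)] using p
      by (simp add: SUP_mult_left_ennreal[symmetric] epowr_mult nn_integral_cmult)
  next
    case (2 Q)
    have "csum (\<lambda>k. epowr (c * X k x) Q) = epowr c Q * csum (\<lambda>k. epowr (X k x) Q)" for x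
      using 2 by (simp add: epowr_mult csum_cmult)
    then show ?thesis unfolding p 2 dtn_fin_fin[OF p(2) 2(2)] using p 2
      by (simp add: epowr_mult nn_integral_cmult)
  qed
qed

subsection \<open>Superposition\<close>

lemma epowr_csum_weighted_pow:
  fixes e :: "'i \<Rightarrow> real"
  assumes "0 < \<kappa>" "\<And>i. 0 \<le> e i" "0 < s"
  shows "epowr (csum (\<lambda>i. ennreal (e i powr s) * a i)) \<kappa>
    \<le> epowr (csum (\<lambda>i. ennreal (e i powr (s / 2)))) \<kappa> * csum (\<lambda>i. ennreal (e i powr (s * \<kappa> / 2)) * epowr (a i) \<kappa>)"
  using epowr_csum_weighted[of \<kappa> "\<lambda>i. e i powr s" a] assms
  by (simp add: powr_powr powr_half_sqrt[symmetric])

text \<open>A substitute for the countable triangle inequality that works for all exponents. Each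
  use of \<open>epowr_csum_weighted\<close> spends part of the decay of e; therefore summability is
  required for every positive power of e, against every power of the growing norms h. The constant
  does not depend on the functions b.\<close>

lemma dtn_superposition:
  fixes e h :: "'i::countable \<Rightarrow> real"
  assumes pq: "0 < p" "0 < q" and e: "\<And>i. 0 \<le> e i" and h: "\<And>i. 0 \<le> h i"
    and sum: "\<And>s t. 0 < s \<Longrightarrow> 0 \<le> t \<Longrightarrow> csum (\<lambda>i. ennreal (e i powr s * (1 + h i) powr t)) < top"
  shows "\<exists>C<top. \<forall>(b :: 'i \<Rightarrow> int \<Rightarrow> real ^ 'n \<Rightarrow> ennreal) D.
    (\<forall>i k. b i k \<in> borel_measurable borel) \<longrightarrow> (\<forall>i. dtn p q (b i) \<le> ennreal (h i) * D) \<longrightarrow>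
    dtn p q (\<lambda>k x. csum (\<lambda>i. ennreal (e i) * b i k x)) \<le> C * D"
proof -
  define S where "S s \<kappa> = epowr (csum (\<lambda>i. ennreal (e i powr s))) \<kappa>" for s \<kappa>
  define H where "H s t = csum (\<lambda>i. ennreal (e i powr s) * ennreal (h i powr t))" for s t
  have S: "S s \<kappa> < top" if "0 < s" for s \<kappa> using sum[of s 0] that h by (auto simp: S_def add_nonneg_eq_0_iff)
  have H: "H s t < top" if "0 < s" "0 < t" for s t
  proof -
    have "H s t \<le> csum (\<lambda>i. ennreal (e i powr s * (1 + h i) powr t))"
      unfolding H_def using h that by (intro nn_integral_mono) (auto simp flip: ennreal_mult intro!: ennreal_leI mult_left_mono powr_mono2)
    then show ?thesis using sum[of s t] that by (simp add: order_le_less_trans)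
  qed
  have e1: "e i = e i powr 1" for i using e by simp
  from pq(1) show ?thesis
  proof (cases rule: exponent_cases)
    case p: 1
    from pq(2) show ?thesis
    proof (cases rule: exponent_cases)
      case q: 1
      have "dtn p q (\<lambda>k x. csum (\<lambda>i. ennreal (e i) * b i k x)) \<le> H 1 1 * D"
        if b: "\<forall>i. dtn p q (b i) \<le> ennreal (h i) * D" for b :: "'i \<Rightarrow> int \<Rightarrow> real ^ 'n \<Rightarrow> ennreal" and D
        unfolding p q dtn_inf_inf
      proof (intro SUP_least)
        fix k x
        have "b i k x \<le> ennreal (h i) * D" for i
          using b[rule_format, of i] unfolding p q dtn_inf_inf by (simp add: SUP_le_iff)
        then have "csum (\<lambda>i. ennreal (e i) * b i k x) \<le> csum (\<lambda>i. D * (ennreal (e i powr 1) * ennreal (h i powr 1)))"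
        proof (intro nn_integral_mono)
          fix i
          have "ennreal (e i) * b i k x \<le> ennreal (e i) * (ennreal (h i) * D)"
            using \<open>\<And>i. b i k x \<le> _\<close> by (intro mult_left_mono) auto
          then show "ennreal (e i) * b i k x \<le> D * (ennreal (e i powr 1) * ennreal (h i powr 1))"
            using e[of i] h[of i] by (simp add: mult_ac)
        qed
        then show "csum (\<lambda>i. ennreal (e i) * b i k x) \<le> H 1 1 * D"
          by (simp add: csum_cmult H_def mult.commute)
      qed
      then show ?thesis using H[of 1 1] by (intro exI[of _ "H 1 1"]) auto
    next
      case q: (2 Q)
      define C where "C = epowr (S (1 / 2) Q * H (Q / 2) Q) (1 / Q)"
      have "dtn p q (\<lambda>k x. csum (\<lambda>i. ennreal (e i) * b i k x)) \<le> C * D"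
        if b: "\<forall>i. dtn p q (b i) \<le> ennreal (h i) * D" and [measurable]: "\<And>i k. b i k \<in> borel_measurable borel"
        for b :: "'i \<Rightarrow> int \<Rightarrow> real ^ 'n \<Rightarrow> ennreal" and D
        unfolding p q
      proof (rule dtn_inf_fin_le[OF q(2)])
        fix j y
        define V where "V = ennreal (tau CARD('n) j ^ CARD('n))"
        define B :: "real ^ 'n \<Rightarrow> ennreal" where "B = indicator (ball y (tau CARD('n) j))"
        have [measurable]: "B \<in> borel_measurable borel" unfolding B_def by (rule borel_measurable_indicator) simp
        have "csum (\<lambda>k. if k \<le> j then epowr (csum (\<lambda>i. ennreal (e i) * b i k x)) Q else 0)
          \<le> S (1 / 2) Q * csum (\<lambda>i. ennreal (e i powr (Q / 2)) * csum (\<lambda>k. if k \<le> j then epowr (b i k x) Q else 0))" for x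
        proof -
          have "csum (\<lambda>k. if k \<le> j then epowr (csum (\<lambda>i. ennreal (e i) * b i k x)) Q else 0)
            \<le> csum (\<lambda>k. S (1 / 2) Q * csum (\<lambda>i. ennreal (e i powr (Q / 2)) * (if k \<le> j then epowr (b i k x) Q else 0)))"
            using epowr_csum_weighted_pow[of Q e 1 "\<lambda>i. b i _ x"] q e
            by (intro nn_integral_mono) (auto simp: S_def)
          also have "\<dots> = S (1 / 2) Q * csum (\<lambda>i. ennreal (e i powr (Q / 2)) * csum (\<lambda>k. if k \<le> j then epowr (b i k x) Q else 0))"
            by (subst csum_cmult, subst csum_swap2) (simp add: csum_cmult)
          finally show ?thesis .
        qed
        then have "carl Q (\<lambda>k x. csum (\<lambda>i. ennreal (e i) * b i k x)) j y
          \<le> (\<integral>\<^sup>+x. S (1 / 2) Q * csum (\<lambda>i. ennreal (e i powr (Q / 2)) * (csum (\<lambda>k. if k \<le> j then epowr (b i k x) Q else 0) * B x)) \<partial>lborel) / V"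
          unfolding carl_def V_def B_def
          by (intro divide_right_mono_ennreal nn_integral_mono) (auto simp: indicator_def)
        also have "\<dots> = S (1 / 2) Q * csum (\<lambda>i. ennreal (e i powr (Q / 2)) * carl Q (b i) j y)"
        proof -
          define G where "G i x = csum (\<lambda>k. if k \<le> j then epowr (b i k x) Q else 0) * B x" for i x
          have [measurable]: "G i \<in> borel_measurable borel" for i unfolding G_def[abs_def] by measurable
          have "(\<integral>\<^sup>+x. S (1 / 2) Q * csum (\<lambda>i. ennreal (e i powr (Q / 2)) * G i x) \<partial>lborel)
            = S (1 / 2) Q * (\<integral>\<^sup>+x. csum (\<lambda>i. ennreal (e i powr (Q / 2)) * G i x) \<partial>lborel)"
            by (rule nn_integral_cmult) measurable
          also have "(\<integral>\<^sup>+x. csum (\<lambda>i. ennreal (e i powr (Q / 2)) * G i x) \<partial>lborel)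
            = csum (\<lambda>i. \<integral>\<^sup>+x. ennreal (e i powr (Q / 2)) * G i x \<partial>lborel)"
            by (rule csum_swap) measurable
          also have "\<dots> = csum (\<lambda>i. ennreal (e i powr (Q / 2)) * (\<integral>\<^sup>+x. G i x \<partial>lborel))"
            by (intro nn_integral_cong nn_integral_cmult) measurable
          finally have eq: "(\<integral>\<^sup>+x. S (1 / 2) Q * csum (\<lambda>i. ennreal (e i powr (Q / 2)) * G i x) \<partial>lborel) / V
            = S (1 / 2) Q * csum (\<lambda>i. ennreal (e i powr (Q / 2)) * (\<integral>\<^sup>+x. G i x \<partial>lborel)) * inverse V"
            by (simp add: divide_ennreal_def)
          also have "\<dots> = S (1 / 2) Q * csum (\<lambda>i. ennreal (e i powr (Q / 2)) * ((\<integral>\<^sup>+x. G i x \<partial>lborel) * inverse V))"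
            by (simp only: mult.assoc csum_multc[symmetric])
          finally show ?thesis
            by (simp only: G_def carl_def B_def[symmetric] V_def[symmetric] divide_ennreal_def)
        qed
        also have "\<dots> \<le> S (1 / 2) Q * csum (\<lambda>i. epowr D Q * (ennreal (e i powr (Q / 2)) * ennreal (h i powr Q)))"
        proof (intro mult_left_mono nn_integral_mono)
          fix i
          have "carl Q (b i) j y \<le> epowr (dtn p q (b i)) Q" unfolding p q by (rule carl_le_dtn[OF q(2)])
          also have "\<dots> \<le> epowr (ennreal (h i) * D) Q" using b q by (intro epowr_mono) auto
          also have "\<dots> = ennreal (h i powr Q) * epowr D Q" using h q by (simp add: epowr_real_bound)
          finally have "ennreal (e i powr (Q / 2)) * carl Q (b i) j y \<le> ennreal (e i powr (Q / 2)) * (ennreal (h i powr Q) * epowr D Q)"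
            by (rule mult_left_mono) simp
          then show "ennreal (e i powr (Q / 2)) * carl Q (b i) j y \<le> epowr D Q * (ennreal (e i powr (Q / 2)) * ennreal (h i powr Q))"
            by (simp add: mult_ac)
        qed auto
        also have "\<dots> = epowr (C * D) Q"
          unfolding csum_cmult H_def[symmetric] C_def using q by (simp add: epowr_mult mult_ac)
        finally show "carl Q (\<lambda>k x. csum (\<lambda>i. ennreal (e i) * b i k x)) j y \<le> epowr (C * D) Q" .
      qed
      moreover have "C < top" using S[of "1/2" Q] H[of "Q/2" Q] q by (simp add: C_def ennreal_mult_less_top)
      ultimately show ?thesis by blast
    qed
  next
    case p: (2 P)
    from pq(2) show ?thesis
    proof (cases rule: exponent_cases)
      case q: 1
      define C where "C = epowr (S (1 / 2) P * H (P / 2) P) (1 / P)"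
      have "dtn p q (\<lambda>k x. csum (\<lambda>i. ennreal (e i) * b i k x)) \<le> C * D"
        if b: "\<forall>i. dtn p q (b i) \<le> ennreal (h i) * D" and [measurable]: "\<And>i k. b i k \<in> borel_measurable borel"
        for b :: "'i \<Rightarrow> int \<Rightarrow> real ^ 'n \<Rightarrow> ennreal" and D
      proof -
        have "epowr (SUP k. csum (\<lambda>i. ennreal (e i) * b i k x)) P
          \<le> S (1 / 2) P * csum (\<lambda>i. ennreal (e i powr (P / 2)) * epowr (SUP k. b i k x) P)" for x
        proof -
          have "(SUP k. csum (\<lambda>i. ennreal (e i) * b i k x)) \<le> csum (\<lambda>i. ennreal (e i) * (SUP k. b i k x))"
            by (intro SUP_least nn_integral_mono mult_left_mono SUP_upper) auto
          then have "epowr (SUP k. csum (\<lambda>i. ennreal (e i) * b i k x)) P \<le> epowr (csum (\<lambda>i. ennreal (e i) * (SUP k. b i k x))) P"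
            using p by (intro epowr_mono) auto
          also have "\<dots> \<le> S (1 / 2) P * csum (\<lambda>i. ennreal (e i powr (P / 2)) * epowr (SUP k. b i k x) P)"
            using epowr_csum_weighted_pow[of P e 1 "\<lambda>i. SUP k. b i k x"] p e by (simp add: S_def)
          finally show ?thesis .
        qed
        then have "(\<integral>\<^sup>+x. epowr (SUP k. csum (\<lambda>i. ennreal (e i) * b i k x)) P \<partial>lborel)
          \<le> (\<integral>\<^sup>+x. S (1 / 2) P * csum (\<lambda>i. ennreal (e i powr (P / 2)) * epowr (SUP k. b i k x) P) \<partial>lborel)"
          by (intro nn_integral_mono)
        also have "\<dots> = S (1 / 2) P * csum (\<lambda>i. ennreal (e i powr (P / 2)) * epowr (dtn p q (b i)) P)"
          unfolding p q dtn_fin_inf[OF p(2)] using p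
          by (subst nn_integral_cmult, simp, subst csum_swap, simp) (simp add: nn_integral_cmult)
        also have "\<dots> \<le> S (1 / 2) P * csum (\<lambda>i. epowr D P * (ennreal (e i powr (P / 2)) * ennreal (h i powr P)))"
        proof (intro mult_left_mono nn_integral_mono)
          fix i
          have "epowr (dtn p q (b i)) P \<le> epowr (ennreal (h i) * D) P" using b p by (intro epowr_mono) auto
          also have "\<dots> = ennreal (h i powr P) * epowr D P" using h p by (simp add: epowr_real_bound)
          finally have "ennreal (e i powr (P / 2)) * epowr (dtn p q (b i)) P \<le> ennreal (e i powr (P / 2)) * (ennreal (h i powr P) * epowr D P)"
            by (rule mult_left_mono) simp
          then show "ennreal (e i powr (P / 2)) * epowr (dtn p q (b i)) P \<le> epowr D P * (ennreal (e i powr (P / 2)) * ennreal (h i powr P))"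
            by (simp add: mult_ac)
        qed auto
        also have "\<dots> = epowr (C * D) P"
          unfolding csum_cmult H_def[symmetric] C_def using p by (simp add: epowr_mult mult_ac)
        finally show ?thesis
          unfolding p q dtn_fin_inf[OF p(2)] using p by (simp add: epowr_le_swap)
      qed
      moreover have "C < top" using S[of "1/2" P] H[of "P/2" P] p by (simp add: C_def ennreal_mult_less_top)
      ultimately show ?thesis by blast
    next
      case q: (2 Q)
      \<comment> \<open>Two applications occur here, with exponents Q and P / Q. Each halves the
        power of e, which leaves e^(P/4).\<close>
      define K where "K = epowr (S (1 / 2) Q) (P / Q) * S (Q / 4) (P / Q)"
      define C where "C = epowr (K * H (P / 4) P) (1 / P)"
      have PQ: "0 < P / Q" "Q / 2 * (P / Q) / 2 = P / 4" using p q by auto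
      have "dtn p q (\<lambda>k x. csum (\<lambda>i. ennreal (e i) * b i k x)) \<le> C * D"
        if b: "\<forall>i. dtn p q (b i) \<le> ennreal (h i) * D" and [measurable]: "\<And>i k. b i k \<in> borel_measurable borel"
        for b :: "'i \<Rightarrow> int \<Rightarrow> real ^ 'n \<Rightarrow> ennreal" and D
      proof -
        have "epowr (csum (\<lambda>k. epowr (csum (\<lambda>i. ennreal (e i) * b i k x)) Q)) (P / Q)
          \<le> K * csum (\<lambda>i. ennreal (e i powr (P / 4)) * epowr (csum (\<lambda>k. epowr (b i k x) Q)) (P / Q))" for x
        proof -
          have "csum (\<lambda>k. epowr (csum (\<lambda>i. ennreal (e i) * b i k x)) Q)
            \<le> csum (\<lambda>k. S (1 / 2) Q * csum (\<lambda>i. ennreal (e i powr (Q / 2)) * epowr (b i k x) Q))"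
            using epowr_csum_weighted_pow[of Q e 1 "\<lambda>i. b i _ x"] q e
            by (intro nn_integral_mono) (auto simp: S_def)
          also have "\<dots> = S (1 / 2) Q * csum (\<lambda>i. ennreal (e i powr (Q / 2)) * csum (\<lambda>k. epowr (b i k x) Q))"
            by (subst csum_cmult, subst csum_swap2) (simp add: csum_cmult)
          finally have "epowr (csum (\<lambda>k. epowr (csum (\<lambda>i. ennreal (e i) * b i k x)) Q)) (P / Q)
            \<le> epowr \<dots> (P / Q)" using PQ by (intro epowr_mono) auto
          also have "\<dots> = epowr (S (1 / 2) Q) (P / Q) * epowr (csum (\<lambda>i. ennreal (e i powr (Q / 2)) * csum (\<lambda>k. epowr (b i k x) Q))) (P / Q)"
            using PQ by (simp add: epowr_mult)
          also have "\<dots> \<le> epowr (S (1 / 2) Q) (P / Q) * (S (Q / 4) (P / Q) * csum (\<lambda>i. ennreal (e i powr (P / 4)) * epowr (csum (\<lambda>k. epowr (b i k x) Q)) (P / Q)))"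
            using epowr_csum_weighted_pow[of "P / Q" e "Q / 2" "\<lambda>i. csum (\<lambda>k. epowr (b i k x) Q)"] PQ e q
            by (intro mult_left_mono) (auto simp: S_def)
          finally show ?thesis by (simp add: K_def mult.assoc)
        qed
        then have "(\<integral>\<^sup>+x. epowr (csum (\<lambda>k. epowr (csum (\<lambda>i. ennreal (e i) * b i k x)) Q)) (P / Q) \<partial>lborel)
          \<le> (\<integral>\<^sup>+x. K * csum (\<lambda>i. ennreal (e i powr (P / 4)) * epowr (csum (\<lambda>k. epowr (b i k x) Q)) (P / Q)) \<partial>lborel)"
          by (intro nn_integral_mono)
        also have "\<dots> = K * csum (\<lambda>i. ennreal (e i powr (P / 4)) * epowr (dtn p q (b i)) P)"
          unfolding p q dtn_fin_fin[OF p(2) q(2)] using p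
          by (subst nn_integral_cmult, simp, subst csum_swap, simp) (simp add: nn_integral_cmult)
        also have "\<dots> \<le> K * csum (\<lambda>i. epowr D P * (ennreal (e i powr (P / 4)) * ennreal (h i powr P)))"
        proof (intro mult_left_mono nn_integral_mono)
          fix i
          have "epowr (dtn p q (b i)) P \<le> epowr (ennreal (h i) * D) P" using b p by (intro epowr_mono) auto
          also have "\<dots> = ennreal (h i powr P) * epowr D P" using h p by (simp add: epowr_real_bound)
          finally have "ennreal (e i powr (P / 4)) * epowr (dtn p q (b i)) P \<le> ennreal (e i powr (P / 4)) * (ennreal (h i powr P) * epowr D P)"
            by (rule mult_left_mono) simp
          then show "ennreal (e i powr (P / 4)) * epowr (dtn p q (b i)) P \<le> epowr D P * (ennreal (e i powr (P / 4)) * ennreal (h i powr P))"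
            by (simp add: mult_ac)
        qed auto
        also have "\<dots> = epowr (C * D) P"
          unfolding csum_cmult H_def[symmetric] C_def using p by (simp add: epowr_mult mult_ac)
        finally show ?thesis
          unfolding p q dtn_fin_fin[OF p(2) q(2)] using p by (simp add: epowr_le_swap)
      qed
      moreover have "C < top" using S[of "1/2" Q] S[of "Q/4" "P/Q"] H[of "P/4" P] p q
        by (simp add: C_def K_def ennreal_mult_less_top)
      ultimately show ?thesis by blast
    qed
  qed
qed


subsection \<open>Averaging operators\<close>

text \<open>The exponent \<open>1\<close> for \<open>p = q = top\<close> is an arbitrary choice.\<close>

definition min_exp :: "ennreal \<Rightarrow> ennreal \<Rightarrow> real" where
  "min_exp p q = (if p = top \<and> q = top then 1 else enn2real (min p q))"

lemma min_exp_pos: "0 < p \<Longrightarrow> 0 < q \<Longrightarrow> 0 < min_exp p q"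
  by (cases p; cases q) (auto simp: min_exp_def enn2real_positive_iff min_def top_unique)

text \<open>Cubes of level k \<le> j have diameter below the radius of the ball, so the average
  lives in the doubled ball. Two levels up the radius has tripled.\<close>

lemma avg_indicator_le:
  fixes x y :: "real ^ 'n"
  assumes "k \<le> j"
  shows "avg a k (indicator (ball y (tau CARD('n) j))) x \<le> indicator (ball y (tau CARD('n) (j + 2))) x"
proof (cases "x \<in> ball y (tau CARD('n) (j + 2))")
  case True
  have "avg a k (indicator (ball y (tau CARD('n) j))) x \<le> avg a k (\<lambda>y. 1) x"
    by (intro avg_mono) (auto simp: indicator_def)
  then show ?thesis using True by (simp add: avg_const)
next
  case False
  have "z \<notin> ball y (tau CARD('n) j)" if "z \<in> cube a k x" for z
  proof
    assume "z \<in> ball y (tau CARD('n) j)"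
    then have "norm (y - z) < tau CARD('n) j" by (simp add: dist_norm)
    moreover have "norm (z - x) < tau CARD('n) j"
      using cube_norm_tau[OF that] tau_mono[OF assms, of "CARD('n)"] by linarith
    moreover have "norm (y - x) \<le> norm (y - z) + norm (z - x)"
      using norm_triangle_ineq[of "y - z" "z - x"] by simp
    moreover have "tau CARD('n) (j + 2) = 3 * tau CARD('n) j" by (simp add: tau_add)
    ultimately show False using False tau_pos[of "CARD('n)" j] by (simp add: dist_norm)
  qed
  then have "(\<integral>\<^sup>+z. indicator (ball y (tau CARD('n) j)) z * indicator (cube a k x) z \<partial>lborel) = (\<integral>\<^sup>+z. 0 \<partial>(lborel :: (real^'n) measure))"
    by (intro nn_integral_cong) (auto simp: indicator_def)
  then have "avg a k (indicator (ball y (tau CARD('n) j))) x = 0"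
    by (simp add: avg_def)
  then show ?thesis by simp
qed

text \<open>The Carleson condition is stable under averages: scales below the box only see a slightly larger
  box, while the boundedly many scales crossing it are controlled pointwise.\<close>

lemma carl_avg_le:
  fixes w :: "int \<Rightarrow> real ^ 'n \<Rightarrow> ennreal"
  assumes w [measurable]: "\<And>k. w k \<in> borel_measurable borel" and j: "0 \<le> j"
    and N: "\<And>i y. carl 1 w i y \<le> N"
  shows "carl 1 (\<lambda>k. avg a (max k (k + m) + j) (w (k + m))) i y
    \<le> ennreal (3 ^ CARD('n) + (real (nat j) + real (nat \<bar>m\<bar>)) * (unit_ball_vol CARD('n) * (3 ^ (CARD('n) + 1)) ^ CARD('n))) * N"
proof -
  define d where "d = CARD('n)"
  define K where "K k = max k (k + m) + j" for k
  have ball_le: "(\<integral>\<^sup>+x. csum (\<lambda>k. if k \<le> i then w k x else 0) * indicator (ball y (tau d i)) x \<partial>lborel)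
      \<le> ennreal (tau d i ^ d) * N" for i and y :: "real ^ 'n"
  proof -
    define V where "V = ennreal (tau d i ^ d)"
    have "0 < tau d i ^ d" by simp
    then have V: "V \<noteq> 0" "V \<noteq> top" unfolding V_def by (simp_all only: ennreal_eq_0_iff not_le ennreal_neq_top not_False_eq_True)
    define A where "A = (\<integral>\<^sup>+x. csum (\<lambda>k. if k \<le> i then w k x else 0) * indicator (ball y (tau d i)) x \<partial>lborel)"
    have "A / V \<le> N" using N[of i y] by (simp add: carl_def d_def A_def V_def cong: if_cong)
    then have "V * (A / V) \<le> V * N" by (rule mult_left_mono) simp
    then show ?thesis using V unfolding A_def[symmetric] V_def[symmetric]
      by (simp add: ennreal_times_divide ennreal_mult_divide_eq mult.commute)
  qed
  \<comment> \<open>A single box gives a pointwise bound: the one of size \<open>tau d (K k)\<close>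
    around x contains the cube and sees the scale k + m. The constant is the d-th power of a bound
    for \<open>tau\<close> over \<open>side\<close>.\<close>
  have big: "avg a (K k) (w (k + m)) x \<le> ennreal ((3 ^ (d + 1)) ^ d) * N" for k x
  proof -
    have "(\<integral>\<^sup>+y. w (k + m) y * indicator (cube a (K k) x) y \<partial>lborel)
       \<le> (\<integral>\<^sup>+y. csum (\<lambda>l. if l \<le> K k then w l y else 0) * indicator (ball x (tau d (K k))) y \<partial>lborel)"
    proof (intro nn_integral_mono)
      fix y
      have "w (k + m) y \<le> csum (\<lambda>l. if l \<le> K k then w l y else 0)"
      proof -
        have "k + m \<le> K k" using j by (simp add: K_def)
        then show ?thesis using csum_ge[of "\<lambda>l. if l \<le> K k then w l y else 0" "k + m"] by simp
      qed
      moreover have "y \<in> cube a (K k) x \<Longrightarrow> y \<in> ball x (tau d (K k))"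
        using cube_norm_tau[of y a "K k" x] by (simp add: d_def dist_norm norm_minus_commute)
      ultimately show "w (k + m) y * indicator (cube a (K k) x) y \<le> csum (\<lambda>l. if l \<le> K k then w l y else 0) * indicator (ball x (tau d (K k))) y"
        by (auto simp: indicator_def)
    qed
    also have "\<dots> \<le> ennreal (tau d (K k) ^ d) * N" by (rule ball_le)
    also have "\<dots> \<le> ennreal ((3 ^ (d + 1)) ^ d * side (K k) ^ d) * N"
      unfolding power_mult_distrib[symmetric]
      by (intro mult_right_mono ennreal_leI power_mono tau_side) (auto simp: less_imp_le)
    finally have "avg a (K k) (w (k + m)) x \<le> ennreal ((3 ^ (d + 1)) ^ d * side (K k) ^ d) * N / ennreal (side (K k) ^ d)"
      unfolding avg_def d_def by (rule divide_right_mono_ennreal)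
    also have "\<dots> = (ennreal ((3 ^ (d + 1)) ^ d) * N) * ennreal (side (K k) ^ d) / ennreal (side (K k) ^ d)"
    proof -
      have "ennreal (c * s) * N = (ennreal c * N) * ennreal s" if "0 \<le> c" "0 \<le> s" for c s
        using that by (simp add: ennreal_mult mult_ac)
      from this[of "(3 ^ (d + 1)) ^ d" "side (K k) ^ d"] show ?thesis by (simp add: less_imp_le)
    qed
    also have "\<dots> = ennreal ((3 ^ (d + 1)) ^ d) * N" by (rule ennreal_mult_divide_eq) auto
    finally show ?thesis .
  qed
  define B :: "real ^ 'n \<Rightarrow> ennreal" where "B = indicator (ball y (tau d i))"
  define B2 :: "real ^ 'n \<Rightarrow> ennreal" where "B2 = indicator (ball y (tau d (i + 2)))"
  have [measurable]: "B \<in> borel_measurable borel" "B2 \<in> borel_measurable borel"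
    unfolding B_def B2_def by (rule borel_measurable_indicator, simp)+
  \<comment> \<open>If k \<le> i < K k, the averaging cube outgrows the box; this happens only for k
    > i - j - |m|.\<close>
  define F where "F = {i - j - \<bar>m\<bar><..i}"
  have split: "csum (\<lambda>k. if k \<le> i then avg a (K k) (w (k + m)) x else 0)
     \<le> csum (\<lambda>k. if K k \<le> i then avg a (K k) (w (k + m)) x else 0) + of_nat (card F) * (ennreal ((3 ^ (d + 1)) ^ d) * N)" for x
  proof -
    have "csum (\<lambda>k. if k \<le> i then avg a (K k) (w (k + m)) x else 0)
      \<le> csum (\<lambda>k. (if K k \<le> i then avg a (K k) (w (k + m)) x else 0) + (ennreal ((3 ^ (d + 1)) ^ d) * N) * indicator F k)"
      using big[of _ x] j by (intro nn_integral_mono) (auto simp: F_def K_def indicator_def)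
    also have "\<dots> = csum (\<lambda>k. if K k \<le> i then avg a (K k) (w (k + m)) x else 0)
        + (ennreal ((3 ^ (d + 1)) ^ d) * N) * of_nat (card F)"
      by (subst nn_integral_add) (auto simp: nn_integral_cmult F_def)
    finally show ?thesis by (simp add: mult_ac)
  qed
  have card: "card F = nat j + nat \<bar>m\<bar>" using j by (simp add: F_def nat_add_distrib)
  \<comment> \<open>The averaging cubes are no larger than the box here, so the averages can be
    moved onto its indicator. The box grows by a factor 3, that is, by two levels.\<close>
  have small: "(\<integral>\<^sup>+x. csum (\<lambda>k. if K k \<le> i then avg a (K k) (w (k + m)) x else 0) * B x \<partial>lborel)
      \<le> ennreal (tau d (i + 2) ^ d) * N"
  proof -
    have "(\<integral>\<^sup>+x. csum (\<lambda>k. if K k \<le> i then avg a (K k) (w (k + m)) x else 0) * B x \<partial>lborel)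
       = (\<integral>\<^sup>+x. csum (\<lambda>k. (if K k \<le> i then avg a (K k) (w (k + m)) x else 0) * B x) \<partial>lborel)"
      by (intro nn_integral_cong) (simp add: nn_integral_multc)
    also have "\<dots> = csum (\<lambda>k. \<integral>\<^sup>+x. (if K k \<le> i then avg a (K k) (w (k + m)) x else 0) * B x \<partial>lborel)"
      by (rule csum_swap) measurable
    also have "\<dots> \<le> csum (\<lambda>k. \<integral>\<^sup>+x. (if k + m \<le> i + 2 then w (k + m) x else 0) * B2 x \<partial>lborel)"
    proof (rule nn_integral_mono)
      fix k
      show "(\<integral>\<^sup>+x. (if K k \<le> i then avg a (K k) (w (k + m)) x else 0) * B x \<partial>lborel)
        \<le> (\<integral>\<^sup>+x. (if k + m \<le> i + 2 then w (k + m) x else 0) * B2 x \<partial>lborel)"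
      proof (cases "K k \<le> i")
        case True
        then have "(\<integral>\<^sup>+x. (if K k \<le> i then avg a (K k) (w (k + m)) x else 0) * B x \<partial>lborel)
          = (\<integral>\<^sup>+x. w (k + m) x * avg a (K k) B x \<partial>lborel)"
          by (simp add: avg_adjoint)
        also have "\<dots> \<le> (\<integral>\<^sup>+x. w (k + m) x * B2 x \<partial>lborel)"
          unfolding B_def B2_def d_def using True by (intro nn_integral_mono mult_left_mono avg_indicator_le) auto
        finally have "(\<integral>\<^sup>+x. (if K k \<le> i then avg a (K k) (w (k + m)) x else 0) * B x \<partial>lborel)
          \<le> (\<integral>\<^sup>+x. w (k + m) x * B2 x \<partial>lborel)" .
        moreover have "k + m \<le> i + 2" using True j by (simp add: K_def)
        ultimately show ?thesis by simp
      qed simp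
    qed
    also have "\<dots> = csum (\<lambda>k. \<integral>\<^sup>+x. (if k \<le> i + 2 then w k x else 0) * B2 x \<partial>lborel)"
      by (rule csum_int_shift[where f="\<lambda>k. \<integral>\<^sup>+x. (if k \<le> i + 2 then w k x else 0) * B2 x \<partial>lborel"])
    also have "\<dots> = (\<integral>\<^sup>+x. csum (\<lambda>k. (if k \<le> i + 2 then w k x else 0) * B2 x) \<partial>lborel)"
      by (rule csum_swap[symmetric]) measurable
    also have "\<dots> = (\<integral>\<^sup>+x. csum (\<lambda>k. if k \<le> i + 2 then w k x else 0) * B2 x \<partial>lborel)"
      by (intro nn_integral_cong) (simp add: nn_integral_multc)
    also have "\<dots> \<le> ennreal (tau d (i + 2) ^ d) * N" unfolding B2_def by (rule ball_le)
    finally show ?thesis .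
  qed
  define V where "V = tau d i ^ d"
  have V: "0 < V" by (simp add: V_def)
  define c where "c = real (nat j + nat \<bar>m\<bar>) * (3 ^ (d + 1)) ^ d"
  have "(\<integral>\<^sup>+x. csum (\<lambda>k. if k \<le> i then avg a (K k) (w (k + m)) x else 0) * B x \<partial>lborel)
    \<le> (\<integral>\<^sup>+x. csum (\<lambda>k. if K k \<le> i then avg a (K k) (w (k + m)) x else 0) * B x + (ennreal c * N) * B x \<partial>lborel)"
  proof (intro nn_integral_mono)
    fix x
    have "csum (\<lambda>k. if k \<le> i then avg a (K k) (w (k + m)) x else 0) * B x \<le>
      (csum (\<lambda>k. if K k \<le> i then avg a (K k) (w (k + m)) x else 0) + of_nat (card F) * (ennreal ((3 ^ (d + 1)) ^ d) * N)) * B x"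
      by (rule mult_right_mono[OF split]) simp
    also have "of_nat (card F) * (ennreal ((3 ^ (d + 1)) ^ d) * N) = ennreal c * N"
      unfolding card c_def by (subst ennreal_mult) (auto simp: ennreal_of_nat_eq_real_of_nat mult.assoc)
    finally show "csum (\<lambda>k. if k \<le> i then avg a (K k) (w (k + m)) x else 0) * B x \<le>
      csum (\<lambda>k. if K k \<le> i then avg a (K k) (w (k + m)) x else 0) * B x + ennreal c * N * B x"
      by (simp only: distrib_right)
  qed
  also have "\<dots> = (\<integral>\<^sup>+x. csum (\<lambda>k. if K k \<le> i then avg a (K k) (w (k + m)) x else 0) * B x \<partial>lborel)
      + (ennreal c * N) * emeasure lborel (ball y (tau d i))"
    by (subst nn_integral_add, measurable, subst nn_integral_cmult, measurable) (simp add: B_def)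
  also have "emeasure lborel (ball y (tau d i)) = ennreal (unit_ball_vol d * V)"
    by (simp add: emeasure_ball d_def V_def less_imp_le)
  also have "(\<integral>\<^sup>+x. csum (\<lambda>k. if K k \<le> i then avg a (K k) (w (k + m)) x else 0) * B x \<partial>lborel)
      + (ennreal c * N) * ennreal (unit_ball_vol d * V)
      \<le> ennreal (tau d (i + 2) ^ d) * N + (ennreal c * N) * ennreal (unit_ball_vol d * V)"
    by (intro add_right_mono small)
  also have "\<dots> = (ennreal (3 ^ d + c * unit_ball_vol d) * N) * ennreal V"
  proof -
    have "ennreal (tau d (i + 2) ^ d) = ennreal (3 ^ d) * ennreal V"
      using V by (subst ennreal_mult[symmetric]) (auto simp: tau_add V_def power_mult_distrib less_imp_le)
    moreover have "ennreal (unit_ball_vol d * V) = ennreal (unit_ball_vol d) * ennreal V"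
      using V by (intro ennreal_mult) auto
    moreover have "0 \<le> c" by (simp add: c_def)
    ultimately show ?thesis by (simp add: ennreal_mult algebra_simps)
  qed
  finally have "(\<integral>\<^sup>+x. csum (\<lambda>k. if k \<le> i then avg a (K k) (w (k + m)) x else 0) * B x \<partial>lborel) / ennreal V
     \<le> (ennreal (3 ^ d + c * unit_ball_vol d) * N) * ennreal V / ennreal V"
    by (rule divide_right_mono_ennreal)
  also have "\<dots> = ennreal (3 ^ d + c * unit_ball_vol d) * N"
    using V by (intro ennreal_mult_divide_eq) auto
  finally show ?thesis
    by (simp add: carl_def K_def B_def V_def d_def c_def mult_ac cong: if_cong)
qed

definition pmean :: "real \<Rightarrow> 'n::finite set \<Rightarrow> int \<Rightarrow> (real ^ 'n \<Rightarrow> ennreal) \<Rightarrow> real ^ 'n \<Rightarrow> ennreal" where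
  "pmean \<mu> a k w x = epowr (avg a k (\<lambda>y. epowr (w y) \<mu>) x) (1 / \<mu>)"

lemma pmean_measurable [measurable]: "w \<in> borel_measurable borel \<Longrightarrow> pmean \<mu> a k w \<in> borel_measurable borel"
  unfolding pmean_def[abs_def] by measurable

text \<open>Raising to the power \<mu> = min p q turns power means into plain averages and leaves
  the exponent pairs (top, 1), (1, top), (R, 1) and (1, R) with R \<ge> 1, besides the elementary
  pair of two infinities. The pair (top, 1) is the Carleson estimate; (R, 1) has a constant free of
  the delay; (1, top) and (1, R) lose the length of the delay. A common polynomial bound is all that
  the later summation asks for.\<close>

lemma dtn_pmean_le:
  assumes pq: "0 < p" "0 < q"
  shows "\<exists>C\<ge>0. \<exists>\<kappa>\<ge>0. \<forall>(g :: int \<Rightarrow> real ^ 'n \<Rightarrow> ennreal) a m j.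
    (\<forall>k. g k \<in> borel_measurable borel) \<longrightarrow> (\<forall>k. level a k (g k)) \<longrightarrow> 0 \<le> j \<longrightarrow>
    dtn p q (\<lambda>k. pmean (min_exp p q) a (max k (k + m) + j) (g (k + m)))
      \<le> ennreal (C * real (nat \<bar>m\<bar> + nat j + 2) powr \<kappa>) * dtn p q g"
  (is "\<exists>C\<ge>0. \<exists>\<kappa>\<ge>0. \<forall>g a m j. ?P C \<kappa> g a m j")
proof -
  define N where "N m j = nat \<bar>m\<bar> + nat j + 2" for m j :: int
  have N1: "1 \<le> real (N m j)" for m j by (simp add: N_def)
  from pq(1) show ?thesis
  proof (cases rule: exponent_cases)
    case p: 1
    from pq(2) show ?thesis
    proof (cases rule: exponent_cases)
      case q: 1
      have "?P 1 1 g a m j" for g :: "int \<Rightarrow> real ^ 'n \<Rightarrow> ennreal" and a m j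
      proof (intro impI)
        assume "\<forall>k. g k \<in> borel_measurable borel"
        define D where "D = dtn p q g"
        have "g k x \<le> D" for k x unfolding D_def p q dtn_inf_inf by (meson SUP_upper SUP_upper2 UNIV_I)
        then have "avg a (max k (k + m) + j) (g (k + m)) x \<le> avg a (max k (k + m) + j) (\<lambda>x. D) x" for k x
          by (intro avg_mono)
        then have "dtn p q (\<lambda>k. pmean (min_exp p q) a (max k (k + m) + j) (g (k + m))) \<le> D"
          unfolding p q dtn_inf_inf by (auto simp: pmean_def min_exp_def avg_const intro!: SUP_least)
        also have "\<dots> \<le> ennreal (1 * real (N m j) powr 1) * D"
        proof -
          have "1 \<le> ennreal (1 * real (N m j) powr 1)" using N1 by simp
          from mult_right_mono[OF this, of D] show ?thesis by simp
        qed
        finally show "dtn p q (\<lambda>k. pmean (min_exp p q) a (max k (k + m) + j) (g (k + m)))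
           \<le> ennreal (1 * real (nat \<bar>m\<bar> + nat j + 2) powr 1) * dtn p q g" by (simp add: D_def N_def)
      qed
      then have X: "\<forall>g a m j. ?P (1) (1) g a m j" by blast
      show ?thesis by (rule exI[of _ "1"], intro conjI, simp, rule exI[of _ "1"], intro conjI, simp, rule X)
    next
      case q: (2 Q)
      define A where "A = 3 ^ CARD('n) + unit_ball_vol CARD('n) * (3 ^ (CARD('n) + 1)) ^ CARD('n)"
      have A: "0 \<le> A" by (simp add: A_def)
      have mu: "min_exp p q = Q" using p q by (simp add: min_exp_def min_def top_unique)
      have "?P (A powr (1 / Q)) (1 / Q) g a m j" for g :: "int \<Rightarrow> real ^ 'n \<Rightarrow> ennreal" and a m j
      proof (intro impI)
        assume "\<forall>k. g k \<in> borel_measurable borel" and j: "0 \<le> j"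
        then have [measurable]: "\<And>k. g k \<in> borel_measurable borel" by auto
        define D where "D = dtn p q g"
        have carl1: "carl Q X i y = carl 1 (\<lambda>k x. epowr (X k x) Q) i y" for X i and y :: "real ^ 'n"
          by (simp add: carl_def cong: if_cong)
        have "carl 1 (\<lambda>k. avg a (max k (k + m) + j) (\<lambda>x. epowr (g (k + m) x) Q)) i y
          \<le> ennreal (3 ^ CARD('n) + (real (nat j) + real (nat \<bar>m\<bar>)) * (unit_ball_vol CARD('n) * (3 ^ (CARD('n) + 1)) ^ CARD('n))) * epowr D Q" for i y
        proof (rule carl_avg_le[OF _ j])
          show "carl 1 (\<lambda>k x. epowr (g k x) Q) i y \<le> epowr D Q" for i y
            unfolding carl1[symmetric] D_def p q by (rule carl_le_dtn[OF q(2)])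
        qed measurable
        also have "ennreal (3 ^ CARD('n) + (real (nat j) + real (nat \<bar>m\<bar>)) * (unit_ball_vol CARD('n) * (3 ^ (CARD('n) + 1)) ^ CARD('n)))
            \<le> ennreal (A * real (N m j))"
        proof (rule ennreal_leI)
          have "3 ^ CARD('n) * 1 \<le> 3 ^ CARD('n) * real (N m j)" by (rule mult_left_mono[OF N1]) simp
          moreover have "(real (nat j) + real (nat \<bar>m\<bar>)) * (unit_ball_vol CARD('n) * (3 ^ (CARD('n) + 1)) ^ CARD('n))
            \<le> real (N m j) * (unit_ball_vol CARD('n) * (3 ^ (CARD('n) + 1)) ^ CARD('n))"
            by (intro mult_right_mono) (auto simp: N_def)
          ultimately
          show "3 ^ CARD('n) + (real (nat j) + real (nat \<bar>m\<bar>)) * (unit_ball_vol CARD('n) * (3 ^ (CARD('n) + 1)) ^ CARD('n)) \<le> A * real (N m j)"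
          proof -
            have arith: "a + s * u \<le> (a + u) * n" if "a * 1 \<le> a * n" "s * u \<le> n * u" for a s u n :: real
              using that by (simp add: algebra_simps)
            show ?thesis unfolding A_def by (rule arith; fact)
          qed
        qed
        finally have c: "carl 1 (\<lambda>k. avg a (max k (k + m) + j) (\<lambda>x. epowr (g (k + m) x) Q)) i y \<le> ennreal (A * real (N m j)) * epowr D Q" for i y
          by (simp add: mult_right_mono)
        have "dtn p q (\<lambda>k. pmean (min_exp p q) a (max k (k + m) + j) (g (k + m))) \<le> ennreal ((A * real (N m j)) powr (1 / Q)) * D"
          unfolding p q(1)
        proof (rule dtn_inf_fin_le[OF q(2)])
          fix i y
          have "carl Q (\<lambda>k. pmean (min_exp top (ennreal Q)) a (max k (k + m) + j) (g (k + m))) i y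
              = carl 1 (\<lambda>k. avg a (max k (k + m) + j) (\<lambda>x. epowr (g (k + m) x) Q)) i y"
            unfolding carl1 using mu p q by (simp add: pmean_def)
          also have "\<dots> \<le> ennreal (A * real (N m j)) * epowr D Q" by (rule c)
          also have "\<dots> = epowr (ennreal ((A * real (N m j)) powr (1 / Q)) * D) Q"
            using q A by (simp add: epowr_mult powr_powr)
          finally show "carl Q (\<lambda>k. pmean (min_exp top (ennreal Q)) a (max k (k + m) + j) (g (k + m))) i y
            \<le> epowr (ennreal ((A * real (N m j)) powr (1 / Q)) * D) Q" .
        qed
        then show "dtn p q (\<lambda>k. pmean (min_exp p q) a (max k (k + m) + j) (g (k + m)))
           \<le> ennreal (A powr (1 / Q) * real (nat \<bar>m\<bar> + nat j + 2) powr (1 / Q)) * dtn p q g"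
          using A by (simp add: D_def N_def powr_mult)
      qed
      then have X: "\<forall>g a m j. ?P (A powr (1 / Q)) (1 / Q) g a m j" by blast
      show ?thesis by (rule exI[of _ "A powr (1 / Q)"], intro conjI, simp, rule exI[of _ "1 / Q"], intro conjI, simp add: q(2) less_imp_le, rule X)
    qed
  next
    case p: (2 P)
    from pq(2) show ?thesis
    proof (cases rule: exponent_cases)
      case q: 1
      have mu: "min_exp p q = P" using p q by (simp add: min_exp_def min_def)
      have "?P 1 (1 / P) g a m j" for g :: "int \<Rightarrow> real ^ 'n \<Rightarrow> ennreal" and a m j
      proof (intro impI)
        assume "\<forall>k. g k \<in> borel_measurable borel" "\<forall>k. level a k (g k)" and j: "0 \<le> j"
        then have [measurable]: "\<And>k. g k \<in> borel_measurable borel" and lev: "\<And>k. level a k (g k)" by auto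
        have "(\<integral>\<^sup>+x. (SUP k. avg a (max k (k + m) + j) (\<lambda>x. epowr (g (k + m) x) P) x) \<partial>lborel)
          \<le> of_nat (N m j) * (\<integral>\<^sup>+x. (SUP k. epowr (g k x) P) \<partial>lborel)"
          unfolding N_def using j
          by (intro nn_integral_SUP_avg_le[of "\<lambda>k x. epowr (g k x) P"]) (auto intro: level_comp lev)
        then have "epowr (\<integral>\<^sup>+x. (SUP k. avg a (max k (k + m) + j) (\<lambda>x. epowr (g (k + m) x) P) x) \<partial>lborel) (1 / P)
          \<le> epowr \<dots> (1 / P)" using p by (intro epowr_mono) auto
        then show "dtn p q (\<lambda>k. pmean (min_exp p q) a (max k (k + m) + j) (g (k + m)))
           \<le> ennreal (1 * real (nat \<bar>m\<bar> + nat j + 2) powr (1 / P)) * dtn p q g"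
          unfolding mu N_def[symmetric] using p unfolding p(1) q dtn_fin_inf[OF p(2)]
          by (simp add: epowr_SUP pmean_def epowr_mult ennreal_of_nat_eq_real_of_nat)
      qed
      then have X: "\<forall>g a m j. ?P (1) (1 / P) g a m j" by blast
      show ?thesis by (rule exI[of _ "1"], intro conjI, simp, rule exI[of _ "1 / P"], intro conjI, simp add: p(2) less_imp_le, rule X)
    next
      case q: (2 Q)
      show ?thesis
      proof (cases "Q \<le> P")
        case True
        then have mu: "min_exp p q = Q" using p q by (simp add: min_exp_def min_def)
        define R where "R = P / Q"
        have R: "1 \<le> R" using True q by (simp add: R_def)
        define c where "c = 2 * (R * (2 * R) powr (R - 1))"
        have c: "0 \<le> c" using R by (simp add: c_def)
        have "?P (c powr (1 / P)) 0 g a m j" for g :: "int \<Rightarrow> real ^ 'n \<Rightarrow> ennreal" and a m j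
        proof (intro impI)
          assume "\<forall>k. g k \<in> borel_measurable borel"
          then have [measurable]: "\<And>k. g k \<in> borel_measurable borel" by auto
          have "(\<integral>\<^sup>+x. epowr (csum (\<lambda>k. avg a (max k (k + m) + j) (\<lambda>x. epowr (g (k + m) x) Q) x)) R \<partial>lborel)
            \<le> ennreal c * (\<integral>\<^sup>+x. epowr (csum (\<lambda>k. epowr (g k x) Q)) R \<partial>lborel)"
            unfolding c_def using R
            by (intro nn_integral_powr_csum_avg_le[of "\<lambda>k x. epowr (g k x) Q"]) auto
          then have "epowr (\<integral>\<^sup>+x. epowr (csum (\<lambda>k. avg a (max k (k + m) + j) (\<lambda>x. epowr (g (k + m) x) Q) x)) R \<partial>lborel) (1 / P)
            \<le> epowr \<dots> (1 / P)" using p by (intro epowr_mono) auto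
          then show "dtn p q (\<lambda>k. pmean (min_exp p q) a (max k (k + m) + j) (g (k + m)))
             \<le> ennreal (c powr (1 / P) * real (nat \<bar>m\<bar> + nat j + 2) powr 0) * dtn p q g"
            unfolding mu using p q c unfolding p(1) q(1) dtn_fin_fin[OF p(2) q(2)]
            by (simp add: pmean_def epowr_mult R_def)
        qed
        then have X: "\<forall>g a m j. ?P (c powr (1 / P)) (0) g a m j" by blast
      show ?thesis by (rule exI[of _ "c powr (1 / P)"], intro conjI, simp, rule exI[of _ "0"], intro conjI, simp, rule X)
      next
        case False
        then have mu: "min_exp p q = P" using p q by (simp add: min_exp_def min_def)
        define R where "R = Q / P"
        have R: "1 \<le> R" using False p by (simp add: R_def)
        have "?P 1 (1 / P) g a m j" for g :: "int \<Rightarrow> real ^ 'n \<Rightarrow> ennreal" and a m j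
        proof (intro impI)
          assume "\<forall>k. g k \<in> borel_measurable borel" "\<forall>k. level a k (g k)" and j: "0 \<le> j"
          then have [measurable]: "\<And>k. g k \<in> borel_measurable borel" and lev: "\<And>k. level a k (g k)" by auto
          have "(\<integral>\<^sup>+x. epowr (csum (\<lambda>k. epowr (avg a (max k (k + m) + j) (\<lambda>x. epowr (g (k + m) x) P) x) R)) (1 / R) \<partial>lborel)
            \<le> of_nat (N m j) * (\<integral>\<^sup>+x. epowr (csum (\<lambda>k. epowr (epowr (g k x) P) R)) (1 / R) \<partial>lborel)"
            unfolding N_def using R j
            by (intro nn_integral_lQ_avg_le[of "\<lambda>k x. epowr (g k x) P"]) (auto intro: level_comp lev)
          then have "epowr (\<integral>\<^sup>+x. epowr (csum (\<lambda>k. epowr (avg a (max k (k + m) + j) (\<lambda>x. epowr (g (k + m) x) P) x) R)) (1 / R) \<partial>lborel) (1 / P)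
            \<le> epowr \<dots> (1 / P)" using p by (intro epowr_mono) auto
          then show "dtn p q (\<lambda>k. pmean (min_exp p q) a (max k (k + m) + j) (g (k + m)))
             \<le> ennreal (1 * real (nat \<bar>m\<bar> + nat j + 2) powr (1 / P)) * dtn p q g"
            unfolding mu N_def[symmetric] using p q unfolding p(1) q(1) dtn_fin_fin[OF p(2) q(2)]
            by (simp add: pmean_def epowr_mult R_def ennreal_of_nat_eq_real_of_nat)
        qed
        then have X: "\<forall>g a m j. ?P (1) (1 / P) g a m j" by blast
      show ?thesis by (rule exI[of _ "1"], intro conjI, simp, rule exI[of _ "1 / P"], intro conjI, simp add: p(2) less_imp_le, rule X)
      qed
    qed
  qed
qed

text \<open>Turns a finite norm of the majorant into finiteness at almost every point for each
  scale, the form in which the construction of the extension consumes it.\<close>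

lemma dtn_finite_AE:
  fixes X :: "int \<Rightarrow> real ^ 'n \<Rightarrow> ennreal"
  assumes pq: "0 < p" "0 < q" and [measurable]: "\<And>k. X k \<in> borel_measurable borel" and fin: "dtn p q X < top"
  shows "AE x in lborel. X k x < top"
  using pq(1)
proof (cases rule: exponent_cases)
  case p: 1
  from pq(2) show ?thesis
  proof (cases rule: exponent_cases)
    case q: 1
    have "X k x \<le> dtn p q X" for x unfolding p q dtn_inf_inf by (meson SUP_upper SUP_upper2 UNIV_I)
    then show ?thesis using fin by (auto intro: le_less_trans)
  next
    case q: (2 Q)
    define B :: "nat \<Rightarrow> (real ^ 'n) set" where "B i = ball 0 (tau CARD('n) (int i))" for i
    have "AE x in lborel. x \<in> B i \<longrightarrow> X k x < top" for i
    proof -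
      \<comment> \<open>A box of this size contains \<open>B i\<close> and sees the scale k.\<close>
      define j where "j = max k (int i)"
      define I where "I = (\<integral>\<^sup>+x. csum (\<lambda>k. if k \<le> j then epowr (X k x) Q else 0) * indicator (ball 0 (tau CARD('n) j)) x \<partial>lborel)"
      have "carl Q X j 0 < top"
        using carl_le_dtn[OF q(2), of X j 0] fin unfolding p q by (simp add: le_less_trans)
      then have "I < top"
        by (auto simp: carl_def I_def divide_less_ennreal less_top[symmetric] ennreal_divide_eq_top_iff)
      moreover have [measurable]: "ball (0 :: real ^ 'n) (tau CARD('n) j) \<in> sets borel" by simp
      have "(\<lambda>x. csum (\<lambda>k. if k \<le> j then epowr (X k x) Q else 0) * indicator (ball 0 (tau CARD('n) j)) x) \<in> borel_measurable lborel"
        by measurable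
      ultimately have "AE x in lborel. csum (\<lambda>k. if k \<le> j then epowr (X k x) Q else 0) * indicator (ball 0 (tau CARD('n) j)) x \<noteq> \<infinity>"
        unfolding I_def by (intro nn_integral_PInf_AE) auto
      then have "AE x in lborel. csum (\<lambda>k. if k \<le> j then epowr (X k x) Q else 0) * indicator (ball 0 (tau CARD('n) j)) x < top"
        by (simp add: less_top)
      then show ?thesis
      proof (rule AE_mp, intro AE_I2 impI)
        fix x
        assume fx: "csum (\<lambda>k. if k \<le> j then epowr (X k x) Q else 0) * indicator (ball 0 (tau CARD('n) j)) x < top" and "x \<in> B i"
        then have "x \<in> ball 0 (tau CARD('n) j)"
          using tau_mono[of "int i" j "CARD('n)"] by (auto simp: B_def j_def)
        then have "csum (\<lambda>k. if k \<le> j then epowr (X k x) Q else 0) < top" using fx by simp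
        moreover have "epowr (X k x) Q \<le> csum (\<lambda>k. if k \<le> j then epowr (X k x) Q else 0)"
          using csum_ge[of "\<lambda>k. if k \<le> j then epowr (X k x) Q else 0" k] by (simp add: j_def)
        ultimately have "epowr (X k x) Q < top" by (rule le_less_trans[rotated])
        then show "X k x < top" by simp
      qed
    qed
    then have "AE x in lborel. \<forall>i. x \<in> B i \<longrightarrow> X k x < top" unfolding AE_all_countable ..
    moreover have "\<exists>i. x \<in> B i" for x
    proof -
      obtain i :: nat where i: "norm x < real i" using reals_Archimedean2 by blast
      have "real i \<le> 3 ^ i" by (rule le_power_3)
      also have "\<dots> = 3 powr (real_of_int (int (2 * i)) / 2)" by (simp add: powr_realpow)
      also have "\<dots> \<le> tau CARD('n) (int (2 * i))" by (simp add: tau_def)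
      finally show ?thesis using i by (intro exI[of _ "2 * i"]) (auto simp: B_def)
    qed
    ultimately show ?thesis by (auto elim!: eventually_mono)
  qed
next
  case p: (2 P)
  from pq(2) show ?thesis
  proof (cases rule: exponent_cases)
    case q: 1
    have "AE x in lborel. epowr (SUP k. X k x) P \<noteq> \<infinity>"
      using fin p unfolding p q dtn_fin_inf[OF p(2)] by (intro nn_integral_PInf_AE) (auto simp: less_top[symmetric])
    then show ?thesis
    proof (rule AE_mp, intro AE_I2 impI)
      fix x assume "epowr (SUP k. X k x) P \<noteq> \<infinity>"
      then have "(SUP k. X k x) < top" by (simp only: epowr_eq_top_iff infinity_ennreal_def less_top not_False_eq_True)
      moreover have "X k x \<le> (SUP k. X k x)" by (rule SUP_upper) simp
      ultimately show "X k x < top" by (rule le_less_trans[rotated])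
    qed
  next
    case q: (2 Q)
    have "AE x in lborel. epowr (csum (\<lambda>k. epowr (X k x) Q)) (P / Q) \<noteq> \<infinity>"
      using fin p unfolding p q dtn_fin_fin[OF p(2) q(2)] by (intro nn_integral_PInf_AE) (auto simp: less_top[symmetric])
    then show ?thesis
    proof (rule AE_mp, intro AE_I2 impI)
      fix x assume "epowr (csum (\<lambda>k. epowr (X k x) Q)) (P / Q) \<noteq> \<infinity>"
      then have "csum (\<lambda>k. epowr (X k x) Q) < top" by (simp add: less_top)
      then have "epowr (X k x) Q < top" using csum_ge[of "\<lambda>k. epowr (X k x) Q" k] by (rule le_less_trans[rotated])
      then show "X k x < top" by simp
    qed
  qed
qed


section \<open>Whitney averages\<close>

lemma half_space_borel [measurable]: "half_space \<in> sets borel"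
proof -
  have "open ({0<..} \<times> UNIV :: (real \<times> (real ^ 'n)) set)" by (intro open_Times) auto
  then show ?thesis unfolding half_space_def by (rule borel_open)
qed

lemma fst_borel_measurable [measurable]: "(fst :: 'a::euclidean_space \<times> 'b::euclidean_space \<Rightarrow> 'a) \<in> borel_measurable borel"
  and snd_borel_measurable [measurable]: "(snd :: 'a::euclidean_space \<times> 'b::euclidean_space \<Rightarrow> 'b) \<in> borel_measurable borel"
  by (intro borel_measurable_continuous_onI continuous_intros)+

lemma AE_lborel_iff: "(AE z in lebesgue. P z) \<longleftrightarrow> (AE z in lborel. P z)"
  by (rule AE_completion_iff)

lemma AE_half_leb:
  "(AE z in half_leb. P z) \<longleftrightarrow> (AE z in lborel. z \<in> (half_space :: (real \<times> (real ^ 'n)) set) \<longrightarrow> P z)"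
proof -
  have "half_space \<inter> space lebesgue \<in> sets (lebesgue :: (real \<times> (real ^ 'n)) measure)"
    using half_space_borel by (auto intro: sets_completionI_sets)
  then show ?thesis by (subst AE_restrict_space_iff) (auto simp: AE_lborel_iff)
qed

lemma nn_integral_half_leb:
  "(\<integral>\<^sup>+z. f z \<partial>half_leb) = (\<integral>\<^sup>+z. f z * indicator (half_space :: (real \<times> (real ^ 'n)) set) z \<partial>lborel)"
proof -
  have "half_space \<inter> space lebesgue \<in> sets (lebesgue :: (real \<times> (real ^ 'n)) measure)"
    using half_space_borel by (auto intro: sets_completionI_sets)
  then show ?thesis by (subst nn_integral_restrict_space) (auto simp: nn_integral_completion)
qed

lemma AE_lborel_sections:
  fixes P :: "'a::euclidean_space \<times> 'b::euclidean_space \<Rightarrow> bool"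
  assumes "AE z in lborel. P z"
  shows "AE x in lborel. AE y in lborel. P (x, y)"
  using assms unfolding lborel_prod[symmetric] by (rule lborel_pair.AE_pair)

text \<open>Sections of Lebesgue measurable functions need not be measurable, whereas Borel
  functions have Borel sections and products. Arguments with iterated integrals are therefore run on
  a Borel representative, chosen to vanish off H; it is found for real and imaginary part
  separately.\<close>

lemma borel_representative_on:
  fixes f :: "'a::euclidean_space \<Rightarrow> complex"
  assumes H: "H \<in> sets borel" and f: "f \<in> borel_measurable (lebesgue_on H)"
  obtains g where "g \<in> borel_measurable borel" "AE z in lborel. z \<in> H \<longrightarrow> f z = g z" "\<And>z. z \<notin> H \<Longrightarrow> g z = 0"
proof -
  note [measurable] = H
  have hs: "H \<inter> space lebesgue \<in> sets (lebesgue :: 'a measure)"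
    using H by (auto intro: sets_completionI_sets)
  have "(\<lambda>z. indicator H z *\<^sub>R f z) \<in> borel_measurable lebesgue"
    using f borel_measurable_restrict_space_iff[OF hs, of f] by simp
  then have "(\<lambda>z. Re (indicator H z *\<^sub>R f z)) \<in> borel_measurable lebesgue"
    "(\<lambda>z. Im (indicator H z *\<^sub>R f z)) \<in> borel_measurable lebesgue"
    by measurable
  then obtain a b where ab [measurable]: "a \<in> borel_measurable lborel" "b \<in> borel_measurable lborel"
    and eq: "AE z in lborel. Re (indicator H z *\<^sub>R f z) = a z" "AE z in lborel. Im (indicator H z *\<^sub>R f z) = b z"
    using completion_ex_borel_measurable_real[of "\<lambda>z. Re (indicator H z *\<^sub>R f z)" lborel]
      completion_ex_borel_measurable_real[of "\<lambda>z. Im (indicator H z *\<^sub>R f z)" lborel] by blast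
  define g where "g z = indicator H z *\<^sub>R Complex (a z) (b z)" for z
  have "g = (\<lambda>z. indicator H z *\<^sub>R (complex_of_real (a z) + \<i> * complex_of_real (b z)))"
    by (auto simp: g_def complex_eq_iff)
  also have "\<dots> \<in> borel_measurable borel" using ab by measurable
  finally have "g \<in> borel_measurable borel" .
  moreover have "AE z in lborel. z \<in> H \<longrightarrow> f z = g z"
    using eq by eventually_elim (auto simp: g_def complex_eq_iff)
  ultimately show thesis by (rule that) (simp add: g_def)
qed

lemma borel_representative:
  fixes f :: "real \<times> (real ^ 'n) \<Rightarrow> complex"
  assumes "f \<in> borel_measurable half_leb"
  obtains g where "g \<in> borel_measurable borel" "AE z in half_leb. f z = g z" "\<And>z. z \<notin> half_space \<Longrightarrow> g z = 0"
proof (rule borel_representative_on[OF half_space_borel assms])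
  fix g assume g: "g \<in> borel_measurable borel" "AE z in lborel. z \<in> half_space \<longrightarrow> f z = g z"
    "\<And>z. z \<notin> half_space \<Longrightarrow> g z = 0"
  have "AE z in half_leb. f z = g z" unfolding AE_half_leb by (rule g(2))
  from g(1) this show thesis by (rule that) (rule g(3))
qed

definition box_int :: "real \<Rightarrow> (real \<times> (real ^ 'n) \<Rightarrow> complex) \<Rightarrow> real \<Rightarrow> real ^ 'n \<Rightarrow> ennreal" where
  "box_int r f t x = (\<integral>\<^sup>+z. ennreal (norm (f z) powr r) * indicator ({t / 2..t} \<times> ball x t) z \<partial>lborel)"

text \<open>The average is an iterated integral, so equality almost everywhere is first passed to
  almost every section in s.\<close>

lemma whitney_avg_cong:
  assumes "AE z in half_leb. f z = g z" "0 < t"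
  shows "whitney_avg r f t x = whitney_avg r g t x"
proof -
  have "AE s in lborel. AE y in lborel. (s, y) \<in> half_space \<longrightarrow> f (s, y) = g (s, y)"
    using assms(1) unfolding AE_half_leb by (rule AE_lborel_sections)
  then have "AE s in lborel. s \<in> {t/2..t} \<longrightarrow>
      mean_value (ball x t) (\<lambda>y. ennreal (norm (f (s, y)) powr r)) = mean_value (ball x t) (\<lambda>y. ennreal (norm (g (s, y)) powr r))"
  proof (rule AE_mp, intro AE_I2 impI)
    fix s assume s: "AE y in lborel. (s, y) \<in> half_space \<longrightarrow> f (s, y) = g (s, y)" "s \<in> {t/2..t}"
    then have "AE y in lborel. f (s, y) = g (s, y)" using assms(2) by (auto simp: half_space_def)
    then have "AE y in lebesgue. ennreal (norm (f (s, y)) powr r) * indicator (ball x t) y = ennreal (norm (g (s, y)) powr r) * indicator (ball x t) y"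
      unfolding AE_lborel_iff by eventually_elim simp
    then show "mean_value (ball x t) (\<lambda>y. ennreal (norm (f (s, y)) powr r)) = mean_value (ball x t) (\<lambda>y. ennreal (norm (g (s, y)) powr r))"
      unfolding mean_value_def by (simp cong: nn_integral_cong_AE)
  qed
  then have "(\<integral>\<^sup>+s\<in>{t/2..t}. mean_value (ball x t) (\<lambda>y. ennreal (norm (f (s, y)) powr r)) \<partial>lebesgue)
    = (\<integral>\<^sup>+s\<in>{t/2..t}. mean_value (ball x t) (\<lambda>y. ennreal (norm (g (s, y)) powr r)) \<partial>lebesgue)"
    by (intro nn_integral_cong_AE) (auto simp: AE_lborel_iff indicator_def elim!: eventually_mono)
  then show ?thesis unfolding whitney_avg_def by (subst (1 2) mean_value_def) simp
qed

lemma whitney_avg_eq_borel: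
  fixes g :: "real \<times> (real ^ 'n) \<Rightarrow> complex"
  assumes [measurable]: "g \<in> borel_measurable borel" and t: "0 < t"
  shows "whitney_avg r g t x = epowr (box_int r g t x / ennreal (unit_ball_vol CARD('n) / 2 * t ^ (1 + CARD('n)))) (1 / r)"
proof -
  define V where "V = ennreal (unit_ball_vol CARD('n) * t ^ CARD('n))"
  have vol: "emeasure lebesgue (ball x t) = V" "emeasure lebesgue {t/2..t} = ennreal (t / 2)"
    using t emeasure_ball[of t x] by (auto simp: V_def)
  have mb: "(\<lambda>z. ennreal (norm (g z) powr r)) \<in> borel_measurable borel" by measurable
  have mb2: "(\<lambda>z. ennreal (norm (g z) powr r) * indicator ({t / 2..t} \<times> ball x t) z) \<in> borel_measurable (lborel \<Otimes>\<^sub>M lborel)"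
  proof -
    have [measurable]: "{t / 2..t} \<times> ball x t \<in> sets borel" 
      by (intro borel_Times) auto
    show ?thesis using mb by (simp add: lborel_prod)
  qed
  have inner: "mean_value (ball x t) (\<lambda>y. ennreal (norm (g (s, y)) powr r)) * indicator {t/2..t} s
     = (\<integral>\<^sup>+y. ennreal (norm (g (s, y)) powr r) * indicator ({t / 2..t} \<times> ball x t) (s, y) \<partial>lborel) * inverse V" for s
    unfolding mean_value_def vol nn_integral_completion divide_ennreal_def
    by (auto simp: indicator_def)
  have "(\<integral>\<^sup>+s\<in>{t/2..t}. mean_value (ball x t) (\<lambda>y. ennreal (norm (g (s, y)) powr r)) \<partial>lebesgue)
     = (\<integral>\<^sup>+s. (\<integral>\<^sup>+y. ennreal (norm (g (s, y)) powr r) * indicator ({t / 2..t} \<times> ball x t) (s, y) \<partial>lborel) \<partial>lborel) * inverse V"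
    unfolding nn_integral_completion inner
    by (rule nn_integral_multc) (rule lborel.borel_measurable_nn_integral, use mb2 in simp)
  also have "(\<integral>\<^sup>+s. (\<integral>\<^sup>+y. ennreal (norm (g (s, y)) powr r) * indicator ({t / 2..t} \<times> ball x t) (s, y) \<partial>lborel) \<partial>lborel) = box_int r g t x"
    unfolding box_int_def lborel_prod[symmetric] by (rule lborel.nn_integral_fst[OF mb2])
  finally have "mean_value {t/2..t} (\<lambda>s. mean_value (ball x t) (\<lambda>y. ennreal (norm (g (s, y)) powr r)))
     = box_int r g t x * (inverse V * inverse (ennreal (t / 2)))"
    unfolding mean_value_def[of "{t/2..t}"] vol divide_ennreal_def by (simp add: mult.assoc)
  also have "inverse V * inverse (ennreal (t / 2)) = inverse (ennreal (unit_ball_vol CARD('n) / 2 * t ^ (1 + CARD('n))))"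
    unfolding V_def using t by (simp add: inverse_ennreal unit_ball_vol_pos flip: ennreal_mult) (simp add: field_simps)
  finally show ?thesis by (simp add: whitney_avg_def divide_ennreal_def)
qed

lemma box_int_cong:
  assumes "AE z in half_leb. f z = g z" "0 < t"
  shows "box_int r f t x = box_int r g t x"
  unfolding box_int_def
proof (rule nn_integral_cong_AE)
  show "AE z in lborel. ennreal (norm (f z) powr r) * indicator ({t / 2..t} \<times> ball x t) z
      = ennreal (norm (g z) powr r) * indicator ({t / 2..t} \<times> ball x t) z"
    using assms(1) unfolding AE_half_leb
    by eventually_elim (use assms(2) in \<open>auto simp: indicator_def half_space_def\<close>)
qed

lemma whitney_avg_eq:
  fixes f :: "real \<times> (real ^ 'n) \<Rightarrow> complex"
  assumes "f \<in> borel_measurable half_leb" "0 < t"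
  shows "whitney_avg r f t x = epowr (box_int r f t x / ennreal (unit_ball_vol CARD('n) / 2 * t ^ (1 + CARD('n)))) (1 / r)"
proof -
  obtain g where "g \<in> borel_measurable borel" "AE z in half_leb. f z = g z" using borel_representative[OF assms(1)] .
  then show ?thesis
    using whitney_avg_eq_borel[of g t r x] whitney_avg_cong[of f g t r x] box_int_cong[of f g t r x] assms(2) by simp
qed

text \<open>The moving box is rewritten as inequalities in the parameter and the integration
  variable jointly, so that measurability in (t, x) comes from Tonelli.\<close>

lemma weighted_avg_measurable:
  fixes f :: "real \<times> (real ^ 'n) \<Rightarrow> complex"
  assumes "f \<in> borel_measurable half_leb"
  obtains w :: "real \<times> (real ^ 'n) \<Rightarrow> ennreal" where "w \<in> borel_measurable borel" "\<And>t x. 0 < t \<Longrightarrow> weighted_avg r \<beta> f t x = w (t, x)"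
proof -
  obtain g where g [measurable]: "g \<in> borel_measurable borel" and fg: "AE z in half_leb. f z = g z" using borel_representative[OF assms] .
  define W where "W p = (\<integral>\<^sup>+z. ennreal (norm (g z) powr r) * indicator {z. fst p / 2 \<le> fst z \<and> fst z \<le> fst p \<and> dist (snd p) (snd z) < fst p} z \<partial>lborel)"
    for p :: "real \<times> (real ^ 'n)"
  have [measurable]: "W \<in> borel_measurable borel"
  proof -
    have "(\<lambda>p. \<integral>\<^sup>+z. ennreal (norm (g z) powr r) * (if fst p / 2 \<le> fst z \<and> fst z \<le> fst p \<and> dist (snd p) (snd z) < fst p then 1 else 0) \<partial>lborel) \<in> borel_measurable borel"
    proof (rule lborel.borel_measurable_nn_integral)
      show "(\<lambda>(p :: real \<times> (real^'n), z). ennreal (norm (g z) powr r) * (if fst p / 2 \<le> fst z \<and> fst z \<le> fst p \<and> dist (snd p) (snd z) < fst p then 1 else 0)) \<in> borel_measurable (borel \<Otimes>\<^sub>M lborel)"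
        unfolding case_prod_beta by measurable
    qed
    then show ?thesis unfolding W_def[abs_def] by (simp add: indicator_def of_bool_def)
  qed
  have "weighted_avg r \<beta> f t x = ennreal (fst (t, x) powr (- \<beta>)) * epowr (W (t, x) / ennreal (unit_ball_vol CARD('n) / 2 * fst (t, x) ^ (1 + CARD('n)))) (1 / r)" if "0 < t" for t x
  proof -
    have "W (t, x) = box_int r g t x"
      unfolding W_def box_int_def by (intro nn_integral_cong) (auto simp: indicator_def)
    then show ?thesis
      using whitney_avg_eq_borel[OF g that] whitney_avg_cong[OF fg that] by (simp add: weighted_avg_def)
  qed
  moreover have "(\<lambda>p. ennreal (fst p powr (- \<beta>)) * epowr (W p / ennreal (unit_ball_vol CARD('n) / 2 * fst p ^ (1 + CARD('n)))) (1 / r)) \<in> borel_measurable borel"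
    by measurable
  ultimately show thesis using that by blast
qed

lemma tent_norm_cong:
  fixes f g :: "real \<times> (real ^ 'n) \<Rightarrow> complex"
  assumes "\<And>t x. 0 < t \<Longrightarrow> whitney_avg r f t x = whitney_avg r g t x"
  shows "tent_norm p q r \<beta> f = tent_norm p q r \<beta> g"
proof -
  have w: "weighted_avg r \<beta> f t x = weighted_avg r \<beta> g t x" if "0 < t" for t x
    using assms[OF that] by (simp add: weighted_avg_def)
  have 1: "(\<integral>\<^sup>+t\<in>{0<..}. epowr (weighted_avg r \<beta> f t x) Q \<partial>lebesgue) = (\<integral>\<^sup>+t\<in>{0<..}. epowr (weighted_avg r \<beta> g t x) Q \<partial>lebesgue)" for x Q
    by (intro nn_integral_cong) (auto simp: indicator_def w)
  have 2: "(\<integral>\<^sup>+t\<in>{0<..<\<tau>}. mean_value (ball y \<tau>) (\<lambda>x. epowr (weighted_avg r \<beta> f t x) Q) \<partial>lebesgue)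
     = (\<integral>\<^sup>+t\<in>{0<..<\<tau>}. mean_value (ball y \<tau>) (\<lambda>x. epowr (weighted_avg r \<beta> g t x) Q) \<partial>lebesgue)" for y Q \<tau>
    by (intro nn_integral_cong) (auto simp: indicator_def w)
  \<comment> \<open>\<open>esssup\<close> distinguishes measurable from non-measurable functions, so
    measurability is transferred along with the values.\<close>
  have ess: "esssup M u = esssup M v" if "\<And>x. x \<in> space M \<Longrightarrow> u x = v x" for M :: "'z measure" and u v :: "'z \<Rightarrow> ennreal"
  proof -
    have "u \<in> borel_measurable M \<longleftrightarrow> v \<in> borel_measurable M" using that by (rule measurable_cong)
    moreover have "Limsup (ae_filter M) u = Limsup (ae_filter M) v"
      using that by (intro Limsup_eq AE_I2)
    ultimately show ?thesis by (simp add: esssup_def)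
  qed
  have 3: "esssup (lebesgue_on {0<..}) (\<lambda>t. weighted_avg r \<beta> f t x) = esssup (lebesgue_on {0<..}) (\<lambda>t. weighted_avg r \<beta> g t x)" for x
    by (rule ess) (simp add: w space_restrict_space)
  have 4: "esssup half_leb (\<lambda>(t, x). weighted_avg r \<beta> f t x) = esssup half_leb (\<lambda>(t, x). weighted_avg r \<beta> g t x)"
    by (rule ess) (auto simp add: w space_restrict_space half_space_def)
  show ?thesis unfolding tent_norm_def 1 2 3 4 ..
qed

lemma tent_norm_cong_AE:
  assumes "AE z in half_leb. f z = g z"
  shows "tent_norm p q r \<beta> f = tent_norm p q r \<beta> g"
  by (rule tent_norm_cong) (rule whitney_avg_cong[OF assms])


section \<open>Discretisation of tent norms\<close>

definition slice :: "nat \<Rightarrow> int \<Rightarrow> real set" where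
  "slice d k = {tau d (k - 1)<..tau d k}"

lemma slice_unique: "t \<in> slice d k \<Longrightarrow> t \<in> slice d j \<Longrightarrow> k = j"
  using tau_mono[of k "j - 1" d] tau_mono[of j "k - 1" d] by (auto simp: slice_def) (smt (verit))

lemma slice_pos: "t \<in> slice d k \<Longrightarrow> 0 < t"
  using tau_pos[of d "k - 1"] by (auto simp: slice_def simp del: tau_pos)

lemma ex_slice:
  assumes "0 < t"
  obtains k where "t \<in> slice d k"
proof
  define u where "u = log 3 t"
  define k where "k = \<lceil>2 * (u - real d)\<rceil>"
  have t: "t = 3 powr u" using assms by (simp add: u_def)
  have "real_of_int k \<ge> 2 * (u - real d)" "real_of_int k < 2 * (u - real d) + 1"
    unfolding k_def by linarith+
  then have "(real_of_int k - 1) / 2 + real d < u" "u \<le> real_of_int k / 2 + real d"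
    by (auto simp: field_simps)
  then show "t \<in> slice d k" unfolding t slice_def tau_def by auto
qed

lemma tau_pred: "tau d (k - 1) = tau d k / sqrt 3"
proof -
  have "(3 :: real) powr (- (1 / 2)) = 1 / sqrt 3"
    by (simp only: powr_minus powr_half_sqrt[OF zero_le_numeral] inverse_eq_divide)
  then show ?thesis using tau_add[of d k "-1"] by simp
qed

lemma csum_disjoint_le:
  assumes "\<And>k j. P k \<Longrightarrow> P j \<Longrightarrow> k = j" "\<And>k. P k \<Longrightarrow> a k \<le> b"
  shows "csum (\<lambda>k. if P k then a k else 0) \<le> b"
proof (cases "\<exists>k. P k")
  case True
  then obtain k0 where k0: "P k0" by blast
  then have "csum (\<lambda>k. if P k then a k else 0) \<le> csum (\<lambda>k. a k0 * indicator {k0} k)"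
    using assms(1) by (intro nn_integral_mono) (auto simp: indicator_def)
  also have "\<dots> = a k0" by (simp add: nn_integral_cmult)
  finally show ?thesis using assms(2)[OF k0] by simp
qed simp

text \<open>For these times t the window [t/2, t] contains the whole slice k. Since sqrt 3 < 2 the
  interval has length comparable with \<open>tau d k\<close>; it lies in the next slice, so
  different k give disjoint intervals.\<close>

definition whit :: "nat \<Rightarrow> int \<Rightarrow> real set" where
  "whit d k = {tau d k<..2 * tau d (k - 1)}"

lemma sqrt3: "sqrt 3 < (2 :: real)" "1 < sqrt (3 :: real)" "sqrt 3 * sqrt 3 = (3 :: real)"
  by (auto intro: real_less_lsqrt)

lemma whit_slice: "whit d k \<subseteq> slice d (k + 1)"
proof -
  have "2 * tau d (k - 1) \<le> tau d (k + 1)"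
  proof -
    have "k - 1 + 2 = k + 1" by simp
    from tau_add[of d "k - 1" 2, unfolded this] show ?thesis using tau_pos[of d "k - 1"] by simp
  qed
  then show ?thesis by (auto simp: whit_def slice_def)
qed

lemma emeasure_whit: "emeasure lborel (whit d k) = ennreal ((2 / sqrt 3 - 1) * tau d k)"
  using sqrt3 tau_pos[of d k] by (simp add: whit_def tau_pred field_simps)

lemma emeasure_slice_le: "emeasure lborel (slice d k) \<le> ennreal (tau d k)"
  using tau_mono[of "k - 1" k d] tau_pos[of d "k - 1"]
  by (auto simp: slice_def intro!: ennreal_leI simp del: tau_pos)

text \<open>Positive length of the interval turns a bound for almost every t, such as the one by an
  essential supremum, into a bound at an actual time of the right scale.\<close>

lemma ex_whit:
  assumes "AE t in lborel. 0 < t \<longrightarrow> P t"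
  obtains t where "t \<in> whit d k" "P t"
proof -
  have "\<exists>t\<in>whit d k. P t"
  proof (rule ccontr)
    assume no: "\<not> ?thesis"
  have "AE t in lborel. t \<notin> whit d k"
    using assms
  proof (rule AE_mp, intro AE_I2 impI notI)
    fix t assume "0 < t \<longrightarrow> P t" "t \<in> whit d k"
    then show False using no tau_pos[of d k] by (auto simp: whit_def simp del: tau_pos)
  qed
  then have "emeasure lborel (whit d k) = 0"
    by (subst (asm) AE_iff_measurable[of "whit d k"]) (auto simp: whit_def)
  moreover have "0 < (2 / sqrt 3 - 1) * tau d k" using sqrt3 by (intro mult_pos_pos) auto
  ultimately show False unfolding emeasure_whit by (simp add: ennreal_eq_0_iff)
  qed
  then show thesis using that by blast
qed

lemma ennreal_mult_inverse_cancel: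
  fixes a u :: ennreal
  assumes "a \<noteq> 0" "a \<noteq> top"
  shows "a * (inverse a * u) = u" "inverse a * (a * u) = u"
proof -
  have "a * inverse a = 1"
    using assms by (simp add: divide_ennreal_def[symmetric] ennreal_divide_self less_top)
  moreover have "a * (inverse a * u) = (a * inverse a) * u" "inverse a * (a * u) = (a * inverse a) * u"
    by (simp_all only: mult_ac)
  ultimately show "a * (inverse a * u) = u" "inverse a * (a * u) = u" by simp_all
qed

text \<open>Valid for arbitrary h: division by a maps simple functions below a h to simple functions
  below h. The inner integrals of the tent norm are pulled through constants in this way, without a
  discussion of their measurability.\<close>

lemma nn_integral_cmult_le:
  fixes h :: "'a \<Rightarrow> ennreal"
  assumes a: "a \<noteq> 0" "a \<noteq> top"
  shows "(\<integral>\<^sup>+x. a * h x \<partial>M) \<le> a * (\<integral>\<^sup>+x. h x \<partial>M)"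
  unfolding nn_integral_def[of M "\<lambda>x. a * h x"]
proof (rule SUP_least, clarify)
  fix g assume g: "simple_function M g" "g \<le> (\<lambda>x. a * h x)"
  note inv = ennreal_mult_inverse_cancel[OF a]
  have [measurable]: "g \<in> borel_measurable M" using g(1) by (rule borel_measurable_simple_function)
  have "integral\<^sup>S M g = (\<integral>\<^sup>+x. a * (inverse a * g x) \<partial>M)"
    using g(1) by (simp add: nn_integral_eq_simple_integral inv)
  also have "\<dots> = a * (\<integral>\<^sup>+x. inverse a * g x \<partial>M)" by (rule nn_integral_cmult) measurable
  also have "\<dots> \<le> a * (\<integral>\<^sup>+x. h x \<partial>M)"
  proof (intro mult_left_mono nn_integral_mono)
    fix x
    have "inverse a * g x \<le> inverse a * (a * h x)" using g(2) by (intro mult_left_mono) (auto simp: le_fun_def)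
    then show "inverse a * g x \<le> h x" by (simp only: inv)
  qed simp
  finally show "integral\<^sup>S M g \<le> a * (\<integral>\<^sup>+x. h x \<partial>M)" .
qed

lemma sqrt3_powr: "sqrt 3 powr b = 3 powr (b / 2)"
proof -
  have "sqrt 3 = (3 :: real) powr (1 / 2)" by (rule powr_half_sqrt[symmetric]) simp
  then show ?thesis by (simp only: powr_powr) simp
qed

lemma powr_near:
  fixes t u b :: real
  assumes "0 < t" "0 < u" "t \<le> sqrt 3 * u" "u \<le> sqrt 3 * t"
  shows "t powr b \<le> 3 powr (\<bar>b\<bar> / 2) * u powr b"
proof (cases "0 \<le> b")
  case True
  then have "t powr b \<le> (sqrt 3 * u) powr b" using assms by (intro powr_mono2) auto
  also have "\<dots> = 3 powr (b / 2) * u powr b" using assms by (simp add: powr_mult sqrt3_powr)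
  finally show ?thesis using True by simp
next
  case False
  then have "t powr b \<le> (u / sqrt 3) powr b" using assms by (intro powr_mono2') (auto simp: pos_divide_le_eq mult.commute)
  also have "\<dots> = 3 powr (- b / 2) * u powr b"
  proof -
    have "(u / sqrt 3) powr b = u powr b / 3 powr (b / 2)"
      using assms by (subst powr_divide) (auto simp: sqrt3_powr)
    moreover have "- b / 2 = - (b / 2)" by simp
    then have "(3 :: real) powr (- b / 2) = inverse (3 powr (b / 2))" by (simp only: powr_minus)
    ultimately show ?thesis by (simp only: divide_inverse mult.commute)
  qed
  finally show ?thesis using False by simp
qed

lemma rcp_simps: "0 < Q \<Longrightarrow> rcp (ennreal Q) = 1 / Q" "rcp top = 0"
  by (simp_all add: rcp_def inverse_ennreal divide_inverse)

section \<open>The shapes of the tent norm for the four ranges of exponents\<close>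

lemma tent_fin_fin:
  assumes "0 < P" "0 < Q"
  shows "tent_norm (ennreal P) (ennreal Q) r \<beta> f
    = epowr (\<integral>\<^sup>+x. epowr (\<integral>\<^sup>+t\<in>{0<..}. epowr (weighted_avg r \<beta> f t x) Q \<partial>lborel) (P / Q) \<partial>lborel) (1 / P)"
  using assms by (simp add: tent_norm_def nn_integral_completion)

lemma tent_fin_inf:
  assumes "0 < P"
  shows "tent_norm (ennreal P) top r \<beta> f
    = epowr (\<integral>\<^sup>+x. epowr (esssup (lebesgue_on {0<..}) (\<lambda>t. weighted_avg r \<beta> f t x)) P \<partial>lborel) (1 / P)"
  using assms by (simp add: tent_norm_def nn_integral_completion)

definition tcarl :: "real \<Rightarrow> real \<Rightarrow> real \<Rightarrow> (real \<times> (real ^ 'n) \<Rightarrow> complex) \<Rightarrow> real \<Rightarrow> real ^ 'n \<Rightarrow> ennreal" where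
  "tcarl Q r \<beta> f \<tau> y = (\<integral>\<^sup>+t\<in>{0<..<\<tau>}. mean_value (ball y \<tau>) (\<lambda>x. epowr (weighted_avg r \<beta> f t x) Q) \<partial>lborel)"

lemma tent_inf_fin:
  assumes "0 < Q"
  shows "tent_norm top (ennreal Q) r \<beta> f = (SUP (\<tau>, y)\<in>half_space. epowr (tcarl Q r \<beta> f \<tau> y) (1 / Q))"
  using assms by (simp add: tent_norm_def tcarl_def nn_integral_completion cong: if_cong)

lemma tent_inf_inf: "tent_norm top top r \<beta> f = esssup half_leb (\<lambda>(t, x). weighted_avg r \<beta> f t x)"
  by (simp add: tent_norm_def)

lemma AE_pos_reals: "(AE t in lebesgue_on {0<..}. P t) \<longleftrightarrow> (AE t in lborel. 0 < (t :: real) \<longrightarrow> P t)"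
  by (subst AE_restrict_space_iff) (auto simp: AE_lborel_iff)

lemma weighted_avg_measurable_t:
  fixes f :: "real \<times> (real ^ 'n) \<Rightarrow> complex"
  assumes "f \<in> borel_measurable half_leb"
  shows "(\<lambda>t. weighted_avg r \<beta> f t x) \<in> borel_measurable (lebesgue_on {0<..})"
proof -
  obtain w where w [measurable]: "w \<in> borel_measurable borel" and eq: "\<And>t x. 0 < t \<Longrightarrow> weighted_avg r \<beta> f t x = w (t, x)"
    using weighted_avg_measurable[where r=r and \<beta>=\<beta>, OF assms] by blast
  have "(\<lambda>t. (t, x)) \<in> measurable borel borel" by (intro borel_measurable_continuous_onI continuous_intros)
  from measurable_compose[OF this w] have "(\<lambda>t. w (t, x)) \<in> borel_measurable lborel" by simp
  then have "(\<lambda>t. w (t, x)) \<in> borel_measurable (lebesgue_on {0<..})"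
    by (intro measurable_restrict_space1 measurable_completion)
  then show ?thesis by (rule measurable_cong[THEN iffD2, rotated]) (simp add: eq space_restrict_space)
qed

lemma weighted_avg_measurable_pair:
  fixes f :: "real \<times> (real ^ 'n) \<Rightarrow> complex"
  assumes "f \<in> borel_measurable half_leb"
  shows "(\<lambda>(t, x). weighted_avg r \<beta> f t x) \<in> borel_measurable half_leb"
proof -
  obtain w where w [measurable]: "w \<in> borel_measurable borel" and eq: "\<And>t x. 0 < t \<Longrightarrow> weighted_avg r \<beta> f t x = w (t, x)"
    using weighted_avg_measurable[where r=r and \<beta>=\<beta>, OF assms] by blast
  have "w \<in> borel_measurable half_leb"
    by (intro measurable_restrict_space1 measurable_completion) simp
  then show ?thesis by (rule measurable_cong[THEN iffD2, rotated]) (auto simp: eq space_restrict_space half_space_def)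
qed

text \<open>The exponent 1/Q supplies one factor \<open>tau\<close>, the length of a slice up to
  constants, and so represents the measure dt.\<close>

lemma powr_epowr_tau:
  assumes "0 < Q"
  shows "epowr (ennreal (tau d k powr (1 / Q - \<beta>)) * u) Q = ennreal (tau d k) * epowr (ennreal (tau d k powr (- \<beta>)) * u) Q"
proof -
  have "(tau d k powr (1 / Q - \<beta>)) powr Q = tau d k * (tau d k powr (- \<beta>)) powr Q"
  proof -
    have "(1 / Q - \<beta>) * Q = 1 + (- \<beta>) * Q" using assms by (simp add: field_simps)
    then show ?thesis by (simp only: powr_powr powr_add) (simp add: abs_of_pos)
  qed
  then show ?thesis using assms by (simp add: epowr_mult ennreal_mult less_imp_le mult.assoc)
qed

text \<open>Each time lies in exactly one slice, on which t powr - \<beta> is comparable with a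
  power of \<open>tau\<close>. The statement is about an arbitrary majorant R of the Whitney
  averages because the image under the operator is known only through such a bound.\<close>

lemma tent_norm_le_dtn:
  fixes p q :: ennreal and \<beta> r :: real
  assumes pq: "0 < p" "0 < q"
  shows "\<exists>C<top. \<forall>(F :: real \<times> (real ^ 'n) \<Rightarrow> complex) R. F \<in> borel_measurable half_leb \<longrightarrow> (\<forall>k. R k \<in> borel_measurable borel) \<longrightarrow>
    (\<forall>k t x. t \<in> slice CARD('n) k \<longrightarrow> whitney_avg r F t x \<le> R k x) \<longrightarrow>
    tent_norm p q r \<beta> F \<le> C * dtn p q (\<lambda>k x. ennreal (tau CARD('n) k powr (rcp q - \<beta>)) * R k x)"
proof -
  define d where "d = CARD('n)"
  define c where "c = 3 powr (\<bar>\<beta>\<bar> / 2)"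
  have c: "0 < c" by (simp add: c_def)
  define wt :: "(int \<Rightarrow> real ^ 'n \<Rightarrow> ennreal) \<Rightarrow> int \<Rightarrow> real ^ 'n \<Rightarrow> ennreal" where "wt R k x = ennreal (tau d k powr (- \<beta>)) * R k x" for R k x
  have W: "weighted_avg r \<beta> F t x \<le> ennreal c * wt R k x"
    if "whitney_avg r F t x \<le> R k x" "t \<in> slice d k" for F :: "real \<times> (real ^ 'n) \<Rightarrow> complex" and t x R k
  proof -
    have "t powr (- \<beta>) \<le> c * tau d k powr (- \<beta>)"
      using powr_near[of t "tau d k" "- \<beta>"] that(2) slice_pos[OF that(2)] sqrt3 tau_pos[of d k]
      by (auto simp: c_def slice_def tau_pred field_simps simp del: tau_pos) (smt (verit) mult_less_cancel_left1 mult_right_mono)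
    then have "weighted_avg r \<beta> F t x \<le> ennreal (c * tau d k powr (- \<beta>)) * R k x"
      unfolding weighted_avg_def using that by (intro mult_mono ennreal_leI) auto
    then show ?thesis using c by (simp add: wt_def ennreal_mult mult.assoc)
  qed
  have pt: "epowr (weighted_avg r \<beta> F t x) Q * indicator {0<..} t
      \<le> csum (\<lambda>k. ennreal (c powr Q) * (epowr (wt R k x) Q * indicator (slice d k) t))"
    if "0 < Q" and R: "\<And>k t x. t \<in> slice d k \<Longrightarrow> whitney_avg r F t x \<le> R k x" for F :: "real \<times> (real ^ 'n) \<Rightarrow> complex" and R t x Q
  proof (cases "0 < t")
    case True
    obtain k where k: "t \<in> slice d k" using ex_slice[OF True] .
    have "epowr (weighted_avg r \<beta> F t x) Q \<le> epowr (ennreal c * wt R k x) Q"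
      using W[of F t x R k, OF R[OF k] k] k that by (intro epowr_mono) auto
    also have "\<dots> = ennreal (c powr Q) * (epowr (wt R k x) Q * indicator (slice d k) t)"
      using k c that by (simp add: epowr_real_bound less_imp_le)
    also have "\<dots> \<le> csum (\<lambda>k. ennreal (c powr Q) * (epowr (wt R k x) Q * indicator (slice d k) t))"
      by (rule csum_ge[of "\<lambda>k. ennreal (c powr Q) * (epowr (wt R k x) Q * indicator (slice d k) t)"])
    finally show ?thesis using True by simp
  qed simp
  have sb [measurable]: "slice d k \<in> sets borel" for k by (simp add: slice_def)
  from pq(1) show ?thesis
  proof (cases rule: exponent_cases)
    case p: 1
    from pq(2) show ?thesis
    proof (cases rule: exponent_cases)
      case q: 1
      have "tent_norm p q r \<beta> F \<le> ennreal c * dtn p q (\<lambda>k x. ennreal (tau CARD('n) k powr (rcp q - \<beta>)) * R k x)"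
        if F: "F \<in> borel_measurable half_leb" and R: "\<forall>k t x. t \<in> slice CARD('n) k \<longrightarrow> whitney_avg r F t x \<le> R k x" for F :: "real \<times> (real ^ 'n) \<Rightarrow> complex" and R
        unfolding p q tent_inf_inf
      proof (rule esssup_I[OF weighted_avg_measurable_pair[OF F]])
        show "AE z in half_leb. (case z of (t, x) \<Rightarrow> weighted_avg r \<beta> F t x) \<le> ennreal c * dtn top top (\<lambda>k x. ennreal (tau CARD('n) k powr (rcp top - \<beta>)) * R k x)"
          unfolding AE_half_leb
        proof (intro AE_I2 impI, clarify)
          fix t x assume "(t, x) \<in> (half_space :: (real \<times> (real ^ 'n)) set)"
          then have "0 < t" by (simp add: half_space_def)
          then obtain k where k: "t \<in> slice d k" using ex_slice by blast
          have "wt R k x \<le> dtn top top (\<lambda>k x. ennreal (tau CARD('n) k powr (rcp top - \<beta>)) * R k x)"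
            unfolding dtn_inf_inf by (rule SUP_upper2[of k], simp, rule SUP_upper2[of x]) (auto simp: wt_def rcp_simps d_def)
          then show "weighted_avg r \<beta> F t x \<le> ennreal c * dtn top top (\<lambda>k x. ennreal (tau CARD('n) k powr (rcp top - \<beta>)) * R k x)"
            using R k by (intro order_trans[OF W[of F t x R k, OF _ k] mult_left_mono]) (auto simp: d_def)
        qed
      qed
      then show ?thesis by (intro exI[of _ "ennreal c"]) auto
    next
      case q: (2 Q)
      \<comment> \<open>The ball of radius \<tau> is enlarged to one of radius
        \<open>tau d j\<close> \<le> sqrt 3 \<tau>, which accounts for 3^(d/2). The volume of the
        unit ball enters because the discrete Carleson functional is normalised without it.\<close>
      define K where "K = ennreal (c powr Q) * ennreal (3 powr (real d / 2) / unit_ball_vol d)"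
      define C where "C = epowr K (1 / Q)"
      have "tent_norm p q r \<beta> F \<le> C * dtn p q (\<lambda>k x. ennreal (tau CARD('n) k powr (rcp q - \<beta>)) * R k x)"
        if R: "\<forall>k t x. t \<in> slice CARD('n) k \<longrightarrow> whitney_avg r F t x \<le> R k x"
          and [measurable]: "\<And>k. R k \<in> borel_measurable borel" for F :: "real \<times> (real ^ 'n) \<Rightarrow> complex" and R
      proof -
        define X where "X k x = ennreal (tau CARD('n) k powr (rcp q - \<beta>)) * R k x" for k x
        have [measurable]: "wt R k \<in> borel_measurable borel" for k unfolding wt_def[abs_def] by measurable
        have "tcarl Q r \<beta> F \<tau> y \<le> K * epowr (dtn p q X) Q"
          if \<tau>: "0 < \<tau>" for \<tau> and y :: "real ^ 'n"
        proof -
          obtain j where j: "\<tau> \<in> slice d j" using ex_slice[OF \<tau>] .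
          define B :: "real ^ 'n \<Rightarrow> ennreal" where "B = indicator (ball y \<tau>)"
          have [measurable]: "B \<in> borel_measurable borel" unfolding B_def by (rule borel_measurable_indicator) simp
          define V where "V = ennreal (unit_ball_vol d * \<tau> ^ d)"
          have V: "emeasure lebesgue (ball y \<tau>) = V" using \<tau> emeasure_ball[of \<tau> y] by (simp add: V_def d_def)
          define I where "I k = (\<integral>\<^sup>+x. epowr (wt R k x) Q * B x \<partial>lborel)" for k
          have "mean_value (ball y \<tau>) (\<lambda>x. epowr (weighted_avg r \<beta> F t x) Q) * indicator {0<..<\<tau>} t
             \<le> csum (\<lambda>k. (ennreal (c powr Q) * I k / V) * (if k \<le> j then indicator (slice d k) t else 0))" for t
          proof (cases "0 < t \<and> t < \<tau>")
            case True
            then obtain k where k: "t \<in> slice d k" using ex_slice by blast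
            have kj: "k \<le> j"
            proof (rule ccontr)
              assume "\<not> k \<le> j"
              then have "tau d j \<le> tau d (k - 1)" by (intro tau_mono) auto
              then show False using k j True by (auto simp: slice_def)
            qed
            have "mean_value (ball y \<tau>) (\<lambda>x. epowr (weighted_avg r \<beta> F t x) Q)
              \<le> (\<integral>\<^sup>+x. ennreal (c powr Q) * (epowr (wt R k x) Q * B x) \<partial>lborel) / V"
              unfolding mean_value_def V nn_integral_completion
            proof (intro divide_right_mono_ennreal nn_integral_mono)
              fix x
              have "epowr (weighted_avg r \<beta> F t x) Q \<le> epowr (ennreal c * wt R k x) Q"
                using W[of F t x R k, OF _ k] R k q by (intro epowr_mono) (auto simp: d_def)
              also have "\<dots> = ennreal (c powr Q) * epowr (wt R k x) Q" using c q by (simp add: epowr_real_bound less_imp_le)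
              finally show "epowr (weighted_avg r \<beta> F t x) Q * indicator (ball y \<tau>) x \<le> ennreal (c powr Q) * (epowr (wt R k x) Q * B x)"
                by (auto simp: B_def indicator_def)
            qed
            also have "\<dots> = ennreal (c powr Q) * I k / V"
              unfolding I_def by (subst nn_integral_cmult) auto
            also have "\<dots> = (ennreal (c powr Q) * I k / V) * (if k \<le> j then indicator (slice d k) t else 0)"
              using k kj by simp
            also have "\<dots> \<le> csum (\<lambda>k. (ennreal (c powr Q) * I k / V) * (if k \<le> j then indicator (slice d k) t else 0))"
              by (rule csum_ge[of "\<lambda>k. (ennreal (c powr Q) * I k / V) * (if k \<le> j then indicator (slice d k) t else 0)"])
            finally show ?thesis using True by simp
          qed simp
          then have "tcarl Q r \<beta> F \<tau> y \<le> (\<integral>\<^sup>+t. csum (\<lambda>k. (ennreal (c powr Q) * I k / V) * (if k \<le> j then indicator (slice d k) t else 0)) \<partial>lborel)"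
            unfolding tcarl_def by (rule nn_integral_mono)
          also have "\<dots> = csum (\<lambda>k. \<integral>\<^sup>+t. (ennreal (c powr Q) * I k / V) * (if k \<le> j then indicator (slice d k) t else 0) \<partial>lborel)"
            by (rule csum_swap) measurable
          also have "\<dots> \<le> csum (\<lambda>k. ennreal (c powr Q) / V * (if k \<le> j then \<integral>\<^sup>+x. epowr (X k x) Q * indicator (ball y (tau d j)) x \<partial>lborel else 0))"
          proof (rule nn_integral_mono)
            fix k
            show "(\<integral>\<^sup>+t. (ennreal (c powr Q) * I k / V) * (if k \<le> j then indicator (slice d k) t else 0) \<partial>lborel)
              \<le> ennreal (c powr Q) / V * (if k \<le> j then \<integral>\<^sup>+x. epowr (X k x) Q * indicator (ball y (tau d j)) x \<partial>lborel else 0)"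
            proof (cases "k \<le> j")
              case True
              have "(\<integral>\<^sup>+t. (ennreal (c powr Q) * I k / V) * (if k \<le> j then indicator (slice d k) t else 0) \<partial>lborel)
                 = (ennreal (c powr Q) * I k / V) * emeasure lborel (slice d k)"
                using True by (simp add: nn_integral_cmult)
              also have "\<dots> \<le> (ennreal (c powr Q) * I k / V) * ennreal (tau d k)"
                by (intro mult_left_mono emeasure_slice_le) simp
              also have "\<dots> = ennreal (c powr Q) / V * (ennreal (tau d k) * I k)"
                by (simp add: divide_ennreal_def mult_ac)
              also have "ennreal (tau d k) * I k = (\<integral>\<^sup>+x. epowr (X k x) Q * B x \<partial>lborel)"
                unfolding I_def X_def q using q powr_epowr_tau[OF q(2)]
                by (subst nn_integral_cmult[symmetric]) (auto simp: rcp_simps wt_def d_def mult.assoc)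
              also have "\<dots> \<le> (\<integral>\<^sup>+x. epowr (X k x) Q * indicator (ball y (tau d j)) x \<partial>lborel)"
                using j by (intro nn_integral_mono mult_left_mono) (auto simp: B_def slice_def indicator_def)
              finally show ?thesis using True by (simp add: mult_left_mono)
            qed simp
          qed
          also have "\<dots> = ennreal (c powr Q) / V * (\<integral>\<^sup>+x. csum (\<lambda>k. if k \<le> j then epowr (X k x) Q else 0) * indicator (ball y (tau d j)) x \<partial>lborel)"
          proof -
            have [measurable]: "ball y (tau d j) \<in> sets borel" "X k \<in> borel_measurable borel" for k unfolding X_def[abs_def] by (simp, measurable)
            have "csum (\<lambda>k. if k \<le> j then \<integral>\<^sup>+x. epowr (X k x) Q * indicator (ball y (tau d j)) x \<partial>lborel else 0)
              = csum (\<lambda>k. \<integral>\<^sup>+x. (if k \<le> j then epowr (X k x) Q else 0) * indicator (ball y (tau d j)) x \<partial>lborel)"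
              by (intro nn_integral_cong) simp
            also have "\<dots> = (\<integral>\<^sup>+x. csum (\<lambda>k. (if k \<le> j then epowr (X k x) Q else 0) * indicator (ball y (tau d j)) x) \<partial>lborel)"
              by (rule csum_swap[symmetric]) measurable
            finally show ?thesis by (simp only: csum_multc csum_cmult)
          qed
          also have "\<dots> = ennreal (c powr Q) * (ennreal (tau d j ^ d) / V) * carl Q X j y"
          proof -
            have "0 < tau d j ^ d" by simp
            then have "ennreal (tau d j ^ d) * inverse (ennreal (tau d j ^ d)) = 1"
              by (subst inverse_ennreal) (auto simp flip: ennreal_mult simp: less_imp_le)
            moreover have arr: "u * (T * v) * (w * T') = (u * v * w) * (T * T')" for u T v w T' :: ennreal
              by (simp only: mult_ac)
            ultimately show ?thesis unfolding carl_def d_def[symmetric] divide_ennreal_def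
              by (simp only: arr mult_1_right)
          qed
          also have "\<dots> \<le> ennreal (c powr Q) * ennreal (3 powr (real d / 2) / unit_ball_vol d) * epowr (dtn p q X) Q"
          proof (intro mult_mono)
            have "tau d j \<le> sqrt 3 * \<tau>" using j sqrt3 by (auto simp: slice_def tau_pred field_simps)
            then have "tau d j ^ d \<le> (sqrt 3 * \<tau>) ^ d" by (intro power_mono) (auto simp: less_imp_le)
            also have "\<dots> = 3 powr (real d / 2) * \<tau> ^ d"
              by (simp only: power_mult_distrib powr_realpow[symmetric] real_sqrt_gt_zero zero_less_numeral sqrt3_powr)
            finally have "tau d j ^ d / (unit_ball_vol d * \<tau> ^ d) \<le> 3 powr (real d / 2) / unit_ball_vol d"
              using \<tau> by (simp add: field_simps unit_ball_vol_pos)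
            then show "ennreal (tau d j ^ d) / V \<le> ennreal (3 powr (real d / 2) / unit_ball_vol d)"
              unfolding V_def using \<tau> by (subst divide_ennreal) (auto simp: unit_ball_vol_pos less_imp_le)
            show "carl Q X j y \<le> epowr (dtn p q X) Q" unfolding p q by (rule carl_le_dtn[OF q(2)])
          qed auto
          finally show ?thesis unfolding K_def .
        qed
        then show ?thesis
          unfolding X_def[symmetric] unfolding p q tent_inf_fin[OF q(2)] C_def
          using q by (auto intro!: SUP_least simp: half_space_def epowr_le_swap epowr_mult p)
      qed
      moreover have "C < top" by (simp add: C_def K_def ennreal_mult_less_top)
      ultimately show ?thesis by blast
    qed
  next
    case p: (2 P)
    from pq(2) show ?thesis
    proof (cases rule: exponent_cases)
      case q: 1
      have "tent_norm p q r \<beta> F \<le> ennreal c * dtn p q (\<lambda>k x. ennreal (tau CARD('n) k powr (rcp q - \<beta>)) * R k x)"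
        if F: "F \<in> borel_measurable half_leb" and R: "\<forall>k t x. t \<in> slice CARD('n) k \<longrightarrow> whitney_avg r F t x \<le> R k x"
          and [measurable]: "\<And>k. R k \<in> borel_measurable borel" for F :: "real \<times> (real ^ 'n) \<Rightarrow> complex" and R
      proof -
        have "esssup (lebesgue_on {0<..}) (\<lambda>t. weighted_avg r \<beta> F t x) \<le> ennreal c * (SUP k. wt R k x)" for x
        proof (rule esssup_I[OF weighted_avg_measurable_t[OF F]])
          show "AE t in lebesgue_on {0<..}. weighted_avg r \<beta> F t x \<le> ennreal c * (SUP k. wt R k x)"
            unfolding AE_pos_reals
          proof (intro AE_I2 impI)
            fix t :: real assume "0 < t"
            then obtain k where k: "t \<in> slice d k" using ex_slice by blast
            have "wt R k x \<le> (SUP k. wt R k x)" by (rule SUP_upper) simp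
            then show "weighted_avg r \<beta> F t x \<le> ennreal c * (SUP k. wt R k x)"
              using R k by (intro order_trans[OF W[of F t x R k, OF _ k] mult_left_mono]) (auto simp: d_def)
          qed
        qed
        then have "tent_norm p q r \<beta> F \<le> epowr (\<integral>\<^sup>+x. epowr (ennreal c * (SUP k. wt R k x)) P \<partial>lborel) (1 / P)"
          unfolding p q tent_fin_inf[OF p(2)] using p by (intro epowr_mono nn_integral_mono) auto
        also have "\<dots> = dtn p q (\<lambda>k x. ennreal c * wt R k x)"
          unfolding p q dtn_fin_inf[OF p(2)] by (simp add: SUP_mult_left_ennreal)
        also have "\<dots> = ennreal c * dtn p q (wt R)"
          by (rule dtn_cmult) (use pq in \<open>auto simp: wt_def\<close>)
        finally show ?thesis by (simp add: wt_def[abs_def] q rcp_simps d_def)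
      qed
      then show ?thesis by (intro exI[of _ "ennreal c"]) auto
    next
      case q: (2 Q)
      have "tent_norm p q r \<beta> F \<le> ennreal c * dtn p q (\<lambda>k x. ennreal (tau CARD('n) k powr (rcp q - \<beta>)) * R k x)"
        if R: "\<forall>k t x. t \<in> slice CARD('n) k \<longrightarrow> whitney_avg r F t x \<le> R k x"
          and [measurable]: "\<And>k. R k \<in> borel_measurable borel" for F :: "real \<times> (real ^ 'n) \<Rightarrow> complex" and R
      proof -
        define X where "X k x = ennreal (tau CARD('n) k powr (rcp q - \<beta>)) * R k x" for k x
        have "(\<integral>\<^sup>+t\<in>{0<..}. epowr (weighted_avg r \<beta> F t x) Q \<partial>lborel) \<le> csum (\<lambda>k. epowr (ennreal c * X k x) Q)" for x
        proof -
          have "(\<integral>\<^sup>+t\<in>{0<..}. epowr (weighted_avg r \<beta> F t x) Q \<partial>lborel)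
            \<le> (\<integral>\<^sup>+t. csum (\<lambda>k. ennreal (c powr Q) * (epowr (wt R k x) Q * indicator (slice d k) t)) \<partial>lborel)"
            using R q by (intro nn_integral_mono pt) (auto simp: d_def)
          also have "\<dots> = csum (\<lambda>k. \<integral>\<^sup>+t. ennreal (c powr Q) * (epowr (wt R k x) Q * indicator (slice d k) t) \<partial>lborel)"
            by (rule csum_swap) measurable
          also have "\<dots> = csum (\<lambda>k. ennreal (c powr Q) * (epowr (wt R k x) Q * emeasure lborel (slice d k)))"
            by (simp add: nn_integral_cmult)
          also have "\<dots> \<le> csum (\<lambda>k. ennreal (c powr Q) * (epowr (wt R k x) Q * ennreal (tau d k)))"
            by (intro nn_integral_mono mult_left_mono emeasure_slice_le) auto
          also have "\<dots> = csum (\<lambda>k. epowr (ennreal c * X k x) Q)"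
            using q c powr_epowr_tau[OF q(2), of d _ \<beta>]
            by (simp add: X_def wt_def rcp_simps epowr_real_bound less_imp_le d_def[symmetric] mult.commute)
          finally show ?thesis .
        qed
        then have "tent_norm p q r \<beta> F \<le> epowr (\<integral>\<^sup>+x. epowr (csum (\<lambda>k. epowr (ennreal c * X k x) Q)) (P / Q) \<partial>lborel) (1 / P)"
          unfolding p q tent_fin_fin[OF p(2) q(2)] using p q by (intro epowr_mono nn_integral_mono) auto
        also have "\<dots> = dtn p q (\<lambda>k x. ennreal c * X k x)"
          unfolding p q dtn_fin_fin[OF p(2) q(2)] ..
        also have "\<dots> = ennreal c * dtn p q X"
          by (rule dtn_cmult) (use pq in \<open>auto simp: X_def\<close>)
        finally show ?thesis by (simp add: X_def[abs_def])
      qed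
      then show ?thesis by (intro exI[of _ "ennreal c"]) auto
    qed
  qed
qed

text \<open>Restricting the times of a scale to \<open>whit\<close> loses only the fixed proportion
  \<kappa> = 2 / sqrt 3 - 1. That G is constant on cubes is needed for p = q = top, where the
  essential supremum controls the averages at almost every x only.\<close>

lemma dtn_le_tent_norm:
  fixes p q :: ennreal and \<beta> r :: real
  assumes pq: "0 < p" "0 < q"
  shows "\<exists>C<top. \<forall>(F :: real \<times> (real ^ 'n) \<Rightarrow> complex) G a. F \<in> borel_measurable half_leb \<longrightarrow>
    (\<forall>k. G k \<in> borel_measurable borel) \<longrightarrow> (\<forall>k. level a k (G k)) \<longrightarrow>
    (\<forall>k t x. t \<in> whit CARD('n) k \<longrightarrow> G k x \<le> whitney_avg r F t x) \<longrightarrow>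
    dtn p q (\<lambda>k x. ennreal (tau CARD('n) k powr (rcp q - \<beta>)) * G k x) \<le> C * tent_norm p q r \<beta> F"
proof -
  define d where "d = CARD('n)"
  define c where "c = 3 powr (\<bar>\<beta>\<bar> / 2)"
  define \<kappa> where "\<kappa> = 2 / sqrt 3 - (1::real)"
  have c: "0 < c" by (simp add: c_def)
  have \<kappa>: "0 < \<kappa>" using sqrt3 by (simp add: \<kappa>_def)
  define wt :: "(int \<Rightarrow> real ^ 'n \<Rightarrow> ennreal) \<Rightarrow> int \<Rightarrow> real ^ 'n \<Rightarrow> ennreal" where "wt R k x = ennreal (tau d k powr (- \<beta>)) * R k x" for R k x
  have W: "wt G k x \<le> ennreal c * weighted_avg r \<beta> F t x"
    if "G k x \<le> whitney_avg r F t x" "t \<in> whit d k" for F :: "real \<times> (real ^ 'n) \<Rightarrow> complex" and t x G k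
  proof -
    have t: "0 < t" "t \<le> sqrt 3 * tau d k" "tau d k \<le> sqrt 3 * t"
    proof -
      have "tau d (k + 1) = sqrt 3 * tau d k" by (simp add: tau_add powr_half_sqrt)
      then show "t \<le> sqrt 3 * tau d k" using whit_slice[of d k] that(2) by (auto simp: slice_def)
      show pos: "0 < t" using that(2) tau_pos[of d k] by (auto simp: whit_def simp del: tau_pos)
      have "1 * t \<le> sqrt 3 * t" using pos sqrt3 by (intro mult_right_mono) auto
      then show "tau d k \<le> sqrt 3 * t" using that(2) by (auto simp: whit_def)
    qed
    have "tau d k powr (- \<beta>) \<le> c * t powr (- \<beta>)"
      using powr_near[of "tau d k" t "- \<beta>"] t by (simp add: c_def)
    then have "wt G k x \<le> ennreal (c * t powr (- \<beta>)) * whitney_avg r F t x"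
      unfolding wt_def using that by (intro mult_mono ennreal_leI) auto
    then show ?thesis using c by (simp add: weighted_avg_def ennreal_mult mult.assoc)
  qed
  have wb [measurable]: "whit d k \<in> sets borel" for k by (simp add: whit_def)
  have tau_whit: "ennreal (tau d k) = ennreal (1 / \<kappa>) * emeasure lborel (whit d k)" for k
    unfolding emeasure_whit \<kappa>_def[symmetric] using \<kappa> by (subst ennreal_mult[symmetric]) (auto simp: less_imp_le)
  have whit_unique: "k = j" if "t \<in> whit d k" "t \<in> whit d j" for t k j
    using slice_unique[of t d "k + 1" "j + 1"] that whit_slice[of d k] whit_slice[of d j] by auto
  from pq(1) show ?thesis
  proof (cases rule: exponent_cases)
    case p: 1
    from pq(2) show ?thesis
    proof (cases rule: exponent_cases)
      case q: 1
      have "dtn p q (\<lambda>k x. ennreal (tau CARD('n) k powr (rcp q - \<beta>)) * G k x) \<le> ennreal c * tent_norm p q r \<beta> F"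
        if F: "F \<in> borel_measurable half_leb" and G: "\<forall>k t x. t \<in> whit CARD('n) k \<longrightarrow> G k x \<le> whitney_avg r F t x"
          and lev: "\<forall>k. level a k (G k)" for F :: "real \<times> (real ^ 'n) \<Rightarrow> complex" and G a
      proof -
        define E where "E = esssup half_leb (\<lambda>(t, x). weighted_avg r \<beta> F t x)"
        have "AE z in half_leb. (case z of (t, x) \<Rightarrow> weighted_avg r \<beta> F t x) \<le> E"
          unfolding E_def by (rule esssup_AE)
        then have AE: "AE t in lborel. AE x in lborel. (t, x) \<in> half_space \<longrightarrow> weighted_avg r \<beta> F t x \<le> E"
          unfolding AE_half_leb by (rule AE_lborel_sections[THEN eventually_mono]) (auto elim: eventually_mono)
        have "wt G k x \<le> ennreal c * E" for k x
        proof -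
          have AE1: "AE t in lborel. 0 < t \<longrightarrow> (AE x in lborel. weighted_avg r \<beta> F t x \<le> E)"
            using AE by (rule eventually_mono) (auto simp: half_space_def)
          obtain t where t: "t \<in> whit d k" "AE x in lborel. weighted_avg r \<beta> F t x \<le> E" by (rule ex_whit[OF AE1])
          \<comment> \<open>The cube has positive measure, so the bound that holds almost everywhere
            is attained at some point y of it, where G has the same value as at x.\<close>
          have "\<exists>y\<in>cube a k x. weighted_avg r \<beta> F t y \<le> E"
          proof (rule ccontr)
            assume no: "\<not> ?thesis"
            have "AE y in lborel. y \<notin> cube a k x" using t(2) by (rule eventually_mono) (use no in auto)
            then have "emeasure lborel (cube a k x) = 0"
              by (subst (asm) AE_iff_measurable[of "cube a k x"]) auto
            then show False by (simp add: emeasure_cube)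
          qed
          then obtain y where y: "y \<in> cube a k x" "weighted_avg r \<beta> F t y \<le> E" by blast
          have "wt G k x = wt G k y" using levelD[OF lev[rule_format] y(1)] by (simp add: wt_def)
          also have "\<dots> \<le> ennreal c * weighted_avg r \<beta> F t y" using W[of G k y F t, OF _ t(1)] G t by (simp add: d_def)
          also have "\<dots> \<le> ennreal c * E" by (intro mult_left_mono y) simp
          finally show ?thesis .
        qed
        then show ?thesis
          unfolding p q tent_inf_inf dtn_inf_inf E_def[symmetric] by (auto intro!: SUP_least simp: wt_def rcp_simps d_def)
      qed
      then show ?thesis by (intro exI[of _ "ennreal c"]) auto
    next
      case q: (2 Q)
      define K where "K = ennreal (1 / \<kappa>) * (ennreal (c powr Q) * ennreal (unit_ball_vol d * 3 ^ d))"
      define C where "C = epowr K (1 / Q)"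
      have "dtn p q (\<lambda>k x. ennreal (tau CARD('n) k powr (rcp q - \<beta>)) * G k x) \<le> C * tent_norm p q r \<beta> F"
        if G: "\<forall>k t x. t \<in> whit CARD('n) k \<longrightarrow> G k x \<le> whitney_avg r F t x"
          and [measurable]: "\<And>k. G k \<in> borel_measurable borel" for F :: "real \<times> (real ^ 'n) \<Rightarrow> complex" and G
        unfolding p q(1)
      proof (rule dtn_inf_fin_le[OF q(2)])
        fix j :: int and y :: "real ^ 'n"
        define X where "X k x = ennreal (tau CARD('n) k powr (rcp (ennreal Q) - \<beta>)) * G k x" for k x
        have [measurable]: "wt G k \<in> borel_measurable borel" "X k \<in> borel_measurable borel" for k
          unfolding wt_def[abs_def] X_def[abs_def] by measurable
        \<comment> \<open>The times in \<open>whit d k\<close> lie in slice k + 1, so for all k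
          \<le> j they are at most \<open>tau d (j + 1)\<close>. The box has to be open at the top,
          hence j + 2.\<close>
        define \<tau> where "\<tau> = tau d (j + 2)"
        have \<tau>: "\<tau> = 3 * tau d j" by (simp add: \<tau>_def tau_add)
        have \<tau>0: "0 < \<tau>" by (simp add: \<tau>)
        define V where "V = ennreal (unit_ball_vol d * \<tau> ^ d)"
        have V: "emeasure lebesgue (ball y \<tau>) = V" using emeasure_ball[of \<tau> y] \<tau>0 by (simp add: V_def d_def)
        have V0: "V \<noteq> 0" "V \<noteq> top"
        proof -
          have "0 < unit_ball_vol d * \<tau> ^ d" using \<tau>0 by (intro mult_pos_pos) (auto simp: unit_ball_vol_pos)
          then show "V \<noteq> 0" "V \<noteq> top" unfolding V_def by (simp_all only: ennreal_eq_0_iff not_le ennreal_neq_top not_False_eq_True)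
        qed
        define B :: "real ^ 'n \<Rightarrow> ennreal" where "B = indicator (ball y (tau d j))"
        have [measurable]: "B \<in> borel_measurable borel" unfolding B_def by (rule borel_measurable_indicator) simp
        define I where "I k = (\<integral>\<^sup>+x. epowr (wt G k x) Q * B x \<partial>lborel)" for k
        define M where "M t = mean_value (ball y \<tau>) (\<lambda>x. epowr (weighted_avg r \<beta> F t x) Q)" for t
        have IM: "I k \<le> ennreal (c powr Q) * (V * M t)" if t: "t \<in> whit d k" for k t
        proof -
          have "I k \<le> (\<integral>\<^sup>+x. ennreal (c powr Q) * (epowr (weighted_avg r \<beta> F t x) Q * indicator (ball y \<tau>) x) \<partial>lborel)"
            unfolding I_def
          proof (rule nn_integral_mono)
            fix x
            have "epowr (wt G k x) Q \<le> epowr (ennreal c * weighted_avg r \<beta> F t x) Q"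
              using W[of G k x F t, OF _ t] G t q by (intro epowr_mono) (auto simp: d_def)
            also have "\<dots> = ennreal (c powr Q) * epowr (weighted_avg r \<beta> F t x) Q" using c q by (simp add: epowr_real_bound less_imp_le)
            finally show "epowr (wt G k x) Q * B x \<le> ennreal (c powr Q) * (epowr (weighted_avg r \<beta> F t x) Q * indicator (ball y \<tau>) x)"
              using \<tau> tau_pos[of d j] by (auto simp: B_def indicator_def simp del: tau_pos)
          qed
          also have "\<dots> \<le> ennreal (c powr Q) * (\<integral>\<^sup>+x. epowr (weighted_avg r \<beta> F t x) Q * indicator (ball y \<tau>) x \<partial>lborel)"
            by (rule nn_integral_cmult_le) (use c in \<open>auto simp: ennreal_eq_0_iff not_le\<close>)
          also have "(\<integral>\<^sup>+x. epowr (weighted_avg r \<beta> F t x) Q * indicator (ball y \<tau>) x \<partial>lborel) = V * M t"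
            unfolding M_def mean_value_def V nn_integral_completion divide_ennreal_def
            using ennreal_mult_inverse_cancel[OF V0] by (simp only: mult.commute[of _ "inverse V"])
          finally show ?thesis .
        qed
        have "csum (\<lambda>k. if k \<le> j then ennreal (tau d k) * I k else 0)
          = csum (\<lambda>k. \<integral>\<^sup>+t. ennreal (1 / \<kappa>) * (if k \<le> j \<and> t \<in> whit d k then I k else 0) \<partial>lborel)"
        proof (rule nn_integral_cong)
          fix k
          have "(\<integral>\<^sup>+t. ennreal (1 / \<kappa>) * (if k \<le> j \<and> t \<in> whit d k then I k else 0) \<partial>lborel)
            = (\<integral>\<^sup>+t. (if k \<le> j then ennreal (1 / \<kappa>) * I k else 0) * indicator (whit d k) t \<partial>lborel)"
            by (intro nn_integral_cong) (auto simp: indicator_def)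
          then show "(if k \<le> j then ennreal (tau d k) * I k else 0) = (\<integral>\<^sup>+t. ennreal (1 / \<kappa>) * (if k \<le> j \<and> t \<in> whit d k then I k else 0) \<partial>lborel)"
            by (simp add: nn_integral_cmult tau_whit mult_ac)
        qed
        also have "\<dots> = (\<integral>\<^sup>+t. csum (\<lambda>k. ennreal (1 / \<kappa>) * (if k \<le> j \<and> t \<in> whit d k then I k else 0)) \<partial>lborel)"
          by (rule csum_swap[symmetric]) measurable
        also have "\<dots> \<le> (\<integral>\<^sup>+t. ennreal (1 / \<kappa>) * (ennreal (c powr Q) * V) * (M t * indicator {0<..<\<tau>} t) \<partial>lborel)"
        proof (rule nn_integral_mono)
          fix t
          have "csum (\<lambda>k. if k \<le> j \<and> t \<in> whit d k then I k else 0) \<le> ennreal (c powr Q) * V * (M t * indicator {0<..<\<tau>} t)"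
          proof (rule csum_disjoint_le)
            fix k assume k: "k \<le> j \<and> t \<in> whit d k"
            then have "t \<in> slice d (k + 1)" using whit_slice by blast
            then have "t < \<tau>" "0 < t" using k tau_strict_mono[of "k + 1" "j + 2" d] slice_pos[of t d "k + 1"] by (auto simp: \<tau>_def slice_def)
            then show "I k \<le> ennreal (c powr Q) * V * (M t * indicator {0<..<\<tau>} t)"
              using IM[of t k] k by (simp add: mult.assoc)
          qed (use whit_unique in blast)
          then show "csum (\<lambda>k. ennreal (1 / \<kappa>) * (if k \<le> j \<and> t \<in> whit d k then I k else 0))
            \<le> ennreal (1 / \<kappa>) * (ennreal (c powr Q) * V) * (M t * indicator {0<..<\<tau>} t)"
            unfolding csum_cmult mult.assoc by (intro mult_left_mono) (auto simp: mult.assoc)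
        qed
        also have "\<dots> \<le> ennreal (1 / \<kappa>) * (ennreal (c powr Q) * V) * (\<integral>\<^sup>+t. M t * indicator {0<..<\<tau>} t \<partial>lborel)"
          by (rule nn_integral_cmult_le) (use c \<kappa> V0 in \<open>auto simp: ennreal_eq_0_iff not_le ennreal_mult_eq_top_iff\<close>)
        also have "(\<integral>\<^sup>+t. M t * indicator {0<..<\<tau>} t \<partial>lborel) \<le> epowr (tent_norm top (ennreal Q) r \<beta> F) Q"
        proof -
          have "epowr (tcarl Q r \<beta> F \<tau> y) (1 / Q) \<le> tent_norm top (ennreal Q) r \<beta> F"
            unfolding tent_inf_fin[OF q(2)] by (rule SUP_upper2[of "(\<tau>, y)"]) (auto simp: half_space_def \<tau>0)
          then show ?thesis using q epowr_le_swap[of "1 / Q"] by (simp add: M_def tcarl_def)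
        qed
        finally have sum: "csum (\<lambda>k. if k \<le> j then ennreal (tau d k) * I k else 0)
          \<le> ennreal (1 / \<kappa>) * (ennreal (c powr Q) * V) * epowr (tent_norm top (ennreal Q) r \<beta> F) Q"
          by (simp add: mult_left_mono)
        have "carl Q X j y = csum (\<lambda>k. if k \<le> j then ennreal (tau d k) * I k else 0) / ennreal (tau d j ^ d)"
        proof -
          have "(\<integral>\<^sup>+x. csum (\<lambda>k. if k \<le> j then epowr (X k x) Q else 0) * B x \<partial>lborel)
            = (\<integral>\<^sup>+x. csum (\<lambda>k. (if k \<le> j then epowr (X k x) Q else 0) * B x) \<partial>lborel)"
            by (simp only: csum_multc)
          also have "\<dots> = csum (\<lambda>k. \<integral>\<^sup>+x. (if k \<le> j then epowr (X k x) Q else 0) * B x \<partial>lborel)"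
            by (rule csum_swap) measurable
          also have "\<dots> = csum (\<lambda>k. if k \<le> j then ennreal (tau d k) * I k else 0)"
            unfolding I_def X_def using q powr_epowr_tau[OF q(2)]
            by (intro nn_integral_cong, subst nn_integral_cmult[symmetric])
              (auto simp: rcp_simps wt_def d_def mult.assoc)
          finally show ?thesis by (simp add: carl_def B_def d_def)
        qed
        also have "\<dots> \<le> ennreal (1 / \<kappa>) * (ennreal (c powr Q) * V) * epowr (tent_norm top (ennreal Q) r \<beta> F) Q / ennreal (tau d j ^ d)"
          by (rule divide_right_mono_ennreal[OF sum])
        also have "V = ennreal (unit_ball_vol d * 3 ^ d) * ennreal (tau d j ^ d)"
          unfolding V_def \<tau> by (subst ennreal_mult[symmetric]) (auto simp: power_mult_distrib less_imp_le mult.assoc)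
        also have "ennreal (1 / \<kappa>) * (ennreal (c powr Q) * (ennreal (unit_ball_vol d * 3 ^ d) * ennreal (tau d j ^ d))) * epowr (tent_norm top (ennreal Q) r \<beta> F) Q / ennreal (tau d j ^ d)
           = (K * epowr (tent_norm top (ennreal Q) r \<beta> F) Q) * ennreal (tau d j ^ d) / ennreal (tau d j ^ d)"
          unfolding K_def by (simp add: mult_ac)
        also have "\<dots> = K * epowr (tent_norm top (ennreal Q) r \<beta> F) Q"
        proof (rule ennreal_mult_divide_eq)
          have "0 < tau d j ^ d" by simp
          then show "ennreal (tau d j ^ d) \<noteq> 0" by (simp only: ennreal_eq_0_iff not_le)
        qed simp
        also have "\<dots> = epowr (C * tent_norm top (ennreal Q) r \<beta> F) Q"
          using q by (simp add: C_def epowr_mult)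
        finally show "carl Q (\<lambda>k x. ennreal (tau CARD('n) k powr (rcp (ennreal Q) - \<beta>)) * G k x) j y \<le> epowr (C * tent_norm top (ennreal Q) r \<beta> F) Q"
          by (simp add: X_def[abs_def])
      qed
      moreover have "C < top" by (simp add: C_def K_def ennreal_mult_less_top)
      ultimately show ?thesis by blast
    qed
  next
    case p: (2 P)
    from pq(2) show ?thesis
    proof (cases rule: exponent_cases)
      case q: 1
      have "dtn p q (\<lambda>k x. ennreal (tau CARD('n) k powr (rcp q - \<beta>)) * G k x) \<le> ennreal c * tent_norm p q r \<beta> F"
        if F: "F \<in> borel_measurable half_leb" and G: "\<forall>k t x. t \<in> whit CARD('n) k \<longrightarrow> G k x \<le> whitney_avg r F t x" for F :: "real \<times> (real ^ 'n) \<Rightarrow> complex" and G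
      proof -
        have "wt G k x \<le> ennreal c * esssup (lebesgue_on {0<..}) (\<lambda>t. weighted_avg r \<beta> F t x)" for k x
        proof -
          have AE1: "AE t in lborel. 0 < t \<longrightarrow> weighted_avg r \<beta> F t x \<le> esssup (lebesgue_on {0<..}) (\<lambda>t. weighted_avg r \<beta> F t x)"
            unfolding AE_pos_reals[symmetric] by (rule esssup_AE)
          obtain t where t: "t \<in> whit d k" "weighted_avg r \<beta> F t x \<le> esssup (lebesgue_on {0<..}) (\<lambda>t. weighted_avg r \<beta> F t x)"
            by (rule ex_whit[OF AE1])
          have "wt G k x \<le> ennreal c * weighted_avg r \<beta> F t x" using W[of G k x F t, OF _ t(1)] G t by (simp add: d_def)
          also have "\<dots> \<le> ennreal c * esssup (lebesgue_on {0<..}) (\<lambda>t. weighted_avg r \<beta> F t x)" by (intro mult_left_mono t) simp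
          finally show ?thesis .
        qed
        then have "epowr (SUP k. wt G k x) P \<le> ennreal (c powr P) * epowr (esssup (lebesgue_on {0<..}) (\<lambda>t. weighted_avg r \<beta> F t x)) P" for x
          using p c by (subst epowr_real_bound[symmetric]) (auto simp: less_imp_le intro!: epowr_mono SUP_least)
        then have "(\<integral>\<^sup>+x. epowr (SUP k. wt G k x) P \<partial>lborel) \<le> (\<integral>\<^sup>+x. ennreal (c powr P) * epowr (esssup (lebesgue_on {0<..}) (\<lambda>t. weighted_avg r \<beta> F t x)) P \<partial>lborel)"
          by (intro nn_integral_mono)
        also have "\<dots> \<le> ennreal (c powr P) * (\<integral>\<^sup>+x. epowr (esssup (lebesgue_on {0<..}) (\<lambda>t. weighted_avg r \<beta> F t x)) P \<partial>lborel)"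
          by (rule nn_integral_cmult_le) (use c in \<open>auto simp: ennreal_eq_0_iff not_le\<close>)
        finally have "epowr (\<integral>\<^sup>+x. epowr (SUP k. wt G k x) P \<partial>lborel) (1 / P) \<le> epowr \<dots> (1 / P)"
          using p by (intro epowr_mono) auto
        then show ?thesis
          unfolding p q tent_fin_inf[OF p(2)] dtn_fin_inf[OF p(2)] using p c
          by (simp add: epowr_mult powr_powr wt_def rcp_simps d_def)
      qed
      then show ?thesis by (intro exI[of _ "ennreal c"]) auto
    next
      case q: (2 Q)
      define K where "K = 1 / \<kappa> * c powr Q"
      have K: "0 < K" using \<kappa> c by (simp add: K_def)
      have "dtn p q (\<lambda>k x. ennreal (tau CARD('n) k powr (rcp q - \<beta>)) * G k x) \<le> ennreal (K powr (1 / Q)) * tent_norm p q r \<beta> F"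
        if G: "\<forall>k t x. t \<in> whit CARD('n) k \<longrightarrow> G k x \<le> whitney_avg r F t x" for F :: "real \<times> (real ^ 'n) \<Rightarrow> complex" and G
      proof -
        define T where "T x = (\<integral>\<^sup>+t\<in>{0<..}. epowr (weighted_avg r \<beta> F t x) Q \<partial>lborel)" for x
        have "csum (\<lambda>k. epowr (ennreal (tau d k powr (1 / Q - \<beta>)) * G k x) Q) \<le> ennreal K * T x" for x
        proof -
          have "csum (\<lambda>k. epowr (ennreal (tau d k powr (1 / Q - \<beta>)) * G k x) Q)
            = csum (\<lambda>k. \<integral>\<^sup>+t. ennreal (1 / \<kappa>) * (if t \<in> whit d k then epowr (wt G k x) Q else 0) \<partial>lborel)"
          proof (rule nn_integral_cong)
            fix k
            have "(\<integral>\<^sup>+t. ennreal (1 / \<kappa>) * (if t \<in> whit d k then epowr (wt G k x) Q else 0) \<partial>lborel)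
              = (\<integral>\<^sup>+t. (ennreal (1 / \<kappa>) * epowr (wt G k x) Q) * indicator (whit d k) t \<partial>lborel)"
              by (intro nn_integral_cong) (auto simp: indicator_def)
            also have "\<dots> = (ennreal (1 / \<kappa>) * epowr (wt G k x) Q) * emeasure lborel (whit d k)"
              by (rule nn_integral_cmult_indicator) simp
            finally show "epowr (ennreal (tau d k powr (1 / Q - \<beta>)) * G k x) Q = (\<integral>\<^sup>+t. ennreal (1 / \<kappa>) * (if t \<in> whit d k then epowr (wt G k x) Q else 0) \<partial>lborel)"
              unfolding powr_epowr_tau[OF q(2)] tau_whit wt_def by (simp only: mult_ac)
          qed
          also have "\<dots> = (\<integral>\<^sup>+t. csum (\<lambda>k. ennreal (1 / \<kappa>) * (if t \<in> whit d k then epowr (wt G k x) Q else 0)) \<partial>lborel)"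
            by (rule csum_swap[symmetric]) measurable
          also have "\<dots> \<le> (\<integral>\<^sup>+t. ennreal K * (epowr (weighted_avg r \<beta> F t x) Q * indicator {0<..} t) \<partial>lborel)"
          proof (rule nn_integral_mono)
            fix t
            have "csum (\<lambda>k. if t \<in> whit d k then epowr (wt G k x) Q else 0) \<le> ennreal (c powr Q) * (epowr (weighted_avg r \<beta> F t x) Q * indicator {0<..} t)"
            proof (rule csum_disjoint_le)
              fix k assume k: "t \<in> whit d k"
              then have t: "0 < t" using tau_pos[of d k] by (auto simp: whit_def simp del: tau_pos)
              have "epowr (wt G k x) Q \<le> epowr (ennreal c * weighted_avg r \<beta> F t x) Q"
                using W[of G k x F t, OF _ k] G k q by (intro epowr_mono) (auto simp: d_def)
              then show "epowr (wt G k x) Q \<le> ennreal (c powr Q) * (epowr (weighted_avg r \<beta> F t x) Q * indicator {0<..} t)"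
                using t c q by (simp add: epowr_real_bound less_imp_le)
            qed (use whit_unique in blast)
            then have "ennreal (1 / \<kappa>) * csum (\<lambda>k. if t \<in> whit d k then epowr (wt G k x) Q else 0)
              \<le> ennreal (1 / \<kappa>) * (ennreal (c powr Q) * (epowr (weighted_avg r \<beta> F t x) Q * indicator {0<..} t))" by (intro mult_left_mono) auto
            then show "csum (\<lambda>k. ennreal (1 / \<kappa>) * (if t \<in> whit d k then epowr (wt G k x) Q else 0))
              \<le> ennreal K * (epowr (weighted_avg r \<beta> F t x) Q * indicator {0<..} t)"
              unfolding csum_cmult K_def using \<kappa> by (subst ennreal_mult) (auto simp: mult.assoc less_imp_le)
          qed
          also have "\<dots> \<le> ennreal K * T x"
            unfolding T_def by (rule nn_integral_cmult_le) (use K in \<open>auto simp: ennreal_eq_0_iff not_le\<close>)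
          finally show ?thesis .
        qed
        then have "epowr (csum (\<lambda>k. epowr (ennreal (tau d k powr (1 / Q - \<beta>)) * G k x) Q)) (P / Q) \<le> ennreal (K powr (P / Q)) * epowr (T x) (P / Q)" for x
          using p q K by (subst epowr_real_bound[symmetric]) (auto simp: less_imp_le intro!: epowr_mono)
        then have "(\<integral>\<^sup>+x. epowr (csum (\<lambda>k. epowr (ennreal (tau d k powr (1 / Q - \<beta>)) * G k x) Q)) (P / Q) \<partial>lborel)
           \<le> (\<integral>\<^sup>+x. ennreal (K powr (P / Q)) * epowr (T x) (P / Q) \<partial>lborel)"
          by (intro nn_integral_mono)
        also have "\<dots> \<le> ennreal (K powr (P / Q)) * (\<integral>\<^sup>+x. epowr (T x) (P / Q) \<partial>lborel)"
          by (rule nn_integral_cmult_le) (use K in \<open>auto simp: ennreal_eq_0_iff not_le\<close>)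
        finally have "epowr (\<integral>\<^sup>+x. epowr (csum (\<lambda>k. epowr (ennreal (tau d k powr (1 / Q - \<beta>)) * G k x) Q)) (P / Q) \<partial>lborel) (1 / P) \<le> epowr \<dots> (1 / P)"
          using p by (intro epowr_mono) auto
        then show ?thesis
          unfolding p(1) q(1) tent_fin_fin[OF p(2) q(2)] dtn_fin_fin[OF p(2) q(2)] T_def using p q K
          by (simp add: epowr_mult powr_powr rcp_simps d_def)
      qed
      then show ?thesis by (intro exI[of _ "ennreal (K powr (1 / Q))"]) auto
    qed
  qed
qed


section \<open>Size estimates\<close>

definition slab :: "real \<Rightarrow> (real \<times> (real ^ 'n) \<Rightarrow> complex) \<Rightarrow> int \<Rightarrow> real ^ 'n \<Rightarrow> ennreal" where
  "slab r f k y = (\<integral>\<^sup>+s. ennreal (norm (f (s, y)) powr r) * indicator (slice CARD('n) k) s \<partial>lborel)"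

text \<open>The L^r mean over slice times cube, up to the ratio between \<open>tau\<close> and the
  length of the slice. Being constant on cubes it is the adapted counterpart of the Whitney
  average.\<close>

definition gavg :: "real \<Rightarrow> (real \<times> (real ^ 'n) \<Rightarrow> complex) \<Rightarrow> 'n::finite set \<Rightarrow> int \<Rightarrow> real ^ 'n \<Rightarrow> ennreal" where
  "gavg r f a k x = epowr (avg a k (slab r f k) x / ennreal (tau CARD('n) k)) (1 / r)"

lemma slice_borel [measurable]: "slice d k \<in> sets borel"
  by (simp add: slice_def)

lemma slice_cube_borel [measurable]:
  "slice d k \<times> cube a j x \<in> sets borel"
  by (intro borel_Times) auto

lemma power_norm_measurable:
  fixes f :: "real \<times> (real ^ 'n) \<Rightarrow> complex"
  assumes [measurable]: "f \<in> borel_measurable borel"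
  shows "(\<lambda>z. ennreal (norm (f z) powr r) * indicator (slice CARD('n) k) (fst z)) \<in> borel_measurable (lborel \<Otimes>\<^sub>M lborel)"
  by (simp add: lborel_prod)

lemma slab_measurable [measurable]:
  fixes f :: "real \<times> (real ^ 'n) \<Rightarrow> complex"
  assumes "f \<in> borel_measurable borel"
  shows "slab r f k \<in> borel_measurable borel"
proof -
  have "(\<lambda>(y, s). ennreal (norm (f (s, y)) powr r) * indicator (slice CARD('n) k) s) \<in> borel_measurable (borel \<Otimes>\<^sub>M lborel)"
    using measurable_compose[OF measurable_pair_swap' power_norm_measurable[OF assms, of r k]]
    by (simp add: case_prod_beta' comp_def)
  from lborel.borel_measurable_nn_integral[OF this] show ?thesis by (simp add: slab_def[abs_def])
qed

lemma gavg_measurable [measurable]: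
  fixes f :: "real \<times> (real ^ 'n) \<Rightarrow> complex"
  shows "f \<in> borel_measurable borel \<Longrightarrow> gavg r f a k \<in> borel_measurable borel"
  unfolding gavg_def[abs_def] divide_ennreal_def by (intro measurable_epowr_fun borel_measurable_times_ennreal avg_measurable slab_measurable) auto

lemma level_gavg: "level a k (gavg r f a k)"
  unfolding gavg_def[abs_def] by (rule level_comp[OF level_avg])

lemma side_power_cancel: "ennreal (side k ^ n) * (I / ennreal (side k ^ n)) = I"
  unfolding divide_ennreal_def
  by (subst mult.commute[of I]) (rule ennreal_mult_inverse_cancel; simp)

lemma tau_power_neq [simp]: "ennreal (tau d k ^ n) \<noteq> 0" "ennreal (tau d k) \<noteq> 0"
  using tau_pos[of d k] by (simp_all add: ennreal_eq_0_iff not_le del: tau_pos)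

lemma avg_cmult: "w \<in> borel_measurable borel \<Longrightarrow> avg a k (\<lambda>y. c * w y) x = c * avg a k w x"
  unfolding avg_def mult.assoc divide_ennreal_def by (subst nn_integral_cmult) (auto simp: mult.assoc)

lemma nn_integral_slab:
  fixes f :: "real \<times> (real ^ 'n) \<Rightarrow> complex"
  assumes f: "f \<in> borel_measurable borel"
  shows "(\<integral>\<^sup>+z. ennreal (norm (f z) powr r) * indicator (slice CARD('n) k \<times> cube a j x) z \<partial>lborel)
    = ennreal (side j ^ CARD('n)) * avg a j (slab r f k) x"
proof -
  have m: "(\<lambda>z. ennreal (norm (f z) powr r) * indicator (slice CARD('n) k \<times> cube a j x) z) \<in> borel_measurable (lborel \<Otimes>\<^sub>M lborel)"
    using f by (simp add: lborel_prod)
  have "(\<integral>\<^sup>+z. ennreal (norm (f z) powr r) * indicator (slice CARD('n) k \<times> cube a j x) z \<partial>lborel)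
    = (\<integral>\<^sup>+y. (\<integral>\<^sup>+s. ennreal (norm (f (s, y)) powr r) * indicator (slice CARD('n) k \<times> cube a j x) (s, y) \<partial>lborel) \<partial>lborel)"
    unfolding lborel_prod[symmetric] by (rule lborel_pair.nn_integral_snd[symmetric]) (rule m)
  also have "\<dots> = (\<integral>\<^sup>+y. slab r f k y * indicator (cube a j x) y \<partial>lborel)"
    by (intro nn_integral_cong) (auto simp: slab_def indicator_def intro!: nn_integral_cong)
  finally show ?thesis by (simp add: avg_def side_power_cancel)
qed

lemma avg_slab_eq:
  fixes f :: "real \<times> (real ^ 'n) \<Rightarrow> complex"
  assumes [measurable]: "f \<in> borel_measurable borel" and r: "0 < r" and "k \<le> j"
  shows "avg a j (slab r f k) x = ennreal (tau CARD('n) k) * avg a j (\<lambda>y. epowr (gavg r f a k y) r) x"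
proof -
  have "avg a j (slab r f k) x = avg a j (avg a k (slab r f k)) x"
    by (rule avg_tower[symmetric]) (use assms in auto)
  also have "avg a k (slab r f k) = (\<lambda>y. ennreal (tau CARD('n) k) * epowr (gavg r f a k y) r)"
  proof
    fix y
    show "avg a k (slab r f k) y = ennreal (tau CARD('n) k) * epowr (gavg r f a k y) r"
      using r ennreal_mult_inverse_cancel(1)[of "ennreal (tau CARD('n) k)" "avg a k (slab r f k) y"]
      by (simp add: gavg_def divide_ennreal_def mult.commute)
  qed
  also have "avg a j \<dots> x = ennreal (tau CARD('n) k) * avg a j (\<lambda>y. epowr (gavg r f a k y) r) x"
    by (rule avg_cmult) simp
  finally show ?thesis .
qed

text \<open>Hoelder's inequality in time on a slice of length m. Afterwards m may be enlarged to
  \<open>tau\<close>, because m enters as m^(1 - 1/r).\<close>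

lemma slab_1_le:
  fixes f :: "real \<times> (real ^ 'n) \<Rightarrow> complex"
  assumes [measurable]: "f \<in> borel_measurable borel" and r: "1 \<le> r"
  shows "slab 1 f k y \<le> ennreal (tau CARD('n) k) * epowr (slab r f k y / ennreal (tau CARD('n) k)) (1 / r)"
proof -
  define S where "S = slice CARD('n) k"
  define m where "m = tau CARD('n) k - tau CARD('n) (k - 1)"
  have m: "0 < m" "m \<le> tau CARD('n) k" using tau_strict_mono[of "k - 1" k] by (simp_all add: m_def less_imp_le)
  have em: "emeasure lborel S = ennreal m" using m by (simp add: S_def slice_def m_def)
  have [measurable]: "S \<in> sets borel" by (simp add: S_def)
  interpret prob_space "uniform_measure lborel S"
    by (rule prob_space_uniform_measure) (use em m in \<open>auto simp: ennreal_eq_0_iff not_le\<close>)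
  have sec: "(\<lambda>s. f (s, y)) \<in> borel_measurable borel"
    by (rule measurable_compose[of _ _ borel, OF borel_measurable_continuous_onI]) (auto intro!: continuous_intros)
  have g: "(\<lambda>s. ennreal (norm (f (s, y)) powr 1)) \<in> borel_measurable lborel" using sec by measurable
  have I: "(\<integral>\<^sup>+s. ennreal (norm (f (s, y)) powr u) \<partial>uniform_measure lborel S) = slab u f k y / ennreal m" for u
    using sec by (subst nn_integral_uniform_measure) (auto simp: slab_def S_def[symmetric] em)
  have "epowr (slab 1 f k y / ennreal m) r \<le> (\<integral>\<^sup>+s. epowr (ennreal (norm (f (s, y)) powr 1)) r \<partial>uniform_measure lborel S)"
    unfolding I[symmetric] by (rule jensen_epowr[OF _ r]) (use g in simp)
  also have "\<dots> = slab r f k y / ennreal m" unfolding I[symmetric] by simp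
  finally have "slab 1 f k y / ennreal m \<le> epowr (slab r f k y / ennreal m) (1 / r)"
    using r by (simp add: epowr_le_swap)
  then have "ennreal m * (slab 1 f k y / ennreal m) \<le> ennreal m * epowr (slab r f k y / ennreal m) (1 / r)"
    by (rule mult_left_mono) simp
  also have "ennreal m * (slab 1 f k y / ennreal m) = slab 1 f k y"
    using ennreal_mult_inverse_cancel(1)[of "ennreal m" "slab 1 f k y"] m
    by (simp add: divide_ennreal_def mult.commute ennreal_eq_0_iff not_le)
  also have "ennreal m * epowr (slab r f k y / ennreal m) (1 / r) \<le> ennreal (tau CARD('n) k) * epowr (slab r f k y / ennreal (tau CARD('n) k)) (1 / r)"
  proof -
    have "ennreal u * epowr (w / ennreal u) (1 / r) = ennreal (u powr (1 - 1 / r)) * epowr w (1 / r)" if "0 < u" for u w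
    proof -
      have "u * inverse u powr (1 / r) = u powr (1 - 1 / r)"
        using that by (simp add: powr_diff inverse_eq_divide powr_divide)
      then show ?thesis using that r
        by (simp add: divide_ennreal_def inverse_ennreal epowr_mult mult.left_commute less_imp_le flip: ennreal_mult)
           (simp add: mult.assoc[symmetric] ennreal_mult[symmetric] less_imp_le mult.commute)
    qed
    then show ?thesis using m r by (auto intro!: mult_right_mono ennreal_leI powr_mono2)
  qed
  finally show ?thesis .
qed

text \<open>Jensen's inequality is applied on cubes of level k only. Beyond that level plain
  averages are kept, since power means over large cubes would not satisfy the bounds needed for
  small p and q.\<close>

lemma avg_slab_1_le:
  fixes f :: "real \<times> (real ^ 'n) \<Rightarrow> complex"
  assumes [measurable]: "f \<in> borel_measurable borel" and r: "1 \<le> r" and "k \<le> j"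
  shows "avg a j (slab 1 f k) x \<le> ennreal (tau CARD('n) k) * avg a j (gavg r f a k) x"
proof -
  have one: "avg a k (slab 1 f k) y \<le> ennreal (tau CARD('n) k) * gavg r f a k y" for y
  proof -
    define w where "w y = epowr (slab r f k y / ennreal (tau CARD('n) k)) (1 / r)" for y
    have [measurable]: "w \<in> borel_measurable borel" unfolding w_def[abs_def] by measurable
    have "avg a k (slab 1 f k) y \<le> avg a k (\<lambda>y. ennreal (tau CARD('n) k) * w y) y"
      unfolding w_def by (intro avg_mono slab_1_le r) auto
    also have "\<dots> = ennreal (tau CARD('n) k) * avg a k w y"
      by (rule avg_cmult) simp
    also have "avg a k w y \<le> epowr (avg a k (\<lambda>y. epowr (w y) r) y) (1 / r)"
      using prob_space.jensen_epowr[OF prob_cube, of w a k y r] r by (simp add: avg_uniform epowr_le_swap)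
    also have "avg a k (\<lambda>y. epowr (w y) r) y = avg a k (slab r f k) y / ennreal (tau CARD('n) k)"
    proof -
      have "(\<lambda>y. epowr (w y) r) = (\<lambda>y. inverse (ennreal (tau CARD('n) k)) * slab r f k y)"
        using r by (auto simp: w_def divide_ennreal_def mult.commute)
      then have "avg a k (\<lambda>y. epowr (w y) r) y = inverse (ennreal (tau CARD('n) k)) * avg a k (slab r f k) y"
        by (simp only: avg_cmult[OF slab_measurable[OF assms(1)]])
      then show ?thesis by (simp only: divide_ennreal_def mult.commute)
    qed
    finally show ?thesis by (simp add: gavg_def mult_left_mono)
  qed
  have "avg a j (slab 1 f k) x = avg a j (avg a k (slab 1 f k)) x"
    by (rule avg_tower[symmetric]) (use assms in auto)
  also have "\<dots> \<le> avg a j (\<lambda>y. ennreal (tau CARD('n) k) * gavg r f a k y) x" by (intro avg_mono one)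
  also have "\<dots> = ennreal (tau CARD('n) k) * avg a j (gavg r f a k) x"
    by (rule avg_cmult) simp
  finally show ?thesis .
qed

text \<open>Slice times cube lies in the Whitney box at (t, x): in time by the choice of
  \<open>whit\<close>, in space because the diameter of the cube is below \<open>tau\<close> at
  level k, which is less than t. The volumes of the two sets are comparable.\<close>

lemma gavg_le_whitney:
  assumes r: "1 \<le> r"
  obtains A where "0 < A" "\<And>(f :: real \<times> (real ^ 'n) \<Rightarrow> complex) a k t x. f \<in> borel_measurable borel \<Longrightarrow>
    t \<in> whit CARD('n) k \<Longrightarrow> ennreal A * gavg r f a k x \<le> whitney_avg r f t x"
proof -
  define d where "d = CARD('n)"
  define B where "B = unit_ball_vol d / 2 * 2 ^ (1 + d) * (3 ^ (d + 1)) ^ d"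
  have B: "0 < B" by (simp add: B_def unit_ball_vol_pos)
  have le: "gavg r f a k x \<le> ennreal (B powr (1 / r)) * whitney_avg r f t x"
    if f: "f \<in> borel_measurable borel" and t: "t \<in> whit CARD('n) k" for f :: "real \<times> (real ^ 'n) \<Rightarrow> complex" and a k t x
  proof -
    have tt: "tau d k < t" "t \<le> 2 * tau d (k - 1)" using t by (auto simp: whit_def d_def)
    have t0: "0 < t" using tt tau_pos[of d k] by (simp del: tau_pos)
    have t2: "t \<le> 2 * tau d k" using tt tau_mono[of "k - 1" k d] by simp
    define V where "V = unit_ball_vol d / 2 * t ^ (1 + d)"
    have V: "0 < V" using t0 by (simp add: V_def unit_ball_vol_pos)
    have "slice d k \<times> cube a k x \<subseteq> {t / 2..t} \<times> ball x t"
      using tt cube_norm_tau[of _ a k x] by (auto simp: slice_def d_def dist_norm norm_minus_commute) (smt (verit))+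
    then have "ennreal (side k ^ d) * avg a k (slab r f k) x \<le> box_int r f t x"
      unfolding d_def nn_integral_slab[OF f, symmetric] box_int_def
      by (intro nn_integral_mono mult_left_mono) (auto simp: indicator_def)
    then have "ennreal (side k ^ d) * avg a k (slab r f k) x / ennreal V \<le> box_int r f t x / ennreal V"
      by (rule divide_right_mono_ennreal)
    then have 1: "ennreal B * (ennreal (side k ^ d) * avg a k (slab r f k) x / ennreal V) \<le> ennreal B * (box_int r f t x / ennreal V)"
      by (rule mult_left_mono) simp
    have "V \<le> unit_ball_vol d / 2 * (2 * tau d k) ^ (1 + d)"
      unfolding V_def using t0 t2 by (intro mult_left_mono power_mono) (auto simp: unit_ball_vol_pos less_imp_le)
    also have "\<dots> = unit_ball_vol d / 2 * 2 ^ (1 + d) * (tau d k * tau d k ^ d)"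
      by (simp add: power_mult_distrib)
    also have "\<dots> \<le> unit_ball_vol d / 2 * 2 ^ (1 + d) * (tau d k * (3 ^ (d + 1) * side k) ^ d)"
      by (intro mult_left_mono power_mono tau_side) (auto simp: unit_ball_vol_pos less_imp_le)
    also have "\<dots> = B * tau d k * side k ^ d" by (simp add: B_def power_mult_distrib)
    finally have "V \<le> B * tau d k * side k ^ d" .
    then have "1 / tau d k \<le> B * side k ^ d / V" using V by (simp add: field_simps)
    then have "ennreal (1 / tau d k) * avg a k (slab r f k) x \<le> ennreal (B * side k ^ d / V) * avg a k (slab r f k) x"
      by (intro mult_right_mono ennreal_leI) auto
    also have "\<dots> = ennreal B * (ennreal (side k ^ d) * avg a k (slab r f k) x / ennreal V)"
      using B V by (simp add: divide_ennreal_def inverse_ennreal divide_inverse ennreal_mult less_imp_le mult_ac)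
    also note 1
    finally have "avg a k (slab r f k) x / ennreal (tau d k) \<le> ennreal B * (box_int r f t x / ennreal V)"
      by (simp add: divide_ennreal_def inverse_ennreal inverse_eq_divide mult.commute)
    then have "gavg r f a k x \<le> epowr (ennreal B * (box_int r f t x / ennreal V)) (1 / r)"
      unfolding gavg_def d_def using r by (intro epowr_mono) auto
    then show ?thesis using whitney_avg_eq_borel[OF f t0, of r x] B r by (simp add: epowr_real_bound V_def d_def less_imp_le)
  qed
  have "ennreal (1 / B powr (1 / r)) * gavg r f a k x \<le> whitney_avg r f t x"
    if f: "f \<in> borel_measurable borel" and t: "t \<in> whit CARD('n) k" for f :: "real \<times> (real ^ 'n) \<Rightarrow> complex" and a k t x
  proof -
    have "ennreal (1 / B powr (1 / r)) * gavg r f a k x \<le> ennreal (1 / B powr (1 / r)) * (ennreal (B powr (1 / r)) * whitney_avg r f t x)"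
      by (intro mult_left_mono le f t) simp
    also have "\<dots> = whitney_avg r f t x"
      using B by (simp add: mult.assoc[symmetric] flip: ennreal_mult)
    finally show ?thesis .
  qed
  moreover have "0 < 1 / B powr (1 / r)" using B by simp
  ultimately show thesis using that by blast
qed

subsection \<open>The majorant\<close>

text \<open>2 d levels undo the factor 3^d in \<open>tau\<close>, four more give a factor 9, and one
  makes up for the rounding in \<open>k div 2\<close>.\<close>

abbreviation lev_shift :: "nat \<Rightarrow> int" where "lev_shift d \<equiv> 2 * int d + 5"

text \<open>The quotient of tau (k + m) by 3^i tau (max k (k + m)). It is what remains of kernel
  size times volume for a source in slice k + m and a cube of side about 3^i tau (max k (k +
  m)).\<close>

definition weight :: "int set \<Rightarrow> int \<Rightarrow> nat \<Rightarrow> real" where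
  "weight M m i = (if m \<in> M then 3 powr (real_of_int (min m 0) / 2 - real i) else 0)"

text \<open>Here m is the relative scale of the source, i measures its spatial distance in powers of
  3, and \<open>a\<close> is a grid in which source and target share a cube.\<close>

definition majorant :: "int set \<Rightarrow> real \<Rightarrow> (real \<times> (real ^ 'n) \<Rightarrow> complex) \<Rightarrow> int \<Rightarrow> real ^ 'n \<Rightarrow> ennreal" where
  "majorant M r f k x = csum (\<lambda>(m, i, a). ennreal (weight M m i) *
     avg a (max k (k + m) + (lev_shift CARD('n) + 2 * int i)) (gavg r f a (k + m)) x)"

text \<open>The time range is the union of the slices k - 4 to k + 3, those which are too close in
  time for the size bound to help; this is the set {-4..3} of relative scales that reappears in the
  conditions on M.\<close>

definition nbhd :: "int \<Rightarrow> real ^ 'n \<Rightarrow> (real \<times> (real ^ 'n)) set" where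
  "nbhd k x = {tau CARD('n) (k - 5)<..tau CARD('n) (k + 3)} \<times> ball x (3 * tau CARD('n) k)"

lemma majorant_measurable [measurable]:
  fixes f :: "real \<times> (real ^ 'n) \<Rightarrow> complex"
  shows "f \<in> borel_measurable borel \<Longrightarrow> majorant M r f k \<in> borel_measurable borel"
  unfolding majorant_def[abs_def] case_prod_beta' by measurable

lemma nbhd_borel [measurable]: "nbhd k x \<in> sets borel"
  unfolding nbhd_def by (intro borel_Times) auto

lemma majorant_ge:
  "ennreal (weight M m i) * avg a (max k (k + m) + (lev_shift CARD('n) + 2 * int i)) (gavg r f a (k + m)) x
     \<le> majorant M r (f :: real \<times> (real ^ 'n) \<Rightarrow> complex) k x"
  unfolding majorant_def
  using csum_ge[of "\<lambda>(m, i, a). ennreal (weight M m i) *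
     avg a (max k (k + m) + (lev_shift CARD('n) + 2 * int i)) (gavg r f a (k + m)) x" "(m, i, a)"] by simp

lemma side_lev_shift: "tau d K * 3 ^ (i + 2) \<le> side (K + (lev_shift d + 2 * int i))"
proof -
  have "real_of_int K / 2 + real d + real (i + 2) \<le> real_of_int ((K + (lev_shift d + 2 * int i)) div 2)"
  proof -
    have "real_of_int (K + (lev_shift d + 2 * int i)) / 2 \<le> real_of_int ((K + (lev_shift d + 2 * int i)) div 2) + 1 / 2"
    proof -
      have "n \<le> 2 * (n div 2) + 1" for n :: int by presburger
      then have "real_of_int n \<le> real_of_int (2 * (n div 2) + 1)" for n :: int by (simp only: of_int_le_iff)
      from this[of "K + (lev_shift d + 2 * int i)"] show ?thesis by simp
    qed
    then show ?thesis by simp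
  qed
  then have "(3::real) powr (real_of_int K / 2 + real d + real (i + 2)) \<le> 3 powr real_of_int ((K + (lev_shift d + 2 * int i)) div 2)"
    by (intro powr_mono) auto
  moreover have "(3::real) ^ (i + 2) = 3 powr real (i + 2)" by (rule powr_realpow[symmetric]) simp
  ultimately show ?thesis by (simp only: side_def tau_def powr_add)
qed

lemma side_lev_shift_le: "side (K + (lev_shift d + 2 * int i)) \<le> 3 powr (real_of_int (lev_shift d) / 2) * (3 ^ i * tau d K)"
proof -
  have "side (K + (lev_shift d + 2 * int i)) * 3 ^ d \<le> tau d (K + (lev_shift d + 2 * int i))" by (rule side_tau)
  moreover have "side (K + (lev_shift d + 2 * int i)) * 1 \<le> side (K + (lev_shift d + 2 * int i)) * 3 ^ d"
    by (intro mult_left_mono) (auto simp: less_imp_le)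
  moreover have "tau d (K + (lev_shift d + 2 * int i)) = 3 powr (real_of_int (lev_shift d) / 2) * (3 ^ i * tau d K)"
    by (simp add: tau_def powr_realpow[symmetric] powr_add[symmetric] add_divide_distrib ac_simps del: powr_realpow)
  ultimately show ?thesis by linarith
qed

lemma cover_at_scale:
  fixes x y :: "real ^ 'n"
  assumes "norm (x - y) < 9 / 2 * 3 ^ i * tau CARD('n) K"
  shows "\<exists>a. y \<in> cube a (K + (lev_shift CARD('n) + 2 * int i)) x"
proof (rule in_some_cube)
  have "norm (x - y) < tau CARD('n) K * 3 ^ (i + 2) / 2" using assms by (simp add: mult_ac)
  also have "\<dots> \<le> side (K + (lev_shift CARD('n) + 2 * int i)) / 2" using side_lev_shift by (intro divide_right_mono) auto
  finally show "norm (x - y) < side (K + (lev_shift CARD('n) + 2 * int i)) / 2" .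
qed

lemma tau_shift4: "tau d (k + 4) = 9 * tau d k" "tau d (k - 4) = tau d k / 9"
  using tau_add[of d k 4] tau_add[of d "k - 4" 4] by simp_all

text \<open>Off \<open>nbhd\<close> two points are separated, up to a constant, by the side of the
  cube that joins them. The size of the kernel on such a cube is then determined by i and by the
  larger of the two scales.\<close>

lemma far_scale:
  fixes x x' y :: "real ^ 'n"
  assumes t: "t \<in> slice CARD('n) k" "t' \<in> {t / 2..t}" "norm (x' - x) < t"
    and s: "s \<in> slice CARD('n) (k + m)" and far: "(s, y) \<notin> nbhd k x"
  obtains i a where "y \<in> cube a (max k (k + m) + (lev_shift CARD('n) + 2 * int i)) x"
    "3 ^ i * tau CARD('n) (max k (k + m)) / 9 \<le> \<bar>t' - s\<bar> + norm (x' - y)"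
proof -
  define d where "d = CARD('n)"
  define \<rho> where "\<rho> = tau d (max k (k + m))"
  have \<rho>: "0 < \<rho>" "tau d k \<le> \<rho>" by (simp_all add: \<rho>_def tau_mono)
  have t1: "t \<le> tau d k" "tau d (k - 1) < t" using t by (auto simp: slice_def d_def)
  have ex: "\<exists>i. norm (x - y) < 9 / 2 * 3 ^ i * \<rho>"
  proof -
    obtain i where "norm (x - y) / (9 / 2 * \<rho>) < 3 ^ i" using real_arch_pow[of 3] by force
    then show ?thesis using \<rho> by (auto simp: field_simps)
  qed
  define i where "i = (LEAST i. norm (x - y) < 9 / 2 * 3 ^ i * \<rho>)"
  have i: "norm (x - y) < 9 / 2 * 3 ^ i * \<rho>" unfolding i_def by (rule LeastI_ex[OF ex])
  then obtain a where a: "y \<in> cube a (max k (k + m) + (lev_shift CARD('n) + 2 * int i)) x"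
    using cover_at_scale[of x y i "max k (k + m)"] by (auto simp: \<rho>_def d_def)
  have tri: "norm (x - y) \<le> norm (x' - x) + norm (x' - y)"
    using norm_triangle_ineq[of "x - x'" "x' - y"] by (simp add: norm_minus_commute)
  have "3 ^ i * \<rho> / 9 \<le> \<bar>t' - s\<bar> + norm (x' - y)"
  proof (cases i)
    \<comment> \<open>Minimality of i gives |x - y| \<ge> (9/2) 3^l \<rho>, and replacing x by x'
      costs at most \<rho>.\<close>
    case (Suc l)
    then have "\<not> norm (x - y) < 9 / 2 * 3 ^ l * \<rho>" unfolding i_def using not_less_Least lessI by metis
    then have "9 / 2 * 3 ^ l * \<rho> \<le> norm (x' - y) + \<rho>" using tri t(3) t1 \<rho> by linarith
    moreover have "1 * \<rho> \<le> 3 ^ l * \<rho>" using \<rho> by (intro mult_right_mono) auto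
    moreover have "3 ^ i * \<rho> / 9 = 3 ^ l * \<rho> / 3" by (simp add: Suc)
    ultimately show ?thesis using \<rho> by linarith
  next
    \<comment> \<open>Now the separation comes from leaving \<open>nbhd\<close>: in time for m \<le>
      -5 and m \<ge> 4, otherwise in space. For m \<le> -5 one has t' \<ge> tau k / 4 and s \<le>
      tau k / 9, and 1/4 - 1/9 \<ge> 1/9. For m \<ge> 4 one has s \<ge> \<rho> / 2 and t' \<le>
      \<rho> / 9. In between |x' - y| \<ge> 2 tau k, while \<rho> \<le> 9 tau k.\<close>
    case 0
    consider "m \<le> -5" | "4 \<le> m" | "-5 < m" "m < 4" by linarith
    then show ?thesis
    proof cases
      case 1
      have "s \<le> tau d (k + m)" using s by (auto simp: slice_def d_def)
      also have "\<dots> \<le> tau d (k - 4)" using 1 by (intro tau_mono) auto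
      finally have "s \<le> tau d k / 9" by (simp add: tau_shift4)
      moreover have "tau d k / 4 \<le> t / 2"
      proof -
        have "tau d k / 2 \<le> tau d k / sqrt 3" using sqrt3 by (intro divide_left_mono) (auto simp: less_imp_le)
        then show ?thesis using t1(2) unfolding tau_pred by linarith
      qed
      moreover have "\<rho> = tau d k" using 1 by (simp add: \<rho>_def max_def)
      ultimately have "\<rho> / 9 \<le> t' - s" using t(2) \<rho> by auto
      moreover have "0 \<le> norm (x' - y)" by simp
      ultimately have "\<rho> / 9 \<le> \<bar>t' - s\<bar> + norm (x' - y)" by linarith
      then show ?thesis using 0 by simp
    next
      case 2
      have "tau d k \<le> tau d (k + m - 4)" using 2 by (intro tau_mono) auto
      then have "t' \<le> \<rho> / 9" using t(2) t1 2 by (auto simp: \<rho>_def tau_shift4 max_def)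
      moreover have "\<rho> / 2 \<le> s"
      proof -
        have "tau d (k + m) / 2 \<le> tau d (k + m) / sqrt 3" using sqrt3 by (intro divide_left_mono) (auto simp: less_imp_le)
        moreover have "tau d (k + m - 1) < s" using s by (auto simp: slice_def d_def)
        ultimately have "tau d (k + m) / 2 \<le> s" unfolding tau_pred by linarith
        then show ?thesis using 2 by (simp add: \<rho>_def max_def)
      qed
      ultimately have "\<rho> / 9 \<le> s - t'" using \<rho> by simp
      moreover have "0 \<le> norm (x' - y)" by simp
      ultimately have "\<rho> / 9 \<le> \<bar>t' - s\<bar> + norm (x' - y)" by linarith
      then show ?thesis using 0 by simp
    next
      case 3
      have "tau d (k - 5) \<le> tau d (k + m - 1)" "tau d (k + m) \<le> tau d (k + 3)" using 3 by (auto intro!: tau_mono)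
      then have "tau d (k - 5) < s" "s \<le> tau d (k + 3)" using s by (auto simp: slice_def d_def)
      then have "3 * tau d k \<le> norm (x - y)" using far by (auto simp: nbhd_def dist_norm d_def)
      then have "2 * tau d k \<le> norm (x' - y)" using tri t(3) t1 by linarith
      moreover have "\<rho> \<le> tau d (k + 4)" unfolding \<rho>_def using 3 by (intro tau_mono) auto
      ultimately have "\<rho> / 9 \<le> norm (x' - y)" unfolding tau_shift4 using \<rho> tau_pos[of d k] by (simp del: tau_pos)
      then have "\<rho> / 9 \<le> \<bar>t' - s\<bar> + norm (x' - y)" by linarith
      then show ?thesis using 0 by simp
    qed
  qed
  then show thesis using that[OF a] by (simp add: \<rho>_def d_def)
qed

text \<open>Every w off \<open>nbhd\<close> with nonzero kernel lies in the piece of at least one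
  triple (m, i, a) with m in M, so the sum over all triples dominates although pieces overlap. On
  each piece the kernel is bounded by a constant and f is integrated by
  \<open>avg_slab_1_le\<close>.\<close>

lemma far_integral_le:
  fixes kk :: "real \<times> (real ^ 'n) \<Rightarrow> real \<times> (real ^ 'n) \<Rightarrow> complex"
  assumes r: "1 \<le> r" and C0: "0 \<le> C0"
    and size: "\<And>z w. z \<in> half_space \<Longrightarrow> w \<in> half_space \<Longrightarrow> z \<noteq> w \<Longrightarrow>
      norm (kk z w) \<le> C0 / (\<bar>fst z - fst w\<bar> + norm (snd z - snd w)) ^ (1 + CARD('n))"
    and supp: "\<And>z w k m t. t \<in> slice CARD('n) k \<Longrightarrow> fst z \<in> {t / 2..t} \<Longrightarrow> fst w \<in> slice CARD('n) (k + m) \<Longrightarrow> m \<notin> M \<Longrightarrow> kk z w = 0"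
  shows "\<exists>C\<ge>0. \<forall>f k t x z. f \<in> borel_measurable borel \<longrightarrow> t \<in> slice CARD('n) k \<longrightarrow> z \<in> {t / 2..t} \<times> ball x t \<longrightarrow>
    (\<integral>\<^sup>+w. ennreal (norm (kk z w) * norm (f w)) * indicator (half_space - nbhd k x) w \<partial>lborel) \<le> ennreal C * majorant M r f k x"
proof -
  define d where "d = CARD('n)"
  define H where "H = 3 powr (real_of_int (lev_shift d) / 2)"
  define C where "C = C0 * 9 ^ (1 + d) * H ^ d"
  have H: "0 < H" by (simp add: H_def)
  have C: "0 \<le> C" using C0 H by (simp add: C_def)
  have "(\<integral>\<^sup>+w. ennreal (norm (kk z w) * norm (f w)) * indicator (half_space - nbhd k x) w \<partial>lborel) \<le> ennreal C * majorant M r f k x"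
    if f [measurable]: "f \<in> borel_measurable borel" and t: "t \<in> slice CARD('n) k" and z: "z \<in> {t / 2..t} \<times> ball x t"
    for f :: "real \<times> (real ^ 'n) \<Rightarrow> complex" and k t x z
  proof -
    define \<rho> where "\<rho> m = tau d (max k (k + m))" for m
    have \<rho>: "0 < \<rho> m" for m by (simp add: \<rho>_def)
    define K where "K m i = max k (k + m) + (lev_shift d + 2 * int i)" for m i
    define e where "e m i = (if m \<in> M then C0 * 9 ^ (1 + d) / (3 ^ i * \<rho> m) ^ (1 + d) else 0)" for m i
    have e: "0 \<le> e m i" for m i using C0 \<rho>[of m] by (simp add: e_def)
    have pt: "ennreal (norm (kk z w) * norm (f w)) * indicator (half_space - nbhd k x) w
       \<le> csum (\<lambda>(m, i, a). ennreal (e m i) * (ennreal (norm (f w) powr 1) * indicator (slice d (k + m) \<times> cube a (K m i) x) w))" for w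
    proof (cases "w \<in> half_space - nbhd k x \<and> kk z w \<noteq> 0")
      case True
      obtain s y where w: "w = (s, y)" by force
      obtain t' x' where z': "z = (t', x')" by force
      have s: "0 < s" using True by (auto simp: w half_space_def)
      obtain j where j: "s \<in> slice d j" using ex_slice[OF s] .
      define m where "m = j - k"
      have sm: "s \<in> slice CARD('n) (k + m)" using j by (simp add: m_def d_def)
      have zz: "t' \<in> {t / 2..t}" "norm (x' - x) < t" using z by (auto simp: z' dist_norm norm_minus_commute)
      have nb: "(s, y) \<notin> nbhd k x" using True by (simp add: w)
      obtain i a where "y \<in> cube a (max k (k + m) + (lev_shift CARD('n) + 2 * int i)) x"
        "3 ^ i * tau CARD('n) (max k (k + m)) / 9 \<le> \<bar>t' - s\<bar> + norm (x' - y)"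
        by (rule far_scale[OF t zz sm nb])
      then have ia: "y \<in> cube a (K m i) x" "3 ^ i * \<rho> m / 9 \<le> \<bar>t' - s\<bar> + norm (x' - y)"
        by (simp_all add: K_def \<rho>_def d_def)
      have mM: "m \<in> M" using supp[of t k z w m] t zz sm True by (auto simp: w z')
      have pos: "0 < 3 ^ i * \<rho> m / 9" using \<rho>[of m] by simp
      then have "z \<noteq> w" using ia(2) by (auto simp: w z')
      moreover have "z \<in> half_space" using zz slice_pos[OF t] by (auto simp: z' half_space_def)
      ultimately have "norm (kk z w) \<le> C0 / (\<bar>t' - s\<bar> + norm (x' - y)) ^ (1 + d)"
        using size[of z w] True by (simp add: w z' d_def)
      also have "\<dots> \<le> C0 / (3 ^ i * \<rho> m / 9) ^ (1 + d)"
        using ia(2) pos C0 by (intro divide_left_mono power_mono mult_pos_pos zero_less_power) auto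
      also have "\<dots> = e m i" using mM by (simp add: e_def power_divide)
      finally have "norm (kk z w) * norm (f w) \<le> e m i * norm (f w)" by (rule mult_right_mono) simp
      then have "ennreal (norm (kk z w) * norm (f w)) \<le> ennreal (e m i) * ennreal (norm (f w))"
        using e by (simp add: ennreal_mult[symmetric] ennreal_leI)
      then have "ennreal (norm (kk z w) * norm (f w)) * indicator (half_space - nbhd k x) w
        \<le> ennreal (e m i) * (ennreal (norm (f w) powr 1) * indicator (slice d (k + m) \<times> cube a (K m i) x) w)"
        using True ia sm by (simp add: w d_def)
      also have "\<dots> \<le> csum (\<lambda>(m, i, a). ennreal (e m i) * (ennreal (norm (f w) powr 1) * indicator (slice d (k + m) \<times> cube a (K m i) x) w))"
        using csum_ge[of "\<lambda>(m, i, a). ennreal (e m i) * (ennreal (norm (f w) powr 1) * indicator (slice d (k + m) \<times> cube a (K m i) x) w)" "(m, i, a)"] by simp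
      finally show ?thesis .
    qed auto
    have "(\<integral>\<^sup>+w. ennreal (norm (kk z w) * norm (f w)) * indicator (half_space - nbhd k x) w \<partial>lborel)
      \<le> (\<integral>\<^sup>+w. csum (\<lambda>(m, i, a). ennreal (e m i) * (ennreal (norm (f w) powr 1) * indicator (slice d (k + m) \<times> cube a (K m i) x) w)) \<partial>lborel)"
      by (intro nn_integral_mono pt)
    also have "\<dots> = csum (\<lambda>(m, i, a). ennreal (e m i) * (ennreal (side (K m i) ^ d) * avg a (K m i) (slab 1 f (k + m)) x))"
      unfolding case_prod_beta'
      by (subst csum_swap) (auto simp: nn_integral_cmult nn_integral_slab[OF f, of 1, folded d_def, simplified] intro!: nn_integral_cong)
    also have "\<dots> \<le> csum (\<lambda>(m, i, a). ennreal C * (ennreal (weight M m i) * avg a (K m i) (gavg r f a (k + m)) x))"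
      unfolding case_prod_beta'
    proof (rule nn_integral_mono)
      fix \<nu> :: "int \<times> nat \<times> 'n set"
      obtain m i a where \<nu>: "\<nu> = (m, i, a)" by (metis surj_pair)
      have "avg a (K m i) (slab 1 f (k + m)) x \<le> ennreal (tau d (k + m)) * avg a (K m i) (gavg r f a (k + m)) x"
        unfolding d_def by (rule avg_slab_1_le[OF f r]) (simp add: K_def d_def)
      then have "ennreal (e m i) * (ennreal (side (K m i) ^ d) * avg a (K m i) (slab 1 f (k + m)) x)
        \<le> ennreal (e m i) * (ennreal (side (K m i) ^ d) * (ennreal (tau d (k + m)) * avg a (K m i) (gavg r f a (k + m)) x))"
        by (intro mult_left_mono) auto
      also have "\<dots> = ennreal (e m i * side (K m i) ^ d * tau d (k + m)) * avg a (K m i) (gavg r f a (k + m)) x"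
        using e by (simp add: ennreal_mult less_imp_le mult.assoc)
      also have "\<dots> \<le> ennreal (C * weight M m i) * avg a (K m i) (gavg r f a (k + m)) x"
      proof (intro mult_right_mono ennreal_leI)
        show "e m i * side (K m i) ^ d * tau d (k + m) \<le> C * weight M m i"
        proof (cases "m \<in> M")
          case True
          have "side (K m i) ^ d \<le> (H * (3 ^ i * \<rho> m)) ^ d"
            unfolding K_def H_def \<rho>_def by (intro power_mono side_lev_shift_le) (simp add: less_imp_le)
          then have "e m i * side (K m i) ^ d * tau d (k + m) \<le> e m i * (H * (3 ^ i * \<rho> m)) ^ d * tau d (k + m)"
            using e by (intro mult_right_mono mult_left_mono) (auto simp: less_imp_le)
          \<comment> \<open>The volume of the cube cancels d of the 1 + d powers in the size bound;
            the length of the slice over the remaining power is the weight.\<close>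
          also have "\<dots> = C * (tau d (k + m) / (3 ^ i * \<rho> m))"
            using True \<rho>[of m] by (simp add: e_def C_def power_mult_distrib field_simps)
          also have "tau d (k + m) / (3 ^ i * \<rho> m) = weight M m i"
          proof -
            have "real_of_int (k + m) = real_of_int (max k (k + m)) + real_of_int (min m 0)" by auto
            then have "tau d (k + m) = 3 powr (real_of_int (min m 0) / 2) * \<rho> m"
              by (simp add: \<rho>_def tau_def powr_add[symmetric] add_divide_distrib ac_simps)
            then show ?thesis using True \<rho>[of m] by (simp add: weight_def powr_diff powr_realpow)
          qed
          finally show ?thesis .
        qed (simp add: e_def weight_def)
      qed simp
      also have "\<dots> = ennreal C * (ennreal (weight M m i) * avg a (K m i) (gavg r f a (k + m)) x)"
        using C by (simp add: ennreal_mult weight_def mult.assoc)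
      finally show "ennreal (e (fst \<nu>) (fst (snd \<nu>))) * (ennreal (side (K (fst \<nu>) (fst (snd \<nu>))) ^ d) * avg (snd (snd \<nu>)) (K (fst \<nu>) (fst (snd \<nu>))) (slab 1 f (k + fst \<nu>)) x)
        \<le> ennreal C * (ennreal (weight M (fst \<nu>) (fst (snd \<nu>))) * avg (snd (snd \<nu>)) (K (fst \<nu>) (fst (snd \<nu>))) (gavg r f (snd (snd \<nu>)) (k + fst \<nu>)) x)"
        by (simp add: \<nu>)
    qed
    also have "\<dots> = ennreal C * majorant M r f k x"
      unfolding majorant_def case_prod_beta' csum_cmult K_def d_def ..
    finally show ?thesis .
  qed
  then show ?thesis using C by blast
qed

text \<open>An L^r integral can be controlled by L^1 averages of \<open>gavg\<close> because only
  boundedly many cubes of level k + m lie in the averaging cube when m is in {-4..3}: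
  \<open>avg_le_power_mean\<close> with exponent 1 / r reverses Jensen's inequality at the price of
  the constant N.\<close>

lemma local_integral_le:
  assumes r: "1 \<le> r" and M: "{-4..3} \<subseteq> M"
  shows "\<exists>C\<ge>0. \<forall>(f :: real \<times> (real ^ 'n) \<Rightarrow> complex) k x. f \<in> borel_measurable borel \<longrightarrow>
    (\<integral>\<^sup>+w. ennreal (norm (f w) powr r) * indicator (nbhd k x) w \<partial>lborel)
      \<le> ennreal (C * tau CARD('n) k ^ (1 + CARD('n))) * epowr (majorant M r f k x) r"
proof -
  define d where "d = CARD('n)"
  define H where "H = 3 powr (real_of_int (lev_shift d) / 2) * 9"
  define N where "N = (3 ^ (d + 1) * (3 powr (real_of_int (lev_shift d) / 2) * 9)) ^ d"
  define C1 where "C1 = H ^ d * 9 * N powr (r - 1) * 9 powr r"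
  define T :: "(int \<times> 'n set) set" where "T = {-4..3} \<times> UNIV"
  have T: "finite T" by (simp add: T_def)
  have H: "0 < H" by (simp add: H_def)
  have C1: "0 \<le> C1" using H by (simp add: C1_def)
  have "(\<integral>\<^sup>+w. ennreal (norm (f w) powr r) * indicator (nbhd k x) w \<partial>lborel)
      \<le> ennreal (real (card T) * C1 * tau d k ^ (1 + d)) * epowr (majorant M r f k x) r"
    if f [measurable]: "f \<in> borel_measurable borel" for f :: "real \<times> (real ^ 'n) \<Rightarrow> complex" and k x
  proof -
    define K where "K m = max k (k + m) + (lev_shift d + 2 * int 0)" for m
    have "(\<integral>\<^sup>+w. ennreal (norm (f w) powr r) * indicator (nbhd k x) w \<partial>lborel)
      \<le> (\<integral>\<^sup>+w. (\<Sum>(m, a)\<in>T. ennreal (norm (f w) powr r) * indicator (slice d (k + m) \<times> cube a (K m) x) w) \<partial>lborel)"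
    proof (rule nn_integral_mono)
      fix w
      show "ennreal (norm (f w) powr r) * indicator (nbhd k x) w \<le> (\<Sum>(m, a)\<in>T. ennreal (norm (f w) powr r) * indicator (slice d (k + m) \<times> cube a (K m) x) w)"
      proof (cases "w \<in> nbhd k x")
        case True
        obtain s y where w: "w = (s, y)" by force
        have s: "tau d (k - 5) < s" "s \<le> tau d (k + 3)" "norm (x - y) < 3 * tau d k"
          using True by (auto simp: w nbhd_def dist_norm d_def)
        have "0 < s" using s(1) tau_pos[of d "k - 5"] by (simp del: tau_pos)
        then obtain j where j: "s \<in> slice d j" using ex_slice by blast
        define m where "m = j - k"
        have "-5 < m" using s(1) j tau_mono[of j "k - 5" d] by (force simp: m_def slice_def)
        moreover have "m < 4" using s(2) j tau_mono[of "k + 3" "j - 1" d] by (force simp: m_def slice_def)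
        moreover have "norm (x - y) < 9 / 2 * 3 ^ 0 * tau CARD('n) (max k (k + m))"
          using s(3) tau_mono[of k "max k (k + m)" d] tau_pos[of d k] by (simp add: d_def del: tau_pos)
        then obtain a where "y \<in> cube a (K m) x" using cover_at_scale[of x y 0 "max k (k + m)"] by (auto simp: K_def d_def)
        ultimately have "(m, a) \<in> T" "w \<in> slice d (k + m) \<times> cube a (K m) x" using j by (auto simp: T_def w m_def)
        moreover from this have "(case (m, a) of (m, a) \<Rightarrow> ennreal (norm (f w) powr r) * indicator (slice d (k + m) \<times> cube a (K m) x) w)
          \<le> (\<Sum>(m, a)\<in>T. ennreal (norm (f w) powr r) * indicator (slice d (k + m) \<times> cube a (K m) x) w)"
          using T by (intro member_le_sum) auto
        ultimately show ?thesis using True by simp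
      qed simp
    qed
    also have "\<dots> = (\<Sum>(m, a)\<in>T. ennreal (side (K m) ^ d) * avg a (K m) (slab r f (k + m)) x)"
      unfolding case_prod_beta' by (subst nn_integral_sum) (auto simp: nn_integral_slab[OF f, folded d_def])
    also have "\<dots> \<le> (\<Sum>(m, a)\<in>T. ennreal (C1 * tau d k ^ (1 + d)) * epowr (majorant M r f k x) r)"
    proof (rule sum_mono, clarify)
      fix m a assume "(m, a) \<in> T"
      then have m: "-4 \<le> m" "m \<le> 3" "m \<in> M" using M by (auto simp: T_def)
      have jK: "k + m \<le> K m" by (simp add: K_def d_def)
      have kk: "tau d (max k (k + m)) \<le> 9 * tau d k" using m tau_mono[of "max k (k + m)" "k + 4" d] by (simp add: tau_shift4)
      have sK: "side (K m) \<le> H * tau d k"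
      proof -
        have "side (K m) \<le> 3 powr (real_of_int (lev_shift d) / 2) * (3 ^ 0 * tau d (max k (k + m)))"
          unfolding K_def by (rule side_lev_shift_le)
        also have "\<dots> \<le> 3 powr (real_of_int (lev_shift d) / 2) * (9 * tau d k)" using kk by (intro mult_left_mono) auto
        finally show ?thesis by (simp add: H_def)
      qed
      have NN: "(side (K m) / side (k + m)) ^ d \<le> N"
      proof -
        have "side (K m) \<le> 3 powr (real_of_int (lev_shift d) / 2) * (3 ^ 0 * tau d (max k (k + m)))"
          unfolding K_def by (rule side_lev_shift_le)
        also have "\<dots> \<le> 3 powr (real_of_int (lev_shift d) / 2) * (9 * tau d (k + m))"
          using m tau_mono[of "max k (k + m)" "k + m + 4" d] by (intro mult_left_mono) (auto simp: tau_shift4)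
        also have "\<dots> \<le> 3 powr (real_of_int (lev_shift d) / 2) * (9 * (3 ^ (d + 1) * side (k + m)))"
          by (intro mult_left_mono tau_side) auto
        finally have "side (K m) / side (k + m) \<le> 3 ^ (d + 1) * (3 powr (real_of_int (lev_shift d) / 2) * 9)"
          by (simp add: pos_divide_le_eq mult_ac)
        then show ?thesis unfolding N_def by (intro power_mono) (auto simp: less_imp_le)
      qed
      define Av where "Av = avg a (K m) (gavg r f a (k + m)) x"
      have "avg a (K m) (slab r f (k + m)) x = ennreal (tau d (k + m)) * avg a (K m) (\<lambda>y. epowr (gavg r f a (k + m) y) r) x"
        unfolding d_def using r jK by (intro avg_slab_eq) auto
      also have "avg a (K m) (\<lambda>y. epowr (gavg r f a (k + m) y) r) x
        \<le> ennreal (((side (K m) / side (k + m)) ^ CARD('n)) powr max (1 / (1 / r) - 1) 0)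
          * epowr (avg a (K m) (\<lambda>y. epowr (epowr (gavg r f a (k + m) y) r) (1 / r)) x) (1 / (1 / r))"
        using r jK by (intro avg_le_power_mean) (auto intro: level_comp level_gavg)
      also have "\<dots> = ennreal (((side (K m) / side (k + m)) ^ d) powr (r - 1)) * epowr Av r"
        using r by (simp add: d_def Av_def max_def)
      also have "\<dots> \<le> ennreal (N powr (r - 1)) * epowr Av r"
        using r NN by (intro mult_right_mono ennreal_leI powr_mono2) (auto simp: less_imp_le)
      finally have 1: "avg a (K m) (slab r f (k + m)) x \<le> ennreal (tau d (k + m)) * (ennreal (N powr (r - 1)) * epowr Av r)"
        by (simp add: mult_left_mono)
      have "Av \<le> ennreal 9 * majorant M r f k x"
      proof -
        have "1 / 9 \<le> weight M m 0"
        proof -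
          have "(3::real) powr (-2) \<le> 3 powr (real_of_int (min m 0) / 2 - real 0)" using m by (intro powr_mono) auto
          moreover have "(3::real) powr (-2) = 1 / 9" using powr_minus[of "3 :: real" 2] by simp
          ultimately show ?thesis using m by (simp add: weight_def)
        qed
        then have "ennreal (9 * (1 / 9)) * Av \<le> ennreal (9 * weight M m 0) * Av" by (intro mult_right_mono ennreal_leI) auto
        also have "\<dots> = ennreal 9 * (ennreal (weight M m 0) * Av)" by (subst ennreal_mult) (auto simp: weight_def mult.assoc)
        also have "\<dots> \<le> ennreal 9 * majorant M r f k x"
          unfolding Av_def K_def d_def by (intro mult_left_mono majorant_ge) auto
        finally show ?thesis by simp
      qed
      then have "epowr Av r \<le> ennreal (9 powr r) * epowr (majorant M r f k x) r"
        using r by (subst epowr_real_bound[symmetric]) (auto intro!: epowr_mono)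
      then have "ennreal (side (K m) ^ d) * avg a (K m) (slab r f (k + m)) x
        \<le> ennreal ((H * tau d k) ^ d) * (ennreal (9 * tau d k) * (ennreal (N powr (r - 1)) * (ennreal (9 powr r) * epowr (majorant M r f k x) r)))"
      proof (intro mult_mono order_trans[OF 1] ennreal_leI power_mono sK)
        show "tau d (k + m) \<le> 9 * tau d k" using kk tau_mono[of "k + m" "max k (k + m)" d] by simp
      qed (auto simp: less_imp_le)
      also have "\<dots> = ennreal ((H * tau d k) ^ d * (9 * tau d k) * N powr (r - 1) * 9 powr r) * epowr (majorant M r f k x) r"
        using H by (simp only: ennreal_mult mult_nonneg_nonneg zero_le_power less_imp_le tau_pos zero_le_numeral powr_ge_zero mult.assoc)
      also have "(H * tau d k) ^ d * (9 * tau d k) * N powr (r - 1) * 9 powr r = C1 * tau d k ^ (1 + d)"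
        by (simp add: C1_def power_mult_distrib)
      finally show "ennreal (side (K m) ^ d) * avg a (K m) (slab r f (k + m)) x \<le> ennreal (C1 * tau d k ^ (1 + d)) * epowr (majorant M r f k x) r" .
    qed
    also have "\<dots> = ennreal (real (card T) * C1 * tau d k ^ (1 + d)) * epowr (majorant M r f k x) r"
      using C1 by (simp add: case_prod_beta' ennreal_mult less_imp_le ennreal_of_nat_eq_real_of_nat mult.assoc)
    finally show ?thesis .
  qed
  then show ?thesis using C1 by (intro exI[of _ "real (card T) * C1"]) (auto simp: d_def)
qed


section \<open>The tent norm of the majorant\<close>

lemma one_plus_powr_le_exp:
  fixes u \<delta> :: real
  assumes "0 \<le> u" "0 < \<delta>"
  obtains C where "0 < C" "\<And>n::nat. (1 + real n) powr u \<le> C * 3 powr (\<delta> * real n)"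
proof
  define b where "b = \<delta> * ln 3 / (u + 1)"
  define c where "c = min 1 b"
  have b: "0 < b" using assms by (simp add: b_def)
  then have c: "0 < c" "c \<le> 1" "c \<le> b" by (auto simp: c_def)
  show "0 < c powr (- u)" using c by simp
  fix n :: nat
  have "c * (1 + real n) \<le> 1 + b * real n"
    using c by (simp add: distrib_left add_mono mult_right_mono)
  also have "\<dots> \<le> exp (b * real n)" by (rule exp_ge_add_one_self)
  finally have "(c * (1 + real n)) powr u \<le> exp (b * real n) powr u"
    using c assms by (intro powr_mono2) auto
  also have "\<dots> = exp (u * b * real n)" by (simp add: powr_def mult_ac)
  also have "\<dots> \<le> exp (\<delta> * ln 3 * real n)"
  proof -
    have "u * b \<le> \<delta> * ln 3" using assms by (simp add: b_def pos_divide_le_eq field_simps)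
    then show ?thesis by (simp add: mult_right_mono)
  qed
  also have "\<dots> = 3 powr (\<delta> * real n)" by (simp add: powr_def mult_ac)
  finally have "c powr u * (1 + real n) powr u \<le> 3 powr (\<delta> * real n)"
    using c by (simp add: powr_mult)
  then have "c powr (- u) * (c powr u * (1 + real n) powr u) \<le> c powr (- u) * 3 powr (\<delta> * real n)"
    by (rule mult_left_mono) simp
  moreover have "c powr (- u) * (c powr u * (1 + real n) powr u) = (1 + real n) powr u"
    using c by (simp add: mult.assoc[symmetric] powr_add[symmetric])
  ultimately show "(1 + real n) powr u \<le> c powr (- u) * 3 powr (\<delta> * real n)" by simp
qed

lemma csum_prod:
  fixes f :: "'i::countable \<times> 'j::countable \<Rightarrow> ennreal"
  shows "csum f = csum (\<lambda>i. csum (\<lambda>j. f (i, j)))"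
  using nn_integral_fst_count_space[of f] by simp

lemma csum_nat_geometric:
  assumes "0 < \<delta>"
  shows "csum (\<lambda>n::nat. ennreal (3 powr (- \<delta> * real n))) < top"
proof -
  have "(\<lambda>n. (3 powr - \<delta>) ^ n) = (\<lambda>n::nat. 3 powr (- \<delta> * real n))"
    by (simp add: powr_realpow[symmetric] powr_powr)
  moreover have "3 powr - \<delta> < (1::real)" using assms by (simp add: powr_less_one)
  then have "summable (\<lambda>n. (3 powr - \<delta>) ^ n)" by (intro summable_geometric) auto
  ultimately have "summable (\<lambda>n::nat. 3 powr (- \<delta> * real n))" by simp
  then have "(\<Sum>n. ennreal (3 powr (- \<delta> * real n))) \<noteq> top" by (rule ennreal_suminf_neq_top) simp
  then show ?thesis by (simp add: nn_integral_count_space_nat less_top)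
qed

lemma csum_int_le:
  fixes f :: "int \<Rightarrow> ennreal"
  shows "csum f \<le> csum (\<lambda>n::nat. f (int n)) + csum (\<lambda>n::nat. f (- int n))"
proof -
  have pt: "f k \<le> csum (\<lambda>n::nat. f (int n) * indicator {int n} k + f (- int n) * indicator {- int n} k)" for k
    using csum_ge[of "\<lambda>n::nat. f (int n) * indicator {int n} k + f (- int n) * indicator {- int n} k" "nat \<bar>k\<bar>"]
    by (cases "0 \<le> k") (auto elim!: order_trans[rotated])
  have "csum f \<le> csum (\<lambda>k. csum (\<lambda>n::nat. f (int n) * indicator {int n} k + f (- int n) * indicator {- int n} k))"
    by (intro nn_integral_mono pt)
  also have "\<dots> = csum (\<lambda>n::nat. csum (\<lambda>k. f (int n) * indicator {int n} k + f (- int n) * indicator {- int n} k))"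
    by (rule csum_swap2)
  also have "\<dots> = csum (\<lambda>n::nat. f (int n) + f (- int n))"
    by (subst nn_integral_add) (auto simp: nn_integral_cmult)
  finally show ?thesis by (simp add: nn_integral_add)
qed

lemma csum_index_geometric:
  assumes "0 < \<delta>"
  shows "csum (\<lambda>(m :: int, i :: nat, a :: 'n::finite set). ennreal (3 powr (- \<delta> * real (nat \<bar>m\<bar> + i)))) < top"
proof -
  have eq: "ennreal (3 powr (- \<delta> * real (nat \<bar>m\<bar> + i))) = ennreal (3 powr (- \<delta> * real (nat \<bar>m\<bar>))) * ennreal (3 powr (- \<delta> * real i))" for m :: int and i
    by (simp add: ennreal_mult[symmetric] powr_add[symmetric] distrib_left)
  define A where "A = csum (\<lambda>n::nat. ennreal (3 powr (- \<delta> * real n)))"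
  define cc :: ennreal where "cc = of_nat (card (UNIV :: 'n set set))"
  have cc: "cc < top" unfolding cc_def by (rule of_nat_less_top)
  have A: "A < top" unfolding A_def by (rule csum_nat_geometric[OF assms])
  have "csum (\<lambda>(m :: int, i :: nat, a :: 'n set). ennreal (3 powr (- \<delta> * real (nat \<bar>m\<bar> + i))))
     = csum (\<lambda>m::int. ennreal (3 powr (- \<delta> * real (nat \<bar>m\<bar>))) * (A * cc))"
    unfolding csum_prod split_conv eq csum_cmult
    by (simp add: csum_cmult csum_multc A_def cc_def)
  also have "\<dots> = csum (\<lambda>m::int. ennreal (3 powr (- \<delta> * real (nat \<bar>m\<bar>)))) * (A * cc)"
    by (rule csum_multc)
  also have "\<dots> \<le> (A + A) * (A * cc)"
    using csum_int_le[of "\<lambda>m. ennreal (3 powr (- \<delta> * real (nat \<bar>m\<bar>)))"] by (intro mult_right_mono) (auto simp: A_def)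
  also have "\<dots> < top" using A cc by (simp add: ennreal_mult_less_top)
  finally show ?thesis .
qed

lemma tau_powr_shift: "tau d k powr \<sigma> = 3 powr (- real_of_int m * \<sigma> / 2) * tau d (k + m) powr \<sigma>"
proof -
  have "(real_of_int k / 2 + real d) * \<sigma> = - real_of_int m * \<sigma> / 2 + (real_of_int (k + m) / 2 + real d) * \<sigma>"
    by (simp add: algebra_simps add_divide_distrib)
  then show ?thesis by (simp only: tau_def powr_powr powr_add[symmetric])
qed

text \<open>Each triple (m, i, a) contributes power means of one adapted sequence, controlled by
  \<open>dtn_pmean_le\<close> with polynomial growth, times an exponential factor. The hypotheses on
  \<beta> and M make that factor decay in |m| and i, and \<open>dtn_superposition\<close> sums
  up.\<close>

lemma dtn_majorant_le:
  fixes p q :: ennreal and \<beta> r \<gamma> :: real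
  assumes pq: "0 < p" "0 < q" and r: "1 \<le> r"
    and \<gamma>: "0 < \<gamma>" "real CARD('n) * max (1 / min_exp p q - 1) 0 = 1 - \<gamma>"
    and up: "rcp q - \<beta> > 0 \<or> (\<exists>B. \<forall>m\<in>M. m \<le> B)" and down: "rcp q - \<beta> < \<gamma> \<or> (\<exists>B. \<forall>m\<in>M. B \<le> m)"
  shows "\<exists>C<top. \<forall>f :: real \<times> (real ^ 'n) \<Rightarrow> complex. f \<in> borel_measurable borel \<longrightarrow>
    dtn p q (\<lambda>k x. ennreal (tau CARD('n) k powr (rcp q - \<beta>)) * majorant M r f k x) \<le> C * tent_norm p q r \<beta> f"
proof -
  define d where "d = CARD('n)"
  define \<sigma> where "\<sigma> = rcp q - \<beta>"
  define \<mu> where "\<mu> = min_exp p q"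
  have \<mu>: "0 < \<mu>" unfolding \<mu>_def by (rule min_exp_pos[OF pq])
  define \<theta> where "\<theta> = max (1 / \<mu> - 1) 0"
  have \<theta>: "0 \<le> \<theta>" "real d * \<theta> = 1 - \<gamma>" using \<gamma>(2) by (simp_all add: \<theta>_def \<mu>_def d_def)
  define J where "J = lev_shift d"
  define c1 where "c1 = (3 powr (real d + 1 + real_of_int J / 2)) powr (1 - \<gamma>)"
  \<comment> \<open>The exponent collects the weight, the factor 3^(-m \<sigma>/2) from moving
    tau^\<sigma> to scale k + m, and the loss (max (-m) 0 / 2 + i)(1 - \<gamma>) from counting
    subcubes. It equals -m \<sigma>/2 - i \<gamma> for m \<ge> 0 and m (\<gamma> - \<sigma>)/2 - i
    \<gamma> for m < 0. So decay upwards means \<sigma> > 0 and decay downwards means \<sigma> <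
    \<gamma>, unless M is bounded in that direction.\<close>
  obtain \<eta> c2 where \<eta>: "0 < \<eta>" and c2: "0 < c2"
    and expo: "\<And>m i. m \<in> M \<Longrightarrow>
      3 powr (real_of_int (min m 0) / 2 - real i - real_of_int m * \<sigma> / 2 + (real_of_int (max (- m) 0) / 2 + real i) * (1 - \<gamma>))
        \<le> c2 * 3 powr (- \<eta> * real (nat \<bar>m\<bar> + i))"
  proof -
    have "\<exists>\<eta>>0. \<exists>c. \<forall>m\<in>M. 0 \<le> m \<longrightarrow> - real_of_int m * \<sigma> / 2 \<le> c - \<eta> * real_of_int m"
    proof (cases "0 < \<sigma>")
      case True
      then show ?thesis by (intro exI[of _ "\<sigma> / 2"] conjI exI[of _ 0]) (auto simp: mult.commute)
    next
      \<comment> \<open>On a set bounded above every exponential rate is available at the price of a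
        constant; the rate 1 is taken.\<close>
      case False
      then obtain B where B: "\<forall>m\<in>M. m \<le> B" using up by (auto simp: \<sigma>_def)
      have "- real_of_int m * \<sigma> / 2 \<le> (1 - \<sigma> / 2) * \<bar>real_of_int B\<bar> - 1 * real_of_int m" if "m \<in> M" "0 \<le> m" for m
      proof -
        have "(1 - \<sigma> / 2) * real_of_int m \<le> (1 - \<sigma> / 2) * \<bar>real_of_int B\<bar>"
          using that B False by (intro mult_left_mono) (auto intro: order_trans[OF _ abs_ge_self])
        then show ?thesis by (simp add: algebra_simps)
      qed
      then show ?thesis by (intro exI[of _ 1]) auto
    qed
    then obtain \<eta>1 k1 where 1: "0 < \<eta>1" "\<And>m. m \<in> M \<Longrightarrow> 0 \<le> m \<Longrightarrow> - real_of_int m * \<sigma> / 2 \<le> k1 - \<eta>1 * real_of_int m" by blast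
    have "\<exists>\<eta>>0. \<exists>c. \<forall>m\<in>M. m < 0 \<longrightarrow> real_of_int m * (\<gamma> - \<sigma>) / 2 \<le> c + \<eta> * real_of_int m"
    proof (cases "\<sigma> < \<gamma>")
      case True
      then show ?thesis by (intro exI[of _ "(\<gamma> - \<sigma>) / 2"] conjI exI[of _ 0]) (auto simp: mult.commute)
    next
      case False
      then obtain B where B: "\<forall>m\<in>M. B \<le> m" using down by (auto simp: \<sigma>_def)
      have "real_of_int m * (\<gamma> - \<sigma>) / 2 \<le> (1 + (\<sigma> - \<gamma>) / 2) * \<bar>real_of_int B\<bar> + 1 * real_of_int m" if "m \<in> M" "m < 0" for m
      proof -
        have "- real_of_int m \<le> \<bar>real_of_int B\<bar>" using B that by force
        then have "(1 + (\<sigma> - \<gamma>) / 2) * (- real_of_int m) \<le> (1 + (\<sigma> - \<gamma>) / 2) * \<bar>real_of_int B\<bar>"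
          using False by (intro mult_left_mono) auto
        then show ?thesis by (simp add: algebra_simps)
      qed
      then show ?thesis by (intro exI[of _ 1]) auto
    qed
    then obtain \<eta>2 k2 where 2: "0 < \<eta>2" "\<And>m. m \<in> M \<Longrightarrow> m < 0 \<Longrightarrow> real_of_int m * (\<gamma> - \<sigma>) / 2 \<le> k2 + \<eta>2 * real_of_int m" by blast
    define \<eta> where "\<eta> = min \<gamma> (min \<eta>1 \<eta>2)"
    have \<eta>: "0 < \<eta>" "\<eta> \<le> \<gamma>" "\<eta> \<le> \<eta>1" "\<eta> \<le> \<eta>2" using \<gamma> 1 2 by (auto simp: \<eta>_def)
    define k0 where "k0 = max k1 k2"
    have ex: "real_of_int (min m 0) / 2 - real i - real_of_int m * \<sigma> / 2 + (real_of_int (max (- m) 0) / 2 + real i) * (1 - \<gamma>)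
        \<le> k0 + - \<eta> * real (nat \<bar>m\<bar> + i)" if m: "m \<in> M" for m i
    proof -
      have i: "\<eta> * real i \<le> \<gamma> * real i" using \<eta> by (intro mult_right_mono) auto
      show ?thesis
      proof (cases "0 \<le> m")
        case True
        have "\<eta> * real_of_int m \<le> \<eta>1 * real_of_int m" using \<eta> True by (intro mult_right_mono) auto
        then have "- real_of_int m * \<sigma> / 2 \<le> k0 - \<eta> * real_of_int m" using 1(2)[OF m True] by (simp add: k0_def)
        then show ?thesis using True i by (simp add: algebra_simps)
      next
        case False
        have "\<eta> * (- real_of_int m) \<le> \<eta>2 * (- real_of_int m)" using \<eta> False by (intro mult_right_mono) auto
        then have "real_of_int m * (\<gamma> - \<sigma>) / 2 \<le> k0 + \<eta> * real_of_int m"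
        proof -
          have "k2 \<le> k0" by (simp add: k0_def)
          moreover have "real_of_int m * (\<gamma> - \<sigma>) / 2 \<le> k2 + \<eta>2 * real_of_int m" using 2(2)[OF m] False by simp
          ultimately show ?thesis using \<open>\<eta> * (- real_of_int m) \<le> \<eta>2 * (- real_of_int m)\<close> by simp
        qed
        then show ?thesis using False i by (simp add: min_def max_def algebra_simps add_divide_distrib diff_divide_distrib)
      qed
    qed
    show thesis
    proof (rule that[OF \<eta>(1), of "3 powr k0"])
      fix m i assume "m \<in> M"
      then show "3 powr (real_of_int (min m 0) / 2 - real i - real_of_int m * \<sigma> / 2 + (real_of_int (max (- m) 0) / 2 + real i) * (1 - \<gamma>))
          \<le> 3 powr k0 * 3 powr (- \<eta> * real (nat \<bar>m\<bar> + i))"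
        unfolding powr_add[symmetric] by (intro powr_mono ex) auto
    qed simp
  qed
  define E :: "int \<times> nat \<times> 'n set \<Rightarrow> real" where "E = (\<lambda>(m, i, a). c1 * c2 * 3 powr (- \<eta> * real (nat \<bar>m\<bar> + i)))"
  have E: "0 \<le> E \<nu>" for \<nu> using c2 by (auto simp: E_def c1_def split: prod.split)
  obtain Cp \<kappa> where Cp: "0 \<le> Cp" "0 \<le> \<kappa>" and pm: "\<And>(g :: int \<Rightarrow> real ^ 'n \<Rightarrow> ennreal) a m j.
    (\<forall>k. g k \<in> borel_measurable borel) \<Longrightarrow> (\<forall>k. level a k (g k)) \<Longrightarrow> 0 \<le> j \<Longrightarrow>
    dtn p q (\<lambda>k. pmean \<mu> a (max k (k + m) + j) (g (k + m))) \<le> ennreal (Cp * real (nat \<bar>m\<bar> + nat j + 2) powr \<kappa>) * dtn p q g"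
    using dtn_pmean_le[OF pq, where 'n='n] unfolding \<mu>_def by blast
  define h :: "int \<times> nat \<times> 'n set \<Rightarrow> real" where "h = (\<lambda>(m, i, a). Cp * real (nat \<bar>m\<bar> + nat (J + 2 * int i) + 2) powr \<kappa>)"
  have h: "0 \<le> h \<nu>" for \<nu> using Cp by (auto simp: h_def split: prod.split)
  \<comment> \<open>E decays exponentially in n = |m| + i and h grows polynomially; half of the
    decay is spent on the power of 1 + h.\<close>
  have sum: "csum (\<lambda>\<nu>. ennreal (E \<nu> powr s * (1 + h \<nu>) powr t)) < top" if s: "0 < s" and t: "0 \<le> t" for s t
  proof -
    obtain C where C: "0 < C" "\<And>n::nat. (1 + real n) powr (\<kappa> * t) \<le> C * 3 powr ((\<eta> * s / 2) * real n)"
      using one_plus_powr_le_exp[of "\<kappa> * t" "\<eta> * s / 2"] Cp \<eta> s t by (auto simp del: of_nat_add)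
    define c3 where "c3 = real (nat J) + 4"
    define c4 where "c4 = (c1 * c2) powr s * (1 + Cp * c3 powr \<kappa>) powr t * C"
    have c4: "0 \<le> c4" using C by (simp add: c4_def)
    have "E \<nu> powr s * (1 + h \<nu>) powr t \<le> c4 * (\<lambda>(m, i, a). 3 powr (- (\<eta> * s / 2) * real (nat \<bar>m\<bar> + i))) \<nu>" for \<nu>
    proof -
      obtain m i a where \<nu>: "\<nu> = (m, i, a)" by (metis surj_pair)
      define n where "n = nat \<bar>m\<bar> + i"
      have "real (nat \<bar>m\<bar> + nat (J + 2 * int i) + 2) \<le> c3 * (1 + real n)"
      proof -
        have "nat (J + 2 * int i) = nat J + 2 * i" by (simp add: J_def nat_add_distrib)
        then show ?thesis by (simp add: c3_def n_def algebra_simps)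
      qed
      then have "real (nat \<bar>m\<bar> + nat (J + 2 * int i) + 2) powr \<kappa> \<le> c3 powr \<kappa> * (1 + real n) powr \<kappa>"
        using Cp by (subst powr_mult[symmetric]) (auto simp: c3_def intro!: powr_mono2)
      then have "h \<nu> \<le> Cp * c3 powr \<kappa> * (1 + real n) powr \<kappa>"
        unfolding h_def \<nu> split_conv mult.assoc using Cp by (intro mult_left_mono)
      moreover have "1 \<le> (1 + real n) powr \<kappa>" using Cp by (simp add: ge_one_powr_ge_zero)
      ultimately have "1 + h \<nu> \<le> (1 + Cp * c3 powr \<kappa>) * (1 + real n) powr \<kappa>" by (simp add: distrib_right)
      then have "(1 + h \<nu>) powr t \<le> ((1 + Cp * c3 powr \<kappa>) * (1 + real n) powr \<kappa>) powr t"
        using t h[of \<nu>] by (intro powr_mono2) auto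
      also have "\<dots> = (1 + Cp * c3 powr \<kappa>) powr t * (1 + real n) powr (\<kappa> * t)"
        using Cp by (simp add: powr_mult powr_powr)
      also have "\<dots> \<le> (1 + Cp * c3 powr \<kappa>) powr t * (C * 3 powr ((\<eta> * s / 2) * real n))"
        by (intro mult_left_mono C) auto
      finally have "E \<nu> powr s * (1 + h \<nu>) powr t \<le> E \<nu> powr s * ((1 + Cp * c3 powr \<kappa>) powr t * (C * 3 powr ((\<eta> * s / 2) * real n)))"
        by (rule mult_left_mono) simp
      also have Eeq: "E \<nu> powr s = (c1 * c2) powr s * 3 powr (- \<eta> * s * real n)"
        using c2 by (simp add: E_def \<nu> n_def powr_mult powr_powr c1_def mult_ac)
      also have "(c1 * c2) powr s * 3 powr (- \<eta> * s * real n) * ((1 + Cp * c3 powr \<kappa>) powr t * (C * 3 powr ((\<eta> * s / 2) * real n)))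
        = c4 * (3 powr (- \<eta> * s * real n) * 3 powr ((\<eta> * s / 2) * real n))" by (simp add: c4_def mult_ac)
      also have "3 powr (- \<eta> * s * real n) * 3 powr ((\<eta> * s / 2) * real n) = 3 powr (- (\<eta> * s / 2) * real n)"
        unfolding powr_add[symmetric] by (simp add: field_simps)
      finally show ?thesis unfolding Eeq[symmetric] by (simp add: \<nu> n_def)
    qed
    then have "csum (\<lambda>\<nu>. ennreal (E \<nu> powr s * (1 + h \<nu>) powr t))
      \<le> csum (\<lambda>\<nu>. ennreal c4 * (\<lambda>(m, i, a :: 'n set). ennreal (3 powr (- (\<eta> * s / 2) * real (nat \<bar>m\<bar> + i)))) \<nu>)"
      using c4 by (intro nn_integral_mono) (auto simp: ennreal_mult[symmetric] intro!: ennreal_leI split: prod.splits)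
    also have "\<dots> = ennreal c4 * csum (\<lambda>(m, i, a :: 'n set). ennreal (3 powr (- (\<eta> * s / 2) * real (nat \<bar>m\<bar> + i))))"
      by (rule csum_cmult)
    also have "\<dots> < top"
      using csum_index_geometric[where 'n='n, of "\<eta> * s / 2"] \<eta> s by (simp add: ennreal_mult_less_top)
    finally show ?thesis .
  qed
  obtain C2 where C2: "C2 < top" and super: "\<And>(b :: int \<times> nat \<times> 'n set \<Rightarrow> int \<Rightarrow> real ^ 'n \<Rightarrow> ennreal) D.
    (\<forall>\<nu> k. b \<nu> k \<in> borel_measurable borel) \<Longrightarrow> (\<forall>\<nu>. dtn p q (b \<nu>) \<le> ennreal (h \<nu>) * D) \<Longrightarrow>
    dtn p q (\<lambda>k x. csum (\<lambda>\<nu>. ennreal (E \<nu>) * b \<nu> k x)) \<le> C2 * D"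
    using dtn_superposition[OF pq E h sum, where 'n='n] by blast
  obtain C3 where C3: "C3 < top" and tent: "\<And>(F :: real \<times> (real ^ 'n) \<Rightarrow> complex) G a. F \<in> borel_measurable half_leb \<Longrightarrow>
    (\<forall>k. G k \<in> borel_measurable borel) \<Longrightarrow> (\<forall>k. level a k (G k)) \<Longrightarrow>
    (\<forall>k t x. t \<in> whit CARD('n) k \<longrightarrow> G k x \<le> whitney_avg r F t x) \<Longrightarrow>
    dtn p q (\<lambda>k x. ennreal (tau CARD('n) k powr (rcp q - \<beta>)) * G k x) \<le> C3 * tent_norm p q r \<beta> F"
    using dtn_le_tent_norm[OF pq, where 'n='n and \<beta>=\<beta> and r=r] by blast
  obtain A where A: "0 < A" and gw: "\<And>(f :: real \<times> (real ^ 'n) \<Rightarrow> complex) a k t x. f \<in> borel_measurable borel \<Longrightarrow>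
    t \<in> whit CARD('n) k \<Longrightarrow> ennreal A * gavg r f a k x \<le> whitney_avg r f t x"
    using gavg_le_whitney[OF r, where 'n='n] by blast
  have "dtn p q (\<lambda>k x. ennreal (tau CARD('n) k powr (rcp q - \<beta>)) * majorant M r f k x) \<le> (C2 * (ennreal (1 / A) * C3)) * tent_norm p q r \<beta> f"
    if f [measurable]: "f \<in> borel_measurable borel" for f :: "real \<times> (real ^ 'n) \<Rightarrow> complex"
  proof -
    \<comment> \<open>The weight tau^\<sigma> is built into the sequence before averaging, so that
      the sequence stays adapted and its norm is directly comparable with the tent norm.\<close>
    define g where "g a k x = ennreal (tau d k powr \<sigma>) * gavg r f a k x" for a k x
    define T where "T = tent_norm p q r \<beta> f"
    have [measurable]: "g a k \<in> borel_measurable borel" for a k unfolding g_def[abs_def] by measurable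
    have lg: "level a k (g a k)" for a k unfolding g_def[abs_def] by (rule level_comp[OF level_gavg])
    have gT: "dtn p q (g a) \<le> (ennreal (1 / A) * C3) * T" for a
    proof -
      have "dtn p q (\<lambda>k x. ennreal (tau CARD('n) k powr (rcp q - \<beta>)) * (ennreal A * gavg r f a k x)) \<le> C3 * T"
        unfolding T_def
      proof (rule tent)
        show "f \<in> borel_measurable half_leb" by (intro measurable_restrict_space1 measurable_completion) simp
        show "\<forall>k. level a k (\<lambda>x. ennreal A * gavg r f a k x)" by (auto intro: level_comp[OF level_gavg])
      qed (auto intro: gw)
      also have "(\<lambda>k x. ennreal (tau CARD('n) k powr (rcp q - \<beta>)) * (ennreal A * gavg r f a k x)) = (\<lambda>k x. ennreal A * g a k x)"
        by (auto simp: g_def d_def \<sigma>_def mult_ac)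
      also have "dtn p q \<dots> = ennreal A * dtn p q (g a)" by (rule dtn_cmult) (use pq in auto)
      finally have "ennreal (1 / A) * (ennreal A * dtn p q (g a)) \<le> ennreal (1 / A) * (C3 * T)" by (rule mult_left_mono) simp
      moreover have "ennreal (1 / A) * (ennreal A * dtn p q (g a)) = dtn p q (g a)"
        using A by (simp add: mult.assoc[symmetric] flip: ennreal_mult)
      ultimately show ?thesis by (simp add: mult.assoc)
    qed
    define b where "b = (\<lambda>(m, i, a) k. pmean \<mu> a (max k (k + m) + (J + 2 * int i)) (g a (k + m)))"
    have step: "ennreal (tau CARD('n) k powr (rcp q - \<beta>)) * majorant M r f k x \<le> csum (\<lambda>\<nu>. ennreal (E \<nu>) * b \<nu> k x)" for k x
      unfolding majorant_def csum_cmult[symmetric]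
    proof (rule nn_integral_mono)
      fix \<nu> :: "int \<times> nat \<times> 'n set"
      obtain m i a where \<nu>: "\<nu> = (m, i, a)" by (metis surj_pair)
      define K where "K = max k (k + m) + (J + 2 * int i)"
      show "ennreal (tau CARD('n) k powr (rcp q - \<beta>)) * (case \<nu> of (m, i, a) \<Rightarrow> ennreal (weight M m i) *
         avg a (max k (k + m) + (lev_shift CARD('n) + 2 * int i)) (gavg r f a (k + m)) x) \<le> ennreal (E \<nu>) * b \<nu> k x"
      proof (cases "m \<in> M")
        case True
        have "ennreal (tau d k powr \<sigma>) * (ennreal (weight M m i) * avg a K (gavg r f a (k + m)) x)
          = ennreal (weight M m i * 3 powr (- real_of_int m * \<sigma> / 2)) * avg a K (g a (k + m)) x"
          unfolding g_def[abs_def] avg_cmult[OF gavg_measurable[OF f]] tau_powr_shift[of d k \<sigma> m]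
          by (simp add: ennreal_mult weight_def mult_ac)
        also have "\<dots> \<le> ennreal (weight M m i * 3 powr (- real_of_int m * \<sigma> / 2)) *
            (ennreal (((side K / side (k + m)) ^ d) powr \<theta>) * pmean \<mu> a K (g a (k + m)) x)"
          unfolding pmean_def \<theta>_def d_def
          by (intro mult_left_mono avg_le_power_mean) (auto simp: lg K_def J_def \<mu>)
        also have "\<dots> \<le> ennreal (weight M m i * 3 powr (- real_of_int m * \<sigma> / 2)) *
            (ennreal (c1 * 3 powr ((real_of_int (max (- m) 0) / 2 + real i) * (1 - \<gamma>))) * pmean \<mu> a K (g a (k + m)) x)"
        proof (intro mult_left_mono mult_right_mono ennreal_leI)
          \<comment> \<open>An upper bound for the base 3 logarithm of the ratio of the sides: half
            the difference of the levels, plus d + 1 for passing from \<open>tau\<close> back to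
            \<open>side\<close>.\<close>
          define w where "w = real d + 1 + real_of_int J / 2 + (real_of_int (max (- m) 0) / 2 + real i)"
          have "side K \<le> side K * 3 ^ d" by (simp add: less_imp_le)
          also have "\<dots> \<le> tau d K" by (rule side_tau)
          also have "\<dots> = 3 powr (w - real d - 1) * tau d (k + m)"
          proof -
            have "K = (k + m) + (max (- m) 0 + J + 2 * int i)" by (simp add: K_def)
            then show ?thesis by (simp only: tau_add) (simp add: w_def add_divide_distrib ac_simps)
          qed
          also have "\<dots> \<le> 3 powr (w - real d - 1) * (3 ^ (d + 1) * side (k + m))" by (intro mult_left_mono tau_side) simp
          also have "\<dots> = 3 powr w * side (k + m)"
          proof -
            have "(3::real) ^ (d + 1) = 3 powr (real d + 1)" by (simp add: powr_add powr_realpow)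
            then show ?thesis by (simp only: mult.assoc[symmetric] powr_add[symmetric]) simp
          qed
          finally have "side K / side (k + m) \<le> 3 powr w" by (simp add: pos_divide_le_eq)
          then have "((side K / side (k + m)) ^ d) powr \<theta> \<le> ((3 powr w) ^ d) powr \<theta>"
            using \<theta> by (intro powr_mono2 power_mono) (auto simp: less_imp_le)
          also have "\<dots> = 3 powr (w * (1 - \<gamma>))"
            unfolding \<theta>(2)[symmetric] by (simp add: powr_realpow[symmetric] powr_powr mult_ac)
          also have "\<dots> = c1 * 3 powr ((real_of_int (max (- m) 0) / 2 + real i) * (1 - \<gamma>))"
            unfolding c1_def powr_powr powr_add[symmetric] w_def by (simp add: distrib_right)
          finally show "((side K / side (k + m)) ^ d) powr \<theta> \<le> c1 * 3 powr ((real_of_int (max (- m) 0) / 2 + real i) * (1 - \<gamma>))" .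
        qed auto
        also have "\<dots> = ennreal (c1 * (weight M m i * 3 powr (- real_of_int m * \<sigma> / 2) * 3 powr ((real_of_int (max (- m) 0) / 2 + real i) * (1 - \<gamma>)))) * pmean \<mu> a K (g a (k + m)) x"
          by (simp add: ennreal_mult weight_def c1_def mult_ac)
        also have "weight M m i * 3 powr (- real_of_int m * \<sigma> / 2) * 3 powr ((real_of_int (max (- m) 0) / 2 + real i) * (1 - \<gamma>))
          = 3 powr (real_of_int (min m 0) / 2 - real i - real_of_int m * \<sigma> / 2 + (real_of_int (max (- m) 0) / 2 + real i) * (1 - \<gamma>))"
          using True by (simp add: weight_def powr_add[symmetric] diff_conv_add_uminus del: add_uminus_conv_diff)
        also have "ennreal (c1 * \<dots>) * pmean \<mu> a K (g a (k + m)) x \<le> ennreal (E \<nu>) * pmean \<mu> a K (g a (k + m)) x"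
        proof (intro mult_right_mono ennreal_leI)
          have "0 \<le> c1" by (simp add: c1_def)
          from mult_left_mono[OF expo[OF True, of i] this] show "c1 * 3 powr (real_of_int (min m 0) / 2 - real i - real_of_int m * \<sigma> / 2 + (real_of_int (max (- m) 0) / 2 + real i) * (1 - \<gamma>)) \<le> E \<nu>"
            by (simp add: E_def \<nu> mult.assoc)
        qed simp
        finally show ?thesis by (simp add: \<nu> b_def K_def J_def d_def \<sigma>_def)
      qed (simp add: \<nu> weight_def)
    qed
    have "dtn p q (\<lambda>k x. ennreal (tau CARD('n) k powr (rcp q - \<beta>)) * majorant M r f k x)
       \<le> dtn p q (\<lambda>k x. csum (\<lambda>\<nu>. ennreal (E \<nu>) * b \<nu> k x))"
      by (rule dtn_mono[OF pq step])
    also have "\<dots> \<le> C2 * ((ennreal (1 / A) * C3) * T)"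
    proof (rule super)
      show "\<forall>\<nu> k. b \<nu> k \<in> borel_measurable borel" by (auto simp: b_def split: prod.split)
      show "\<forall>\<nu>. dtn p q (b \<nu>) \<le> ennreal (h \<nu>) * ((ennreal (1 / A) * C3) * T)"
      proof
        fix \<nu> :: "int \<times> nat \<times> 'n set"
        obtain m i a where \<nu>: "\<nu> = (m, i, a)" by (metis surj_pair)
        have "dtn p q (b \<nu>) \<le> ennreal (h \<nu>) * dtn p q (g a)"
          unfolding \<nu> b_def h_def split_conv by (rule pm) (auto simp: lg J_def)
        also have "\<dots> \<le> ennreal (h \<nu>) * ((ennreal (1 / A) * C3) * T)" by (intro mult_left_mono gT) simp
        finally show "dtn p q (b \<nu>) \<le> ennreal (h \<nu>) * ((ennreal (1 / A) * C3) * T)" .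
      qed
    qed
    finally show ?thesis by (simp add: T_def mult.assoc)
  qed
  moreover have "C2 * (ennreal (1 / A) * C3) < top" using C2 C3 by (simp add: ennreal_mult_less_top)
  ultimately show ?thesis by blast
qed


section \<open>Extension of the operator\<close>

text \<open>The r-th power of the norm; limits and comparisons are then free of roots.\<close>

definition Ir :: "real \<Rightarrow> (real \<times> (real ^ 'n) \<Rightarrow> complex) \<Rightarrow> ennreal" where
  "Ir r f = (\<integral>\<^sup>+z. ennreal (norm (f z) powr r) \<partial>half_leb)"

lemma Lr_norm_Ir: "Lr_norm r f = epowr (Ir r f) (1 / r)"
  by (simp add: Lr_norm_def Ir_def)

lemma space_Lr_iff: "f \<in> space_of (Lr_norm r) \<longleftrightarrow> f \<in> borel_measurable half_leb \<and> Ir r f < top"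
  by (simp add: space_of_def Lr_norm_Ir)

lemma Ir_cong_AE: "AE z in half_leb. f z = g z \<Longrightarrow> Ir r f = Ir r g"
  unfolding Ir_def by (intro nn_integral_cong_AE) (auto elim: eventually_mono)

lemma Ir_mono_AE: "0 < r \<Longrightarrow> AE z in half_leb. norm (f z) \<le> norm (g z) \<Longrightarrow> Ir r f \<le> Ir r g"
  unfolding Ir_def by (intro nn_integral_mono_AE) (auto elim!: eventually_mono intro!: ennreal_leI powr_mono2)

lemma norm_add_powr_le:
  fixes a b :: "'a::real_normed_vector"
  assumes "0 < r"
  shows "ennreal (norm (a + b) powr r) \<le> ennreal (2 powr r) * (ennreal (norm a powr r) + ennreal (norm b powr r))"
proof -
  have "ennreal (norm (a + b) powr r) \<le> epowr (ennreal (norm a) + ennreal (norm b)) r"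
    using assms norm_triangle_ineq[of a b] by (simp add: powr_mono2 ennreal_leI flip: ennreal_plus)
  also have "\<dots> \<le> ennreal (2 powr r) * (epowr (ennreal (norm a)) r + epowr (ennreal (norm b)) r)"
    by (rule epowr_max_sum[OF assms])
  finally show ?thesis by simp
qed

lemma Ir_add_le:
  assumes [measurable]: "f \<in> borel_measurable half_leb" "g \<in> borel_measurable half_leb" and r: "0 < r"
  shows "Ir r (\<lambda>z. f z + g z) \<le> ennreal (2 powr r) * (Ir r f + Ir r g)"
proof -
  have "Ir r (\<lambda>z. f z + g z) \<le> (\<integral>\<^sup>+z. ennreal (2 powr r) * (ennreal (norm (f z) powr r) + ennreal (norm (g z) powr r)) \<partial>half_leb)"
    unfolding Ir_def by (intro nn_integral_mono norm_add_powr_le r)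
  also have "\<dots> = ennreal (2 powr r) * (Ir r f + Ir r g)"
    unfolding Ir_def by (simp add: nn_integral_cmult nn_integral_add)
  finally show ?thesis .
qed

lemma Ir_cmult:
  assumes "f \<in> borel_measurable half_leb" "0 < r"
  shows "Ir r (\<lambda>z. c * f z) = ennreal (norm c powr r) * Ir r f"
  unfolding Ir_def using assms
  by (subst nn_integral_cmult[symmetric]) (auto simp: norm_mult powr_mult ennreal_mult)

lemma Ir_0_iff:
  assumes "f \<in> borel_measurable half_leb"
  shows "Ir r f = 0 \<longleftrightarrow> (AE z in half_leb. f z = 0)"
  unfolding Ir_def using assms
  by (subst nn_integral_0_iff_AE) (auto simp: not_le elim!: eventually_mono)

lemma measurable_half_leb_borel: "f \<in> borel_measurable borel \<Longrightarrow> f \<in> borel_measurable half_leb"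
  by (intro measurable_restrict_space1 measurable_completion) simp

lemma measurable_half_leb_AE:
  fixes f g :: "real \<times> (real ^ 'n) \<Rightarrow> complex"
  assumes "f \<in> borel_measurable half_leb" "AE z in half_leb. f z = g z"
  shows "g \<in> borel_measurable half_leb"
proof -
  have hs: "half_space \<inter> space lebesgue \<in> sets (lebesgue :: (real \<times> (real ^ 'n)) measure)"
    using half_space_borel by (auto intro: sets_completionI_sets)
  have "(\<lambda>z. indicator half_space z *\<^sub>R f z) \<in> borel_measurable lebesgue"
    using assms(1) borel_measurable_restrict_space_iff[OF hs, of f] by simp
  moreover have "AE z in lebesgue. indicator half_space z *\<^sub>R f z = indicator half_space z *\<^sub>R g z"
    unfolding AE_lborel_iff using assms(2) unfolding AE_half_leb
  proof eventually_elim
    case (elim z)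
    then show ?case by (cases "z \<in> half_space") auto
  qed
  ultimately have "(\<lambda>z. indicator half_space z *\<^sub>R g z) \<in> borel_measurable lebesgue"
    by (rule borel_measurable_AE)
  then show ?thesis using borel_measurable_restrict_space_iff[OF hs, of g] by simp
qed

lemma restrict_borel:
  assumes [measurable]: "K \<in> sets borel" "f \<in> borel_measurable borel"
  shows "restrict_to K f \<in> borel_measurable borel"
  unfolding restrict_to_def[abs_def] by measurable

lemma restrict_measurable:
  fixes f :: "real \<times> (real ^ 'n) \<Rightarrow> complex"
  assumes "K \<in> sets borel" "f \<in> borel_measurable half_leb"
  shows "restrict_to K f \<in> borel_measurable half_leb"
proof -
  have "indicator K \<in> borel_measurable half_leb"
    using assms(1) by (intro measurable_half_leb_borel) simp
  then show ?thesis unfolding restrict_to_def[abs_def] using assms(2) by (rule borel_measurable_times)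
qed

definition trunc :: "nat \<Rightarrow> ('a \<Rightarrow> complex) \<Rightarrow> 'a \<Rightarrow> complex" where
  "trunc j g w = (if norm (g w) \<le> real j then g w else 0)"

lemma trunc_eventually: "\<forall>\<^sub>F j in sequentially. trunc j g w = g w"
proof -
  obtain n :: nat where "norm (g w) \<le> real n" using real_arch_simple by blast
  then show ?thesis unfolding eventually_sequentially by (intro exI[of _ n]) (auto simp: trunc_def)
qed

lemma trunc_measurable:
  assumes [measurable]: "g \<in> borel_measurable M"
  shows "trunc j g \<in> borel_measurable M"
  unfolding trunc_def[abs_def] by measurable

lemma Ir_trunc_tendsto:
  fixes g :: "real \<times> (real ^ 'n) \<Rightarrow> complex"
  assumes g [measurable]: "g \<in> borel_measurable half_leb" and fin: "Ir r g < top" and r0: "0 < r"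
  shows "(\<lambda>j. Ir r (\<lambda>w. trunc j g w - g w)) \<longlonglongrightarrow> 0"
proof -
  note trunc_measurable[OF g, measurable]
  have "(\<lambda>j. \<integral>\<^sup>+z. ennreal (norm (trunc j g z - g z) powr r) \<partial>half_leb) \<longlonglongrightarrow> (\<integral>\<^sup>+z. 0 \<partial>(half_leb :: (real \<times> (real ^ 'n)) measure))"
  proof (rule nn_integral_dominated_convergence[where w="\<lambda>z. ennreal (norm (g z) powr r)"])
    show "AE z in half_leb. ennreal (norm (trunc j g z - g z) powr r) \<le> ennreal (norm (g z) powr r)" for j
      by (rule AE_I2) (simp add: trunc_def)
    show "AE z in half_leb. (\<lambda>j. ennreal (norm (trunc j g z - g z) powr r)) \<longlonglongrightarrow> 0"
      by (rule AE_I2, rule tendsto_eventually, rule eventually_mono[OF trunc_eventually]) (simp add: r0)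
  qed (use fin in \<open>auto simp: Ir_def\<close>)
  then show ?thesis by (simp add: Ir_def)
qed

text \<open>The data extracted from the hypotheses: \<open>kap\<close> is a Borel version of the kernel that vanishes
  outside the half-space, \<open>M\<close> is the set of relative time scales on which it lives, and
  \<open>off\<close> says that \<open>A0\<close> is given by the kernel away from the support of the argument.\<close>

locale tent_operator =
  fixes r :: real and kap :: "real \<times> (real ^ 'n) \<Rightarrow> real \<times> (real ^ 'n) \<Rightarrow> complex"
    and A0 :: "(real \<times> (real ^ 'n) \<Rightarrow> complex) \<Rightarrow> real \<times> (real ^ 'n) \<Rightarrow> complex" and M :: "int set" and C0 :: real
  assumes r: "1 < r"
    and kap_measurable: "(\<lambda>(z, w). kap z w) \<in> borel_measurable borel"
    and C0: "0 \<le> C0"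
    and kap_size: "\<And>z w. z \<in> half_space \<Longrightarrow> w \<in> half_space \<Longrightarrow> z \<noteq> w \<Longrightarrow>
      norm (kap z w) \<le> C0 / (\<bar>fst z - fst w\<bar> + norm (snd z - snd w)) ^ (1 + CARD('n))"
    and kap_zero: "\<And>z w. w \<notin> half_space \<Longrightarrow> kap z w = 0"
    and kap_supp: "\<And>z w k m t. t \<in> slice CARD('n) k \<Longrightarrow> fst z \<in> {t / 2..t} \<Longrightarrow> fst w \<in> slice CARD('n) (k + m) \<Longrightarrow> m \<notin> M \<Longrightarrow> kap z w = 0"
    and M: "{-4..3} \<subseteq> M"
    and A0: "bounded_operator (Lr_norm r) A0"
    and off: "\<And>\<phi> U \<delta>. \<phi> \<in> Linf_c \<Longrightarrow> \<phi> \<in> borel_measurable borel \<Longrightarrow> 0 < \<delta> \<Longrightarrow>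
      (\<And>z w. z \<in> U \<Longrightarrow> w \<in> half_space \<Longrightarrow> \<phi> w \<noteq> 0 \<Longrightarrow> \<delta> \<le> dist z w) \<Longrightarrow>
      AE z in half_leb. z \<in> U \<longrightarrow> A0 \<phi> z = (LINT w|lborel. kap z w * \<phi> w)"
begin

abbreviation "L \<equiv> space_of (Lr_norm r) :: (real \<times> (real ^ 'n) \<Rightarrow> complex) set"

section \<open>Elementary properties of the given operator and its kernel\<close>

lemma r0: "0 < r" using r by simp

lemma L_add: "f \<in> L \<Longrightarrow> g \<in> L \<Longrightarrow> (\<lambda>z. f z + g z) \<in> L"
  using Ir_add_le[of f g r] r0
  by (auto simp: space_Lr_iff ennreal_mult_less_top intro: le_less_trans)

lemma L_cmult: "f \<in> L \<Longrightarrow> (\<lambda>z. c * f z) \<in> L"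
  using Ir_cmult[of f r c] r0 by (auto simp: space_Lr_iff ennreal_mult_less_top)

lemma L_cong: "f \<in> L \<Longrightarrow> AE z in half_leb. f z = g z \<Longrightarrow> g \<in> L"
  using Ir_cong_AE[of f g r] measurable_half_leb_AE[of f g] by (simp add: space_Lr_iff)

lemma A0_L: "f \<in> L \<Longrightarrow> A0 f \<in> L"
  using A0 by (simp add: bounded_operator_def)

lemma A0_add: "f \<in> L \<Longrightarrow> g \<in> L \<Longrightarrow> AE z in half_leb. A0 (\<lambda>w. f w + g w) z = A0 f z + A0 g z"
  using A0 by (simp add: bounded_operator_def)

lemma A0_cmult: "f \<in> L \<Longrightarrow> AE z in half_leb. A0 (\<lambda>w. c * f w) z = c * A0 f z"
  using A0 by (simp add: bounded_operator_def)

lemma A0_bound: "\<exists>c\<ge>0. \<forall>f\<in>L. Ir r (A0 f) \<le> ennreal c * Ir r f"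
proof -
  obtain C :: real where C: "\<forall>f\<in>L. Lr_norm r (A0 f) \<le> ennreal C * Lr_norm r f"
    using A0 by (auto simp: bounded_operator_def)
  have "Ir r (A0 f) \<le> ennreal (max C 0 powr r) * Ir r f" if "f \<in> L" for f
  proof -
    have "Lr_norm r (A0 f) \<le> ennreal (max C 0) * Lr_norm r f"
      using C that by (meson ennreal_leI max.cobounded1 mult_right_mono order_trans zero_le)
    then have "epowr (epowr (Ir r (A0 f)) (1 / r)) r \<le> epowr (ennreal (max C 0) * epowr (Ir r f) (1 / r)) r"
      unfolding Lr_norm_Ir using r0 by (intro epowr_mono) auto
    then show ?thesis using r0 by (simp add: epowr_real_bound)
  qed
  then show ?thesis by (intro exI[of _ "max C 0 powr r"]) auto
qed

definition "cA = (SOME c. 0 \<le> c \<and> (\<forall>f\<in>L. Ir r (A0 f) \<le> ennreal c * Ir r f))"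

lemma cA: "0 \<le> cA" "f \<in> L \<Longrightarrow> Ir r (A0 f) \<le> ennreal cA * Ir r f"
proof -
  have "\<exists>c. 0 \<le> c \<and> (\<forall>f\<in>L. Ir r (A0 f) \<le> ennreal c * Ir r f)" using A0_bound by auto
  from someI_ex[OF this] show "0 \<le> cA" "f \<in> L \<Longrightarrow> Ir r (A0 f) \<le> ennreal cA * Ir r f"
    unfolding cA_def[symmetric] by auto
qed

lemma A0_diff:
  assumes "f \<in> L" "g \<in> L"
  shows "AE z in half_leb. A0 (\<lambda>w. f w - g w) z = A0 f z - A0 g z"
proof -
  have "AE z in half_leb. A0 (\<lambda>w. f w + (- 1) * g w) z = A0 f z + A0 (\<lambda>w. (- 1) * g w) z"
    using assms by (intro A0_add L_cmult)
  moreover have "AE z in half_leb. A0 (\<lambda>w. (- 1) * g w) z = (- 1) * A0 g z" by (rule A0_cmult[OF assms(2)])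
  ultimately show ?thesis by eventually_elim simp
qed

lemma L_diff: "f \<in> L \<Longrightarrow> g \<in> L \<Longrightarrow> (\<lambda>z. f z - g z) \<in> L"
  using L_add[of f "\<lambda>z. (- 1) * g z"] L_cmult[of g "- 1"] by simp

text \<open>Linearity and boundedness imply it: the difference of the arguments has norm 0, hence so
  has its image.\<close>

lemma A0_cong:
  assumes f: "f \<in> L" and fg: "AE z in half_leb. f z = g z"
  shows "AE z in half_leb. A0 f z = A0 g z"
proof -
  have g: "g \<in> L" by (rule L_cong[OF f fg])
  have "Ir r (\<lambda>z. f z - g z) = Ir r (\<lambda>z :: real \<times> (real ^ 'n). 0)" by (rule Ir_cong_AE) (use fg in \<open>auto elim: eventually_mono\<close>)
  also have "\<dots> = 0" by (simp add: Ir_def)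
  finally have "Ir r (A0 (\<lambda>z. f z - g z)) = 0" using cA(2)[OF L_diff[OF f g]] by simp
  then have "AE z in half_leb. A0 (\<lambda>z. f z - g z) z = 0"
    using A0_L[OF L_diff[OF f g]] by (subst (asm) Ir_0_iff) (auto simp: space_Lr_iff)
  with A0_diff[OF f g] show ?thesis by eventually_elim simp
qed

lemma kap_section [measurable]: "(\<lambda>w. kap z w) \<in> borel_measurable borel"
proof -
  have "(\<lambda>w. (z, w)) \<in> measurable borel borel" by (intro borel_measurable_continuous_onI continuous_intros)
  from measurable_compose[OF this kap_measurable] show ?thesis by simp
qed

lemma kap_bound_dist:
  assumes "z \<in> half_space" "0 < \<delta>" "\<delta> \<le> dist z w"
  shows "norm (kap z w) \<le> C0 / \<delta> ^ (1 + CARD('n))"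
proof (cases "w \<in> half_space")
  case True
  have "dist z w \<le> \<bar>fst z - fst w\<bar> + norm (snd z - snd w)"
    using sqrt_sum_squares_le_sum[of "dist (fst z) (fst w)" "dist (snd z) (snd w)"]
    by (simp add: dist_prod_def dist_real_def dist_norm)
  then have "\<delta> \<le> \<bar>fst z - fst w\<bar> + norm (snd z - snd w)" using assms by simp
  then have "C0 / (\<bar>fst z - fst w\<bar> + norm (snd z - snd w)) ^ (1 + CARD('n)) \<le> C0 / \<delta> ^ (1 + CARD('n))"
    using assms C0 by (intro divide_left_mono power_mono mult_pos_pos zero_less_power) auto
  moreover have "z \<noteq> w" using assms by auto
  ultimately show ?thesis using kap_size[OF assms(1) True] by linarith
qed (use C0 assms in \<open>simp add: kap_zero\<close>)

text \<open>From |g| \<le> 1 + |g|^r on a set of finite measure.\<close>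

lemma integrable_on_bounded:
  fixes g :: "real \<times> (real ^ 'n) \<Rightarrow> complex"
  assumes g [measurable]: "g \<in> borel_measurable borel" and fin: "Ir r g < top"
    and K: "K \<in> sets borel" "K \<subseteq> half_space" "emeasure lborel K < top"
  shows "(\<integral>\<^sup>+w. ennreal (norm (g w)) * indicator K w \<partial>lborel) < top"
proof -
  note [measurable] = K(1)
  have "(\<integral>\<^sup>+w. ennreal (norm (g w)) * indicator K w \<partial>lborel)
     \<le> (\<integral>\<^sup>+w. indicator K w + ennreal (norm (g w) powr r) * indicator half_space w \<partial>lborel)"
  proof (rule nn_integral_mono)
    fix w
    have "norm (g w) \<le> 1 + norm (g w) powr r"
    proof (cases "norm (g w) \<le> 1")
      case False
      then have "norm (g w) powr 1 \<le> norm (g w) powr r" using r by (intro powr_mono) auto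
      then show ?thesis using False by simp
    qed (simp add: add_increasing2)
    then have "ennreal (norm (g w)) \<le> 1 + ennreal (norm (g w) powr r)"
      by (metis ennreal_1 ennreal_leI ennreal_plus powr_ge_zero zero_le_one)
    then show "ennreal (norm (g w)) * indicator K w \<le> indicator K w + ennreal (norm (g w) powr r) * indicator half_space w"
      using K(2) by (auto simp: indicator_def)
  qed
  also have "\<dots> = emeasure lborel K + Ir r g"
    unfolding Ir_def nn_integral_half_leb by (subst nn_integral_add) auto
  also have "\<dots> < top" using K(3) fin by simp
  finally show ?thesis .
qed

text \<open>Truncation in height reduces to bounded functions; the limit is identified by Fatou's lemma.\<close>

lemma A0_off_support:
  fixes g :: "real \<times> (real ^ 'n) \<Rightarrow> complex"
  assumes g [measurable]: "g \<in> borel_measurable borel" and gL: "g \<in> L"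
    and K: "compact K" "K \<subseteq> half_space" "\<And>w. w \<notin> K \<Longrightarrow> g w = 0" and \<delta>: "0 < \<delta>"
    and U: "\<And>z w. z \<in> U \<Longrightarrow> w \<in> half_space \<Longrightarrow> g w \<noteq> 0 \<Longrightarrow> \<delta> \<le> dist z w"
  shows "AE z in half_leb. z \<in> U \<longrightarrow> A0 g z = (LINT w|lborel. kap z w * g w)"
proof -
  define gj where "gj = (\<lambda>j. trunc j g)"
  note gj_def = gj_def trunc_def
  have [measurable]: "gj j \<in> borel_measurable borel" for j unfolding gj_def trunc_def[abs_def] by measurable
  have Kb: "K \<in> sets borel" using K(1) by (intro borel_closed compact_imp_closed)
  have gj_c: "gj j \<in> Linf_c" for j
    unfolding Linf_c_def
  proof (intro CollectI conjI)
    show "gj j \<in> borel_measurable half_leb" by (rule measurable_half_leb_borel) simp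
    show "\<exists>M. \<forall>z\<in>half_space. norm (gj j z) \<le> M" by (intro exI[of _ "real j"]) (auto simp: gj_def)
    show "\<exists>K. compact K \<and> K \<subseteq> half_space \<and> (\<forall>z\<in>half_space - K. gj j z = 0)"
      using K by (intro exI[of _ K]) (auto simp: gj_def)
  qed
  have gj_le: "norm (gj j w) \<le> norm (g w)" for j w by (simp add: gj_def)
  have gjL: "gj j \<in> L" for j
    using gL Ir_mono_AE[OF r0, of "gj j" g] gj_le measurable_half_leb_borel[of "gj j"]
    by (auto simp: space_Lr_iff intro: le_less_trans)
  have gm: "g \<in> borel_measurable half_leb" "gj j \<in> borel_measurable half_leb" for j by (simp_all add: measurable_half_leb_borel)
  have gj_ev: "\<forall>\<^sub>F j in sequentially. gj j w = g w" for w unfolding gj_def(1) by (rule trunc_eventually)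
  have lim0: "(\<lambda>j. Ir r (\<lambda>w. gj j w - g w)) \<longlonglongrightarrow> 0"
    unfolding gj_def(1) by (rule Ir_trunc_tendsto) (use gL r0 in \<open>auto simp: space_Lr_iff\<close>)
  have "(\<lambda>j. Ir r (\<lambda>z. A0 (gj j) z - A0 g z)) \<longlonglongrightarrow> 0"
  proof (rule tendsto_sandwich[OF _ _ tendsto_const])
    show "\<forall>\<^sub>F j in sequentially. Ir r (\<lambda>z. A0 (gj j) z - A0 g z) \<le> ennreal cA * Ir r (\<lambda>w. gj j w - g w)"
    proof (rule always_eventually, rule allI)
      fix j
      have "Ir r (\<lambda>z. A0 (gj j) z - A0 g z) = Ir r (A0 (\<lambda>w. gj j w - g w))"
        by (rule Ir_cong_AE) (use A0_diff[OF gjL gL, of j] in \<open>auto elim: eventually_mono\<close>)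
      also have "\<dots> \<le> ennreal cA * Ir r (\<lambda>w. gj j w - g w)" by (rule cA(2)[OF L_diff[OF gjL gL]])
      finally show "Ir r (\<lambda>z. A0 (gj j) z - A0 g z) \<le> ennreal cA * Ir r (\<lambda>w. gj j w - g w)" .
    qed
    show "(\<lambda>j. ennreal cA * Ir r (\<lambda>w. gj j w - g w)) \<longlonglongrightarrow> 0"
      using ennreal_tendsto_cmult[OF _ lim0, of "ennreal cA"] by simp
  qed auto
  then have liminf0: "liminf (\<lambda>j. Ir r (\<lambda>z. A0 (gj j) z - A0 g z)) = 0"
    by (intro lim_imp_Liminf) auto
  have [measurable]: "A0 g \<in> borel_measurable half_leb" "A0 (gj j) \<in> borel_measurable half_leb" for j
    using A0_L[OF gL] A0_L[OF gjL] by (auto simp: space_Lr_iff)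
  have "(\<integral>\<^sup>+z. liminf (\<lambda>j. ennreal (norm (A0 (gj j) z - A0 g z) powr r)) \<partial>half_leb) \<le> 0"
    using nn_integral_liminf[of "\<lambda>j z. ennreal (norm (A0 (gj j) z - A0 g z) powr r)" half_leb] liminf0
    by (simp add: Ir_def)
  then have "AE z in half_leb. liminf (\<lambda>j. ennreal (norm (A0 (gj j) z - A0 g z) powr r)) = 0"
    by (subst (asm) le_zero_eq, subst (asm) nn_integral_0_iff_AE) auto
  moreover have "AE z in half_leb. \<forall>j. z \<in> U \<longrightarrow> A0 (gj j) z = (LINT w|lborel. kap z w * gj j w)"
    unfolding AE_all_countable
  proof (intro allI off[OF gj_c _ \<delta>])
    show "\<delta> \<le> dist z w" if "z \<in> U" "w \<in> half_space" "gj j w \<noteq> 0" for j z w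
      using that by (intro U) (auto simp: gj_def split: if_splits)
  qed measurable
  moreover have "AE z in half_leb. z \<in> half_space" unfolding AE_half_leb by simp
  ultimately show ?thesis
  proof eventually_elim
    case (elim z)
    show ?case
    proof
      assume zU: "z \<in> U"
      have int: "integrable lborel (\<lambda>w. C0 / \<delta> ^ (1 + CARD('n)) * (norm (g w) * indicator K w))"
      proof (intro integrable_mult_right integrableI_nonneg)
        have "emeasure lborel K < top" using K(1) emeasure_compact_finite by auto
        then have "(\<integral>\<^sup>+w. ennreal (norm (g w)) * indicator K w \<partial>lborel) < top"
          using gL Kb K(2) by (intro integrable_on_bounded) (auto simp: space_Lr_iff)
        moreover have "(\<lambda>w. ennreal (norm (g w)) * indicator K w) = (\<lambda>w. ennreal (norm (g w) * indicator K w))"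
          by (auto simp: indicator_def)
        ultimately show "(\<integral>\<^sup>+w. ennreal (norm (g w) * indicator K w) \<partial>lborel) < \<infinity>" by simp
      qed (use Kb in auto)
      have "(\<lambda>j. LINT w|lborel. kap z w * gj j w) \<longlonglongrightarrow> (LINT w|lborel. kap z w * g w)"
      proof (rule integral_dominated_convergence[OF _ _ int])
        show "AE w in lborel. (\<lambda>j. kap z w * gj j w) \<longlonglongrightarrow> kap z w * g w"
          by (rule AE_I2, intro tendsto_mult tendsto_const tendsto_eventually gj_ev)
        fix j
        show "AE w in lborel. norm (kap z w * gj j w) \<le> C0 / \<delta> ^ (1 + CARD('n)) * (norm (g w) * indicator K w)"
        proof (rule AE_I2)
          fix w
          show "norm (kap z w * gj j w) \<le> C0 / \<delta> ^ (1 + CARD('n)) * (norm (g w) * indicator K w)"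
          proof (cases "g w = 0")
            case False
            then have "w \<in> K" using K(3) by blast
            then have "norm (kap z w) \<le> C0 / \<delta> ^ (1 + CARD('n))"
              using U[OF zU _ False] K(2) elim(3) \<delta> by (intro kap_bound_dist) auto
            then have "norm (kap z w) * norm (gj j w) \<le> C0 / \<delta> ^ (1 + CARD('n)) * norm (g w)"
              using C0 \<delta> by (intro mult_mono gj_le) auto
            then show ?thesis using \<open>w \<in> K\<close> by (simp add: norm_mult)
          qed (simp add: gj_def)
        qed
      qed measurable
      then have "(\<lambda>j. ennreal (norm (A0 (gj j) z - A0 g z) powr r)) \<longlonglongrightarrow> ennreal (norm ((LINT w|lborel. kap z w * g w) - A0 g z) powr r)"
        using elim(2) zU r0 by (auto intro!: tendsto_ennrealI tendsto_powr' tendsto_norm tendsto_diff)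
      then have "liminf (\<lambda>j. ennreal (norm (A0 (gj j) z - A0 g z) powr r)) = ennreal (norm ((LINT w|lborel. kap z w * g w) - A0 g z) powr r)"
        by (intro lim_imp_Liminf) auto
      then have "ennreal (norm ((LINT w|lborel. kap z w * g w) - A0 g z) powr r) = 0" using elim(1) by simp
      then show "A0 g z = (LINT w|lborel. kap z w * g w)" by (simp add: ennreal_eq_0_iff)
    qed
  qed
qed

subsection \<open>The extension\<close>

text \<open>One fixed exhaustion serves to define the extension. Convergence along every other one
  is established in \<open>Aop_restrict_tendsto\<close>.\<close>

definition Km :: "nat \<Rightarrow> (real \<times> (real ^ 'n)) set" where
  "Km m = {1 / (real m + 1)..real m + 1} \<times> cball 0 (real m + 1)"

definition Aop :: "(real \<times> (real ^ 'n) \<Rightarrow> complex) \<Rightarrow> real \<times> (real ^ 'n) \<Rightarrow> complex" where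
  "Aop f z = lim (\<lambda>m. A0 (restrict_to (Km m) f) z)"

definition tail :: "(real \<times> (real ^ 'n) \<Rightarrow> complex) \<Rightarrow> real \<Rightarrow> real \<times> (real ^ 'n) \<Rightarrow> ennreal" where
  "tail f \<delta> z = (\<integral>\<^sup>+w. ennreal (norm (kap z w) * norm (f w)) * indicator {w \<in> half_space. \<delta> \<le> dist z w} w \<partial>lborel)"

text \<open>A domain for the extension that does not refer to p, q and \<beta>: local L^r
  integrability handles the part near z, and absolute convergence of the kernel integral at every
  positive distance handles the rest. On it the extension is linear.\<close>

definition good :: "(real \<times> (real ^ 'n) \<Rightarrow> complex) \<Rightarrow> bool" where
  "good f \<longleftrightarrow> f \<in> borel_measurable half_leb \<and> (\<forall>m. Ir r (restrict_to (Km m) f) < top) \<and>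
    (\<forall>z\<in>half_space. \<forall>\<delta>>0. tail f \<delta> z < top)"

lemma Km_compact: "compact (Km m)" and Km_half: "Km m \<subseteq> half_space" and Km_borel [measurable]: "Km m \<in> sets borel"
proof -
  show "compact (Km m)" unfolding Km_def by (intro compact_Times) auto
  then show "Km m \<in> sets borel" by (intro borel_closed compact_imp_closed)
  show "Km m \<subseteq> half_space"
  proof
    fix z assume "z \<in> Km m"
    then have "1 / (real m + 1) \<le> fst z" by (auto simp: Km_def)
    moreover have "0 < 1 / (real m + 1)" by simp
    ultimately have "0 < fst z" by linarith
    then show "z \<in> half_space" by (cases z) (auto simp: half_space_def)
  qed
qed

lemma Km_mono: "m \<le> n \<Longrightarrow> Km m \<subseteq> Km n"
proof -
  assume mn: "m \<le> n"
  have "1 / (real n + 1) \<le> 1 / (real m + 1)" using mn by (intro divide_left_mono) auto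
  then show ?thesis using mn by (auto simp: Km_def)
qed

lemma Km_exhaust:
  assumes "z \<in> half_space"
  shows "\<exists>m. z \<in> Km m"
proof -
  obtain t x where z: "z = (t, x)" "0 < t" using assms by (auto simp: half_space_def)
  obtain m :: nat where m: "max (1 / t) (max t (norm x)) \<le> real m" using real_arch_simple by blast
  then have "1 / t \<le> real m + 1" "t \<le> real m + 1" "norm x \<le> real m + 1" by auto
  then have "1 / (real m + 1) \<le> t" using z(2) by (simp add: field_simps)
  then show ?thesis using \<open>t \<le> real m + 1\<close> \<open>norm x \<le> real m + 1\<close> by (intro exI[of _ m]) (auto simp: Km_def z)
qed

lemma compact_in_Km:
  assumes "0 < a" "K \<subseteq> {a..b} \<times> ball x \<rho>"
  shows "\<exists>m. K \<subseteq> Km m"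
proof -
  obtain m :: nat where m: "max (1 / a) (max b (norm x + \<rho>)) \<le> real m" using real_arch_simple by blast
  then have "1 / a \<le> real m + 1" "b \<le> real m + 1" "norm x + \<rho> \<le> real m + 1" by auto
  moreover from this have "1 / (real m + 1) \<le> a" using assms(1) by (simp add: field_simps)
  moreover have "norm y \<le> norm x + \<rho>" if "y \<in> ball x \<rho>" for y
    using that norm_triangle_ineq[of x "y - x"] by (simp add: dist_norm norm_minus_commute)
  ultimately show ?thesis using assms(2) by (intro exI[of _ m]) (force simp: Km_def)
qed

lemma tail_cong: "AE z in half_leb. f z = g z \<Longrightarrow> tail f \<delta> z = tail g \<delta> z"
  unfolding tail_def AE_half_leb by (intro nn_integral_cong_AE) (auto simp: indicator_def elim!: eventually_mono)

lemma restrict_cong: "AE z in half_leb. f z = g z \<Longrightarrow> AE z in half_leb. restrict_to K f z = restrict_to K g z"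
  by (auto simp: restrict_to_def elim: eventually_mono)

lemma good_cong:
  assumes "good f" "AE z in half_leb. f z = g z"
  shows "good g"
  using assms measurable_half_leb_AE[of f g] tail_cong[OF assms(2)] Ir_cong_AE[OF restrict_cong[OF assms(2)]]
  by (auto simp: good_def)

lemma good_L: "good f \<Longrightarrow> restrict_to (Km m) f \<in> L"
  by (auto simp: good_def space_Lr_iff restrict_measurable)

lemma Aop_cong:
  assumes "good f" "AE z in half_leb. f z = g z"
  shows "AE z in half_leb. Aop f z = Aop g z"
proof -
  have "AE z in half_leb. \<forall>m. A0 (restrict_to (Km m) f) z = A0 (restrict_to (Km m) g) z"
    unfolding AE_all_countable by (intro allI A0_cong good_L restrict_cong assms)
  then show ?thesis by eventually_elim (simp add: Aop_def)
qed

lemma Aop_measurable: "good f \<Longrightarrow> Aop f \<in> borel_measurable half_leb"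
  unfolding Aop_def[abs_def] using A0_L[OF good_L]
  by (intro borel_measurable_lim_metric) (auto simp: space_Lr_iff)

lemma good_mono:
  assumes "good f" "g \<in> borel_measurable half_leb" "\<And>z. norm (g z) \<le> norm (f z)"
  shows "good g"
  unfolding good_def
proof (intro conjI allI ballI impI)
  fix m
  have "Ir r (restrict_to (Km m) g) \<le> Ir r (restrict_to (Km m) f)"
    using assms(3) by (intro Ir_mono_AE[OF r0]) (auto simp: restrict_to_def indicator_def)
  then show "Ir r (restrict_to (Km m) g) < top" using assms(1) by (auto simp: good_def intro: le_less_trans)
next
  fix z :: "real \<times> (real ^ 'n)" and \<delta> :: real assume z: "z \<in> half_space" "0 < \<delta>"
  have "tail g \<delta> z \<le> tail f \<delta> z"
    unfolding tail_def using assms(3) by (intro nn_integral_mono mult_right_mono ennreal_leI mult_left_mono) auto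
  then show "tail g \<delta> z < top" using assms(1) z by (auto simp: good_def intro: le_less_trans)
qed (rule assms)

text \<open>Additivity of the integrals in \<open>tail\<close> asks for Borel functions, so the sum
  is formed from representatives and transferred back by \<open>good_cong\<close>.\<close>

lemma good_add:
  assumes f: "good f" and g: "good g"
  shows "good (\<lambda>z. f z + g z)"
proof -
  have fm: "f \<in> borel_measurable half_leb" "g \<in> borel_measurable half_leb" using assms by (auto simp: good_def)
  obtain f' where f' [measurable]: "f' \<in> borel_measurable borel" "AE z in half_leb. f z = f' z" using borel_representative[OF fm(1)] .
  obtain g' where g' [measurable]: "g' \<in> borel_measurable borel" "AE z in half_leb. g z = g' z" using borel_representative[OF fm(2)] .
  have gd: "good f'" "good g'" using good_cong[OF f f'(2)] good_cong[OF g g'(2)] by auto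
  have "good (\<lambda>z. f' z + g' z)"
    unfolding good_def
  proof (intro conjI allI ballI impI)
    show "(\<lambda>z. f' z + g' z) \<in> borel_measurable half_leb" by (rule measurable_half_leb_borel) measurable
    fix m
    have "restrict_to (Km m) (\<lambda>z. f' z + g' z) = (\<lambda>z. restrict_to (Km m) f' z + restrict_to (Km m) g' z)"
      by (auto simp: restrict_to_def distrib_left)
    then show "Ir r (restrict_to (Km m) (\<lambda>z. f' z + g' z)) < top"
      using L_add[OF good_L[OF gd(1)] good_L[OF gd(2)], of m m] by (simp add: space_Lr_iff)
  next
    fix z :: "real \<times> (real ^ 'n)" and \<delta> :: real assume z: "z \<in> half_space" "0 < \<delta>"
    have [measurable]: "{w \<in> half_space. \<delta> \<le> dist z w} \<in> sets borel" by measurable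
    have "tail (\<lambda>z. f' z + g' z) \<delta> z \<le> (\<integral>\<^sup>+w. ennreal (norm (kap z w) * norm (f' w)) * indicator {w \<in> half_space. \<delta> \<le> dist z w} w
       + ennreal (norm (kap z w) * norm (g' w)) * indicator {w \<in> half_space. \<delta> \<le> dist z w} w \<partial>lborel)"
      unfolding tail_def distrib_right[symmetric]
    proof (intro nn_integral_mono mult_right_mono)
      fix w
      have "norm (kap z w) * norm (f' w + g' w) \<le> norm (kap z w) * (norm (f' w) + norm (g' w))"
        by (intro mult_left_mono norm_triangle_ineq) simp
      then show "ennreal (norm (kap z w) * norm (f' w + g' w)) \<le> ennreal (norm (kap z w) * norm (f' w)) + ennreal (norm (kap z w) * norm (g' w))"
        by (simp add: distrib_left ennreal_leI flip: ennreal_plus)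
    qed simp
    also have "\<dots> = tail f' \<delta> z + tail g' \<delta> z" unfolding tail_def by (rule nn_integral_add) measurable
    also have "\<dots> < top" using gd z by (auto simp: good_def)
    finally show "tail (\<lambda>z. f' z + g' z) \<delta> z < top" .
  qed
  moreover have "AE z in half_leb. f' z + g' z = f z + g z" using f'(2) g'(2) by eventually_elim simp
  ultimately show ?thesis by (rule good_cong)
qed

lemma good_cmult:
  assumes f: "good f"
  shows "good (\<lambda>z. c * f z)"
proof -
  have fm: "f \<in> borel_measurable half_leb" using assms by (auto simp: good_def)
  obtain f' where f' [measurable]: "f' \<in> borel_measurable borel" "AE z in half_leb. f z = f' z" using borel_representative[OF fm] .
  have gd: "good f'" using good_cong[OF f f'(2)] .
  have "good (\<lambda>z. c * f' z)"
    unfolding good_def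
  proof (intro conjI allI ballI impI)
    show "(\<lambda>z. c * f' z) \<in> borel_measurable half_leb" by (rule measurable_half_leb_borel) measurable
    fix m
    have "restrict_to (Km m) (\<lambda>z. c * f' z) = (\<lambda>z. c * restrict_to (Km m) f' z)"
      by (auto simp: restrict_to_def)
    then show "Ir r (restrict_to (Km m) (\<lambda>z. c * f' z)) < top"
      using L_cmult[OF good_L[OF gd], of c m] by (simp add: space_Lr_iff)
  next
    fix z :: "real \<times> (real ^ 'n)" and \<delta> :: real assume z: "z \<in> half_space" "0 < \<delta>"
    have [measurable]: "{w \<in> half_space. \<delta> \<le> dist z w} \<in> sets borel" by measurable
    have "tail (\<lambda>z. c * f' z) \<delta> z = (\<integral>\<^sup>+w. ennreal (norm c) * (ennreal (norm (kap z w) * norm (f' w)) * indicator {w \<in> half_space. \<delta> \<le> dist z w} w) \<partial>lborel)"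
      unfolding tail_def by (intro nn_integral_cong) (auto simp: norm_mult ennreal_mult mult_ac)
    also have "\<dots> = ennreal (norm c) * tail f' \<delta> z" unfolding tail_def by (rule nn_integral_cmult) measurable
    also have "\<dots> < top" using gd z by (auto simp: good_def ennreal_mult_less_top)
    finally show "tail (\<lambda>z. c * f' z) \<delta> z < top" .
  qed
  moreover have "AE z in half_leb. c * f' z = c * f z" using f'(2) by eventually_elim simp
  ultimately show ?thesis by (rule good_cong)
qed

text \<open>Beyond S every term of the defining sequence splits into the fixed local part and a
  kernel integral at distance at least \<delta>, for which \<open>tail\<close> provides a dominating
  function. The three conclusions are kept together as they hold off one common null set.\<close>

lemma Aop_representation:
  fixes f :: "real \<times> (real ^ 'n) \<Rightarrow> complex"
  assumes f [measurable]: "f \<in> borel_measurable borel" and good: "good f"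
    and Lb [measurable]: "S \<in> sets borel" and Lm: "S \<subseteq> Km m0" and \<delta>: "0 < \<delta>"
    and U: "\<And>z w. z \<in> U \<Longrightarrow> w \<in> half_space - S \<Longrightarrow> \<delta> \<le> dist z w"
  shows "AE z in half_leb. z \<in> U \<longrightarrow>
    (\<lambda>m. A0 (restrict_to (Km m) f) z) \<longlonglongrightarrow> Aop f z \<and>
    Aop f z = A0 (restrict_to S f) z + (LINT w|lborel. kap z w * (indicator (half_space - S) w * f w)) \<and>
    ennreal (norm (LINT w|lborel. kap z w * (indicator (half_space - S) w * f w)))
      \<le> (\<integral>\<^sup>+w. ennreal (norm (kap z w) * norm (f w)) * indicator (half_space - S) w \<partial>lborel)"
proof -
  define F where "F m = restrict_to (Km (m0 + m) - S) f" for m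
  have sub: "restrict_to (Km (m0 + m)) f = (\<lambda>w. restrict_to S f w + F m w)" for m
    using Lm Km_mono[of m0 "m0 + m"] by (auto simp: F_def restrict_to_def indicator_def fun_eq_iff subset_eq)
  have rb [measurable]: "restrict_to S f \<in> borel_measurable borel" "F m \<in> borel_measurable borel" for m
    unfolding F_def by (intro restrict_borel; measurable)+
  have le: "norm (restrict_to S f z) \<le> norm (restrict_to (Km m0) f z)" "norm (F m z) \<le> norm (restrict_to (Km (m0 + m)) f z)" for m z
    using Lm by (auto simp: F_def restrict_to_def indicator_def)
  have SL: "restrict_to S f \<in> L" "F m \<in> L" for m
    using good_L[OF good] Ir_mono_AE[OF r0, of "restrict_to S f" "restrict_to (Km m0) f"]
      Ir_mono_AE[OF r0, of "F m" "restrict_to (Km (m0 + m)) f"] le rb[THEN measurable_half_leb_borel]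
    by (auto simp: space_Lr_iff intro: le_less_trans)
  have "AE z in half_leb. \<forall>m. A0 (restrict_to (Km (m0 + m)) f) z = A0 (restrict_to S f) z + A0 (F m) z"
    unfolding AE_all_countable sub by (intro allI A0_add SL)
  moreover have "AE z in half_leb. \<forall>m. z \<in> U \<longrightarrow> A0 (F m) z = (LINT w|lborel. kap z w * F m w)"
    unfolding AE_all_countable
  proof (intro allI A0_off_support[OF _ SL(2) Km_compact Km_half _ \<delta>])
    fix m
    show "F m w = 0" if "w \<notin> Km (m0 + m)" for w using that by (simp add: F_def restrict_to_def)
    show "\<delta> \<le> dist z w" if "z \<in> U" "w \<in> half_space" "F m w \<noteq> 0" for z w
      using that U by (auto simp: F_def restrict_to_def indicator_def split: if_splits)
  qed measurable
  moreover have "AE z in half_leb. z \<in> half_space" unfolding AE_half_leb by simp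
  ultimately show ?thesis
  proof eventually_elim
    case (elim z)
    show ?case
    proof
      assume zU: "z \<in> U"
      define h where "h w = kap z w * (indicator (half_space - S) w * f w)" for w
      have hm [measurable]: "h \<in> borel_measurable borel" unfolding h_def[abs_def] by measurable
      have nh: "ennreal (norm (h w)) = ennreal (norm (kap z w) * norm (f w)) * indicator (half_space - S) w" for w
        by (auto simp: h_def norm_mult indicator_def)
      have "(\<integral>\<^sup>+w. ennreal (norm (h w)) \<partial>lborel) \<le> tail f \<delta> z"
        unfolding nh tail_def using U[OF zU] by (intro nn_integral_mono mult_left_mono) (auto simp: indicator_def)
      also have "\<dots> < top" using good elim(3) \<delta> by (auto simp: good_def)
      finally have hi: "integrable lborel h" by (intro integrableI_bounded) auto
      have "(\<lambda>m. LINT w|lborel. kap z w * F m w) \<longlonglongrightarrow> (LINT w|lborel. h w)"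
      proof (rule integral_dominated_convergence[where w="\<lambda>w. norm (h w)"])
        show "integrable lborel (\<lambda>w. norm (h w))" using hi by simp
        show "AE w in lborel. (\<lambda>m. kap z w * F m w) \<longlonglongrightarrow> h w"
        proof (rule AE_I2)
          fix w
          show "(\<lambda>m. kap z w * F m w) \<longlonglongrightarrow> h w"
          proof (cases "w \<in> half_space")
            case True
            then obtain m1 where m1: "w \<in> Km m1" using Km_exhaust by blast
            have "\<forall>\<^sub>F m in sequentially. kap z w * F m w = h w"
              unfolding eventually_sequentially
              using m1 Km_mono[of m1 "m0 + _"] True
              by (intro exI[of _ m1]) (auto simp: F_def h_def restrict_to_def indicator_def subset_eq)
            then show ?thesis by (rule tendsto_eventually)
          qed (simp add: h_def kap_zero)
        qed
        show "AE w in lborel. norm (kap z w * F m w) \<le> norm (h w)" for m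
          using Km_half by (intro AE_I2) (auto simp: F_def h_def restrict_to_def indicator_def norm_mult)
      qed measurable
      then have "(\<lambda>m. A0 (restrict_to (Km (m0 + m)) f) z) \<longlonglongrightarrow> A0 (restrict_to S f) z + (LINT w|lborel. h w)"
        using elim(1,2) zU by (auto intro!: tendsto_add)
      then have lim: "(\<lambda>m. A0 (restrict_to (Km m) f) z) \<longlonglongrightarrow> A0 (restrict_to S f) z + (LINT w|lborel. h w)"
        by (subst (asm) add.commute) (rule LIMSEQ_offset)
      then have "Aop f z = A0 (restrict_to S f) z + (LINT w|lborel. h w)" unfolding Aop_def by (rule limI)
      moreover have "ennreal (norm (LINT w|lborel. h w)) \<le> (\<integral>\<^sup>+w. ennreal (norm (h w)) \<partial>lborel)"
        by (rule integral_norm_bound_ennreal[OF hi])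
      ultimately show "(\<lambda>m. A0 (restrict_to (Km m) f) z) \<longlonglongrightarrow> Aop f z \<and>
        Aop f z = A0 (restrict_to S f) z + (LINT w|lborel. kap z w * (indicator (half_space - S) w * f w)) \<and>
        ennreal (norm (LINT w|lborel. kap z w * (indicator (half_space - S) w * f w)))
          \<le> (\<integral>\<^sup>+w. ennreal (norm (kap z w) * norm (f w)) * indicator (half_space - S) w \<partial>lborel)"
        using lim unfolding nh unfolding h_def by simp
    qed
  qed
qed

end


lemma compact_half_box:
  fixes K :: "(real \<times> (real ^ 'n)) set"
  assumes K: "compact K" "K \<subseteq> half_space"
  obtains a b \<rho> where "0 < a" "K \<subseteq> {a..b} \<times> ball 0 \<rho>"
proof (cases "K = {}")
  case False
  have "compact (fst ` K)" by (intro compact_continuous_image continuous_intros K)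
  then obtain t where t: "t \<in> fst ` K" "\<And>s. s \<in> fst ` K \<Longrightarrow> t \<le> s"
    using compact_attains_inf[of "fst ` K"] False by auto
  obtain B where B: "\<And>z. z \<in> K \<Longrightarrow> norm z \<le> B" using compact_imp_bounded[OF K(1)] by (auto simp: bounded_iff)
  have "0 < t" using t K(2) by (auto simp: half_space_def)
  moreover have "K \<subseteq> {t..B} \<times> ball 0 (B + 1)"
  proof
    fix z assume z: "z \<in> K"
    have "\<bar>fst z\<bar> \<le> norm z" "norm (snd z) \<le> norm z" using norm_fst_le[of "fst z" "snd z"] norm_snd_le[of "snd z" "fst z"] by simp_all
    then have "fst z \<le> B" "norm (snd z) < B + 1" "t \<le> fst z" using B[OF z] t(2) z by auto
    then show "z \<in> {t..B} \<times> ball 0 (B + 1)" by (cases z) auto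
  qed
  ultimately show thesis by (rule that)
next
  case True
  then show thesis using that[of 1 1 1] by simp
qed

section \<open>Linearity of the extension and its domination by the majorant\<close>

context tent_operator
begin

text \<open>Apply the representation with U = \<open>Km i\<close> and S = \<open>Km (Suc i)\<close>.
  The gap between the boxes is 1/(i+1) - 1/(i+2) at the bottom and 1 at the top and at the
  sides.\<close>

lemma Aop_converges:
  fixes f :: "real \<times> (real ^ 'n) \<Rightarrow> complex"
  assumes "good f"
  shows "AE z in half_leb. (\<lambda>m. A0 (restrict_to (Km m) f) z) \<longlonglongrightarrow> Aop f z"
proof -
  have fm: "f \<in> borel_measurable half_leb" using assms by (simp add: good_def)
  obtain f' where f' [measurable]: "f' \<in> borel_measurable borel" "AE z in half_leb. f z = f' z"
    using borel_representative[OF fm] .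
  have gd: "good f'" using good_cong[OF assms f'(2)] .
  have "AE z in half_leb. \<forall>i. z \<in> Km i \<longrightarrow> (\<lambda>m. A0 (restrict_to (Km m) f') z) \<longlonglongrightarrow> Aop f' z"
    unfolding AE_all_countable
  proof
    fix i
    define \<delta> where "\<delta> = min (1 / (real i + 1) - 1 / (real i + 2)) 1"
    have "1 / (real i + 2) < 1 / (real i + 1)" by (intro divide_strict_left_mono) auto
    then have \<delta>: "0 < \<delta>" by (simp add: \<delta>_def)
    have far: "\<delta> \<le> dist z w" if "z \<in> Km i" "w \<in> half_space - Km (Suc i)" for z w
    proof -
      obtain t x s y where zw: "z = (t, x)" "w = (s, y)" by (cases z, cases w)
      have t: "1 / (real i + 1) \<le> t" "t \<le> real i + 1" "norm x \<le> real i + 1" using that by (auto simp: zw Km_def)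
      have "s < 1 / (real i + 2) \<or> real i + 2 < s \<or> real i + 2 < norm y"
        using that by (auto simp: zw Km_def not_le add.commute)
      then have "\<delta> \<le> dist t s \<or> \<delta> \<le> dist x y"
      proof (elim disjE)
        assume "real i + 2 < norm y"
        then have "1 \<le> dist x y" using t norm_triangle_ineq2[of y x] by (simp add: dist_norm norm_minus_commute)
        moreover have "\<delta> \<le> 1" by (simp add: \<delta>_def)
        ultimately show ?thesis by linarith
      qed (use t in \<open>auto simp: \<delta>_def dist_real_def\<close>)
      then show ?thesis using dist_fst_le[of z w] dist_snd_le[of z w] by (auto simp: zw)
    qed
    have "AE z in half_leb. z \<in> Km i \<longrightarrow> (\<lambda>m. A0 (restrict_to (Km m) f') z) \<longlonglongrightarrow> Aop f' z \<and>
      Aop f' z = A0 (restrict_to (Km (Suc i)) f') z + (LINT w|lborel. kap z w * (indicator (half_space - Km (Suc i)) w * f' w)) \<and>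
      ennreal (norm (LINT w|lborel. kap z w * (indicator (half_space - Km (Suc i)) w * f' w)))
        \<le> (\<integral>\<^sup>+w. ennreal (norm (kap z w) * norm (f' w)) * indicator (half_space - Km (Suc i)) w \<partial>lborel)"
      by (rule Aop_representation[OF f'(1) gd Km_borel order_refl \<delta> far])
    then show "AE z in half_leb. z \<in> Km i \<longrightarrow> (\<lambda>m. A0 (restrict_to (Km m) f') z) \<longlonglongrightarrow> Aop f' z"
      by eventually_elim auto
  qed
  moreover have "AE z in half_leb. \<forall>m. A0 (restrict_to (Km m) f) z = A0 (restrict_to (Km m) f') z"
    unfolding AE_all_countable by (intro allI A0_cong good_L assms restrict_cong f')
  moreover have "AE z in half_leb. z \<in> half_space" unfolding AE_half_leb by simp
  ultimately show ?thesis
    using Aop_cong[OF assms f'(2)]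
  proof eventually_elim
    case (elim z)
    then show ?case using Km_exhaust[of z] by auto
  qed
qed

lemma Aop_add:
  assumes f: "good f" and g: "good g"
  shows "AE z in half_leb. Aop (\<lambda>w. f w + g w) z = Aop f z + Aop g z"
proof -
  have eq: "restrict_to K (\<lambda>w. f w + g w) = (\<lambda>w. restrict_to K f w + restrict_to K g w)" for K
    by (auto simp: restrict_to_def distrib_left)
  have "AE z in half_leb. \<forall>m. A0 (restrict_to (Km m) (\<lambda>w. f w + g w)) z = A0 (restrict_to (Km m) f) z + A0 (restrict_to (Km m) g) z"
    unfolding AE_all_countable eq by (intro allI A0_add good_L f g)
  then show ?thesis using Aop_converges[OF f] Aop_converges[OF g]
  proof eventually_elim
    case (elim z)
    then have "(\<lambda>m. A0 (restrict_to (Km m) (\<lambda>w. f w + g w)) z) \<longlonglongrightarrow> Aop f z + Aop g z"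
      by (simp add: tendsto_add)
    then show ?case unfolding Aop_def[of "\<lambda>w. f w + g w"] by (rule limI)
  qed
qed

lemma Aop_cmult:
  assumes f: "good f"
  shows "AE z in half_leb. Aop (\<lambda>w. c * f w) z = c * Aop f z"
proof -
  have eq: "restrict_to K (\<lambda>w. c * f w) = (\<lambda>w. c * restrict_to K f w)" for K
    by (auto simp: restrict_to_def)
  have "AE z in half_leb. \<forall>m. A0 (restrict_to (Km m) (\<lambda>w. c * f w)) z = c * A0 (restrict_to (Km m) f) z"
    unfolding AE_all_countable eq by (intro allI A0_cmult good_L f)
  then show ?thesis using Aop_converges[OF f]
  proof eventually_elim
    case (elim z)
    then have "(\<lambda>m. A0 (restrict_to (Km m) (\<lambda>w. c * f w)) z) \<longlonglongrightarrow> c * Aop f z"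
      by (simp add: tendsto_mult_left)
    then show ?case unfolding Aop_def[of "\<lambda>w. c * f w"] by (rule limI)
  qed
qed

lemma Aop_diff:
  assumes f: "good f" and g: "good g"
  shows "AE z in half_leb. Aop (\<lambda>w. f w - g w) z = Aop f z - Aop g z"
proof -
  have "AE z in half_leb. Aop (\<lambda>w. f w + (- 1) * g w) z = Aop f z + Aop (\<lambda>w. (- 1) * g w) z"
    by (intro Aop_add f good_cmult g)
  with Aop_cmult[OF g, of "- 1"] show ?thesis by eventually_elim simp
qed

lemma good_diff: "good f \<Longrightarrow> good g \<Longrightarrow> good (\<lambda>z. f z - g z)"
  using good_add[of f "\<lambda>z. (- 1) * g z"] good_cmult[of g "- 1"] by simp

text \<open>For compactly supported functions the defining sequence is eventually constant, up to
  null sets.\<close>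

lemma Aop_Linf_c:
  assumes \<phi>: "\<phi> \<in> Linf_c" "good \<phi>"
  shows "AE z in half_leb. Aop \<phi> z = A0 \<phi> z"
proof -
  obtain K where K: "compact K" "K \<subseteq> half_space" "\<And>z. z \<in> half_space - K \<Longrightarrow> \<phi> z = 0"
    using \<phi>(1) by (auto simp: Linf_c_def)
  obtain a b \<rho> where "0 < a" "K \<subseteq> {a..b} \<times> ball 0 \<rho>" by (rule compact_half_box[OF K(1,2)])
  then have "\<exists>m. K \<subseteq> Km m" by (rule compact_in_Km)
  then obtain m0 where m0: "K \<subseteq> Km m0" by blast
  have eq: "AE z in half_leb. restrict_to (Km (m + m0)) \<phi> z = \<phi> z" for m
    unfolding AE_half_leb using m0 Km_mono[of m0 "m + m0"] K(3)
    by (intro AE_I2 impI) (auto simp: restrict_to_def indicator_def)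
  have "AE z in half_leb. \<forall>m. A0 (restrict_to (Km (m + m0)) \<phi>) z = A0 \<phi> z"
    unfolding AE_all_countable by (intro allI A0_cong good_L \<phi> eq)
  with Aop_converges[OF \<phi>(2)] show ?thesis
  proof eventually_elim
    case (elim z)
    from LIMSEQ_ignore_initial_segment[OF elim(1), of m0] elim(2) have "(\<lambda>m. A0 \<phi> z) \<longlonglongrightarrow> Aop \<phi> z" by simp
    from LIMSEQ_unique[OF this tendsto_const] show ?case .
  qed
qed

text \<open>\<open>far_scale\<close> bounds the sum of the distances in time and space from below by
  a ninth of \<open>tau\<close>; the larger of the two is at least half of that, whence 18.\<close>

lemma nbhd_dist:
  fixes x :: "real ^ 'n"
  assumes "t \<in> slice CARD('n) k" "z \<in> {t / 2..t} \<times> ball x t" "w \<in> half_space - nbhd k x"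
  shows "tau CARD('n) k / 18 \<le> dist z w"
proof -
  obtain t' x' s y where zw: "z = (t', x')" "w = (s, y)" by (cases z, cases w)
  have "0 < s" using assms(3) by (auto simp: zw half_space_def)
  then obtain j where j: "s \<in> slice CARD('n) (k + (j - k))" using ex_slice by (metis add.commute diff_add_cancel)
  define m where "m = j - k"
  have t': "t' \<in> {t / 2..t}" "norm (x' - x) < t" using assms(2) by (auto simp: zw dist_norm norm_minus_commute)
  have nb: "(s, y) \<notin> nbhd k x" using assms(3) by (simp add: zw)
  obtain i a where "y \<in> cube a (max k (k + m) + (lev_shift CARD('n) + 2 * int i)) x"
    and le: "3 ^ i * tau CARD('n) (max k (k + m)) / 9 \<le> \<bar>t' - s\<bar> + norm (x' - y)"
    using far_scale[OF assms(1) t' j nb] unfolding m_def by blast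
  have "1 * tau CARD('n) k \<le> 3 ^ i * tau CARD('n) (max k (k + m))"
    by (intro mult_mono tau_mono) (auto simp: less_imp_le)
  then have "tau CARD('n) k / 9 \<le> \<bar>t' - s\<bar> + norm (x' - y)" using le by linarith
  moreover have "\<bar>t' - s\<bar> \<le> dist z w" "norm (x' - y) \<le> dist z w"
    using dist_fst_le[of z w] dist_snd_le[of z w] by (simp_all add: zw dist_real_def dist_norm)
  ultimately show ?thesis by linarith
qed

lemma nbhd_in_Km: "\<exists>m. nbhd k x \<subseteq> Km m"
proof (rule compact_in_Km)
  show "nbhd k x \<subseteq> {tau CARD('n) (k - 5)..tau CARD('n) (k + 3)} \<times> ball x (3 * tau CARD('n) k)"
    by (auto simp: nbhd_def)
qed simp

lemma far_bound:
  obtains C where "0 \<le> C" "\<And>f k t x z. f \<in> borel_measurable borel \<Longrightarrow> t \<in> slice CARD('n) k \<Longrightarrow> z \<in> {t / 2..t} \<times> ball x t \<Longrightarrow>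
    (\<integral>\<^sup>+w. ennreal (norm (kap z w) * norm (f w)) * indicator (half_space - nbhd k x) w \<partial>lborel) \<le> ennreal C * majorant M r f k x"
proof -
  have "\<exists>C\<ge>0. \<forall>f k t x z. f \<in> borel_measurable borel \<longrightarrow> t \<in> slice CARD('n) k \<longrightarrow> z \<in> {t / 2..t} \<times> ball x t \<longrightarrow>
    (\<integral>\<^sup>+w. ennreal (norm (kap z w) * norm (f w)) * indicator (half_space - nbhd k x) w \<partial>lborel) \<le> ennreal C * majorant M r f k x"
  proof (rule far_integral_le[OF _ C0])
    show "1 \<le> r" using r by simp
  qed (rule kap_size kap_supp; assumption)+
  then show thesis using that by blast
qed

text \<open>The tent norm only enters through the finiteness of the majorant, which makes a function
  admissible and bounds the Whitney averages of its image.\<close>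

lemma ex_majorant_finite:
  assumes "AE x in lborel. majorant M r f k x < top" "0 < e"
  shows "\<exists>x. norm (x - y) < e \<and> majorant M r f k (x :: real ^ 'n) < top"
proof (rule ccontr)
  assume no: "\<not> ?thesis"
  have "AE x in lborel. x \<notin> ball y e" using assms(1) by (rule eventually_mono) (use no in \<open>auto simp: dist_norm norm_minus_commute\<close>)
  then have "emeasure lborel (ball y e) = 0" by (subst (asm) AE_iff_measurable[of "ball y e"]) auto
  moreover have "0 < unit_ball_vol CARD('n) * e ^ CARD('n)" using assms(2) by (simp add: unit_ball_vol_pos)
  ultimately show False using assms(2) by (simp add: emeasure_ball ennreal_eq_0_iff not_le[symmetric])
qed

lemma nbhd_integral_finite:
  fixes f :: "real \<times> (real ^ 'n) \<Rightarrow> complex"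
  assumes f: "f \<in> borel_measurable borel" and R: "majorant M r f k x < top"
  shows "(\<integral>\<^sup>+w. ennreal (norm (f w) powr r) * indicator (nbhd k x) w \<partial>lborel) < top"
proof -
  obtain Cl where Cl: "0 \<le> Cl" "\<And>(f :: real \<times> (real ^ 'n) \<Rightarrow> complex) k x. f \<in> borel_measurable borel \<Longrightarrow>
    (\<integral>\<^sup>+w. ennreal (norm (f w) powr r) * indicator (nbhd k x) w \<partial>lborel)
      \<le> ennreal (Cl * tau CARD('n) k ^ (1 + CARD('n))) * epowr (majorant M r f k x) r"
    using local_integral_le[OF _ M, of r, where 'n='n] r by auto
  show ?thesis using Cl(2)[OF f, of k x] R by (auto simp: ennreal_mult_less_top intro: le_less_trans)
qed

text \<open>The majorant is finite at almost every point only, so the spatial coordinate of z is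
  replaced by a nearby x. On the box V the part of the integral over \<open>nbhd\<close> is bounded
  through the distance \<delta>, the rest by the majorant at x. One bound on a neighbourhood is what
  compactness arguments need later.\<close>

lemma tail_locally_bounded:
  fixes f :: "real \<times> (real ^ 'n) \<Rightarrow> complex"
  assumes f [measurable]: "f \<in> borel_measurable borel" and fin: "\<And>k. AE x in lborel. majorant M r f k x < top"
    and z: "z \<in> half_space" "0 < \<delta>"
  shows "\<exists>V. open V \<and> z \<in> V \<and> (\<exists>B<top. \<forall>z'\<in>V. tail f \<delta> z' \<le> B)"
proof -
  obtain Cf where Cf: "0 \<le> Cf" "\<And>f k t x z. f \<in> borel_measurable borel \<Longrightarrow> t \<in> slice CARD('n) k \<Longrightarrow> z \<in> {t / 2..t} \<times> ball x t \<Longrightarrow>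
    (\<integral>\<^sup>+w. ennreal (norm (kap z w) * norm (f w)) * indicator (half_space - nbhd k x) w \<partial>lborel) \<le> ennreal Cf * majorant M r f k x"
    using far_bound by blast
  obtain t0 x0 where zt: "z = (t0, x0)" "0 < t0" using z by (auto simp: half_space_def)
  \<comment> \<open>The factor 4/3 puts t0 into the open interval from t/2 to t, so that V is a
    neighbourhood of z.\<close>
  define t where "t = 4 / 3 * t0"
  have t: "0 < t" "t / 2 < t0" "t0 < t" using zt(2) by (auto simp: t_def)
  obtain k where k: "t \<in> slice CARD('n) k" using ex_slice[OF t(1)] .
  obtain x where x: "norm (x - x0) < t" "majorant M r f k x < top" using ex_majorant_finite[OF fin t(1)] by blast
  define V where "V = {t / 2<..<t} \<times> ball x t"
  have oV: "open V" unfolding V_def by (intro open_Times) auto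
  have zV: "z \<in> V" using x(1) t by (auto simp: V_def zt dist_norm)
  define c where "c = C0 / \<delta> ^ (1 + CARD('n))"
  have c: "0 \<le> c" using C0 z by (simp add: c_def)
  obtain m where m: "nbhd k x \<subseteq> Km m" using nbhd_in_Km by blast
  have "restrict_to (nbhd k x) f \<in> borel_measurable borel" by (intro restrict_borel) measurable
  moreover have "Ir r (restrict_to (nbhd k x) f) < top"
    unfolding Ir_def nn_integral_half_leb using nbhd_integral_finite[OF f x(2)]
    by (rule le_less_trans[rotated]) (intro nn_integral_mono, auto simp: restrict_to_def indicator_def)
  moreover have "emeasure lborel (nbhd k x) < top"
    using emeasure_mono[OF m, of lborel] emeasure_compact_finite[OF Km_compact, of m] by (auto intro: le_less_trans)
  ultimately have near: "(\<integral>\<^sup>+w. ennreal (norm (restrict_to (nbhd k x) f w)) * indicator (nbhd k x) w \<partial>lborel) < top"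
    using m Km_half[of m] by (intro integrable_on_bounded) auto
  define B where "B = ennreal c * (\<integral>\<^sup>+w. ennreal (norm (restrict_to (nbhd k x) f w)) * indicator (nbhd k x) w \<partial>lborel) + ennreal Cf * majorant M r f k x"
  have VB: "tail f \<delta> z' \<le> B" if "z' \<in> V" for z'
  proof -
    have zb: "z' \<in> {t / 2..t} \<times> ball x t" and zh: "z' \<in> half_space" using that t by (auto simp: V_def half_space_def)
    have "tail f \<delta> z' \<le> (\<integral>\<^sup>+w. ennreal c * (ennreal (norm (restrict_to (nbhd k x) f w)) * indicator (nbhd k x) w)
        + ennreal (norm (kap z' w) * norm (f w)) * indicator (half_space - nbhd k x) w \<partial>lborel)"
      unfolding tail_def
    proof (rule nn_integral_mono)
      fix w
      show "ennreal (norm (kap z' w) * norm (f w)) * indicator {w \<in> half_space. \<delta> \<le> dist z' w} w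
        \<le> ennreal c * (ennreal (norm (restrict_to (nbhd k x) f w)) * indicator (nbhd k x) w)
        + ennreal (norm (kap z' w) * norm (f w)) * indicator (half_space - nbhd k x) w"
      proof (cases "w \<in> nbhd k x \<and> \<delta> \<le> dist z' w")
        case True
        then have "norm (kap z' w) * norm (f w) \<le> c * norm (f w)"
          unfolding c_def using z(2) zh by (intro mult_right_mono kap_bound_dist) auto
        then show ?thesis using True c by (auto simp: restrict_to_def indicator_def ennreal_mult[symmetric] intro!: ennreal_leI)
      qed (auto simp: indicator_def)
    qed
    also have "\<dots> = ennreal c * (\<integral>\<^sup>+w. ennreal (norm (restrict_to (nbhd k x) f w)) * indicator (nbhd k x) w \<partial>lborel)
       + (\<integral>\<^sup>+w. ennreal (norm (kap z' w) * norm (f w)) * indicator (half_space - nbhd k x) w \<partial>lborel)"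
    proof -
      have [measurable]: "restrict_to (nbhd k x) f \<in> borel_measurable borel" by (intro restrict_borel) measurable
      show ?thesis by (subst nn_integral_add, measurable, subst nn_integral_cmult) measurable
    qed
    also have "\<dots> \<le> B" unfolding B_def by (intro add_left_mono Cf(2)[OF f k zb])
    finally show ?thesis .
  qed
  have "B < top" using near x(2) by (simp add: B_def ennreal_mult_less_top)
  then have "\<exists>B<top. \<forall>z'\<in>V. tail f \<delta> z' \<le> B" using VB by (intro exI[of _ B] conjI ballI)
  then show ?thesis using oV zV by (intro exI[of _ V] conjI)
qed

text \<open>Local integrability follows by covering \<open>Km m\<close> with finitely many open
  boxes, each inside some \<open>nbhd\<close> centred at a point where the majorant is
  finite.\<close>

lemma good_of_majorant:
  fixes f :: "real \<times> (real ^ 'n) \<Rightarrow> complex"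
  assumes f [measurable]: "f \<in> borel_measurable borel" and fin: "\<And>k. AE x in lborel. majorant M r f k x < top"
  shows "good f"
  unfolding good_def
proof (intro conjI allI ballI impI)
  show "f \<in> borel_measurable half_leb" by (rule measurable_half_leb_borel) simp
  fix m
  define P where "P V \<longleftrightarrow> (\<integral>\<^sup>+w. ennreal (norm (f w) powr r) * indicator V w \<partial>lborel) < top" for V
  have "\<exists>V. open V \<and> z \<in> V \<and> P V" if z: "z \<in> Km m" for z
  proof -
    obtain t x0 where zt: "z = (t, x0)" "0 < t" using z Km_half[of m] by (auto simp: half_space_def)
    obtain k where k: "t \<in> slice CARD('n) k" using ex_slice[OF zt(2)] .
    obtain x where x: "norm (x - x0) < tau CARD('n) k" "majorant M r f k x < top" using ex_majorant_finite[OF fin, of "tau CARD('n) k"] by auto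
    define V where "V = {tau CARD('n) (k - 5)<..<tau CARD('n) (k + 3)} \<times> ball x (3 * tau CARD('n) k)"
    have "open V" unfolding V_def by (intro open_Times) auto
    moreover have "z \<in> V"
      using k x(1) tau_mono[of "k - 5" "k - 1" "CARD('n)"] tau_strict_mono[of k "k + 3" "CARD('n)"] tau_pos[of "CARD('n)" k]
      by (auto simp: V_def zt slice_def dist_norm simp del: tau_pos)
    moreover have "P V"
      unfolding P_def using nbhd_integral_finite[OF f x(2)]
      by (rule le_less_trans[rotated]) (intro nn_integral_mono mult_left_mono, auto simp: V_def nbhd_def indicator_def)
    ultimately show ?thesis by blast
  qed
  then obtain V where V: "\<And>z. z \<in> Km m \<Longrightarrow> open (V z)" "\<And>z. z \<in> Km m \<Longrightarrow> z \<in> V z" "\<And>z. z \<in> Km m \<Longrightarrow> P (V z)" by metis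
  obtain F where F: "F \<subseteq> Km m" "finite F" "Km m \<subseteq> (\<Union>z\<in>F. V z)"
    by (rule compactE_image[OF Km_compact[of m], where C="Km m" and f=V]) (use V in auto)
  have "Ir r (restrict_to (Km m) f) \<le> (\<integral>\<^sup>+w. (\<Sum>z\<in>F. ennreal (norm (f w) powr r) * indicator (V z) w) \<partial>lborel)"
    unfolding Ir_def nn_integral_half_leb
  proof (rule nn_integral_mono)
    fix w
    show "ennreal (norm (restrict_to (Km m) f w) powr r) * indicator half_space w \<le> (\<Sum>z\<in>F. ennreal (norm (f w) powr r) * indicator (V z) w)"
    proof (cases "w \<in> Km m")
      case True
      then obtain z where z: "z \<in> F" "w \<in> V z" using F(3) by auto
      have "ennreal (norm (f w) powr r) * indicator (V z) w \<le> (\<Sum>z\<in>F. ennreal (norm (f w) powr r) * indicator (V z) w)"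
        using F(2) z by (intro member_le_sum) auto
      moreover have "ennreal (norm (restrict_to (Km m) f w) powr r) * indicator half_space w \<le> ennreal (norm (f w) powr r) * indicator (V z) w"
        using z True by (simp add: restrict_to_def indicator_def)
      ultimately show ?thesis by (rule order_trans[rotated])
    qed (simp add: restrict_to_def)
  qed
  also have "\<dots> = (\<Sum>z\<in>F. \<integral>\<^sup>+w. ennreal (norm (f w) powr r) * indicator (V z) w \<partial>lborel)"
  proof (rule nn_integral_sum)
    fix z assume "z \<in> F"
    then have "z \<in> Km m" using F(1) by blast
    then have [measurable]: "V z \<in> sets borel" by (intro borel_open V)
    show "(\<lambda>w. ennreal (norm (f w) powr r) * indicator (V z) w) \<in> borel_measurable lborel" by measurable
  qed
  also have "\<dots> < top" using V(3) F(1,2) by (auto simp: P_def subset_eq)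
  finally show "Ir r (restrict_to (Km m) f) < top" .
next
  fix z :: "real \<times> (real ^ 'n)" and \<delta> :: real assume z: "z \<in> half_space" "0 < \<delta>"
  then show "tail f \<delta> z < top" using tail_locally_bounded[OF f fin z] by (auto intro: le_less_trans)
qed

text \<open>On the Whitney box the image splits at \<open>nbhd\<close>. The near part is estimated
  by boundedness of \<open>A0\<close> and \<open>local_integral_le\<close>, whose volume factor
  matches that of the box; the far part is bounded pointwise by the majorant at the centre
  x.\<close>

lemma whitney_Aop_le:
  "\<exists>C<top. \<forall>f k t x. f \<in> borel_measurable borel \<longrightarrow> good f \<longrightarrow> t \<in> slice CARD('n) k \<longrightarrow>
    whitney_avg r (Aop f) t (x :: real ^ 'n) \<le> C * majorant M r f k x"
proof -
  define d where "d = CARD('n)"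
  obtain Cl where Cl: "0 \<le> Cl" "\<And>(f :: real \<times> (real ^ 'n) \<Rightarrow> complex) k x. f \<in> borel_measurable borel \<Longrightarrow>
    (\<integral>\<^sup>+w. ennreal (norm (f w) powr r) * indicator (nbhd k x) w \<partial>lborel)
      \<le> ennreal (Cl * tau d k ^ (1 + d)) * epowr (majorant M r f k x) r"
    using local_integral_le[OF _ M, of r, where 'n='n] r by (auto simp: d_def)
  obtain Cf where Cf: "0 \<le> Cf" "\<And>f k t x z. f \<in> borel_measurable borel \<Longrightarrow> t \<in> slice CARD('n) k \<Longrightarrow> z \<in> {t / 2..t} \<times> ball x t \<Longrightarrow>
    (\<integral>\<^sup>+w. ennreal (norm (kap z w) * norm (f w)) * indicator (half_space - nbhd k x) w \<partial>lborel) \<le> ennreal Cf * majorant M r f k x"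
    using far_bound by blast
  define \<omega> where "\<omega> = unit_ball_vol (real d)"
  have \<omega>: "0 < \<omega>" by (simp add: \<omega>_def unit_ball_vol_pos)
  \<comment> \<open>2^r comes from the r-th power of a sum, 2^(1+d) from \<open>tau d k\<close>
    \<le> 2 t, and 2/\<omega> from the volume of the Whitney box.\<close>
  define B where "B = 2 powr r * (cA * Cl * 2 ^ (1 + d) * 2 / \<omega> + Cf powr r)"
  have B: "0 \<le> B" using cA Cl \<omega> by (simp add: B_def)
  have "whitney_avg r (Aop f) t x \<le> ennreal (B powr (1 / r)) * majorant M r f k x"
    if f [measurable]: "f \<in> borel_measurable borel" and gd: "good f" and t: "t \<in> slice CARD('n) k"
    for f :: "real \<times> (real ^ 'n) \<Rightarrow> complex" and k t x
  proof -
    define R where "R = majorant M r f k x"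
    define Bx where "Bx = {t / 2..t} \<times> ball x t"
    define S where "S = nbhd k x"
    have t0: "0 < t" "tau d k \<le> 2 * t"
    proof -
      show "0 < t" by (rule slice_pos[OF t])
      have "tau d k / sqrt 3 < t" using t by (simp add: slice_def tau_pred d_def)
      moreover have "tau d k / 2 \<le> tau d k / sqrt 3" using sqrt3 by (intro divide_left_mono) (auto simp: less_imp_le)
      ultimately show "tau d k \<le> 2 * t" by linarith
    qed
    obtain m0 where m0: "S \<subseteq> Km m0" using nbhd_in_Km unfolding S_def by blast
    have [measurable]: "S \<in> sets borel" "Bx \<in> sets borel" by (auto simp: S_def Bx_def intro!: borel_Times)
    have Bxh: "Bx \<subseteq> half_space" using t0 by (auto simp: Bx_def half_space_def)
    have rb: "restrict_to S f \<in> borel_measurable borel" by (rule restrict_borel) measurable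
    have SL: "restrict_to S f \<in> L"
    proof -
      have "Ir r (restrict_to S f) \<le> Ir r (restrict_to (Km m0) f)"
        using m0 by (intro Ir_mono_AE[OF r0]) (auto simp: restrict_to_def indicator_def)
      then show ?thesis using good_L[OF gd, of m0] measurable_half_leb_borel[OF rb] by (auto simp: space_Lr_iff intro: le_less_trans)
    qed
    have IS: "Ir r (restrict_to S f) \<le> ennreal (Cl * tau d k ^ (1 + d)) * epowr R r"
    proof -
      have "Ir r (restrict_to S f) \<le> (\<integral>\<^sup>+w. ennreal (norm (f w) powr r) * indicator S w \<partial>lborel)"
        unfolding Ir_def nn_integral_half_leb by (intro nn_integral_mono) (auto simp: restrict_to_def indicator_def)
      also have "\<dots> \<le> ennreal (Cl * tau d k ^ (1 + d)) * epowr R r" unfolding S_def R_def by (rule Cl(2)[OF f])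
      finally show ?thesis .
    qed
    have pos: "0 < tau CARD('n) k / 18" by simp
    have "AE z in half_leb. z \<in> Bx \<longrightarrow>
        ennreal (norm (Aop f z) powr r) \<le> ennreal (2 powr r) * (ennreal (norm (A0 (restrict_to S f) z) powr r) + epowr (ennreal Cf * R) r)"
    proof -
      have "AE z in half_leb. z \<in> Bx \<longrightarrow>
        (\<lambda>m. A0 (restrict_to (Km m) f) z) \<longlonglongrightarrow> Aop f z \<and>
        Aop f z = A0 (restrict_to S f) z + (LINT w|lborel. kap z w * (indicator (half_space - S) w * f w)) \<and>
        ennreal (norm (LINT w|lborel. kap z w * (indicator (half_space - S) w * f w)))
          \<le> (\<integral>\<^sup>+w. ennreal (norm (kap z w) * norm (f w)) * indicator (half_space - S) w \<partial>lborel)"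
        by (rule Aop_representation[OF f gd _ m0 pos]) (use nbhd_dist[OF t, of _ x] in \<open>auto simp: Bx_def S_def\<close>)
      then show ?thesis
      proof eventually_elim
        case (elim z)
        show ?case
        proof
          assume zB: "z \<in> Bx"
          define I where "I = (LINT w|lborel. kap z w * (indicator (half_space - S) w * f w))"
          have "ennreal (norm I) \<le> ennreal Cf * R"
            using elim zB Cf(2)[OF f _ zB[unfolded Bx_def], of k] t unfolding I_def R_def S_def d_def
            by (meson order_trans)
          then have "ennreal (norm I powr r) \<le> epowr (ennreal Cf * R) r"
            using r0 epowr_mono[of "ennreal (norm I)" "ennreal Cf * R" r] by simp
          moreover have "Aop f z = A0 (restrict_to S f) z + I" using elim zB by (simp add: I_def)
          ultimately show "ennreal (norm (Aop f z) powr r) \<le> ennreal (2 powr r) * (ennreal (norm (A0 (restrict_to S f) z) powr r) + epowr (ennreal Cf * R) r)"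
            by (auto intro!: order_trans[OF norm_add_powr_le[OF r0]] mult_left_mono add_left_mono)
        qed
      qed
    qed
    then have "box_int r (Aop f) t x \<le> (\<integral>\<^sup>+z. ennreal (2 powr r) * (ennreal (norm (A0 (restrict_to S f) z) powr r) + epowr (ennreal Cf * R) r * indicator Bx z) \<partial>half_leb)"
      unfolding box_int_def nn_integral_half_leb AE_half_leb Bx_def[symmetric]
      by (intro nn_integral_mono_AE) (use Bxh in \<open>auto elim!: eventually_mono simp: indicator_def subset_eq\<close>)
    also have "\<dots> = ennreal (2 powr r) * (Ir r (A0 (restrict_to S f)) + epowr (ennreal Cf * R) r * emeasure lborel Bx)"
    proof -
      have [measurable]: "(\<lambda>z. ennreal (norm (A0 (restrict_to S f) z) powr r)) \<in> borel_measurable half_leb"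
        using A0_L[OF SL] by (auto simp: space_Lr_iff)
      have [measurable]: "(indicator Bx :: _ \<Rightarrow> ennreal) \<in> borel_measurable half_leb" by (rule measurable_half_leb_borel) simp
      have "(\<integral>\<^sup>+z. indicator Bx z \<partial>half_leb) = (\<integral>\<^sup>+z. indicator Bx z \<partial>lborel)"
        unfolding nn_integral_half_leb using Bxh by (intro nn_integral_cong) (auto simp: indicator_def subset_eq)
      then have "(\<integral>\<^sup>+z. indicator Bx z \<partial>half_leb) = emeasure lborel Bx" by simp
      then show ?thesis by (subst nn_integral_cmult, measurable, subst nn_integral_add, measurable, subst nn_integral_cmult, measurable, simp add: Ir_def)
    qed
    also have "emeasure lborel Bx = ennreal (\<omega> / 2 * t ^ (1 + d))"
    proof -
      have "emeasure lborel Bx = emeasure lborel {t / 2..t} * emeasure lborel (ball x t)"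
        unfolding Bx_def lborel_prod[symmetric] by (rule lborel.emeasure_pair_measure_Times) auto
      also have "\<dots> = ennreal (t / 2) * ennreal (\<omega> * t ^ d)" using t0 by (simp add: emeasure_ball \<omega>_def d_def)
      also have "\<dots> = ennreal (\<omega> / 2 * t ^ (1 + d))" using t0 \<omega> by (subst ennreal_mult[symmetric]) (auto simp: mult_ac)
      finally show ?thesis .
    qed
    also have "ennreal (2 powr r) * (Ir r (A0 (restrict_to S f)) + epowr (ennreal Cf * R) r * ennreal (\<omega> / 2 * t ^ (1 + d)))
      \<le> ennreal (2 powr r) * (ennreal (cA * Cl * 2 ^ (1 + d) * t ^ (1 + d)) * epowr R r + ennreal (Cf powr r * (\<omega> / 2 * t ^ (1 + d))) * epowr R r)"
    proof (intro mult_left_mono add_mono)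
      have "Ir r (A0 (restrict_to S f)) \<le> ennreal cA * Ir r (restrict_to S f)" by (rule cA(2)[OF SL])
      also have "\<dots> \<le> ennreal cA * (ennreal (Cl * tau d k ^ (1 + d)) * epowr R r)" by (intro mult_left_mono IS) simp
      also have "\<dots> \<le> ennreal cA * (ennreal (Cl * (2 * t) ^ (1 + d)) * epowr R r)"
        using t0 Cl by (intro mult_left_mono mult_right_mono ennreal_leI power_mono) (auto simp: less_imp_le)
      also have "\<dots> = ennreal (cA * Cl * 2 ^ (1 + d) * t ^ (1 + d)) * epowr R r"
        using t0 Cl cA by (simp only: mult.assoc[symmetric] power_mult_distrib ennreal_mult[symmetric] mult_nonneg_nonneg zero_le_power less_imp_le zero_le_numeral)
      finally show "Ir r (A0 (restrict_to S f)) \<le> ennreal (cA * Cl * 2 ^ (1 + d) * t ^ (1 + d)) * epowr R r" .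
      have "epowr (ennreal Cf * R) r * ennreal (\<omega> / 2 * t ^ (1 + d)) = ennreal (Cf powr r * (\<omega> / 2 * t ^ (1 + d))) * epowr R r"
      proof -
        have "0 \<le> \<omega> / 2 * t ^ (1 + d)" using t0 \<omega> by simp
        then have "ennreal (Cf powr r * (\<omega> / 2 * t ^ (1 + d))) = ennreal (Cf powr r) * ennreal (\<omega> / 2 * t ^ (1 + d))"
          by (intro ennreal_mult) auto
        then show ?thesis unfolding epowr_real_bound[OF Cf(1) r0] by (simp only: mult_ac)
      qed
      then show "epowr (ennreal Cf * R) r * ennreal (\<omega> / 2 * t ^ (1 + d)) \<le> ennreal (Cf powr r * (\<omega> / 2 * t ^ (1 + d))) * epowr R r" by simp
    qed simp
    also have "\<dots> = (ennreal B * epowr R r) * ennreal (\<omega> / 2 * t ^ (1 + d))"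
    proof -
      have "B * (\<omega> / 2 * t ^ (1 + d)) = 2 powr r * (cA * Cl * 2 ^ (1 + d) * t ^ (1 + d) + Cf powr r * (\<omega> / 2 * t ^ (1 + d)))"
        using \<omega> by (simp add: B_def field_simps)
      moreover have "ennreal B * epowr R r * ennreal (\<omega> / 2 * t ^ (1 + d)) = ennreal (B * (\<omega> / 2 * t ^ (1 + d))) * epowr R r"
        using B t0 \<omega> by (subst ennreal_mult) (auto simp: mult_ac)
      moreover have "0 \<le> cA * Cl * 2 ^ (1 + d) * t ^ (1 + d)" "0 \<le> Cf powr r * (\<omega> / 2 * t ^ (1 + d))"
        using cA Cl t0 \<omega> by auto
      ultimately show ?thesis by (simp only: ennreal_mult ennreal_plus distrib_right mult.assoc powr_ge_zero add_nonneg_nonneg)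
    qed
    finally have "box_int r (Aop f) t x / ennreal (\<omega> / 2 * t ^ (1 + d)) \<le> (ennreal B * epowr R r) * ennreal (\<omega> / 2 * t ^ (1 + d)) / ennreal (\<omega> / 2 * t ^ (1 + d))"
      by (rule divide_right_mono_ennreal)
    also have "\<dots> = ennreal B * epowr R r"
    proof (rule ennreal_mult_divide_eq)
      have "0 < \<omega> / 2 * t ^ (1 + d)" using \<omega> t0 by simp
      then show "ennreal (\<omega> / 2 * t ^ (1 + d)) \<noteq> 0" by (simp only: ennreal_eq_0_iff not_le)
    qed simp
    finally have "epowr (box_int r (Aop f) t x / ennreal (\<omega> / 2 * t ^ (1 + d))) (1 / r) \<le> epowr (ennreal B * epowr R r) (1 / r)"
      using r0 by (intro epowr_mono) auto
    then show ?thesis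
      using whitney_avg_eq[OF Aop_measurable[OF gd] t0(1), of r x] r0 B
      by (simp add: epowr_real_bound R_def \<omega>_def d_def)
  qed
  then show ?thesis by (intro exI[of _ "ennreal (B powr (1 / r))"]) auto
qed

end


section \<open>Functions supported in a fixed compact set\<close>

lemma epowr_indicator [simp]: "epowr (indicator A x) a = indicator A x"
  by (simp add: indicator_def)

lemma epowr_tendsto_0:
  assumes "0 < a" "(u \<longlongrightarrow> 0) F"
  shows "((\<lambda>i. epowr (u i) a) \<longlongrightarrow> 0) F"
proof (rule order_tendstoI)
  fix e :: ennreal assume "0 < e"
  then have "0 < epowr e (1 / a)" using assms(1) by (cases e) auto
  from order_tendstoD(2)[OF assms(2) this] show "\<forall>\<^sub>F i in F. epowr (u i) a < e"
    by eventually_elim (use le_epowr_swap[OF assms(1)] in \<open>simp add: not_le[symmetric]\<close>)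
qed simp

lemma slice_index_mono: "t \<in> slice d k \<Longrightarrow> s \<in> slice d j \<Longrightarrow> t \<le> s \<Longrightarrow> k \<le> j"
  using tau_mono[of j "k - 1" d] by (force simp: slice_def)

lemma dtn_box_finite:
  assumes pq: "0 < p" "0 < q"
  shows "dtn p q (\<lambda>k x. indicator {k0..k1} k * indicator (ball (0 :: real ^ 'n) \<rho>) x) < top"
proof -
  define Z where "Z k x = (indicator {k0..k1} k * indicator (ball (0 :: real ^ 'n) \<rho>) x :: ennreal)" for k x
  define N where "N = csum (\<lambda>k :: int. indicator {k0..k1} k)"
  have N: "N < top" by (simp add: N_def ennreal_of_nat_eq_real_of_nat)
  have Z1: "Z k x \<le> indicator (ball 0 \<rho>) x" for k x by (simp add: Z_def indicator_def)
  have eZ: "epowr (Z k x) Q = Z k x" for k x Q by (simp add: Z_def indicator_def)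
  have cZ: "csum (\<lambda>k. Z k x) = N * indicator (ball 0 \<rho>) x" for x
    unfolding Z_def N_def by (rule csum_multc)
  have vol: "emeasure lborel (ball (0 :: real ^ 'n) \<rho>) < top" using emeasure_lborel_ball_finite[of "0 :: real ^ 'n" \<rho>] by simp
  have "dtn p q Z < top"
    using pq(1)
  proof (cases rule: exponent_cases)
    case p: 1
    from pq(2) show ?thesis
    proof (cases rule: exponent_cases)
      case 1
      have "(SUP k. SUP x. Z k x) \<le> 1" by (intro SUP_least) (simp add: Z_def indicator_def)
      then show ?thesis unfolding p 1 dtn_inf_inf using ennreal_one_less_top by (rule le_less_trans)
    next
      case (2 Q)
      define V where "V = ennreal (unit_ball_vol CARD('n))"
      have "carl Q Z j y \<le> epowr (epowr (N * V) (1 / Q)) Q" for j y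
      proof -
        have "(\<integral>\<^sup>+x. csum (\<lambda>k. if k \<le> j then epowr (Z k x) Q else 0) * indicator (ball y (tau CARD('n) j)) x \<partial>lborel)
          \<le> (\<integral>\<^sup>+x. N * indicator (ball y (tau CARD('n) j)) x \<partial>lborel)"
          unfolding N_def eZ
          by (intro nn_integral_mono mult_right_mono) (auto simp: Z_def indicator_def)
        also have "\<dots> = N * (V * ennreal (tau CARD('n) j ^ CARD('n)))"
          by (simp add: nn_integral_cmult_indicator emeasure_ball V_def less_imp_le ennreal_mult)
        finally have "carl Q Z j y \<le> N * V * ennreal (tau CARD('n) j ^ CARD('n)) / ennreal (tau CARD('n) j ^ CARD('n))"
          unfolding carl_def by (intro divide_right_mono_ennreal) (simp add: mult.assoc)
        also have "\<dots> = N * V" by (rule ennreal_mult_divide_eq) auto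
        finally show ?thesis using 2 by simp
      qed
      then have "dtn p q Z \<le> epowr (N * V) (1 / Q)" unfolding p 2 by (rule dtn_inf_fin_le[OF 2(2)])
      also have "\<dots> < top" using N by (simp add: V_def ennreal_mult_less_top)
      finally show ?thesis .
    qed
  next
    case p: (2 P)
    have fin: "(\<integral>\<^sup>+x. c * indicator (ball (0 :: real ^ 'n) \<rho>) x \<partial>lborel) < top" if "c < top" for c
      using that vol by (simp add: nn_integral_cmult_indicator ennreal_mult_less_top)
    from pq(2) show ?thesis
    proof (cases rule: exponent_cases)
      case 1
      have "(\<integral>\<^sup>+x. epowr (SUP k. Z k x) P \<partial>lborel) \<le> (\<integral>\<^sup>+x. 1 * indicator (ball (0 :: real ^ 'n) \<rho>) x \<partial>lborel)"
      proof (rule nn_integral_mono)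
        fix x
        have "epowr (SUP k. Z k x) P \<le> epowr (indicator (ball 0 \<rho>) x) P" using p by (intro epowr_mono SUP_least Z1) auto
        then show "epowr (SUP k. Z k x) P \<le> 1 * indicator (ball 0 \<rho>) x" by simp
      qed
      from le_less_trans[OF this fin] show ?thesis unfolding p 1 dtn_fin_inf[OF p(2)] by simp
    next
      case (2 Q)
      have "(\<integral>\<^sup>+x. epowr (csum (\<lambda>k. epowr (Z k x) Q)) (P / Q) \<partial>lborel) = (\<integral>\<^sup>+x. epowr N (P / Q) * indicator (ball (0 :: real ^ 'n) \<rho>) x \<partial>lborel)"
        unfolding eZ cZ using p 2 by (simp add: epowr_mult)
      with fin[of "epowr N (P / Q)"] N show ?thesis unfolding p 2 dtn_fin_fin[OF p(2) 2(2)] by simp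
    qed
  qed
  then show ?thesis by (simp add: Z_def[abs_def])
qed

text \<open>For functions supported in K the Whitney averages vanish unless t and x stay in a
  bounded range with t away from 0. Only finitely many scales occur, and all weights become
  constants. Convergence in L^r on K therefore implies convergence in any of the tent norms.\<close>

lemma tent_norm_le_Lr_norm:
  fixes K :: "(real \<times> (real ^ 'n)) set"
  assumes pq: "0 < p" "0 < q" and r: "0 < r" and K: "compact K" "K \<subseteq> half_space"
  shows "\<exists>C<top. \<forall>h\<in>borel_measurable half_leb. (\<forall>z\<in>half_space - K. h z = 0) \<longrightarrow> tent_norm p q r \<beta> h \<le> C * Lr_norm r h"
proof -
  define d where "d = CARD('n)"
  obtain a b \<rho> where ab: "0 < a" "K \<subseteq> {a..b} \<times> ball 0 \<rho>" by (rule compact_half_box[OF K])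
  \<comment> \<open>A window [t/2, t] meeting the times of K has a \<le> t \<le> 2 b; the maximum
    with a secures positivity.\<close>
  define b' where "b' = 2 * max a b"
  have "0 < b'" using ab by (simp add: b'_def)
  obtain k0 where k0: "a \<in> slice d k0" using ex_slice[OF ab(1)] .
  obtain k1 where k1: "b' \<in> slice d k1" using ex_slice[OF \<open>0 < b'\<close>] .
  define Z where "Z k x = (indicator {k0..k1} k * indicator (ball (0 :: real ^ 'n) (\<rho> + b')) x :: ennreal)" for k x
  have [measurable]: "Z k \<in> borel_measurable borel" for k
    unfolding Z_def[abs_def] by (intro borel_measurable_times_ennreal borel_measurable_const borel_measurable_indicator borel_open open_ball)
  define V where "V t = unit_ball_vol d / 2 * t ^ (1 + d)" for t
  define c where "c = (1 / V a) powr (1 / r)"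
  \<comment> \<open>One of the two end scales maximises the weight, depending on the sign of the
    exponent.\<close>
  define e where "e = tau d k0 powr (rcp q - \<beta>) + tau d k1 powr (rcp q - \<beta>)"
  obtain C where C: "C < top" "\<And>(F :: real \<times> (real ^ 'n) \<Rightarrow> complex) R. F \<in> borel_measurable half_leb \<Longrightarrow> (\<forall>k. R k \<in> borel_measurable borel) \<Longrightarrow>
    (\<forall>k t x. t \<in> slice d k \<longrightarrow> whitney_avg r F t x \<le> R k x) \<Longrightarrow>
    tent_norm p q r \<beta> F \<le> C * dtn p q (\<lambda>k x. ennreal (tau d k powr (rcp q - \<beta>)) * R k x)"
    using tent_norm_le_dtn[OF pq, of r \<beta>, where 'n='n] unfolding d_def by blast
  have Va: "0 < V a" using ab by (simp add: V_def unit_ball_vol_pos)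
  have "tent_norm p q r \<beta> h \<le> (C * (ennreal e * ennreal c * dtn p q Z)) * Lr_norm r h"
    if h: "h \<in> borel_measurable half_leb" "\<forall>z\<in>half_space - K. h z = 0" for h
  proof -
    define l where "l = Lr_norm r h"
    have W: "whitney_avg r h t x \<le> ennreal c * l * Z k x" if t: "t \<in> slice d k" for k t x
    proof (cases "box_int r h t x = 0")
      case True
      then show ?thesis using whitney_avg_eq[OF h(1) slice_pos[OF t], of r x] by simp
    next
      case False
      have t0: "0 < t" by (rule slice_pos[OF t])
      have "\<exists>s y. (s, y) \<in> K \<and> t / 2 \<le> s \<and> s \<le> t \<and> norm (y - x) < t"
      proof (rule ccontr)
        assume no: "\<not> ?thesis"
        have "h z = 0" if "z \<in> {t / 2..t} \<times> ball x t" for z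
        proof -
          obtain s y where z: "z = (s, y)" by (cases z)
          have "z \<notin> K" using no that by (auto simp: z dist_norm norm_minus_commute[of x y])
          moreover have "z \<in> half_space" using that t0 by (auto simp: half_space_def)
          ultimately show ?thesis using h(2) by auto
        qed
        then have "box_int r h t x = (\<integral>\<^sup>+z. 0 \<partial>(lborel :: (real \<times> (real ^ 'n)) measure))"
          unfolding box_int_def by (intro nn_integral_cong) (auto simp: indicator_def)
        with False show False by simp
      qed
      then obtain s y where sy: "(s, y) \<in> K" "t / 2 \<le> s" "s \<le> t" "norm (y - x) < t" by blast
      have ta: "a \<le> t" "t \<le> b'" and y: "norm y < \<rho>" using sy ab by (auto simp: b'_def)
      have "norm x < \<rho> + b'" using norm_triangle_ineq2[of x y] sy(4) y ta by (simp add: norm_minus_commute)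
      then have Z: "Z k x = 1" using slice_index_mono[OF k0 t ta(1)] slice_index_mono[OF t k1 ta(2)] by (simp add: Z_def)
      have "box_int r h t x \<le> Ir r h"
        unfolding box_int_def Ir_def nn_integral_half_leb using t0
        by (intro nn_integral_mono) (auto simp: indicator_def half_space_def)
      moreover have "V a \<le> V t" unfolding V_def using ab ta by (intro mult_left_mono power_mono) auto
      ultimately have "box_int r h t x / ennreal (V t) \<le> Ir r h / ennreal (V a)"
        unfolding divide_ennreal_def using Va by (intro mult_mono) (auto simp: inverse_ennreal intro!: le_imp_inverse_le)
      also have "\<dots> = ennreal (1 / V a) * Ir r h"
        using Va by (simp add: divide_ennreal_def inverse_ennreal mult.commute inverse_eq_divide)
      finally have "epowr (box_int r h t x / ennreal (V t)) (1 / r) \<le> epowr (ennreal (1 / V a) * Ir r h) (1 / r)"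
        using r by (intro epowr_mono) auto
      also have "\<dots> = ennreal c * l" unfolding c_def l_def Lr_norm_Ir using Va r by (intro epowr_real_bound) auto
      finally show ?thesis using whitney_avg_eq[OF h(1) t0, of r x] by (simp add: V_def Z d_def)
    qed
    have "tent_norm p q r \<beta> h \<le> C * dtn p q (\<lambda>k x. ennreal (tau d k powr (rcp q - \<beta>)) * (ennreal c * l * Z k x))"
      by (rule C(2)[OF h(1)]) (use W in auto)
    also have "\<dots> \<le> C * dtn p q (\<lambda>k x. (ennreal e * ennreal c * l) * Z k x)"
    proof (intro mult_left_mono dtn_mono pq)
      fix k x
      have "tau d k powr (rcp q - \<beta>) \<le> e" if "k0 \<le> k" "k \<le> k1"
      proof (cases "0 \<le> rcp q - \<beta>")
        case True
        then show ?thesis unfolding e_def using tau_mono[OF that(2), of d] tau_pos[of d k]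
          by (intro add_increasing powr_mono2) (auto simp: less_imp_le simp del: tau_pos)
      next
        case False
        then show ?thesis unfolding e_def using tau_mono[OF that(1), of d] tau_pos[of d k0]
          by (intro add_increasing2 powr_mono2') (auto simp: less_imp_le simp del: tau_pos)
      qed
      then show "ennreal (tau d k powr (rcp q - \<beta>)) * (ennreal c * l * Z k x) \<le> ennreal e * ennreal c * l * Z k x"
        unfolding mult.assoc by (cases "k \<in> {k0..k1}") (auto simp: Z_def intro!: mult_right_mono ennreal_leI)
    qed simp
    also have "dtn p q (\<lambda>k x. (ennreal e * ennreal c * l) * Z k x) = (ennreal e * ennreal c * l) * dtn p q Z"
      using pq by (intro dtn_cmult) auto
    finally show ?thesis by (simp add: l_def mult_ac)
  qed
  moreover have "C * (ennreal e * ennreal c * dtn p q Z) < top"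
    using C(1) dtn_box_finite[OF pq, of k0 k1 "\<rho> + b'", where 'n='n] by (simp add: Z_def[abs_def] ennreal_mult_less_top)
  ultimately show ?thesis by (intro exI[of _ "C * (ennreal e * ennreal c * dtn p q Z)"]) auto
qed

lemma Linf_c_Lr:
  fixes \<phi> :: "real \<times> (real ^ 'n) \<Rightarrow> complex"
  assumes \<phi>: "\<phi> \<in> Linf_c" and r: "0 < r"
  shows "Ir r \<phi> < top"
proof -
  obtain B K where B: "\<And>z. z \<in> half_space \<Longrightarrow> norm (\<phi> z) \<le> B" and K: "compact K" "\<And>z. z \<in> half_space - K \<Longrightarrow> \<phi> z = 0"
    using \<phi> unfolding Linf_c_def by blast
  have [measurable]: "K \<in> sets borel" using K(1) by (intro borel_closed compact_imp_closed)
  have "Ir r \<phi> \<le> (\<integral>\<^sup>+z. ennreal (B powr r) * indicator K z \<partial>lborel)"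
    unfolding Ir_def nn_integral_half_leb
  proof (rule nn_integral_mono)
    fix z
    show "ennreal (norm (\<phi> z) powr r) * indicator half_space z \<le> ennreal (B powr r) * indicator K z"
      using B[of z] K(2)[of z] r by (cases "z \<in> K"; cases "z \<in> half_space") (auto intro!: ennreal_leI powr_mono2)
  qed
  also have "\<dots> < top" using emeasure_compact_finite[OF K(1)] by (simp add: nn_integral_cmult_indicator ennreal_mult_less_top)
  finally show ?thesis .
qed

lemma trunc_Linf_c:
  fixes h :: "real \<times> (real ^ 'n) \<Rightarrow> complex"
  assumes "h \<in> borel_measurable half_leb" "compact K" "K \<subseteq> half_space" "\<And>z. z \<in> half_space - K \<Longrightarrow> h z = 0"
  shows "trunc i h \<in> Linf_c"
  unfolding Linf_c_def
proof (intro CollectI conjI)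
  show "trunc i h \<in> borel_measurable half_leb" by (rule trunc_measurable[OF assms(1)])
  show "\<exists>M. \<forall>z\<in>half_space. norm (trunc i h z) \<le> M" by (intro exI[of _ "real i"]) (simp add: trunc_def)
  show "\<exists>K. compact K \<and> K \<subseteq> half_space \<and> (\<forall>z\<in>half_space - K. trunc i h z = 0)"
    using assms by (intro exI[of _ K]) (auto simp: trunc_def)
qed

lemma exhaustion_mono:
  assumes "compact_exhaustion Ks" "i \<le> j"
  shows "Ks i \<subseteq> Ks j"
proof (rule lift_Suc_mono_le[OF _ assms(2)])
  show "Ks n \<subseteq> Ks (Suc n)" for n
    using assms(1) interior_subset[of "Ks (Suc n)"] by (auto simp: compact_exhaustion_def)
qed

lemma exhaustion_absorbs:
  assumes Ks: "compact_exhaustion Ks" and K: "compact K" "K \<subseteq> half_space"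
  obtains j where "K \<subseteq> interior (Ks j)"
proof -
  have "K \<subseteq> (\<Union>j. interior (Ks (Suc j)))" using Ks K(2) unfolding compact_exhaustion_def by blast
  then obtain F where F: "F \<subseteq> UNIV" "finite F" "K \<subseteq> (\<Union>j\<in>F. interior (Ks (Suc j)))"
    using compactE_image[OF K(1), of UNIV "\<lambda>j. interior (Ks (Suc j))"] by auto
  have "interior (Ks (Suc j)) \<subseteq> interior (Ks (Suc (Max F)))" if "j \<in> F" for j
    using F(2) that by (intro interior_mono exhaustion_mono[OF Ks]) auto
  then have "K \<subseteq> interior (Ks (Suc (Max F)))" using F(3) by blast
  then show thesis by (rule that)
qed

section \<open>Convergence along arbitrary exhaustions\<close>

context tent_operator
begin

text \<open>From some index on, \<open>Ks j\<close> contains a neighbourhood S of K, the difference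
  vanishes on S, and on K only the far kernel integral remains. It tends to 0 pointwise and is
  bounded on K uniformly in j, by compactness and \<open>tail_locally_bounded\<close>; dominated
  convergence on K gives the claim.\<close>

lemma Aop_restrict_tendsto:
  fixes f :: "real \<times> (real ^ 'n) \<Rightarrow> complex"
  assumes f [measurable]: "f \<in> borel_measurable borel" and fin: "\<And>k. AE x in lborel. majorant M r f k x < top"
    and K: "compact K" "K \<subseteq> half_space" and Ks: "compact_exhaustion Ks"
  shows "(\<lambda>j. Ir r (restrict_to K (Aop (\<lambda>w. restrict_to (Ks j) f w - f w)))) \<longlonglongrightarrow> 0"
proof -
  have gf: "good f" by (rule good_of_majorant[OF f fin])
  have Kb [measurable]: "K \<in> sets borel" using K(1) by (intro borel_closed compact_imp_closed)
  have Kc: "compact (Ks j)" "Ks j \<subseteq> half_space" for j using Ks by (auto simp: compact_exhaustion_def)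
  have Ksb [measurable]: "Ks j \<in> sets borel" for j using Kc(1) by (intro borel_closed compact_imp_closed)
  obtain j0 where j0: "K \<subseteq> interior (Ks j0)" by (rule exhaustion_absorbs[OF Ks K])
  define S where "S = Ks j0"
  obtain \<delta> where \<delta>: "0 < \<delta>" "\<And>z w. z \<in> K \<Longrightarrow> w \<in> - interior S \<Longrightarrow> \<delta> \<le> dist z w"
  proof -
    have "\<exists>\<delta>>0. \<forall>z\<in>K. \<forall>w\<in>- interior S. \<delta> \<le> dist z w"
      using j0 by (intro separate_compact_closed K closed_Compl open_interior) (auto simp: S_def)
    then show thesis using that by blast
  qed
  have far: "\<delta> \<le> dist z w" if "z \<in> K" "w \<in> half_space - S" for z w
    using that interior_subset[of S] by (intro \<delta>(2)) auto
  obtain a b \<rho> where "0 < a" "S \<subseteq> {a..b} \<times> ball 0 \<rho>" unfolding S_def by (rule compact_half_box[OF Kc])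
  then have "\<exists>m. S \<subseteq> Km m" by (rule compact_in_Km)
  then obtain m0 where m0: "S \<subseteq> Km m0" by blast
  have Sb: "S \<in> sets borel" by (simp add: S_def)
  obtain V where V: "\<And>z. z \<in> K \<Longrightarrow> open (V z)" "\<And>z. z \<in> K \<Longrightarrow> z \<in> V z"
      "\<And>z. z \<in> K \<Longrightarrow> \<exists>B<top. \<forall>z'\<in>V z. tail f \<delta> z' \<le> B"
    using tail_locally_bounded[OF f fin _ \<delta>(1)] K(2) by (metis subset_iff)
  then obtain B where B: "\<And>z. z \<in> K \<Longrightarrow> B z < top" "\<And>z z'. z \<in> K \<Longrightarrow> z' \<in> V z \<Longrightarrow> tail f \<delta> z' \<le> B z" by metis
  obtain F where F: "F \<subseteq> K" "finite F" "K \<subseteq> (\<Union>z\<in>F. V z)"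
    using compactE_image[OF K(1), of K V] V(1,2) by blast
  define B' where "B' = enn2real (\<Sum>z\<in>F. B z)"
  have "(\<Sum>z\<in>F. B z) < top" using B(1) F(1,2) by (auto simp: subset_eq)
  then have B'eq: "ennreal B' = (\<Sum>z\<in>F. B z)" by (simp add: B'_def less_top)
  have B': "tail f \<delta> z \<le> ennreal B'" if z: "z \<in> K" for z
  proof -
    obtain y where y: "y \<in> F" "z \<in> V y" using F(3) z by blast
    have "B y \<le> (\<Sum>z\<in>F. B z)" using F(2) y(1) by (intro member_le_sum) auto
    then show ?thesis unfolding B'eq using B(2)[of y z] F(1) y by (meson order_trans subset_iff)
  qed
  define v where "v j w = restrict_to (Ks j) f w - f w" for j w
  have vm: "v j \<in> borel_measurable borel" for j
    unfolding v_def[abs_def] by (intro borel_measurable_diff restrict_borel; measurable)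
  have v_le: "norm (v j w) \<le> norm (f w)" for j w by (simp add: v_def restrict_to_def indicator_def)
  have gv: "good (v j)" for j by (rule good_mono[OF gf measurable_half_leb_borel[OF vm] v_le])
  define H where "H j z = (\<integral>\<^sup>+w. ennreal (norm (kap z w) * norm (v j w)) * indicator (half_space - S) w \<partial>lborel)" for j z
  have Hle: "H j z \<le> ennreal B'" if "z \<in> K" for j z
  proof -
    have "H j z \<le> tail f \<delta> z" unfolding H_def tail_def
      using far[OF that] v_le[of j] by (intro nn_integral_mono mult_mono ennreal_leI) (auto simp: indicator_def intro!: mult_left_mono)
    with B'[OF that] show ?thesis by (rule order_trans[rotated])
  qed
  have Hlim: "(\<lambda>j. H j z) \<longlonglongrightarrow> 0" if z: "z \<in> K" for z
  proof -
    have "(\<lambda>j. \<integral>\<^sup>+w. ennreal (norm (kap z w) * norm (v j w)) * indicator (half_space - S) w \<partial>lborel)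
       \<longlonglongrightarrow> (\<integral>\<^sup>+w. 0 \<partial>(lborel :: (real \<times> (real ^ 'n)) measure))"
    proof (rule nn_integral_dominated_convergence[where w="\<lambda>w. ennreal (norm (kap z w) * norm (f w)) * indicator {w \<in> half_space. \<delta> \<le> dist z w} w"])
      have [measurable]: "{w \<in> half_space. \<delta> \<le> dist z w} \<in> sets borel" by measurable
      show "(\<lambda>w. ennreal (norm (kap z w) * norm (f w)) * indicator {w \<in> half_space. \<delta> \<le> dist z w} w) \<in> borel_measurable lborel" by measurable
      show "(\<lambda>w. ennreal (norm (kap z w) * norm (v j w)) * indicator (half_space - S) w) \<in> borel_measurable lborel" for j
        using vm[of j] Sb by measurable
      show "AE w in lborel. ennreal (norm (kap z w) * norm (v j w)) * indicator (half_space - S) w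
          \<le> ennreal (norm (kap z w) * norm (f w)) * indicator {w \<in> half_space. \<delta> \<le> dist z w} w" for j
        using far[OF z] v_le[of j] by (intro AE_I2 mult_mono ennreal_leI) (auto simp: indicator_def intro!: mult_left_mono)
      show "(\<integral>\<^sup>+w. ennreal (norm (kap z w) * norm (f w)) * indicator {w \<in> half_space. \<delta> \<le> dist z w} w \<partial>lborel) < \<infinity>"
        using gf z K(2) \<delta>(1) by (auto simp: good_def tail_def subset_eq)
      show "AE w in lborel. (\<lambda>j. ennreal (norm (kap z w) * norm (v j w)) * indicator (half_space - S) w) \<longlonglongrightarrow> 0"
      proof (rule AE_I2)
        fix w :: "real \<times> (real ^ 'n)"
        have "\<forall>\<^sub>F j in sequentially. ennreal (norm (kap z w) * norm (v j w)) * indicator (half_space - S) w = 0"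
        proof (cases "w \<in> half_space")
          case True
          then obtain j1 where "w \<in> Ks j1" using Ks unfolding compact_exhaustion_def by blast
          then have "w \<in> Ks j" if "j1 \<le> j" for j using exhaustion_mono[OF Ks that] by blast
          then show ?thesis unfolding eventually_sequentially by (intro exI[of _ j1]) (auto simp: v_def restrict_to_def)
        qed simp
        then show "(\<lambda>j. ennreal (norm (kap z w) * norm (v j w)) * indicator (half_space - S) w) \<longlonglongrightarrow> 0"
          by (rule tendsto_eventually)
      qed
    qed simp
    then show ?thesis by (simp add: H_def)
  qed
  have "AE z in half_leb. \<forall>j. z \<in> K \<longrightarrow> Aop (v j) z = A0 (restrict_to S (v j)) z + (LINT w|lborel. kap z w * (indicator (half_space - S) w * v j w)) \<and>
      ennreal (norm (LINT w|lborel. kap z w * (indicator (half_space - S) w * v j w))) \<le> H j z"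
    unfolding AE_all_countable
  proof
    fix j
    from Aop_representation[OF vm[of j] gv Sb m0 \<delta>(1) far]
    show "AE z in half_leb. z \<in> K \<longrightarrow> Aop (v j) z = A0 (restrict_to S (v j)) z + (LINT w|lborel. kap z w * (indicator (half_space - S) w * v j w)) \<and>
      ennreal (norm (LINT w|lborel. kap z w * (indicator (half_space - S) w * v j w))) \<le> H j z"
      by (rule eventually_mono) (auto simp: H_def)
  qed
  \<comment> \<open>\<open>A0\<close> is linear only up to null sets, so its value at 0 is extracted
    from homogeneity with factor 0.\<close>
  moreover have "AE z in half_leb. A0 (\<lambda>_. 0) z = 0"
  proof -
    have "(\<lambda>_. 0) \<in> L" by (simp add: space_Lr_iff Ir_def)
    from A0_cmult[OF this, of 0] show ?thesis by simp
  qed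
  ultimately have main: "AE z in half_leb. \<forall>j\<ge>j0. z \<in> K \<longrightarrow> ennreal (norm (Aop (v j) z)) \<le> H j z"
  proof eventually_elim
    case (elim z)
    have "restrict_to S (v j) = (\<lambda>_. 0)" if "j0 \<le> j" for j
      using exhaustion_mono[OF Ks that] by (auto simp: fun_eq_iff restrict_to_def S_def v_def indicator_def)
    then show ?case using elim by auto
  qed
  have am: "restrict_to K (Aop (v j)) \<in> borel_measurable half_leb" for j
    by (rule restrict_measurable[OF Kb Aop_measurable[OF gv]])
  have "(\<lambda>j. \<integral>\<^sup>+z. ennreal (norm (restrict_to K (Aop (v (j + j0))) z) powr r) \<partial>half_leb) \<longlonglongrightarrow> (\<integral>\<^sup>+z. 0 \<partial>(half_leb :: (real \<times> (real ^ 'n)) measure))"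
  proof (rule nn_integral_dominated_convergence[where w="\<lambda>z. ennreal (B' powr r) * indicator K z"])
    show "(\<lambda>z. ennreal (B' powr r) * indicator K z) \<in> borel_measurable half_leb" by (rule measurable_half_leb_borel) measurable
    show "(\<lambda>z. ennreal (norm (restrict_to K (Aop (v (j + j0))) z) powr r)) \<in> borel_measurable half_leb" for j
      using am[of "j + j0"] by measurable
    have "(\<integral>\<^sup>+z. ennreal (B' powr r) * indicator K z \<partial>half_leb) \<le> (\<integral>\<^sup>+z. ennreal (B' powr r) * indicator K z \<partial>lborel)"
      unfolding nn_integral_half_leb by (intro nn_integral_mono) (simp add: indicator_def)
    also have "\<dots> < top" using emeasure_compact_finite[OF K(1)] by (simp add: nn_integral_cmult_indicator ennreal_mult_less_top)
    finally show "(\<integral>\<^sup>+z. ennreal (B' powr r) * indicator K z \<partial>half_leb) < \<infinity>" by simp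
    show "AE z in half_leb. ennreal (norm (restrict_to K (Aop (v (j + j0))) z) powr r) \<le> ennreal (B' powr r) * indicator K z" for j
      using main
    proof eventually_elim
      case (elim z)
      show ?case
      proof (cases "z \<in> K")
        case True
        with elim have "ennreal (norm (Aop (v (j + j0)) z)) \<le> H (j + j0) z" by simp
        also note Hle[OF True]
        finally have "norm (Aop (v (j + j0)) z) \<le> B'" by (simp add: B'_def)
        then show ?thesis using True r0 by (auto simp: restrict_to_def intro!: ennreal_leI powr_mono2)
      qed (simp add: restrict_to_def)
    qed
    show "AE z in half_leb. (\<lambda>j. ennreal (norm (restrict_to K (Aop (v (j + j0))) z) powr r)) \<longlonglongrightarrow> 0"
      using main
    proof eventually_elim
      case (elim z)
      show ?case
      proof (cases "z \<in> K")
        case True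
        have "(\<lambda>j. ennreal (norm (Aop (v (j + j0)) z))) \<longlonglongrightarrow> 0"
          by (rule tendsto_sandwich[OF _ _ tendsto_const LIMSEQ_ignore_initial_segment[OF Hlim[OF True], of j0]])
             (use elim True in auto)
        from epowr_tendsto_0[OF r0 this] show ?thesis using True by (simp add: restrict_to_def)
      qed (simp add: restrict_to_def)
    qed
  qed simp
  then have "(\<lambda>j. Ir r (restrict_to K (Aop (v (j + j0))))) \<longlonglongrightarrow> 0" by (simp add: Ir_def)
  then have "(\<lambda>j. Ir r (restrict_to K (Aop (v j)))) \<longlonglongrightarrow> 0" by (rule LIMSEQ_offset)
  then show ?thesis by (simp add: v_def[abs_def])
qed

end


section \<open>The extension on a fixed tent space\<close>

context tent_operator
begin

context
  fixes p q :: ennreal and \<beta> \<gamma> :: real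
  assumes pq: "0 < p" "0 < q"
    and \<gamma>: "0 < \<gamma>" "real CARD('n) * max (1 / min_exp p q - 1) 0 = 1 - \<gamma>"
    and up: "rcp q - \<beta> > 0 \<or> (\<exists>B. \<forall>m\<in>M. m \<le> B)" and down: "rcp q - \<beta> < \<gamma> \<or> (\<exists>B. \<forall>m\<in>M. B \<le> m)"
begin

abbreviation "N \<equiv> tent_norm p q r \<beta> :: (real \<times> (real ^ 'n) \<Rightarrow> complex) \<Rightarrow> ennreal"

lemma majorant_norm:
  "\<exists>C<top. \<forall>f :: real \<times> (real ^ 'n) \<Rightarrow> complex. f \<in> borel_measurable borel \<longrightarrow>
    dtn p q (\<lambda>k x. ennreal (tau CARD('n) k powr (rcp q - \<beta>)) * majorant M r f k x) \<le> C * N f"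
  using r by (intro dtn_majorant_le[OF pq _ \<gamma> up down]) simp

lemma majorant_finite:
  assumes "f \<in> borel_measurable borel" "N f < top"
  shows "AE x in lborel. majorant M r f k x < top"
proof -
  obtain C where C: "C < top" "\<And>f :: real \<times> (real ^ 'n) \<Rightarrow> complex. f \<in> borel_measurable borel \<Longrightarrow>
    dtn p q (\<lambda>k x. ennreal (tau CARD('n) k powr (rcp q - \<beta>)) * majorant M r f k x) \<le> C * N f"
    using majorant_norm by blast
  have "C * N f < top" using C(1) assms(2) by (simp add: ennreal_mult_less_top)
  with C(2)[OF assms(1)] have fin: "dtn p q (\<lambda>k x. ennreal (tau CARD('n) k powr (rcp q - \<beta>)) * majorant M r f k x) < top"
    by (rule le_less_trans)
  have "AE x in lborel. ennreal (tau CARD('n) k powr (rcp q - \<beta>)) * majorant M r f k x < top"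
    by (rule dtn_finite_AE[OF pq _ fin]) (use assms(1) in measurable)
  then show ?thesis by eventually_elim (auto simp: ennreal_mult_less_top ennreal_eq_0_iff)
qed

lemma space_borel:
  assumes "f \<in> space_of N"
  obtains f' where "f' \<in> borel_measurable borel" "AE z in half_leb. f z = f' z" "N f' = N f"
    "\<forall>k. AE x in lborel. majorant M r f' k x < top"
proof -
  have f: "f \<in> borel_measurable half_leb" "N f < top" using assms by (auto simp: space_of_def)
  obtain f' where f': "f' \<in> borel_measurable borel" "AE z in half_leb. f z = f' z"
    using borel_representative[OF f(1)] .
  moreover have "N f' = N f" using tent_norm_cong_AE[OF f'(2)] by simp
  moreover from this f(2) have "\<forall>k. AE x in lborel. majorant M r f' k x < top" by (intro allI majorant_finite[OF f'(1)]) simp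
  ultimately show thesis by (rule that)
qed

lemma space_good:
  assumes "f \<in> space_of N"
  shows "good f"
proof -
  obtain f' where f': "f' \<in> borel_measurable borel" "AE z in half_leb. f z = f' z"
    "N f' = N f" "\<forall>k. AE x in lborel. majorant M r f' k x < top" by (rule space_borel[OF assms])
  have "AE z in half_leb. f' z = f z" using f'(2) by (auto elim: eventually_mono)
  with good_of_majorant[OF f'(1) f'(4)[rule_format]] show ?thesis by (rule good_cong)
qed

text \<open>The Whitney averages of the image lie below the majorant, and the discrete norm of the
  majorant lies below the tent norm of f; \<open>tent_norm_le_dtn\<close> closes the circle.\<close>

lemma Aop_bound: "\<exists>C<top. \<forall>f\<in>space_of N. N (Aop f) \<le> C * N f"
proof -
  obtain Cm where Cm: "Cm < top" "\<And>f :: real \<times> (real ^ 'n) \<Rightarrow> complex. f \<in> borel_measurable borel \<Longrightarrow>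
    dtn p q (\<lambda>k x. ennreal (tau CARD('n) k powr (rcp q - \<beta>)) * majorant M r f k x) \<le> Cm * N f"
    using majorant_norm by blast
  obtain Cw where Cw: "Cw < top" "\<And>f k t x. f \<in> borel_measurable borel \<Longrightarrow> good f \<Longrightarrow> t \<in> slice CARD('n) k \<Longrightarrow>
    whitney_avg r (Aop f) t (x :: real ^ 'n) \<le> Cw * majorant M r f k x"
    using whitney_Aop_le by blast
  obtain Ct where Ct: "Ct < top" "\<And>(F :: real \<times> (real ^ 'n) \<Rightarrow> complex) R. F \<in> borel_measurable half_leb \<Longrightarrow> (\<forall>k. R k \<in> borel_measurable borel) \<Longrightarrow>
    (\<forall>k t x. t \<in> slice CARD('n) k \<longrightarrow> whitney_avg r F t x \<le> R k x) \<Longrightarrow>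
    N F \<le> Ct * dtn p q (\<lambda>k x. ennreal (tau CARD('n) k powr (rcp q - \<beta>)) * R k x)"
    using tent_norm_le_dtn[OF pq, of r \<beta>, where 'n='n] by blast
  have "N (Aop f) \<le> Ct * Cw * Cm * N f" if f: "f \<in> space_of N" for f
  proof -
    obtain f' where f': "f' \<in> borel_measurable borel" "AE z in half_leb. f z = f' z" "N f' = N f"
      "\<forall>k. AE x in lborel. majorant M r f' k x < top" by (rule space_borel[OF f])
    note [measurable] = f'(1)
    have gd: "good f'" by (rule good_cong[OF space_good[OF f] f'(2)])
    have "N (Aop f) = N (Aop f')" by (rule tent_norm_cong_AE[OF Aop_cong[OF space_good[OF f] f'(2)]])
    also have "\<dots> \<le> Ct * dtn p q (\<lambda>k x. ennreal (tau CARD('n) k powr (rcp q - \<beta>)) * (Cw * majorant M r f' k x))"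
      by (rule Ct(2)[OF Aop_measurable[OF gd]]) (use Cw(2)[OF f'(1) gd] in auto)
    also have "(\<lambda>k x. ennreal (tau CARD('n) k powr (rcp q - \<beta>)) * (Cw * majorant M r f' k x))
       = (\<lambda>k x. Cw * (ennreal (tau CARD('n) k powr (rcp q - \<beta>)) * majorant M r f' k x))" by (simp only: mult_ac)
    also have "dtn p q \<dots> = Cw * dtn p q (\<lambda>k x. ennreal (tau CARD('n) k powr (rcp q - \<beta>)) * majorant M r f' k x)"
      by (intro dtn_cmult pq) measurable
    also have "Ct * \<dots> \<le> Ct * (Cw * (Cm * N f'))" by (intro mult_left_mono Cm(2) f') auto
    finally show ?thesis by (simp add: f'(3) mult.assoc)
  qed
  moreover have "Ct * Cw * Cm < top" using Cm(1) Cw(1) Ct(1) by (simp add: ennreal_mult_less_top)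
  ultimately show ?thesis by blast
qed

lemma Aop_space:
  assumes f: "f \<in> space_of N"
  shows "Aop f \<in> space_of N"
proof -
  obtain C where C: "C < top" "N (Aop f) \<le> C * N f" using Aop_bound f by blast
  moreover have "C * N f < top" using C(1) f by (simp add: space_of_def ennreal_mult_less_top)
  ultimately show ?thesis using Aop_measurable[OF space_good[OF f]] by (auto simp: space_of_def)
qed

lemma compactly_supported_space:
  assumes "h \<in> borel_measurable half_leb" "compact K" "K \<subseteq> half_space" "\<forall>z\<in>half_space - K. h z = 0" "Ir r h < top"
  shows "h \<in> space_of N"
proof -
  obtain C where C: "C < top" "N h \<le> C * Lr_norm r h"
    using tent_norm_le_Lr_norm[OF pq r0 assms(2,3), of \<beta>] assms by blast
  then show ?thesis using assms(1,5) by (auto simp: space_of_def Lr_norm_Ir ennreal_mult_less_top intro: le_less_trans)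
qed

lemma Linf_c_space: "\<phi> \<in> Linf_c \<Longrightarrow> \<phi> \<in> space_of N"
  using Linf_c_Lr[OF _ r0, of \<phi>] compactly_supported_space[of \<phi>] unfolding Linf_c_def by blast

lemma restrict_space:
  assumes f: "f \<in> space_of N" and K: "compact K" "K \<subseteq> half_space"
  shows "Ir r (restrict_to K f) < top" "restrict_to K f \<in> borel_measurable half_leb" "restrict_to K f \<in> space_of N"
proof -
  have gd: "good f" by (rule space_good[OF f])
  obtain a b \<rho> where "0 < a" "K \<subseteq> {a..b} \<times> ball 0 \<rho>" by (rule compact_half_box[OF K])
  then have "\<exists>m. K \<subseteq> Km m" by (rule compact_in_Km)
  then obtain m where m: "K \<subseteq> Km m" by blast
  have "Ir r (restrict_to K f) \<le> Ir r (restrict_to (Km m) f)"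
    using m by (intro Ir_mono_AE[OF r0]) (auto simp: restrict_to_def indicator_def)
  then show I: "Ir r (restrict_to K f) < top" using gd by (auto simp: good_def intro: le_less_trans)
  have "K \<in> sets borel" using K(1) by (intro borel_closed compact_imp_closed)
  then show m: "restrict_to K f \<in> borel_measurable half_leb" using gd by (intro restrict_measurable) (auto simp: good_def)
  show "restrict_to K f \<in> space_of N"
    by (rule compactly_supported_space[OF m K _ I]) (simp add: restrict_to_def)
qed

text \<open>Truncation in height gives an approximating sequence: it converges in L^r and keeps the
  support in K, so it converges in the tent norm even where density fails globally. For the limit of
  the images, an arbitrary approximating sequence need not be supported in K, so boundedness of the
  extension on the whole space enters.\<close>

lemma value_by_continuity_restrict:
  assumes T: "\<And>\<phi>. \<phi> \<in> Linf_c \<Longrightarrow> AE z in half_leb. A0 \<phi> z = T \<phi> z"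
    and f: "f \<in> space_of N" and K: "compact K" "K \<subseteq> half_space"
  shows "value_by_continuity N T (restrict_to K f) (Aop (restrict_to K f))"
proof -
  define h where "h = restrict_to K f"
  have h: "Ir r h < top" "h \<in> borel_measurable half_leb" "h \<in> space_of N" using restrict_space[OF f K] by (simp_all add: h_def)
  have hK: "h z = 0" if "z \<notin> K" for z using that by (simp add: h_def restrict_to_def)
  obtain C where C: "C < top" "\<And>f. f \<in> space_of N \<Longrightarrow> N (Aop f) \<le> C * N f" using Aop_bound by blast
  show ?thesis
    unfolding value_by_continuity_def h_def[symmetric]
  proof (intro conjI allI impI)
    show "Aop h \<in> space_of N" by (rule Aop_space[OF h(3)])
    obtain CK where CK: "CK < top" "\<And>g. g \<in> borel_measurable half_leb \<Longrightarrow> (\<forall>z\<in>half_space - K. g z = 0) \<Longrightarrow> N g \<le> CK * Lr_norm r g"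
      using tent_norm_le_Lr_norm[OF pq r0 K, of \<beta>] by blast
    have tm: "(\<lambda>z. trunc i h z - h z) \<in> borel_measurable half_leb" for i
      by (intro borel_measurable_diff trunc_measurable h)
    have "(\<lambda>i. N (\<lambda>z. trunc i h z - h z)) \<longlonglongrightarrow> 0"
    proof (rule tendsto_sandwich[OF _ _ tendsto_const])
      show "\<forall>\<^sub>F i in sequentially. N (\<lambda>z. trunc i h z - h z) \<le> CK * Lr_norm r (\<lambda>z. trunc i h z - h z)"
        by (intro always_eventually allI CK(2) tm) (simp add: trunc_def hK)
      show "(\<lambda>i. CK * Lr_norm r (\<lambda>z. trunc i h z - h z)) \<longlonglongrightarrow> 0"
        using ennreal_tendsto_cmult[OF CK(1) epowr_tendsto_0[OF _ Ir_trunc_tendsto[OF h(2,1) r0], of "1 / r"]] r0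
        by (simp add: Lr_norm_Ir)
    qed auto
    moreover have "trunc i h \<in> Linf_c" for i by (rule trunc_Linf_c[OF h(2) K]) (simp add: hK)
    ultimately show "\<exists>\<phi>::nat \<Rightarrow> _. (\<forall>i. \<phi> i \<in> Linf_c) \<and> (\<lambda>i. N (\<lambda>z. \<phi> i z - h z)) \<longlonglongrightarrow> 0"
      by (intro exI[of _ "\<lambda>i. trunc i h"]) auto
  next
    fix \<phi> :: "nat \<Rightarrow> real \<times> (real ^ 'n) \<Rightarrow> complex"
    assume "(\<forall>i. \<phi> i \<in> Linf_c) \<and> (\<lambda>i. N (\<lambda>z. \<phi> i z - h z)) \<longlonglongrightarrow> 0"
    then have \<phi>: "\<And>i. \<phi> i \<in> Linf_c" and lim: "(\<lambda>i. N (\<lambda>z. \<phi> i z - h z)) \<longlonglongrightarrow> 0" by auto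
    show "(\<lambda>i. N (\<lambda>z. T (\<phi> i) z - Aop h z)) \<longlonglongrightarrow> 0"
    proof (rule tendsto_sandwich[OF _ _ tendsto_const])
      show "(\<lambda>i. C * N (\<lambda>z. \<phi> i z - h z)) \<longlonglongrightarrow> 0" using ennreal_tendsto_cmult[OF C(1) lim] by simp
      \<comment> \<open>Membership of the difference in the space requires a finite norm, which the
        convergence grants from some index on.\<close>
      have "\<forall>\<^sub>F i in sequentially. N (\<lambda>z. \<phi> i z - h z) < top" using order_tendstoD(2)[OF lim, of top] by simp
      then show "\<forall>\<^sub>F i in sequentially. N (\<lambda>z. T (\<phi> i) z - Aop h z) \<le> C * N (\<lambda>z. \<phi> i z - h z)"
      proof eventually_elim
        case (elim i)
        have ps: "\<phi> i \<in> space_of N" by (rule Linf_c_space[OF \<phi>])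
        then have "(\<lambda>z. \<phi> i z - h z) \<in> borel_measurable half_leb" using h(2) by (auto simp: space_of_def)
        with elim have ds: "(\<lambda>z. \<phi> i z - h z) \<in> space_of N" by (simp add: space_of_def)
        have "AE z in half_leb. T (\<phi> i) z - Aop h z = Aop (\<lambda>w. \<phi> i w - h w) z"
          using T[OF \<phi>, of i] Aop_Linf_c[OF \<phi> space_good[OF ps]] Aop_diff[OF space_good[OF ps] space_good[OF h(3)]]
          by eventually_elim simp
        then have "N (\<lambda>z. T (\<phi> i) z - Aop h z) = N (Aop (\<lambda>w. \<phi> i w - h w))" by (rule tent_norm_cong_AE)
        also have "\<dots> \<le> C * N (\<lambda>z. \<phi> i z - h z)" by (rule C(2)[OF ds])
        finally show ?case .
      qed
    qed auto
  qed
qed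

text \<open>By linearity the difference is, on K, the image of f restricted minus f; it converges in
  L^r on K and hence in the tent norm.\<close>

lemma Aop_exhaustion:
  assumes f: "f \<in> space_of N" and K: "compact K" "K \<subseteq> half_space" and Ks: "compact_exhaustion Ks"
  shows "(\<lambda>j. N (\<lambda>z. restrict_to K (Aop (restrict_to (Ks j) f)) z - restrict_to K (Aop f) z)) \<longlonglongrightarrow> 0"
proof -
  obtain f' where f': "f' \<in> borel_measurable borel" "AE z in half_leb. f z = f' z" "N f' = N f"
    "\<forall>k. AE x in lborel. majorant M r f' k x < top" by (rule space_borel[OF f])
  have Kc: "compact (Ks j)" "Ks j \<subseteq> half_space" for j using Ks by (auto simp: compact_exhaustion_def)
  have Kb: "K \<in> sets borel" using K(1) by (intro borel_closed compact_imp_closed)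
  define u where "u j = (\<lambda>w. restrict_to (Ks j) f w - f w)" for j
  define v where "v j = (\<lambda>w. restrict_to (Ks j) f' w - f' w)" for j
  have gs: "good (restrict_to (Ks j) f)" for j by (rule space_good[OF restrict_space(3)[OF f Kc]])
  have gu: "good (u j)" for j unfolding u_def by (rule good_diff[OF gs space_good[OF f]])
  have uv: "AE z in half_leb. u j z = v j z" for j
    using f'(2) by eventually_elim (simp add: u_def v_def restrict_to_def)
  have gv: "good (v j)" for j by (rule good_cong[OF gu uv])
  have eq: "AE z in half_leb. restrict_to K (Aop (restrict_to (Ks j) f)) z - restrict_to K (Aop f) z = restrict_to K (Aop (v j)) z" for j
    using Aop_diff[OF gs space_good[OF f], of j] Aop_cong[OF gu uv, of j]
    by eventually_elim (simp add: u_def restrict_to_def right_diff_distrib[symmetric])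
  obtain CK where CK: "CK < top" "\<And>g. g \<in> borel_measurable half_leb \<Longrightarrow> (\<forall>z\<in>half_space - K. g z = 0) \<Longrightarrow> N g \<le> CK * Lr_norm r g"
    using tent_norm_le_Lr_norm[OF pq r0 K, of \<beta>] by blast
  show ?thesis
  proof (rule tendsto_sandwich[OF _ _ tendsto_const])
    show "\<forall>\<^sub>F j in sequentially. N (\<lambda>z. restrict_to K (Aop (restrict_to (Ks j) f)) z - restrict_to K (Aop f) z) \<le> CK * Lr_norm r (restrict_to K (Aop (v j)))"
      unfolding tent_norm_cong_AE[OF eq]
      by (intro always_eventually allI CK(2) restrict_measurable Kb Aop_measurable gv) (simp add: restrict_to_def)
    have "(\<lambda>j. Ir r (restrict_to K (Aop (v j)))) \<longlonglongrightarrow> 0"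
      unfolding v_def by (rule Aop_restrict_tendsto[OF f'(1) f'(4)[rule_format] K Ks])
    from ennreal_tendsto_cmult[OF CK(1) epowr_tendsto_0[OF _ this, of "1 / r"]] r0
    show "(\<lambda>j. CK * Lr_norm r (restrict_to K (Aop (v j)))) \<longlonglongrightarrow> 0" by (simp add: Lr_norm_Ir)
  qed auto
qed

lemma bounded_extension:
  assumes T: "\<And>\<phi>. \<phi> \<in> Linf_c \<Longrightarrow> AE z in half_leb. pv_exists \<kappa> \<phi> z \<and> A0 \<phi> z = pv_operator \<kappa> \<phi> z"
  shows "bounded_on_tent p q r \<beta> \<kappa>"
proof -
  obtain C where C: "C < top" "\<And>f. f \<in> space_of N \<Longrightarrow> N (Aop f) \<le> C * N f" using Aop_bound by blast
  have Creal: "ennreal (enn2real C) = C" using C(1) by (simp add: less_top)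
  have "bounded_operator N Aop"
    unfolding bounded_operator_def
    using Aop_space C(2) Aop_add[OF space_good space_good] Aop_cmult[OF space_good]
    by (intro conjI exI[of _ "enn2real C"]) (auto simp: Creal)
  moreover have "AE z in half_leb. pv_exists \<kappa> \<phi> z \<and> Aop \<phi> z = pv_operator \<kappa> \<phi> z" if "\<phi> \<in> Linf_c" for \<phi>
    using T[OF that] Aop_Linf_c[OF that space_good[OF Linf_c_space[OF that]]] by eventually_elim simp
  moreover have "\<exists>g. (\<forall>j. value_by_continuity N (pv_operator \<kappa>) (restrict_to (Ks j) f) (g j)) \<and>
      (\<lambda>j. N (\<lambda>z. restrict_to K (g j) z - restrict_to K (Aop f) z)) \<longlonglongrightarrow> 0"
    if "f \<in> space_of N" "compact K \<and> K \<subseteq> half_space \<and> compact_exhaustion Ks" for f K Ks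
  proof (intro exI[of _ "\<lambda>j. Aop (restrict_to (Ks j) f)"] conjI allI)
    have Kc: "compact (Ks j)" "Ks j \<subseteq> half_space" for j using that(2) by (auto simp: compact_exhaustion_def)
    show "value_by_continuity N (pv_operator \<kappa>) (restrict_to (Ks j) f) (Aop (restrict_to (Ks j) f))" for j
      by (rule value_by_continuity_restrict[OF _ that(1) Kc]) (use T in \<open>auto elim: eventually_mono\<close>)
    show "(\<lambda>j. N (\<lambda>z. restrict_to K (Aop (restrict_to (Ks j) f)) z - restrict_to K (Aop f) z)) \<longlonglongrightarrow> 0"
      using that(2) by (intro Aop_exhaustion that(1)) auto
  qed
  ultimately show ?thesis unfolding bounded_on_tent_def by (intro exI[of _ Aop]) blast
qed

end

end


section \<open>Kernels\<close>

text \<open>The estimates for \<open>kap\<close> are pointwise, so size and support conditions must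
  hold everywhere. A Borel version of the kernel is set to 0 where one of them fails; since \<kappa>
  itself satisfies them, this changes it only on a null set. D carries the causality
  condition.\<close>

lemma borel_kernel:
  fixes \<kappa> :: "real \<times> (real ^ 'n) \<Rightarrow> real \<times> (real ^ 'n) \<Rightarrow> complex"
  assumes \<kappa>: "size_kernel \<kappa>" and D: "D \<in> sets borel" and supp: "\<And>z w. (z, w) \<notin> D \<Longrightarrow> \<kappa> z w = 0"
  obtains kap C0 where "(\<lambda>(z, w). kap z w) \<in> borel_measurable borel" "0 \<le> C0"
    "\<And>z w. z \<in> half_space \<Longrightarrow> w \<in> half_space \<Longrightarrow> z \<noteq> w \<Longrightarrow>
      norm (kap z w) \<le> C0 / (\<bar>fst z - fst w\<bar> + norm (snd z - snd w)) ^ (1 + CARD('n))"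
    "\<And>z w. w \<notin> half_space \<Longrightarrow> kap z w = 0" "\<And>z w. (z, w) \<notin> D \<Longrightarrow> kap z w = 0"
    "AE z in half_leb. AE w in lborel. w \<in> half_space \<longrightarrow> \<kappa> z w = kap z w"
proof -
  define H :: "((real \<times> (real ^ 'n)) \<times> (real \<times> (real ^ 'n))) set" where "H = half_space \<times> half_space"
  have H [measurable]: "H \<in> sets borel" unfolding H_def by (intro borel_Times half_space_borel)
  note [measurable] = D
  obtain C where C0: "\<forall>t>0. \<forall>s>0. \<forall>x y. (t, x) \<noteq> (s, y) \<longrightarrow>
        norm (\<kappa> (t, x) (s, y)) \<le> C / (\<bar>t - s\<bar> + norm (x - y)) ^ (1 + CARD('n))"
    using \<kappa> unfolding size_kernel_def by blast
  have C: "norm (\<kappa> z w) \<le> C / (\<bar>fst z - fst w\<bar> + norm (snd z - snd w)) ^ (1 + CARD('n))"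
    if "z \<in> half_space" "w \<in> half_space" "z \<noteq> w" for z w
  proof -
    obtain t x s y where zw: "z = (t, x)" "w = (s, y)" by (cases z, cases w)
    then have "0 < t" "0 < s" "(t, x) \<noteq> (s, y)" using that by (auto simp: half_space_def)
    then show ?thesis unfolding zw fst_conv snd_conv by (rule C0[rule_format])
  qed
  define \<Delta> :: "(real \<times> (real ^ 'n)) \<times> (real \<times> (real ^ 'n)) \<Rightarrow> real"
    where "\<Delta> v = (\<bar>fst (fst v) - fst (snd v)\<bar> + norm (snd (fst v) - snd (snd v))) ^ (1 + CARD('n))" for v
  have \<Delta>: "0 < \<Delta> (z, w)" if "z \<noteq> w" for z w
    using that unfolding \<Delta>_def by (intro zero_less_power) (auto simp: prod_eq_iff add_pos_nonneg add_nonneg_pos)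
  obtain g where g [measurable]: "g \<in> borel_measurable borel" and gH: "AE v in lborel. v \<in> H \<longrightarrow> \<kappa> (fst v) (snd v) = g v"
  proof (rule borel_representative_on[OF H])
    show "(\<lambda>v. \<kappa> (fst v) (snd v)) \<in> borel_measurable (lebesgue_on H)"
      using \<kappa> unfolding size_kernel_def H_def case_prod_beta' by (rule conjunct1)
  qed
  define E where "E = {v \<in> H \<inter> D. norm (g v) * \<Delta> v \<le> max C 0}"
  have [measurable]: "\<Delta> \<in> borel_measurable borel" unfolding \<Delta>_def[abs_def] by measurable
  have [measurable]: "E \<in> sets borel" unfolding E_def by measurable
  define kap where "kap z w = indicator E (z, w) * g (z, w)" for z w
  show thesis
  proof (rule that[of kap "max C 0"])
    have "(\<lambda>(z, w). kap z w) = (\<lambda>v. indicator E v * g v)" by (auto simp: kap_def)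
    also have "\<dots> \<in> borel_measurable borel" by measurable
    finally show "(\<lambda>(z, w). kap z w) \<in> borel_measurable borel" .
    show "0 \<le> max C 0" by simp
    show "norm (kap z w) \<le> max C 0 / (\<bar>fst z - fst w\<bar> + norm (snd z - snd w)) ^ (1 + CARD('n))"
      if "z \<in> half_space" "w \<in> half_space" "z \<noteq> w" for z w
    proof (cases "(z, w) \<in> E")
      case True
      then have "norm (g (z, w)) * \<Delta> (z, w) \<le> max C 0" by (simp add: E_def)
      then have "norm (g (z, w)) \<le> max C 0 / \<Delta> (z, w)" using \<Delta>[OF that(3)] by (simp add: pos_le_divide_eq)
      then show ?thesis using True by (simp add: kap_def \<Delta>_def)
    qed (simp add: kap_def)
    show "kap z w = 0" if "w \<notin> half_space" for z w using that by (simp add: kap_def E_def H_def)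
    show "kap z w = 0" if "(z, w) \<notin> D" for z w using that by (simp add: kap_def E_def)
    have "AE v in lborel. v \<in> H \<longrightarrow> \<kappa> (fst v) (snd v) = kap (fst v) (snd v)"
      using gH
    proof eventually_elim
      case (elim v)
      obtain z w where v: "v = (z, w)" by (cases v)
      show ?case
      proof
        assume vH: "v \<in> H"
        show "\<kappa> (fst v) (snd v) = kap (fst v) (snd v)"
        proof (cases "v \<in> D")
          case True
          have "norm (\<kappa> z w) * \<Delta> v \<le> max C 0"
          proof (cases "z = w")
            case False
            have "norm (\<kappa> z w) \<le> C / \<Delta> v" using C[of z w] vH False by (simp add: v H_def \<Delta>_def)
            then show ?thesis using \<Delta>[OF False] by (simp add: v pos_le_divide_eq)
          qed (simp add: v \<Delta>_def)
          then have "v \<in> E" using True vH elim by (simp add: E_def v)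
          then show ?thesis using elim vH by (simp add: kap_def v)
        next
          case False
          then have "\<kappa> z w = 0" "v \<notin> E" using supp[of z w] by (simp_all add: v E_def)
          then show ?thesis by (simp add: v kap_def)
        qed
      qed
    qed
    then have "AE z in lborel. AE w in lborel. (z, w) \<in> H \<longrightarrow> \<kappa> z w = kap z w"
      by (auto dest: AE_lborel_sections)
    then show "AE z in half_leb. AE w in lborel. w \<in> half_space \<longrightarrow> \<kappa> z w = kap z w"
      unfolding AE_half_leb by eventually_elim (auto simp: H_def)
  qed
qed

text \<open>For \<epsilon> < \<delta> the removed ball misses the support of \<phi>, so the
  truncated integrals no longer depend on \<epsilon>.\<close>

lemma pv_operator_off_support:
  fixes \<kappa> :: "real \<times> (real ^ 'n) \<Rightarrow> real \<times> (real ^ 'n) \<Rightarrow> complex"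
  assumes [measurable]: "kap \<in> borel_measurable borel" "\<phi> \<in> borel_measurable borel"
    and zero: "\<And>w. w \<notin> half_space \<Longrightarrow> kap w = 0" and eq: "AE w in lborel. w \<in> half_space \<longrightarrow> \<kappa> z w = kap w"
    and \<delta>: "0 < \<delta>" "\<And>w. w \<in> half_space \<Longrightarrow> \<phi> w \<noteq> 0 \<Longrightarrow> \<delta> \<le> dist z w"
  shows "pv_operator \<kappa> \<phi> z = (LINT w|lborel. kap w * \<phi> w)"
proof -
  have "truncated_integral \<kappa> \<phi> z \<epsilon> = (LINT w|lborel. kap w * \<phi> w)" if \<epsilon>: "0 < \<epsilon>" "\<epsilon> < \<delta>" for \<epsilon>
  proof -
    have "AE w in lebesgue. kap w * \<phi> w = indicat_real {w \<in> half_space. \<epsilon> < dist z w} w *\<^sub>R (\<kappa> z w * \<phi> w)"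
      unfolding AE_lborel_iff using eq
    proof eventually_elim
      case (elim w)
      show ?case using elim zero[of w] \<delta>(2)[of w] \<epsilon> by (cases "w \<in> half_space"; cases "\<phi> w = 0") auto
    qed
    moreover have m: "(\<lambda>w. kap w * \<phi> w) \<in> borel_measurable lborel" by measurable
    moreover from this have "(\<lambda>w. kap w * \<phi> w) \<in> borel_measurable lebesgue" by (rule measurable_completion)
    ultimately have "(LINT w|lebesgue. kap w * \<phi> w) = (LINT w|lebesgue. indicat_real {w \<in> half_space. \<epsilon> < dist z w} w *\<^sub>R (\<kappa> z w * \<phi> w))"
      by (intro integral_cong_AE) (auto intro: borel_measurable_AE)
    with integral_completion[OF m] show ?thesis by (simp add: truncated_integral_def set_lebesgue_integral_def)
  qed
  then have "\<forall>\<^sub>F \<epsilon> in at_right 0. truncated_integral \<kappa> \<phi> z \<epsilon> = (LINT w|lborel. kap w * \<phi> w)"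
    using \<delta>(1) by (auto simp: eventually_at_right_field intro!: exI[of _ \<delta>])
  then show ?thesis unfolding pv_operator_def by (intro tendsto_Lim tendsto_eventually) auto
qed

lemma tent_operator_exists:
  fixes \<kappa> :: "real \<times> (real ^ 'n) \<Rightarrow> real \<times> (real ^ 'n) \<Rightarrow> complex"
  assumes r: "1 < r" and \<kappa>: "size_kernel \<kappa>" and D: "D \<in> sets borel" and supp: "\<And>z w. (z, w) \<notin> D \<Longrightarrow> \<kappa> z w = 0"
    and MD: "\<And>z w k m t. t \<in> slice CARD('n) k \<Longrightarrow> fst z \<in> {t / 2..t} \<Longrightarrow> fst w \<in> slice CARD('n) (k + m) \<Longrightarrow> m \<notin> M \<Longrightarrow> (z, w) \<notin> D"
    and M: "{-4..3} \<subseteq> M"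
    and A: "bounded_operator (Lr_norm r) A" "\<And>\<phi>. \<phi> \<in> Linf_c \<Longrightarrow> AE z in half_leb. pv_exists \<kappa> \<phi> z \<and> A \<phi> z = pv_operator \<kappa> \<phi> z"
  obtains kap C0 where "tent_operator r kap A M C0"
proof (rule borel_kernel[OF \<kappa> D supp])
  fix kap :: "real \<times> (real ^ 'n) \<Rightarrow> real \<times> (real ^ 'n) \<Rightarrow> complex" and C0 :: real
  assume kap: "(\<lambda>(z, w). kap z w) \<in> borel_measurable borel" "0 \<le> C0"
    "\<And>z w. z \<in> half_space \<Longrightarrow> w \<in> half_space \<Longrightarrow> z \<noteq> w \<Longrightarrow>
      norm (kap z w) \<le> C0 / (\<bar>fst z - fst w\<bar> + norm (snd z - snd w)) ^ (1 + CARD('n))"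
    "\<And>z w. w \<notin> half_space \<Longrightarrow> kap z w = 0" "\<And>z w. (z, w) \<notin> D \<Longrightarrow> kap z w = 0"
    "AE z in half_leb. AE w in lborel. w \<in> half_space \<longrightarrow> \<kappa> z w = kap z w"
  have sec: "kap z \<in> borel_measurable borel" for z
  proof -
    have "(\<lambda>w. (z, w)) \<in> measurable borel borel" by (intro borel_measurable_continuous_onI continuous_intros)
    from measurable_compose[OF this kap(1)] show ?thesis by simp
  qed
  have "tent_operator r kap A M C0"
  proof
    fix \<phi> :: "real \<times> (real ^ 'n) \<Rightarrow> complex" and U \<delta>
    assume \<phi>: "\<phi> \<in> Linf_c" "\<phi> \<in> borel_measurable borel" "0 < \<delta>"
      and U: "\<And>z w. z \<in> U \<Longrightarrow> w \<in> half_space \<Longrightarrow> \<phi> w \<noteq> 0 \<Longrightarrow> \<delta> \<le> dist z w"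
    show "AE z in half_leb. z \<in> U \<longrightarrow> A \<phi> z = (LINT w|lborel. kap z w * \<phi> w)"
      using A(2)[OF \<phi>(1)] kap(6)
    proof eventually_elim
      case (elim z)
      then show ?case using pv_operator_off_support[where z=z and \<kappa>=\<kappa>, OF sec \<phi>(2) kap(4) _ \<phi>(3) U] by auto
    qed
  qed (use r kap M MD A(1) in auto)
  then show thesis by (rule that)
qed

lemma causal_borel: "{v. fst (fst v) > fst (snd v)} \<in> sets (borel :: ((real \<times> (real ^ 'n)) \<times> (real \<times> (real ^ 'n))) measure)"
  and anticausal_borel: "{v. fst (fst v) < fst (snd v)} \<in> sets (borel :: ((real \<times> (real ^ 'n)) \<times> (real \<times> (real ^ 'n))) measure)"
  by measurable

lemma size_kernel_restrict:
  fixes k :: "real \<times> (real ^ 'n) \<Rightarrow> real \<times> (real ^ 'n) \<Rightarrow> complex"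
  assumes k: "size_kernel k" and D: "D \<in> sets borel"
  shows "size_kernel (\<lambda>z w. indicator D (z, w) * k z w)"
proof -
  have "indicator D \<in> borel_measurable (lborel :: ((real \<times> (real ^ 'n)) \<times> (real \<times> (real ^ 'n))) measure)" using D by simp
  then have "indicator D \<in> borel_measurable (lebesgue_on (half_space \<times> half_space) :: ((real \<times> (real ^ 'n)) \<times> (real \<times> (real ^ 'n))) measure)"
    by (intro measurable_restrict_space1 measurable_completion)
  then have "(\<lambda>v. indicator D v * (case v of (z, w) \<Rightarrow> k z w)) \<in> borel_measurable (lebesgue_on (half_space \<times> half_space))"
    using k by (intro borel_measurable_times) (auto simp: size_kernel_def)
  also have "(\<lambda>v. indicator D v * (case v of (z, w) \<Rightarrow> k z w)) = (\<lambda>(z, w). indicator D (z, w) * k z w)" by auto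
  finally have m: "(\<lambda>(z, w). indicator D (z, w) * k z w) \<in> borel_measurable (lebesgue_on (half_space \<times> half_space))" .
  have le: "norm (indicator D (z, w) * k z w) \<le> norm (k z w)" for z w by (simp add: indicator_def)
  show ?thesis unfolding size_kernel_def
  proof (intro conjI m)
    show "\<exists>C. \<forall>t>0. \<forall>s>0. \<forall>x y. (t, x) \<noteq> (s, y) \<longrightarrow>
        norm (indicator D ((t, x), (s, y)) * k (t, x) (s, y)) \<le> C / (\<bar>t - s\<bar> + norm (x - y)) ^ (1 + CARD('n))"
      using k order_trans[OF le] unfolding size_kernel_def by meson
  qed
qed

text \<open>Capping the minimum of the exponents at 1 amounts to taking the positive part of 1/\<mu>
  - 1. For two infinite exponents both sides are 0, which is consistent with the value of
  \<open>min_exp\<close> there.\<close>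

lemma min_exp_gap:
  assumes "0 < p" "0 < q"
  shows "max (1 / min_exp p q - 1) 0 = exponent_gap (min p (min q 1)) 1"
proof -
  have r1: "rcp 1 = 1" using rcp_simps(1)[of 1] by simp
  show ?thesis
  proof (cases "p = top \<and> q = top")
    case True
    then show ?thesis by (simp add: min_exp_def exponent_gap_def r1)
  next
    case False
    define m where "m = enn2real (min p q)"
    have m: "min p q = ennreal m" "0 < m"
      using False assms unfolding m_def by (auto simp: min_def enn2real_positive_iff less_top split: if_splits)
    have "min p (min q 1) = min (ennreal m) 1" by (simp only: min.assoc[symmetric] m(1))
    also have "\<dots> = ennreal (min m 1)" using m(2) by (simp add: min_def ennreal_le_iff flip: ennreal_1)
    finally have "rcp (min p (min q 1)) = 1 / min m 1" using m(2) rcp_simps(1)[of "min m 1"] by simp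
    moreover have "max (1 / m - 1) 0 = 1 / min m 1 - 1" using m(2) by (auto simp: min_def max_def field_simps)
    ultimately show ?thesis using False by (simp add: min_exp_def m_def exponent_gap_def r1)
  qed
qed

text \<open>The common form of the three assertions: D is the region where the kernel lives and M
  the set of relative scales it reaches. On each side either \<beta> provides decay or M is
  bounded.\<close>

lemma bounded_on_tent_of_Lr:
  fixes \<kappa> :: "real \<times> (real ^ 'n) \<Rightarrow> real \<times> (real ^ 'n) \<Rightarrow> complex"
  assumes r: "1 < r" and pq: "0 < p" "0 < q"
    and \<gamma>: "0 < \<gamma>" "real CARD('n) * max (1 / min_exp p q - 1) 0 = 1 - \<gamma>"
    and \<kappa>: "size_kernel \<kappa>" and D: "D \<in> sets borel" and supp: "\<And>z w. (z, w) \<notin> D \<Longrightarrow> \<kappa> z w = 0"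
    and MD: "\<And>z w k m t. t \<in> slice CARD('n) k \<Longrightarrow> fst z \<in> {t / 2..t} \<Longrightarrow> fst w \<in> slice CARD('n) (k + m) \<Longrightarrow> m \<notin> M \<Longrightarrow> (z, w) \<notin> D"
    and M: "{-4..3} \<subseteq> M"
    and up: "rcp q - \<beta> > 0 \<or> (\<exists>B. \<forall>m\<in>M. m \<le> B)" and down: "rcp q - \<beta> < \<gamma> \<or> (\<exists>B. \<forall>m\<in>M. B \<le> m)"
    and Lr: "bounded_on_Lr r \<kappa>"
  shows "bounded_on_tent p q r \<beta> \<kappa>"
proof -
  obtain A where A: "bounded_operator (Lr_norm r) A" "\<And>\<phi>. \<phi> \<in> Linf_c \<Longrightarrow> AE z in half_leb. pv_exists \<kappa> \<phi> z \<and> A \<phi> z = pv_operator \<kappa> \<phi> z"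
    using Lr unfolding bounded_on_Lr_def by blast
  obtain kap C0 where "tent_operator r kap A M C0" by (rule tent_operator_exists[OF r \<kappa> D supp MD M A])
  then interpret tent_operator r kap A M C0 .
  show ?thesis by (rule bounded_extension[OF pq \<gamma> up down A(2)])
qed

theorem theorem5p1:
  fixes k :: "real \<times> (real ^ 'n) \<Rightarrow> real \<times> (real ^ 'n) \<Rightarrow> complex"
    and p q :: ennreal and r \<beta> \<gamma> :: real
  assumes "1 < r" and "0 < p" and "0 < q"
    and "\<gamma> = 1 - real CARD('n) * exponent_gap (min p (min q 1)) 1" and "\<gamma> > 0"
    and "size_kernel k"
  shows "(bounded_on_Lr r k \<longrightarrow>
            rcp q - \<gamma> < \<beta> \<and> \<beta> < rcp q \<longrightarrow> bounded_on_tent p q r \<beta> k) \<and>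
         (bounded_on_Lr r (causal k) \<longrightarrow>
            rcp q - \<gamma> < \<beta> \<longrightarrow> bounded_on_tent p q r \<beta> (causal k)) \<and>
         (bounded_on_Lr r (anticausal k) \<longrightarrow>
            \<beta> < rcp q \<longrightarrow> bounded_on_tent p q r \<beta> (anticausal k))"
proof -
  note r = assms(1) and pq = assms(2,3) and k = assms(6)
  have \<gamma>: "0 < \<gamma>" "real CARD('n) * max (1 / min_exp p q - 1) 0 = 1 - \<gamma>"
    using assms(4,5) by (simp_all add: min_exp_gap[OF pq])
  define Dp Dm :: "((real \<times> (real ^ 'n)) \<times> (real \<times> (real ^ 'n))) set"
    where "Dp = {v. fst (fst v) > fst (snd v)}" and "Dm = {v. fst (fst v) < fst (snd v)}"
  have D: "Dp \<in> sets borel" "Dm \<in> sets borel"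
    unfolding Dp_def Dm_def by (rule causal_borel anticausal_borel)+
  have c: "causal k = (\<lambda>z w. indicator Dp (z, w) * k z w)" and a: "anticausal k = (\<lambda>z w. indicator Dm (z, w) * k z w)"
    by (auto simp: causal_def anticausal_def Dp_def Dm_def fun_eq_iff)
  have "bounded_on_tent p q r \<beta> k" if "bounded_on_Lr r k" "rcp q - \<gamma> < \<beta>" "\<beta> < rcp q"
    by (rule bounded_on_tent_of_Lr[where D=UNIV and M=UNIV, OF r pq \<gamma> k]) (use that in auto)
  moreover have "bounded_on_tent p q r \<beta> (causal k)" if "bounded_on_Lr r (causal k)" "rcp q - \<gamma> < \<beta>"
  \<comment> \<open>A causal kernel vanishes as soon as the source lies in a later slice, that is
    for m \<ge> 1; the bound 3 makes M contain {-4..3}.\<close>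
  proof (rule bounded_on_tent_of_Lr[where D=Dp and M="{..3}", OF r pq \<gamma> _ D(1)])
    show "size_kernel (causal k)" unfolding c by (rule size_kernel_restrict[OF k D(1)])
    fix z w :: "real \<times> (real ^ 'n)" and i m :: int and t :: real
    assume "t \<in> slice CARD('n) i" "fst z \<in> {t / 2..t}" "fst w \<in> slice CARD('n) (i + m)" "m \<notin> {..3}"
    then show "(z, w) \<notin> Dp" using tau_mono[of i "i + m - 1" "CARD('n)"] by (auto simp: slice_def Dp_def)
  qed (use that in \<open>auto simp: c\<close>)
  moreover have "bounded_on_tent p q r \<beta> (anticausal k)" if "bounded_on_Lr r (anticausal k)" "\<beta> < rcp q"
  \<comment> \<open>The first time may be as small as t/2, but for m \<le> -5 the second is at most
    tau (i - 1) / 9 < t/2, so an anti-causal kernel vanishes.\<close>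
  proof (rule bounded_on_tent_of_Lr[where D=Dm and M="{-4..}", OF r pq \<gamma> _ D(2)])
    show "size_kernel (anticausal k)" unfolding a by (rule size_kernel_restrict[OF k D(2)])
    fix z w :: "real \<times> (real ^ 'n)" and i m :: int and t :: real
    assume *: "t \<in> slice CARD('n) i" "fst z \<in> {t / 2..t}" "fst w \<in> slice CARD('n) (i + m)" "m \<notin> {-4..}"
    have "tau CARD('n) (i + m) \<le> tau CARD('n) (i - 1 - 4)" using *(4) by (intro tau_mono) simp
    also have "\<dots> = tau CARD('n) (i - 1) / 9" by (rule tau_shift4)
    finally show "(z, w) \<notin> Dm" using * tau_pos[of "CARD('n)" "i - 1"] by (auto simp: slice_def Dm_def simp del: tau_pos)
  qed (use that in \<open>auto simp: a\<close>)
  ultimately show ?thesis by blast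
qed

end
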